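(* Let $K$ be a field of characteristic zero, let $n\ge 1$, and let $\varphi$ be a $K$-algebra endomorphism of the $n$-th Weyl algebra $A_n(K)$. If $\varphi$ is birational, then $\varphi$ is an automorphism.
   Context: For a commutative ring $R$, the $n$-th Weyl algebra $A_n(R)$ is the $R$-algebra generated freely by $x_1,\dots,x_n,\partial_1,\dots,\partial_n$ subject to the relations $[x_i,x_j]=0$, $[\partial_i,\partial_j]=0$, $[\partial_i,x_j]=\delta_{ij}$ for $1\le i,j\le n$, where $[a,b]=ab-ba$. For a (left and right) Ore domain $A$, $Q(A)$ denotes its division ring of fractions. The Weyl algebra $A_n(K)$ over a field is a left and right noetherian domain, hence an Ore domain. An injective ring homomorphism $\varphi:A\rightarrow B$ between Ore domains induces an injection $Q(A)\rightarrow Q(B)$; $\varphi$ is called birational if this induced injection is onto, i.e. $Q(\varphi(A))=Q(B)$. When $K$ is a field of characteristic zero, $A_n(K)$ is a simple ring, so every endomorphism of $A_n(K)$ is injective and the notion applies. *)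

theory Defs
  imports "HOL-Algebra.Algebra"
begin

section \<open>Free associative algebras\<close>

text \<open>
  Elements of the free associative \<open>R\<close>-algebra on a set \<open>S\<close> are finitely supported
  coefficient functions on words over \<open>S\<close>. A word is a list of letters, and a coefficient
  function is total, with value \<open>\<zero>\<^bsub>R\<^esub>\<close> at every word that uses a letter outside \<open>S\<close>.
\<close>

definition free_alg_const :: "('a, 'm) ring_scheme \<Rightarrow> 'a \<Rightarrow> 'g list \<Rightarrow> 'a" where
  "free_alg_const R a = (\<lambda>w. if w = [] then a else \<zero>\<^bsub>R\<^esub>)"

definition free_alg_gen :: "('a, 'm) ring_scheme \<Rightarrow> 'g \<Rightarrow> 'g list \<Rightarrow> 'a" where
  "free_alg_gen R g = (\<lambda>w. if w = [g] then \<one>\<^bsub>R\<^esub> else \<zero>\<^bsub>R\<^esub>)"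

definition free_algebra :: "('a, 'm) ring_scheme \<Rightarrow> 'g set \<Rightarrow> ('g list \<Rightarrow> 'a) ring" where
  "free_algebra R S =
    \<lparr> carrier = {f. range f \<subseteq> carrier R \<and> finite {w. f w \<noteq> \<zero>\<^bsub>R\<^esub>} \<and>
                    (\<forall>w. f w \<noteq> \<zero>\<^bsub>R\<^esub> \<longrightarrow> set w \<subseteq> S)},
      monoid.mult = (\<lambda>f g w. \<Oplus>\<^bsub>R\<^esub>i\<in>{..length w}. f (take i w) \<otimes>\<^bsub>R\<^esub> g (drop i w)),
      one = free_alg_const R \<one>\<^bsub>R\<^esub>,
      ring.zero = (\<lambda>w. \<zero>\<^bsub>R\<^esub>),
      ring.add = (\<lambda>f g w. f w \<oplus>\<^bsub>R\<^esub> g w) \<rparr>"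


section \<open>Weyl algebras\<close>

text \<open>\<open>Gx i\<close> and \<open>Gd i\<close> are the letters for \<open>x\<^sub>i\<close> and \<open>\<partial>\<^sub>i\<close>.\<close>

datatype weyl_gen = Gx nat | Gd nat

definition weyl_gens :: "nat \<Rightarrow> weyl_gen set" where
  "weyl_gens n = Gx ` {1..n} \<union> Gd ` {1..n}"

abbreviation weyl_free :: "('a, 'm) ring_scheme \<Rightarrow> nat \<Rightarrow> (weyl_gen list \<Rightarrow> 'a) ring" where
  "weyl_free R n \<equiv> free_algebra R (weyl_gens n)"

definition ring_commutator :: "('a, 'm) ring_scheme \<Rightarrow> 'a \<Rightarrow> 'a \<Rightarrow> 'a" where
  "ring_commutator A a b = a \<otimes>\<^bsub>A\<^esub> b \<ominus>\<^bsub>A\<^esub> b \<otimes>\<^bsub>A\<^esub> a"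

definition weyl_relators :: "('a, 'm) ring_scheme \<Rightarrow> nat \<Rightarrow> (weyl_gen list \<Rightarrow> 'a) set" where
  "weyl_relators R n =
    (let F = weyl_free R n;
         x = (\<lambda>i. free_alg_gen R (Gx i));
         d = (\<lambda>i. free_alg_gen R (Gd i))
     in (\<Union>i\<in>{1..n}. \<Union>j\<in>{1..n}.
          {ring_commutator F (x i) (x j),
           ring_commutator F (d i) (d j),
           ring_commutator F (d i) (x j) \<ominus>\<^bsub>F\<^esub> (if i = j then \<one>\<^bsub>F\<^esub> else \<zero>\<^bsub>F\<^esub>)}))"

definition weyl_ideal :: "('a, 'm) ring_scheme \<Rightarrow> nat \<Rightarrow> (weyl_gen list \<Rightarrow> 'a) set" where
  "weyl_ideal R n = Idl\<^bsub>weyl_free R n\<^esub> (weyl_relators R n)"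

definition weyl_algebra :: "('a, 'm) ring_scheme \<Rightarrow> nat \<Rightarrow> (weyl_gen list \<Rightarrow> 'a) set ring" where
  "weyl_algebra R n = weyl_free R n Quot weyl_ideal R n"

text \<open>The structure map \<open>R \<rightarrow> A\<^sub>n(R)\<close> of the \<open>R\<close>-algebra \<open>A\<^sub>n(R)\<close>.\<close>

definition weyl_scalar :: "('a, 'm) ring_scheme \<Rightarrow> nat \<Rightarrow> 'a \<Rightarrow> (weyl_gen list \<Rightarrow> 'a) set" where
  "weyl_scalar R n a = weyl_ideal R n +>\<^bsub>weyl_free R n\<^esub> free_alg_const R a"

definition weyl_endomorphisms ::
  "('a, 'm) ring_scheme \<Rightarrow> nat \<Rightarrow> ((weyl_gen list \<Rightarrow> 'a) set \<Rightarrow> (weyl_gen list \<Rightarrow> 'a) set) set" where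
  "weyl_endomorphisms R n =
    {\<phi> \<in> ring_hom (weyl_algebra R n) (weyl_algebra R n).
       \<forall>a\<in>carrier R. \<phi> (weyl_scalar R n a) = weyl_scalar R n a}"


section \<open>The division ring of fractions of an Ore domain\<close>

text \<open>
  \<open>Q(A)\<close> is realised by right fractions \<open>a s\<^sup>-\<^sup>1\<close>. Two fractions \<open>a s\<^sup>-\<^sup>1\<close> and \<open>b t\<^sup>-\<^sup>1\<close> are
  equal iff they agree after being brought to a common denominator \<open>s u = t v \<noteq> 0\<close>.
  \<open>ore_frac A a s\<close> is the equivalence class of \<open>(a, s)\<close>. (If \<open>A\<close> is also left Ore, this ring
  is the ring of left fractions as well.)
\<close>

definition ore_frac :: "('a, 'm) ring_scheme \<Rightarrow> 'a \<Rightarrow> 'a \<Rightarrow> ('a \<times> 'a) set" where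
  "ore_frac A a s =
    {(b, t). b \<in> carrier A \<and> t \<in> carrier A \<and> t \<noteq> \<zero>\<^bsub>A\<^esub> \<and>
       (\<exists>u\<in>carrier A. \<exists>v\<in>carrier A.
          a \<otimes>\<^bsub>A\<^esub> u = b \<otimes>\<^bsub>A\<^esub> v \<and> s \<otimes>\<^bsub>A\<^esub> u = t \<otimes>\<^bsub>A\<^esub> v \<and> s \<otimes>\<^bsub>A\<^esub> u \<noteq> \<zero>\<^bsub>A\<^esub>)}"

text \<open>
  The operations are unions over all representatives and all choices of Ore multipliers; over
  an Ore domain all the sets in such a union coincide. For the product,
  \<open>s u = b v\<close> with \<open>v \<noteq> 0\<close> gives \<open>s\<^sup>-\<^sup>1 b = u v\<^sup>-\<^sup>1\<close>, so \<open>(a s\<^sup>-\<^sup>1) (b t\<^sup>-\<^sup>1) = (a u) (t v)\<^sup>-\<^sup>1\<close>.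
\<close>

definition ore_quotient :: "('a, 'm) ring_scheme \<Rightarrow> ('a \<times> 'a) set ring" where
  "ore_quotient A =
    \<lparr> carrier = {ore_frac A a s | a s. a \<in> carrier A \<and> s \<in> carrier A \<and> s \<noteq> \<zero>\<^bsub>A\<^esub>},
      monoid.mult = (\<lambda>P Q. \<Union>{ore_frac A (a \<otimes>\<^bsub>A\<^esub> u) (t \<otimes>\<^bsub>A\<^esub> v) | a s b t u v.
                (a, s) \<in> P \<and> (b, t) \<in> Q \<and> u \<in> carrier A \<and> v \<in> carrier A \<and>
                s \<otimes>\<^bsub>A\<^esub> u = b \<otimes>\<^bsub>A\<^esub> v \<and> v \<noteq> \<zero>\<^bsub>A\<^esub>}),
      one = ore_frac A \<one>\<^bsub>A\<^esub> \<one>\<^bsub>A\<^esub>,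
      ring.zero = ore_frac A \<zero>\<^bsub>A\<^esub> \<one>\<^bsub>A\<^esub>,
      ring.add = (\<lambda>P Q. \<Union>{ore_frac A (a \<otimes>\<^bsub>A\<^esub> u \<oplus>\<^bsub>A\<^esub> b \<otimes>\<^bsub>A\<^esub> v) (s \<otimes>\<^bsub>A\<^esub> u) | a s b t u v.
                (a, s) \<in> P \<and> (b, t) \<in> Q \<and> u \<in> carrier A \<and> v \<in> carrier A \<and>
                s \<otimes>\<^bsub>A\<^esub> u = t \<otimes>\<^bsub>A\<^esub> v \<and> s \<otimes>\<^bsub>A\<^esub> u \<noteq> \<zero>\<^bsub>A\<^esub>}) \<rparr>"

text \<open>
  The map \<open>Q(A) \<rightarrow> Q(B)\<close>, \<open>a s\<^sup>-\<^sup>1 \<mapsto> \<phi>(a) \<phi>(s)\<^sup>-\<^sup>1\<close>, induced by an injective ring homomorphism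
  \<open>\<phi> : A \<rightarrow> B\<close> (injectivity keeps the denominators nonzero).
\<close>

definition ore_quotient_map ::
  "('b, 'm) ring_scheme \<Rightarrow> ('a \<Rightarrow> 'b) \<Rightarrow> ('a \<times> 'a) set \<Rightarrow> ('b \<times> 'b) set" where
  "ore_quotient_map B \<phi> P = (\<Union>(a, s)\<in>P. ore_frac B (\<phi> a) (\<phi> s))"

definition birational_hom ::
  "('a, 'm) ring_scheme \<Rightarrow> ('b, 'k) ring_scheme \<Rightarrow> ('a \<Rightarrow> 'b) \<Rightarrow> bool" where
  "birational_hom A B \<phi> \<longleftrightarrow>
     ore_quotient_map B \<phi> ` carrier (ore_quotient A) = carrier (ore_quotient B)"

end

theory Submission
  imports Defs "HOL-Library.List_Lexorder"
begin

text \<open>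
  A birational \<open>\<phi>\<close> provides, for every generator \<open>g\<close> of \<open>A\<^sub>n(K)\<close>, elements \<open>s\<close>, \<open>b\<close> with
  \<open>g \<phi>(s) = \<phi>(b)\<close> and \<open>\<phi>(s) \<noteq> 0\<close>. If \<open>b = c s\<close> then \<open>g = \<phi>(c)\<close>, so it suffices that
  \<open>b\<close> is a left multiple of \<open>s\<close>. Otherwise, divide \<open>b\<close> by \<open>s\<close> with a remainder of minimal
  leading exponent, which is then not a multiple of the leading exponent of \<open>s\<close>. The coefficients
  of all the elements involved and the inverses of their leading coefficients generate a subring
  of \<open>K\<close>, which by Zariski's lemma has a finite residue field \<open>k\<close>, of characteristic \<open>p\<close> say;
  everything is reduced to \<open>A\<^sub>n(k)\<close>, and the contradiction is that there \<open>b\<close> is a left multiple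
  of \<open>s\<close>.

  The centre \<open>Z\<close> of \<open>A\<^sub>n(k)\<close> is the polynomial ring in the \<open>p\<close>-th powers of the generators, and
  the reduction of \<open>\<phi>\<close> maps it into itself because \<open>\<phi>\<close> is birational. The commutator with the \<open>p\<close>-th
  power of a generator, or with its image under \<open>\<phi>\<close>, is divisible by \<open>p\<close> before reduction; dividing
  by \<open>p\<close> gives derivations of \<open>A\<^sub>n(k)\<close> that are related by \<open>\<phi>\<close> and act on \<open>Z\<close> as the partial
  derivatives. As \<open>k\<close> is perfect, it follows that a prime of \<open>Z\<close> contracted from a principal prime
  along \<open>\<phi>\<close> is principal, and then that \<open>a \<phi>(c) \<in> \<phi>(A\<^sub>n(k))\<close> with \<open>0 \<noteq> c \<in> Z\<close> implies
  \<open>a \<in> \<phi>(A\<^sub>n(k))\<close>. Since every nonzero element divides a nonzero central one, \<open>g \<in> \<phi>(A\<^sub>n(k))\<close>.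
\<close>

section \<open>Finitely supported functions and the free algebra\<close>

text \<open>In characteristic zero the centre of the Weyl algebra consists of scalars, so a relation
  \<open>g \<phi>(s) = \<phi>(b)\<close> offers no commutative ring in which to study divisibility.
  Reduction modulo p supplies one, at two costs: the reduced algebra is not simple, so injectivity
  of the reduced endomorphism has to be proved, and a quotient found there does not lift. Dividing
  with remainder beforehand meets the second cost: a leading exponent survives reduction once its
  coefficient is invertible, so a single residue field suffices. The derivations [Y, -]/p meet the
  first. They have to be formed before reduction, while p is still nonzero, and must then descend
  along a map that may kill more than the multiples of p. Being related by the endomorphism, they do
  the work of an invertible Jacobian matrix on the centre. Perfectness turns elements killed by all
  of them into p-th powers, which starts a descent on degree. Finiteness of the residue field gives
  perfectness and also lets counting replace dimension arguments.\<close>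

context cring
begin

definition fin_supp :: "'e set \<Rightarrow> ('e \<Rightarrow> 'a) set" where
  "fin_supp B = {f. (\<forall>x. f x \<in> carrier R) \<and> finite {x. f x \<noteq> \<zero>} \<and> (\<forall>x. f x \<noteq> \<zero> \<longrightarrow> x \<in> B)}"

definition single :: "'a \<Rightarrow> 'e \<Rightarrow> 'e \<Rightarrow> 'a" where
  "single a x = (\<lambda>y. if y = x then a else \<zero>)"

lemma fin_suppD:
  assumes "f \<in> fin_supp B"
  shows "f x \<in> carrier R" "finite {x. f x \<noteq> \<zero>}" "f x \<noteq> \<zero> \<Longrightarrow> x \<in> B"
  using assms by (auto simp: fin_supp_def)

lemma fin_suppI:
  assumes "\<And>x. f x \<in> carrier R" "finite {x. f x \<noteq> \<zero>}" "\<And>x. f x \<noteq> \<zero> \<Longrightarrow> x \<in> B"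
  shows "f \<in> fin_supp B"
  using assms by (auto simp: fin_supp_def)

lemma single_carrier: "a \<in> carrier R \<Longrightarrow> single a x y \<in> carrier R"
  by (auto simp: single_def)

lemma single_closed: "a \<in> carrier R \<Longrightarrow> x \<in> B \<Longrightarrow> single a x \<in> fin_supp B"
  by (auto simp: fin_supp_def single_def)

lemma fin_supp_zero: "(\<lambda>x. \<zero>) \<in> fin_supp B"
  by (auto simp: fin_supp_def)

lemma fin_supp_add:
  assumes "f \<in> fin_supp B" "g \<in> fin_supp B"
  shows "(\<lambda>x. f x \<oplus> g x) \<in> fin_supp B"
proof (rule fin_suppI)
  have sub: "{x. f x \<oplus> g x \<noteq> \<zero>} \<subseteq> {x. f x \<noteq> \<zero>} \<union> {x. g x \<noteq> \<zero>}"
    by auto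
  show "finite {x. f x \<oplus> g x \<noteq> \<zero>}"
    using finite_subset[OF sub] assms by (auto simp: fin_supp_def)
  show "f x \<oplus> g x \<noteq> \<zero> \<Longrightarrow> x \<in> B" for x
    using sub assms by (auto simp: fin_supp_def)
qed (use assms in \<open>auto simp: fin_supp_def\<close>)

lemma fin_supp_smult:
  assumes "f \<in> fin_supp B" "a \<in> carrier R"
  shows "(\<lambda>x. a \<otimes> f x) \<in> fin_supp B"
proof (rule fin_suppI)
  have sub: "{x. a \<otimes> f x \<noteq> \<zero>} \<subseteq> {x. f x \<noteq> \<zero>}"
    using assms by auto
  show "finite {x. a \<otimes> f x \<noteq> \<zero>}"
    using finite_subset[OF sub] assms by (auto simp: fin_supp_def)
  show "a \<otimes> f x \<noteq> \<zero> \<Longrightarrow> x \<in> B" for x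
    using sub assms by (auto simp: fin_supp_def)
qed (use assms in \<open>auto simp: fin_supp_def\<close>)

lemma fin_supp_minus:
  assumes "f \<in> fin_supp B"
  shows "(\<lambda>x. \<ominus> f x) \<in> fin_supp B"
proof (rule fin_suppI)
  have eq: "{x. \<ominus> f x \<noteq> \<zero>} = {x. f x \<noteq> \<zero>}"
    using assms by (auto simp: fin_supp_def)
  show "finite {x. \<ominus> f x \<noteq> \<zero>}"
    using eq assms by (auto simp: fin_supp_def)
  show "\<ominus> f x \<noteq> \<zero> \<Longrightarrow> x \<in> B" for x
    using eq assms by (auto simp: fin_supp_def)
qed (use assms in \<open>auto simp: fin_supp_def\<close>)

text \<open>The new term sits where f vanishes, so nothing cancels and the support of f lies in that
  of the sum. Hypotheses on the support of the sum, such as a bound on leading exponents, therefore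
  pass to f.\<close>

lemma fin_supp_insert_induct [consumes 1, case_names zero insert]:
  assumes f: "f \<in> fin_supp B"
    and zero: "P (\<lambda>x. \<zero>)"
    and insert: "\<And>f a x. f \<in> fin_supp B \<Longrightarrow> a \<in> carrier R \<Longrightarrow> a \<noteq> \<zero> \<Longrightarrow> x \<in> B \<Longrightarrow> f x = \<zero> \<Longrightarrow> P f \<Longrightarrow>
      P (\<lambda>y. f y \<oplus> single a x y)"
  shows "P f"
  using f
proof (induction "card {x. f x \<noteq> \<zero>}" arbitrary: f rule: less_induct)
  case (less f)
  note fD = fin_suppD[OF less.prems]
  show ?case
  proof (cases "\<exists>x. f x \<noteq> \<zero>")
    case False
    then have "f = (\<lambda>x. \<zero>)" by auto
    then show ?thesis using zero by simp
  next
    case True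
    then obtain x where x: "f x \<noteq> \<zero>" by auto
    define g where "g = (\<lambda>y. if y = x then \<zero> else f y)"
    have g: "g \<in> fin_supp B"
      using fD by (intro fin_suppI) (auto simp: g_def intro: rev_finite_subset[OF fD(2)] split: if_splits)
    have "{y. g y \<noteq> \<zero>} \<subset> {y. f y \<noteq> \<zero>}"
      using x by (auto simp: g_def)
    then have "P g"
      using less.hyps[OF _ g] psubset_card_mono[OF fD(2)] by blast
    then have "P (\<lambda>y. g y \<oplus> single (f x) x y)"
      using x fD(3) by (intro insert[OF g fD(1)]) (auto simp: g_def)
    moreover have "(\<lambda>y. g y \<oplus> single (f x) x y) = f"
      using fD(1) by (auto simp: g_def single_def)
    ultimately show ?thesis by simp
  qed
qed

lemma fin_supp_induct [consumes 1, case_names zero single add]: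
  assumes "f \<in> fin_supp B"
    and "P (\<lambda>x. \<zero>)"
    and "\<And>a x. a \<in> carrier R \<Longrightarrow> x \<in> B \<Longrightarrow> P (single a x)"
    and "\<And>f g. f \<in> fin_supp B \<Longrightarrow> g \<in> fin_supp B \<Longrightarrow> P f \<Longrightarrow> P g \<Longrightarrow> P (\<lambda>x. f x \<oplus> g x)"
  shows "P f"
  using assms(1)
  by (induction rule: fin_supp_insert_induct) (auto intro!: assms single_closed)

lemma finsum_supp:
  assumes "finite A" "{x. f x \<noteq> \<zero>} \<subseteq> A" "\<And>x. f x \<in> carrier R" "\<And>x. h x \<in> carrier R"
  shows "(\<Oplus>x\<in>{x. f x \<noteq> \<zero>}. f x \<otimes> h x) = (\<Oplus>x\<in>A. f x \<otimes> h x)"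
  by (rule add.finprod_mono_neutral_cong_left) (use assms in auto)

section \<open>Convolution on words, the product of the free algebra\<close>

definition conv :: "('g list \<Rightarrow> 'a) \<Rightarrow> ('g list \<Rightarrow> 'a) \<Rightarrow> 'g list \<Rightarrow> 'a" where
  "conv f g w = (\<Oplus>i\<in>{..length w}. f (take i w) \<otimes> g (drop i w))"

lemma conv_closed:
  assumes "\<And>w. f w \<in> carrier R" "\<And>w. g w \<in> carrier R"
  shows "conv f g w \<in> carrier R"
  unfolding conv_def by (rule finsum_closed) (use assms in auto)

lemma conv_Nil:
  assumes "\<And>w. f w \<in> carrier R" "\<And>w. g w \<in> carrier R"
  shows "conv f g [] = f [] \<otimes> g []"
  unfolding conv_def using assms by simp

text \<open>Splitting off the empty left factor makes convolution a recursion on the word.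
  Associativity becomes an induction on the word instead of a reindexing of double sums.\<close>

lemma conv_Cons:
  assumes "\<And>w. f w \<in> carrier R" "\<And>w. g w \<in> carrier R"
  shows "conv f g (x # w) = f [] \<otimes> g (x # w) \<oplus> conv (\<lambda>u. f (x # u)) g w"
proof -
  have "conv f g (x # w) = (\<Oplus>i\<in>{..Suc (length w)}. f (take i (x # w)) \<otimes> g (drop i (x # w)))"
    by (simp add: conv_def)
  also have "\<dots> = (\<Oplus>i\<in>{..length w}. f (take (Suc i) (x # w)) \<otimes> g (drop (Suc i) (x # w)))
      \<oplus> f (take 0 (x # w)) \<otimes> g (drop 0 (x # w))"
    by (rule finsum_Suc2) (use assms in auto)
  also have "\<dots> = conv (\<lambda>u. f (x # u)) g w \<oplus> f [] \<otimes> g (x # w)"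
    by (simp add: conv_def)
  finally show ?thesis
    using assms conv_closed[of "\<lambda>u. f (x # u)" g w] by (simp add: a_comm)
qed

text \<open>The shape \<open>a f + g\<close> is the one that \<open>conv_Cons\<close> produces for
  the map sending u to \<open>conv f g (x # u)\<close>, as the inductive step of
  \<open>conv_assoc\<close> requires.\<close>

lemma conv_linear_left:
  assumes "\<And>w. f w \<in> carrier R" "\<And>w. g w \<in> carrier R" "\<And>w. h w \<in> carrier R" "a \<in> carrier R"
  shows "conv (\<lambda>u. a \<otimes> f u \<oplus> g u) h w = a \<otimes> conv f h w \<oplus> conv g h w"
  using assms
proof (induction w arbitrary: f g)
  case Nil
  then show ?case
    by (simp add: conv_Nil l_distr m_assoc)
next
  case (Cons x w)
  have c: "conv (\<lambda>u. f (x # u)) h w \<in> carrier R" "conv (\<lambda>u. g (x # u)) h w \<in> carrier R"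
    by (intro conv_closed Cons.prems)+
  have "conv (\<lambda>u. a \<otimes> f u \<oplus> g u) h (x # w)
      = (a \<otimes> f [] \<oplus> g []) \<otimes> h (x # w) \<oplus> conv (\<lambda>u. a \<otimes> f (x # u) \<oplus> g (x # u)) h w"
    using Cons.prems by (subst conv_Cons) auto
  also have "conv (\<lambda>u. a \<otimes> f (x # u) \<oplus> g (x # u)) h w
      = a \<otimes> conv (\<lambda>u. f (x # u)) h w \<oplus> conv (\<lambda>u. g (x # u)) h w"
    using Cons.prems by (intro Cons.IH) auto
  also have "(a \<otimes> f [] \<oplus> g []) \<otimes> h (x # w) \<oplus>
      (a \<otimes> conv (\<lambda>u. f (x # u)) h w \<oplus> conv (\<lambda>u. g (x # u)) h w) =
      a \<otimes> (f [] \<otimes> h (x # w) \<oplus> conv (\<lambda>u. f (x # u)) h w) \<oplus>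
      (g [] \<otimes> h (x # w) \<oplus> conv (\<lambda>u. g (x # u)) h w)"
    using Cons.prems c by (simp add: l_distr r_distr m_assoc a_ac)
  also have "\<dots> = a \<otimes> conv f h (x # w) \<oplus> conv g h (x # w)"
    using Cons.prems by (simp add: conv_Cons)
  finally show ?case .
qed

lemma conv_zero_left:
  assumes "\<And>w. g w \<in> carrier R"
  shows "conv (\<lambda>u. \<zero>) g w = \<zero>"
  unfolding conv_def using assms by (simp add: finsum_zero)

lemma conv_add_left:
  assumes "\<And>w. f w \<in> carrier R" "\<And>w. g w \<in> carrier R" "\<And>w. h w \<in> carrier R"
  shows "conv (\<lambda>u. f u \<oplus> g u) h w = conv f h w \<oplus> conv g h w"
  using conv_linear_left[of f g h \<one> w] assms conv_closed[of f h w] by simp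

lemma conv_add_right:
  assumes "\<And>w. f w \<in> carrier R" "\<And>w. g w \<in> carrier R" "\<And>w. h w \<in> carrier R"
  shows "conv f (\<lambda>u. g u \<oplus> h u) w = conv f g w \<oplus> conv f h w"
  unfolding conv_def using assms by (simp add: r_distr finsum_addf)

lemma conv_assoc:
  assumes "\<And>w. f w \<in> carrier R" "\<And>w. g w \<in> carrier R" "\<And>w. h w \<in> carrier R"
  shows "conv (conv f g) h w = conv f (conv g h) w"
  using assms
proof (induction w arbitrary: f)
  case Nil
  then show ?case
    by (simp add: conv_Nil conv_closed m_assoc)
next
  case (Cons x w)
  have c: "conv (\<lambda>u. f (x # u)) (conv g h) w \<in> carrier R" "conv g h (x # w) \<in> carrier R"
    "conv (\<lambda>u. g (x # u)) h w \<in> carrier R"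
    by (intro conv_closed Cons.prems)+
  have "conv (conv f g) h (x # w) = conv f g [] \<otimes> h (x # w) \<oplus> conv (\<lambda>u. conv f g (x # u)) h w"
    using Cons.prems by (intro conv_Cons conv_closed)
  also have "(\<lambda>u. conv f g (x # u)) = (\<lambda>u. f [] \<otimes> g (x # u) \<oplus> conv (\<lambda>u. f (x # u)) g u)"
    using Cons.prems by (intro ext conv_Cons)
  also have "conv (\<lambda>u. f [] \<otimes> g (x # u) \<oplus> conv (\<lambda>u. f (x # u)) g u) h w
     = f [] \<otimes> conv (\<lambda>u. g (x # u)) h w \<oplus> conv (conv (\<lambda>u. f (x # u)) g) h w"
    using Cons.prems by (intro conv_linear_left conv_closed)
  also have "conv (conv (\<lambda>u. f (x # u)) g) h w = conv (\<lambda>u. f (x # u)) (conv g h) w"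
    using Cons.prems by (intro Cons.IH)
  also have "conv f g [] \<otimes> h (x # w) \<oplus> (f [] \<otimes> conv (\<lambda>u. g (x # u)) h w \<oplus> conv (\<lambda>u. f (x # u)) (conv g h) w)
     = f [] \<otimes> (g [] \<otimes> h (x # w) \<oplus> conv (\<lambda>u. g (x # u)) h w) \<oplus> conv (\<lambda>u. f (x # u)) (conv g h) w"
    using Cons.prems c by (simp add: conv_Nil r_distr m_assoc a_ac)
  also have "g [] \<otimes> h (x # w) \<oplus> conv (\<lambda>u. g (x # u)) h w = conv g h (x # w)"
    using Cons.prems by (simp add: conv_Cons)
  also have "f [] \<otimes> conv g h (x # w) \<oplus> conv (\<lambda>u. f (x # u)) (conv g h) w = conv f (conv g h) (x # w)"
    using Cons.prems by (intro conv_Cons[symmetric] conv_closed)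
  finally show ?case .
qed

lemma conv_nonzeroE:
  assumes "conv f g w \<noteq> \<zero>" "\<And>w. f w \<in> carrier R" "\<And>w. g w \<in> carrier R"
  obtains u v where "w = u @ v" "f u \<noteq> \<zero>" "g v \<noteq> \<zero>"
proof -
  have "\<exists>i. f (take i w) \<otimes> g (drop i w) \<noteq> \<zero>"
  proof (rule ccontr)
    assume "\<nexists>i. f (take i w) \<otimes> g (drop i w) \<noteq> \<zero>"
    then have "conv f g w = (\<Oplus>i\<in>{..length w}. \<zero>)"
      by (simp add: conv_def)
    then show False using assms by (simp add: finsum_zero)
  qed
  then obtain i where "f (take i w) \<otimes> g (drop i w) \<noteq> \<zero>" by auto
  then have "f (take i w) \<noteq> \<zero>" "g (drop i w) \<noteq> \<zero>"
    using assms by auto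
  then show ?thesis using that[of "take i w" "drop i w"] by simp
qed

lemma conv_fin_supp:
  assumes "f \<in> fin_supp {w. set w \<subseteq> S}" "g \<in> fin_supp {w. set w \<subseteq> S}"
  shows "conv f g \<in> fin_supp {w. set w \<subseteq> S}"
proof -
  note D = fin_suppD[OF assms(1)] fin_suppD[OF assms(2)]
  show ?thesis
  proof (rule fin_suppI)
    show "conv f g w \<in> carrier R" for w
      by (intro conv_closed D)
    have "{w. conv f g w \<noteq> \<zero>} \<subseteq> (\<lambda>(u, v). u @ v) ` ({u. f u \<noteq> \<zero>} \<times> {v. g v \<noteq> \<zero>})"
    proof
      fix w assume "w \<in> {w. conv f g w \<noteq> \<zero>}"
      then obtain u v where "w = u @ v" "f u \<noteq> \<zero>" "g v \<noteq> \<zero>"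
        using conv_nonzeroE[of f g w] D(1) D(4) by auto
      then show "w \<in> (\<lambda>(u, v). u @ v) ` ({u. f u \<noteq> \<zero>} \<times> {v. g v \<noteq> \<zero>})"
        by force
    qed
    then show "finite {w. conv f g w \<noteq> \<zero>}"
      using D by (auto intro: finite_subset)
    fix w assume "conv f g w \<noteq> \<zero>"
    then obtain u v where "w = u @ v" "f u \<noteq> \<zero>" "g v \<noteq> \<zero>"
      using conv_nonzeroE[of f g w] D(1) D(4) by auto
    then show "w \<in> {w. set w \<subseteq> S}"
      using D(3)[of u] D(6)[of v] by auto
  qed
qed

lemma conv_single_Nil:
  assumes "\<And>w. g w \<in> carrier R" "a \<in> carrier R"
  shows "conv (single a []) g w = a \<otimes> g w"
proof (cases w)
  case Nil
  then show ?thesis using assms by (simp add: conv_Nil single_def)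
next
  case (Cons x u)
  have "conv (single a []) g (x # u) = single a [] [] \<otimes> g (x # u) \<oplus> conv (\<lambda>u. single a [] (x # u)) g u"
    using assms by (subst conv_Cons) (auto simp: single_def)
  also have "(\<lambda>u. single a [] (x # u)) = (\<lambda>u. \<zero>)"
    by (auto simp: single_def)
  finally show ?thesis
    using assms Cons by (simp add: conv_zero_left single_def)
qed

lemma conv_single_single:
  assumes "a \<in> carrier R" "b \<in> carrier R"
  shows "conv (single a u) (single b v) = single (a \<otimes> b) (u @ v)"
proof
  fix w
  show "conv (single a u) (single b v) w = single (a \<otimes> b) (u @ v) w"
  proof (induction u arbitrary: w)
    case Nil
    then show ?case using assms by (subst conv_single_Nil) (auto simp: single_def)
  next
    case (Cons x u)
    note cl = single_carrier[OF assms(1)] single_carrier[OF assms(2)]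
    show ?case
    proof (cases w)
      case Nil
      then show ?thesis using assms cl conv_Nil[of "single a (x # u)" "single b v"] by (simp add: single_def)
    next
      case [simp]: (Cons y w')
      have "conv (single a (x # u)) (single b v) (y # w') =
          single a (x # u) [] \<otimes> single b v (y # w') \<oplus> conv (\<lambda>w. single a (x # u) (y # w)) (single b v) w'"
        by (intro conv_Cons single_carrier assms)
      also have "single a (x # u) [] = \<zero>" by (simp add: single_def)
      also have "(\<lambda>w. single a (x # u) (y # w)) = (if y = x then single a u else (\<lambda>w. \<zero>))"
        by (auto simp: single_def)
      also have "\<zero> \<otimes> single b v (y # w') \<oplus> conv (if y = x then single a u else (\<lambda>w. \<zero>)) (single b v) w'
          = (if y = x then conv (single a u) (single b v) w' else \<zero>)"
        using assms by (simp add: conv_zero_left conv_closed single_carrier)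
      also have "\<dots> = single (a \<otimes> b) (x # u @ v) (y # w')"
        using Cons.IH[of w'] by (auto simp: single_def)
      finally show ?thesis by simp
    qed
  qed
qed

lemma conv_one_right:
  assumes "\<And>w. f w \<in> carrier R"
  shows "conv f (single \<one> []) w = f w"
  using assms
proof (induction w arbitrary: f)
  case Nil
  then show ?case by (subst conv_Nil) (auto simp: single_def)
next
  case (Cons x w)
  have "conv f (single \<one> []) (x # w) = f [] \<otimes> single \<one> [] (x # w) \<oplus> conv (\<lambda>u. f (x # u)) (single \<one> []) w"
    using Cons.prems by (intro conv_Cons) (auto simp: single_def)
  also have "conv (\<lambda>u. f (x # u)) (single \<one> []) w = f (x # w)"
    using Cons by auto
  finally show ?case using Cons.prems by (simp add: single_def)
qed

lemma free_algebra_simps: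
  "carrier (free_algebra R S) = fin_supp {w. set w \<subseteq> S}"
  "f \<otimes>\<^bsub>free_algebra R S\<^esub> g = conv f g"
  "\<one>\<^bsub>free_algebra R S\<^esub> = single \<one> []"
  "\<zero>\<^bsub>free_algebra R S\<^esub> = (\<lambda>w. \<zero>)"
  "f \<oplus>\<^bsub>free_algebra R S\<^esub> g = (\<lambda>w. f w \<oplus> g w)"
  by (auto simp: free_algebra_def fin_supp_def conv_def fun_eq_iff free_alg_const_def single_def)

lemma free_algebra_ring: "ring (free_algebra R S)"
proof (rule ringI)
  show "abelian_group (free_algebra R S)"
  proof (rule abelian_groupI)
    fix f assume f: "f \<in> carrier (free_algebra R S)"
    show "\<exists>g\<in>carrier (free_algebra R S). g \<oplus>\<^bsub>free_algebra R S\<^esub> f = \<zero>\<^bsub>free_algebra R S\<^esub>"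
      using f fin_supp_minus[of f] fin_suppD(1)[of f]
      by (intro bexI[of _ "\<lambda>x. \<ominus> f x"]) (auto simp: free_algebra_simps fun_eq_iff l_neg)
  qed (auto simp: free_algebra_simps fin_supp_add fin_supp_zero fun_eq_iff fin_suppD(1) a_ac)
  show "monoid (free_algebra R S)"
    by (rule monoidI)
       (auto simp: free_algebra_simps conv_fin_supp single_closed fun_eq_iff conv_assoc fin_suppD(1)
         conv_one_right conv_single_Nil)
qed (auto simp: free_algebra_simps fun_eq_iff conv_add_left conv_add_right fin_suppD(1))

lemma free_alg_gen_single: "free_alg_gen R g = single \<one> [g]"
  by (auto simp: free_alg_gen_def single_def)

lemma free_alg_const_single: "free_alg_const R a = single a []"
  by (auto simp: free_alg_const_def single_def)

end

section \<open>The action on the symbol module\<close>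

locale weyl = cring R for R (structure) +
  fixes n :: nat
begin

definition nc :: "nat \<Rightarrow> 'a" where "nc k = [k] \<cdot> \<one>"

lemma nc_closed [simp]: "nc k \<in> carrier R"
  by (simp add: nc_def)

lemma nc_0 [simp]: "nc 0 = \<zero>"
  by (simp add: nc_def)

lemma nc_Suc: "nc (Suc k) = nc k \<oplus> \<one>"
  by (simp add: nc_def)

text \<open>An exponent \<open>e\<close> stands for the normally ordered monomial
  \<open>x\<^sub>1\<^bsup>e 0\<^esup> \<cdots> x\<^sub>n\<^bsup>e (n-1)\<^esup> \<partial>\<^sub>1\<^bsup>e n\<^esup> \<cdots> \<partial>\<^sub>n\<^bsup>e (2n-1)\<^esup>\<close>.
  On coefficient functions, \<open>shift j\<close> multiplies the symbol by its \<open>j\<close>-th variable, and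
  \<open>pd j\<close> is the partial derivative by it.\<close>

definition exps :: "(nat \<Rightarrow> nat) set" where
  "exps = {e. \<forall>i\<ge>2 * n. e i = 0}"

definition shift :: "nat \<Rightarrow> ((nat \<Rightarrow> nat) \<Rightarrow> 'a) \<Rightarrow> (nat \<Rightarrow> nat) \<Rightarrow> 'a" where
  "shift j v e = (if e j = 0 then \<zero> else v (e(j := e j - 1)))"

definition pd :: "nat \<Rightarrow> ((nat \<Rightarrow> nat) \<Rightarrow> 'a) \<Rightarrow> (nat \<Rightarrow> nat) \<Rightarrow> 'a" where
  "pd j v e = nc (Suc (e j)) \<otimes> v (e(j := Suc (e j)))"

text \<open>The faithful action \<open>x\<^sub>l \<mapsto> x\<^sub>l\<close>, \<open>\<partial>\<^sub>l \<mapsto> \<xi>\<^sub>l + \<partial>/\<partial>x\<^sub>l\<close> on polynomials in \<open>x, \<xi>\<close>.\<close>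

definition lmul :: "nat \<Rightarrow> ((nat \<Rightarrow> nat) \<Rightarrow> 'a) \<Rightarrow> (nat \<Rightarrow> nat) \<Rightarrow> 'a" where
  "lmul j v = (if j < n then shift j v else (\<lambda>e. shift j v e \<oplus> pd (j - n) v e))"

definition funs :: "((nat \<Rightarrow> nat) \<Rightarrow> 'a) set" where
  "funs = {v. \<forall>e. v e \<in> carrier R}"

lemma funsD: "v \<in> funs \<Longrightarrow> v e \<in> carrier R"
  by (simp add: funs_def)

lemma funsI: "(\<And>e. v e \<in> carrier R) \<Longrightarrow> v \<in> funs"
  by (simp add: funs_def)

lemma fin_supp_funs: "v \<in> fin_supp B \<Longrightarrow> v \<in> funs"
  by (simp add: funs_def fin_suppD(1))

lemma shift_funs [simp]: "v \<in> funs \<Longrightarrow> shift j v \<in> funs"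
  by (auto simp: funs_def shift_def)

lemma pd_funs [simp]: "v \<in> funs \<Longrightarrow> pd j v \<in> funs"
  by (auto simp: funs_def pd_def)

lemma lmul_funs [simp]: "v \<in> funs \<Longrightarrow> lmul j v \<in> funs"
  by (auto simp: lmul_def funsD intro!: funsI a_closed)

lemma shift_add: "v \<in> funs \<Longrightarrow> w \<in> funs \<Longrightarrow> shift j (\<lambda>e. v e \<oplus> w e) = (\<lambda>e. shift j v e \<oplus> shift j w e)"
  by (auto simp: shift_def fun_eq_iff)

lemma pd_add: "v \<in> funs \<Longrightarrow> w \<in> funs \<Longrightarrow> pd j (\<lambda>e. v e \<oplus> w e) = (\<lambda>e. pd j v e \<oplus> pd j w e)"
  by (auto simp: pd_def fun_eq_iff r_distr funs_def)

lemma lmul_add: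
  assumes "v \<in> funs" "w \<in> funs"
  shows "lmul j (\<lambda>e. v e \<oplus> w e) = (\<lambda>e. lmul j v e \<oplus> lmul j w e)"
proof -
  have "shift j v e \<in> carrier R" "shift j w e \<in> carrier R" "pd i v e \<in> carrier R" "pd i w e \<in> carrier R" for e i
    using assms by (auto simp: funsD)
  then show ?thesis
    using assms by (auto simp: lmul_def shift_add pd_add a_ac)
qed

lemma shift_smult: "a \<in> carrier R \<Longrightarrow> v \<in> funs \<Longrightarrow> shift j (\<lambda>e. a \<otimes> v e) = (\<lambda>e. a \<otimes> shift j v e)"
  by (auto simp: shift_def fun_eq_iff)

lemma pd_smult: "a \<in> carrier R \<Longrightarrow> v \<in> funs \<Longrightarrow> pd j (\<lambda>e. a \<otimes> v e) = (\<lambda>e. a \<otimes> pd j v e)"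
  by (auto simp: pd_def fun_eq_iff funs_def m_lcomm)

lemma lmul_smult:
  assumes "a \<in> carrier R" "v \<in> funs"
  shows "lmul j (\<lambda>e. a \<otimes> v e) = (\<lambda>e. a \<otimes> lmul j v e)"
proof -
  have "shift j v e \<in> carrier R" "pd i v e \<in> carrier R" for e i
    using assms by (auto simp: funsD)
  then show ?thesis
    using assms by (auto simp: lmul_def shift_smult pd_smult r_distr)
qed

lemma shift_shift: "shift i (shift j v) = shift j (shift i v)"
  by (cases "i = j") (auto simp: shift_def fun_eq_iff fun_upd_twist)

lemma pd_pd: "v \<in> funs \<Longrightarrow> pd i (pd j v) = pd j (pd i v)"
  by (cases "i = j") (auto simp: pd_def fun_eq_iff fun_upd_twist m_lcomm funsD)

lemma pd_shift: "i \<noteq> j \<Longrightarrow> pd i (shift j v) = shift j (pd i v)"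
  by (auto simp: pd_def shift_def fun_eq_iff fun_upd_twist)

lemma pd_shift_same:
  assumes "v \<in> funs"
  shows "pd j (shift j v) = (\<lambda>e. shift j (pd j v) e \<oplus> v e)"
proof
  fix e
  show "pd j (shift j v) e = shift j (pd j v) e \<oplus> v e"
  proof (cases "e j")
    case 0
    then have "e(j := 0) = e" by auto
    then show ?thesis using 0 funsD[OF assms] by (simp add: pd_def shift_def nc_Suc)
  next
    case (Suc k)
    have "e(j := Suc k) = e" using Suc by auto
    then show ?thesis using funsD[OF assms] Suc by (simp add: pd_def shift_def nc_Suc l_distr)
  qed
qed

text \<open>A multiplication commutes with the derivative by a different variable. The hypotheses
  exclude exactly the conjugate pairs x_l, d_l, in either order.\<close>

lemma lmul_comm:
  assumes "i < 2 * n" "j < 2 * n" "i \<noteq> n + j" "j \<noteq> n + i" and v: "v \<in> funs"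
  shows "lmul i (lmul j v) = lmul j (lmul i v)"
proof -
  have *: "lmul i (lmul j v) = lmul j (lmul i v)"
    if "i < n" "j < 2 * n" "j \<noteq> n + i" for i j
  proof (cases "j < n")
    case True
    then show ?thesis using that by (simp add: lmul_def shift_shift)
  next
    case False
    then have "j - n \<noteq> i" using that by auto
    then show ?thesis
      using that False v
      by (simp add: lmul_def shift_add pd_shift) (simp add: shift_shift[of i j])
  qed
  have [simp]: "shift i v e \<in> carrier R" "pd i v e \<in> carrier R" if "v \<in> funs" for e i v
    using that by (auto simp: funsD)
  show ?thesis
  proof (cases "i < n \<or> j < n")
    case True
    then show ?thesis using *[of i j] *[of j i] assms by auto
  next
    case False
    then have "i - n \<noteq> j" "j - n \<noteq> i" using assms by auto
    then show ?thesis
      using False v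
      by (simp add: lmul_def shift_add pd_add pd_shift shift_shift[of i j] pd_pd[of v "i - n" "j - n"] a_ac)
  qed
qed

text \<open>The extra v comes from the Leibniz rule \<open>pd_shift_same\<close>; the symbol part of
  d_l is a multiplication and commutes with x_l.\<close>

lemma lmul_comm_pair:
  assumes "l < n" and v: "v \<in> funs"
  shows "lmul (n + l) (lmul l v) = (\<lambda>e. lmul l (lmul (n + l) v) e \<oplus> v e)"
proof -
  have [simp]: "shift i v e \<in> carrier R" "pd i v e \<in> carrier R" if "v \<in> funs" for e i v
    using that by (auto simp: funsD)
  show ?thesis
    using assms funsD[OF v]
    by (simp add: lmul_def shift_add pd_shift_same shift_shift[of l] a_ac)
qed

lemma shift_fin_supp:
  assumes "v \<in> fin_supp exps" "j < 2 * n"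
  shows "shift j v \<in> fin_supp exps"
proof (rule fin_suppI)
  note D = fin_suppD[OF assms(1)]
  show "shift j v e \<in> carrier R" for e
    using D(1) by (auto simp: shift_def)
  have "{e. shift j v e \<noteq> \<zero>} \<subseteq> (\<lambda>e. e(j := Suc (e j))) ` {e. v e \<noteq> \<zero>}"
  proof
    fix e assume "e \<in> {e. shift j v e \<noteq> \<zero>}"
    then have "e j \<noteq> 0" "v (e(j := e j - 1)) \<noteq> \<zero>" by (auto simp: shift_def split: if_splits)
    then show "e \<in> (\<lambda>e. e(j := Suc (e j))) ` {e. v e \<noteq> \<zero>}"
      by (intro image_eqI[of _ _ "e(j := e j - 1)"]) auto
  qed
  then show "finite {e. shift j v e \<noteq> \<zero>}"
    using D(2) by (auto intro: finite_subset)
  fix e assume "shift j v e \<noteq> \<zero>"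
  then have "e(j := e j - 1) \<in> exps" using D(3)[of "e(j := e j - 1)"] by (auto simp: shift_def split: if_splits)
  then show "e \<in> exps" using assms(2) by (auto simp: exps_def split: if_splits)
qed

lemma pd_fin_supp:
  assumes "v \<in> fin_supp exps"
  shows "pd j v \<in> fin_supp exps"
proof (rule fin_suppI)
  note D = fin_suppD[OF assms(1)]
  show "pd j v e \<in> carrier R" for e
    using D(1) by (auto simp: pd_def)
  have *: "v (e(j := Suc (e j))) \<noteq> \<zero>" if "pd j v e \<noteq> \<zero>" for e
    using that by (auto simp: pd_def)
  have "{e. pd j v e \<noteq> \<zero>} \<subseteq> (\<lambda>e. e(j := e j - 1)) ` {e. v e \<noteq> \<zero>}"
  proof
    fix e assume "e \<in> {e. pd j v e \<noteq> \<zero>}"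
    then show "e \<in> (\<lambda>e. e(j := e j - 1)) ` {e. v e \<noteq> \<zero>}"
      using * by (intro image_eqI[of _ _ "e(j := Suc (e j))"]) auto
  qed
  then show "finite {e. pd j v e \<noteq> \<zero>}"
    using D(2) by (auto intro: finite_subset)
  fix e assume "pd j v e \<noteq> \<zero>"
  then have "e(j := Suc (e j)) \<in> exps" using D(3) * by auto
  then show "e \<in> exps" by (auto simp: exps_def split: if_splits)
qed

lemma lmul_fin_supp:
  assumes "v \<in> fin_supp exps" "j < 2 * n"
  shows "lmul j v \<in> fin_supp exps"
  using fin_supp_add[OF shift_fin_supp[OF assms] pd_fin_supp[OF assms(1), of "j - n"]] shift_fin_supp[OF assms]
  by (auto simp: lmul_def)

lemma exps_zero [simp]: "(\<lambda>_. 0) \<in> exps"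
  by (simp add: exps_def)

lemma shift_single: "shift j (single a e) = single a (e(j := Suc (e j)))"
  by (auto simp: shift_def single_def fun_eq_iff)

lemma pd_single:
  assumes "a \<in> carrier R"
  shows "pd j (single a e) = single (nc (e j) \<otimes> a) (e(j := e j - 1))"
proof
  fix c
  show "pd j (single a e) c = single (nc (e j) \<otimes> a) (e(j := e j - 1)) c"
  proof (cases "e j")
    case 0
    then have "c(j := Suc (c j)) \<noteq> e" by auto
    then show ?thesis using 0 assms by (auto simp: pd_def single_def)
  next
    case (Suc k)
    have "c(j := Suc (c j)) = e \<longleftrightarrow> c = e(j := k)"
      using Suc by (auto simp: fun_eq_iff split: if_splits)
    then show ?thesis using Suc assms by (auto simp: pd_def single_def)
  qed
qed

section \<open>The action of the free algebra\<close>

fun idx :: "weyl_gen \<Rightarrow> nat" where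
  "idx (Gx i) = i - 1"
| "idx (Gd i) = n + (i - 1)"

definition letter :: "nat \<Rightarrow> weyl_gen" where
  "letter j = (if j < n then Gx (Suc j) else Gd (Suc (j - n)))"

lemma idx_letter [simp]: "idx (letter j) = j"
  by (auto simp: letter_def)

lemma letter_idx: "g \<in> weyl_gens n \<Longrightarrow> letter (idx g) = g"
  by (auto simp: letter_def weyl_gens_def)

lemma idx_less: "g \<in> weyl_gens n \<Longrightarrow> idx g < 2 * n"
  by (auto simp: weyl_gens_def)

lemma letter_mem: "j < 2 * n \<Longrightarrow> letter j \<in> weyl_gens n"
  by (auto simp: letter_def weyl_gens_def)

definition act :: "weyl_gen list \<Rightarrow> ((nat \<Rightarrow> nat) \<Rightarrow> 'a) \<Rightarrow> (nat \<Rightarrow> nat) \<Rightarrow> 'a" where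
  "act w v = foldr (\<lambda>g. lmul (idx g)) w v"

lemma act_Nil [simp]: "act [] v = v"
  by (simp add: act_def)

lemma act_Cons [simp]: "act (g # w) v = lmul (idx g) (act w v)"
  by (simp add: act_def)

lemma act_append: "act (u @ w) v = act u (act w v)"
  by (simp add: act_def)

lemma act_funs [simp]: "v \<in> funs \<Longrightarrow> act w v \<in> funs"
  by (induction w) auto

lemma act_fin_supp: "v \<in> fin_supp exps \<Longrightarrow> set w \<subseteq> weyl_gens n \<Longrightarrow> act w v \<in> fin_supp exps"
  by (induction w) (auto intro: lmul_fin_supp idx_less)

lemma act_add: "v \<in> funs \<Longrightarrow> v' \<in> funs \<Longrightarrow> act w (\<lambda>e. v e \<oplus> v' e) = (\<lambda>e. act w v e \<oplus> act w v' e)"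
  by (induction w) (auto simp: lmul_add)

lemma act_smult: "a \<in> carrier R \<Longrightarrow> v \<in> funs \<Longrightarrow> act w (\<lambda>e. a \<otimes> v e) = (\<lambda>e. a \<otimes> act w v e)"
  by (induction w) (auto simp: lmul_smult)

lemma act_zero: "act w (\<lambda>e. \<zero>) = (\<lambda>e. \<zero>)"
  by (induction w) (auto simp: lmul_def shift_def pd_def fun_eq_iff)

definition rho :: "(weyl_gen list \<Rightarrow> 'a) \<Rightarrow> ((nat \<Rightarrow> nat) \<Rightarrow> 'a) \<Rightarrow> (nat \<Rightarrow> nat) \<Rightarrow> 'a" where
  "rho f v = (\<lambda>e. \<Oplus>w\<in>{w. f w \<noteq> \<zero>}. f w \<otimes> act w v e)"

abbreviation "W0 \<equiv> fin_supp {w. set w \<subseteq> weyl_gens n}"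

lemma rho_alt:
  assumes "finite A" "{w. f w \<noteq> \<zero>} \<subseteq> A" "f \<in> W0" "v \<in> funs"
  shows "rho f v e = (\<Oplus>w\<in>A. f w \<otimes> act w v e)"
  unfolding rho_def using assms by (intro finsum_supp) (auto simp: fin_suppD funsD)

lemma rho_funs [simp]: "f \<in> W0 \<Longrightarrow> v \<in> funs \<Longrightarrow> rho f v \<in> funs"
  unfolding rho_def by (intro funsI finsum_closed) (auto simp: fin_suppD funsD)

lemma rho_add:
  assumes "f \<in> W0" "g \<in> W0" "v \<in> funs"
  shows "rho (\<lambda>w. f w \<oplus> g w) v = (\<lambda>e. rho f v e \<oplus> rho g v e)"
proof
  fix e
  let ?A = "{w. f w \<noteq> \<zero>} \<union> {w. g w \<noteq> \<zero>}"
  note D = fin_suppD[OF assms(1)] fin_suppD[OF assms(2)]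
  have fin: "finite ?A" using D by auto
  have sub: "{w. f w \<oplus> g w \<noteq> \<zero>} \<subseteq> ?A" by auto
  have c: "act w v e \<in> carrier R" for w using assms(3) by (auto simp: funsD)
  have "rho (\<lambda>w. f w \<oplus> g w) v e = (\<Oplus>w\<in>?A. (f w \<oplus> g w) \<otimes> act w v e)"
    by (rule rho_alt[OF fin sub fin_supp_add]) (use assms in auto)
  also have "\<dots> = (\<Oplus>w\<in>?A. f w \<otimes> act w v e \<oplus> g w \<otimes> act w v e)"
    using D c by (intro finsum_cong') (auto simp: l_distr)
  also have "\<dots> = (\<Oplus>w\<in>?A. f w \<otimes> act w v e) \<oplus> (\<Oplus>w\<in>?A. g w \<otimes> act w v e)"
    using D c by (intro finsum_addf) auto
  also have "\<dots> = rho f v e \<oplus> rho g v e"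
    using assms fin by (subst (1 2) rho_alt[of ?A]) auto
  finally show "rho (\<lambda>w. f w \<oplus> g w) v e = rho f v e \<oplus> rho g v e" .
qed

lemma rho_single:
  assumes "a \<in> carrier R" "set w \<subseteq> weyl_gens n" "v \<in> funs"
  shows "rho (single a w) v = (\<lambda>e. a \<otimes> act w v e)"
proof
  fix e
  have "rho (single a w) v e = (\<Oplus>w'\<in>{w}. single a w w' \<otimes> act w' v e)"
    using assms by (intro rho_alt single_closed) (auto simp: single_def split: if_splits)
  also have "\<dots> = a \<otimes> act w v e"
    using assms by (simp add: single_def funsD)
  finally show "rho (single a w) v e = a \<otimes> act w v e" .
qed

lemma rho_zero: "rho (\<lambda>w. \<zero>) v = (\<lambda>e. \<zero>)"
  by (simp add: rho_def)

lemma rho_add_right: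
  assumes "f \<in> W0" "v \<in> funs" "v' \<in> funs"
  shows "rho f (\<lambda>e. v e \<oplus> v' e) = (\<lambda>e. rho f v e \<oplus> rho f v' e)"
  unfolding rho_def using assms fin_suppD[OF assms(1)]
  by (auto simp: act_add r_distr funsD intro!: ext finsum_addf trans[OF finsum_cong'[OF refl]])

lemma rho_zero_right: "f \<in> W0 \<Longrightarrow> rho f (\<lambda>e. \<zero>) = (\<lambda>e. \<zero>)"
  by (auto simp: rho_def act_zero fin_suppD(1) intro!: ext trans[OF finsum_cong'[OF refl] finsum_zero])

text \<open>Both sides are biadditive in f and g, so single words suffice, and there the claim is
  \<open>act_append\<close> with linearity of the action.\<close>

lemma rho_conv:
  assumes "f \<in> W0" "g \<in> W0" "v \<in> funs"
  shows "rho (conv f g) v = rho f (rho g v)"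
  using assms(1)
proof (induction rule: fin_supp_induct)
  case zero
  have "conv (\<lambda>x. \<zero>) g = (\<lambda>x. \<zero>)"
    using fin_suppD(1)[OF assms(2)] by (auto simp: conv_zero_left)
  then show ?case by (simp add: rho_zero)
next
  case (add f f')
  have "conv (\<lambda>x. f x \<oplus> f' x) g = (\<lambda>w. conv f g w \<oplus> conv f' g w)"
    using fin_suppD(1)[OF assms(2)] fin_suppD(1)[OF add(1)] fin_suppD(1)[OF add(2)] by (auto simp: conv_add_left)
  then show ?case using add assms by (simp add: rho_add conv_fin_supp)
next
  case (single a w)
  note aw = single
  have sg: "single a w \<in> W0" using single by (auto intro: single_closed)
  show ?case using assms(2)
  proof (induction rule: fin_supp_induct)
    case zero
    have "conv (single a w) (\<lambda>x. \<zero>) = (\<lambda>x. \<zero>)"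
      using aw by (auto simp: conv_def finsum_zero single_carrier)
    then show ?case using sg by (simp add: rho_zero rho_zero_right)
  next
    case (add g g')
    have "conv (single a w) (\<lambda>x. g x \<oplus> g' x) = (\<lambda>u. conv (single a w) g u \<oplus> conv (single a w) g' u)"
      using fin_suppD(1)[OF add(1)] fin_suppD(1)[OF add(2)] aw by (auto simp: conv_add_right single_carrier)
    then show ?case using add assms sg by (simp add: rho_add conv_fin_supp rho_add_right)
  next
    case (single b u)
    then show ?case
      using assms aw by (auto simp: conv_single_single rho_single act_append act_smult fun_eq_iff m_assoc funsD
          funs_def[THEN arg_cong, of "\<lambda>S. (\<lambda>e. b \<otimes> act u v e) \<in> S"])
  qed
qed

section \<open>The relations act by zero\<close>

abbreviation "FA \<equiv> weyl_free R n"
abbreviation "WI \<equiv> weyl_ideal R n"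
abbreviation "WA \<equiv> weyl_algebra R n"

sublocale FA: ring FA
  by (rule free_algebra_ring)

text \<open>The kernel of the action. Being an ideal that contains the relators it contains
  \<open>WI\<close>, which makes the action well defined on the Weyl algebra.\<close>

definition annih :: "(weyl_gen list \<Rightarrow> 'a) set" where
  "annih = {f \<in> W0. \<forall>v\<in>funs. rho f v = (\<lambda>e. \<zero>)}"

lemma annih_ideal: "ideal annih FA"
proof (rule idealI)
  show "ring FA" by (rule free_algebra_ring)
  show "subgroup annih (add_monoid FA)"
  proof (rule FA.add.subgroupI)
    show "annih \<subseteq> carrier FA" by (auto simp: annih_def free_algebra_simps)
    show "annih \<noteq> {}" using rho_zero fin_supp_zero by (auto simp: annih_def)
    fix f assume f: "f \<in> annih"
    then have f0: "f \<in> W0" by (auto simp: annih_def)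
    define g where "g = \<ominus>\<^bsub>FA\<^esub> f"
    have g: "g \<in> W0" using f0 FA.a_inv_closed[of f] by (simp add: g_def free_algebra_simps)
    have fg: "f \<oplus>\<^bsub>FA\<^esub> g = \<zero>\<^bsub>FA\<^esub>" using f0 by (simp add: g_def FA.r_neg free_algebra_simps(1))
    have "rho g v = (\<lambda>e. \<zero>)" if v: "v \<in> funs" for v
    proof -
      have "(\<lambda>e. rho f v e \<oplus> rho g v e) = (\<lambda>e. \<zero>)"
        using rho_add[OF f0 g v] fg by (simp add: free_algebra_simps rho_zero)
      then show ?thesis
        using f v rho_funs[OF g v] by (auto simp: annih_def fun_eq_iff funsD)
    qed
    then show "\<ominus>\<^bsub>FA\<^esub> f \<in> annih" using g by (auto simp: annih_def g_def)
  next
    fix f g assume "f \<in> annih" "g \<in> annih"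
    then show "f \<oplus>\<^bsub>FA\<^esub> g \<in> annih"
      by (auto simp: annih_def free_algebra_simps rho_add fin_supp_add)
  qed
next
  fix a x assume "a \<in> annih" "x \<in> carrier FA"
  then show "x \<otimes>\<^bsub>FA\<^esub> a \<in> annih" "a \<otimes>\<^bsub>FA\<^esub> x \<in> annih"
    by (auto simp: annih_def free_algebra_simps rho_conv conv_fin_supp rho_zero_right)
qed

text \<open>The difference h enters only through \<open>h + g = f\<close>; additivity of
  \<open>rho\<close> then forces it to act by zero.\<close>

lemma annih_minus:
  assumes "f \<in> W0" "g \<in> W0" "\<And>v. v \<in> funs \<Longrightarrow> rho f v = rho g v"
  shows "f \<ominus>\<^bsub>FA\<^esub> g \<in> annih"
proof -
  define h where "h = f \<ominus>\<^bsub>FA\<^esub> g"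
  have h: "h \<in> W0" using assms(1,2) FA.minus_closed[of f g] by (simp add: h_def free_algebra_simps)
  have "f \<in> carrier FA" "g \<in> carrier FA" using assms(1,2) by (auto simp: free_algebra_simps)
  then have "h \<oplus>\<^bsub>FA\<^esub> g = f"
    by (simp add: h_def FA.minus_eq FA.a_assoc FA.l_neg)
  then have eq: "(\<lambda>w. h w \<oplus> g w) = f" by (simp add: free_algebra_simps)
  have "rho h v e = \<zero>" if v: "v \<in> funs" for v e
  proof -
    have "rho h v e \<oplus> rho g v e = rho g v e"
      using rho_add[OF h assms(2) v] eq assms(3)[OF v] by (simp add: fun_eq_iff)
    then show ?thesis
      using v h assms(2) by (simp add: funsD)
  qed
  then show ?thesis using h by (auto simp: annih_def h_def)
qed

lemma single_W0: "a \<in> carrier R \<Longrightarrow> set w \<subseteq> weyl_gens n \<Longrightarrow> single a w \<in> W0"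
  by (rule single_closed) auto

lemma relators_annih: "weyl_relators R n \<subseteq> annih"
proof -
  have gx: "Gx i \<in> weyl_gens n" and gd: "Gd i \<in> weyl_gens n" if "i \<in> {1..n}" for i
    using that by (auto simp: weyl_gens_def)
  have conv2: "free_alg_gen R a \<otimes>\<^bsub>FA\<^esub> free_alg_gen R b = single \<one> [a, b]" for a b
    by (simp add: free_algebra_simps free_alg_gen_single conv_single_single)
  have comm: "ring_commutator FA (free_alg_gen R a) (free_alg_gen R b) \<in> annih"
    if "a \<in> weyl_gens n" "b \<in> weyl_gens n" "\<And>v. v \<in> funs \<Longrightarrow> lmul (idx a) (lmul (idx b) v) = lmul (idx b) (lmul (idx a) v)"
    for a b
    unfolding ring_commutator_def conv2
    using that by (intro annih_minus single_W0) (auto simp: rho_single)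
  have "ring_commutator FA (free_alg_gen R (Gx i)) (free_alg_gen R (Gx j)) \<in> annih"
    if "i \<in> {1..n}" "j \<in> {1..n}" for i j
    using that by (intro comm gx lmul_comm) auto
  moreover have "ring_commutator FA (free_alg_gen R (Gd i)) (free_alg_gen R (Gd j)) \<in> annih"
    if "i \<in> {1..n}" "j \<in> {1..n}" for i j
    using that by (intro comm gd lmul_comm) auto
  moreover have "ring_commutator FA (free_alg_gen R (Gd i)) (free_alg_gen R (Gx j))
      \<ominus>\<^bsub>FA\<^esub> (if i = j then \<one>\<^bsub>FA\<^esub> else \<zero>\<^bsub>FA\<^esub>) \<in> annih"
    if ij: "i \<in> {1..n}" "j \<in> {1..n}" for i j
  proof (cases "i = j")
    case False
    have "ring_commutator FA (free_alg_gen R (Gd i)) (free_alg_gen R (Gx j)) \<in> annih"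
      using False ij by (intro comm gx gd lmul_comm) auto
    then show ?thesis using False annih_ideal
      by (auto simp: FA.minus_eq annih_def free_algebra_simps(1))
  next
    case True
    define a where "a = single \<one> [Gd i, Gx i]"
    define b where "b = single \<one> [Gx i, Gd i]"
    have ab: "a \<in> W0" "b \<in> W0" "\<one>\<^bsub>FA\<^esub> \<in> W0"
      using ij gx gd by (auto simp: a_def b_def free_algebra_simps intro!: single_W0)
    then have ab': "a \<in> carrier FA" "b \<in> carrier FA" by (auto simp: free_algebra_simps)
    have "a \<ominus>\<^bsub>FA\<^esub> (b \<oplus>\<^bsub>FA\<^esub> \<one>\<^bsub>FA\<^esub>) \<in> annih"
    proof (rule annih_minus)
      show "b \<oplus>\<^bsub>FA\<^esub> \<one>\<^bsub>FA\<^esub> \<in> W0" using ab by (simp add: free_algebra_simps(5) fin_supp_add)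
      fix v assume v: "v \<in> funs"
      have "lmul (n + (i - 1)) (lmul (i - 1) v) = (\<lambda>e. lmul (i - 1) (lmul (n + (i - 1)) v) e \<oplus> v e)"
        using ij v by (intro lmul_comm_pair) auto
      then show "rho a v = rho (b \<oplus>\<^bsub>FA\<^esub> \<one>\<^bsub>FA\<^esub>) v"
        using ij v gx gd ab
        by (simp add: free_algebra_simps(5) rho_add)
           (simp add: a_def b_def rho_single free_algebra_simps funsD)
    qed (use ab in auto)
    also have "a \<ominus>\<^bsub>FA\<^esub> (b \<oplus>\<^bsub>FA\<^esub> \<one>\<^bsub>FA\<^esub>) = (a \<ominus>\<^bsub>FA\<^esub> b) \<ominus>\<^bsub>FA\<^esub> \<one>\<^bsub>FA\<^esub>"
      using ab' by (simp add: FA.minus_eq FA.minus_add FA.a_assoc)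
    finally show ?thesis using True
      by (simp add: ring_commutator_def conv2 a_def b_def)
  qed
  ultimately show ?thesis
    unfolding weyl_relators_def Let_def by auto
qed

lemma relators_closed: "weyl_relators R n \<subseteq> carrier FA"
  using relators_annih by (auto simp: annih_def free_algebra_simps)

sublocale WI: ideal WI FA
  unfolding weyl_ideal_def by (rule FA.genideal_ideal[OF relators_closed])

lemma ideal_annih: "WI \<subseteq> annih"
  unfolding weyl_ideal_def by (rule FA.genideal_minimal[OF annih_ideal relators_annih])

end

section \<open>Normal forms in the Weyl algebra\<close>

context weyl
begin

sublocale A: ring WA
  unfolding weyl_algebra_def by (rule WI.quotient_is_ring)

definition cl :: "(weyl_gen list \<Rightarrow> 'a) \<Rightarrow> (weyl_gen list \<Rightarrow> 'a) set" where
  "cl f = WI +>\<^bsub>FA\<^esub> f"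

lemma cl_hom: "cl \<in> ring_hom FA WA"
  using WI.rcos_ring_hom by (simp add: weyl_algebra_def cl_def[abs_def])

lemma cl_closed [simp]: "f \<in> W0 \<Longrightarrow> cl f \<in> carrier WA"
  using ring_hom_closed[OF cl_hom] by (simp add: free_algebra_simps)

lemma cl_conv: "f \<in> W0 \<Longrightarrow> g \<in> W0 \<Longrightarrow> cl (conv f g) = cl f \<otimes>\<^bsub>WA\<^esub> cl g"
  using ring_hom_mult[OF cl_hom, of f g] by (simp add: free_algebra_simps)

lemma cl_add: "f \<in> W0 \<Longrightarrow> g \<in> W0 \<Longrightarrow> cl (\<lambda>w. f w \<oplus> g w) = cl f \<oplus>\<^bsub>WA\<^esub> cl g"
  using ring_hom_add[OF cl_hom, of f g] by (simp add: free_algebra_simps)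

lemma cl_one: "cl (single \<one> []) = \<one>\<^bsub>WA\<^esub>"
  using ring_hom_one[OF cl_hom] by (simp add: free_algebra_simps)

lemma cl_zero: "cl (\<lambda>w. \<zero>) = \<zero>\<^bsub>WA\<^esub>"
  using ring_hom_zero[OF cl_hom FA.ring_axioms A.ring_axioms] by (simp add: free_algebra_simps)

lemma cl_surj: "a \<in> carrier WA \<Longrightarrow> \<exists>f\<in>W0. a = cl f"
  by (auto simp: weyl_algebra_def FactRing_def A_RCOSETS_def' cl_def free_algebra_simps)

lemma cl_eqD: "f \<in> W0 \<Longrightarrow> g \<in> W0 \<Longrightarrow> cl f = cl g \<Longrightarrow> f \<ominus>\<^bsub>FA\<^esub> g \<in> WI"
  using FA.quotient_eq_iff_same_a_r_cos[OF WI.is_ideal, of f g] by (simp add: cl_def free_algebra_simps(1))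

text \<open>The action depends only on the class in the Weyl algebra. This is the source of
  uniqueness of normal forms: equal classes have equal symbols.\<close>

lemma cl_rho:
  assumes "f \<in> W0" "g \<in> W0" "cl f = cl g" "v \<in> funs"
  shows "rho f v = rho g v"
proof -
  define h where "h = f \<ominus>\<^bsub>FA\<^esub> g"
  have fg: "f \<in> carrier FA" "g \<in> carrier FA" using assms by (auto simp: free_algebra_simps)
  have h: "h \<in> W0" using fg FA.minus_closed[of f g] by (simp add: h_def free_algebra_simps(1))
  have "h \<oplus>\<^bsub>FA\<^esub> g = f" using fg by (simp add: h_def FA.minus_eq FA.a_assoc FA.l_neg)
  then have "rho f v = (\<lambda>e. rho h v e \<oplus> rho g v e)"
    using rho_add[OF h assms(2,4)] by (simp add: free_algebra_simps)
  moreover have "rho h v = (\<lambda>e. \<zero>)"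
    using cl_eqD[OF assms(1-3)] ideal_annih assms(4) by (auto simp: h_def annih_def)
  ultimately show ?thesis using assms by (auto simp: funsD)
qed

section \<open>Generators and scalars of the Weyl algebra and their relations\<close>

definition gA :: "nat \<Rightarrow> (weyl_gen list \<Rightarrow> 'a) set" where
  "gA j = cl (single \<one> [letter j])"

definition sA :: "'a \<Rightarrow> (weyl_gen list \<Rightarrow> 'a) set" where
  "sA a = cl (single a [])"

lemma sA_scalar: "sA a = weyl_scalar R n a"
  by (simp add: sA_def weyl_scalar_def cl_def free_alg_const_single)

lemma gA_closed [simp]: "j < 2 * n \<Longrightarrow> gA j \<in> carrier WA"
  by (simp add: gA_def single_W0 letter_mem)

lemma sA_closed [simp]: "a \<in> carrier R \<Longrightarrow> sA a \<in> carrier WA"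
  by (simp add: sA_def single_W0)

lemma sA_add: "a \<in> carrier R \<Longrightarrow> b \<in> carrier R \<Longrightarrow> sA (a \<oplus> b) = sA a \<oplus>\<^bsub>WA\<^esub> sA b"
proof -
  assume "a \<in> carrier R" "b \<in> carrier R"
  then have "sA a \<oplus>\<^bsub>WA\<^esub> sA b = cl (\<lambda>w. single a [] w \<oplus> single b [] w)"
    by (simp add: sA_def cl_add single_W0)
  also have "(\<lambda>w. single a [] w \<oplus> single b [] w) = single (a \<oplus> b) []"
    by (auto simp: single_def)
  finally show ?thesis by (simp add: sA_def)
qed

lemma sA_mult: "a \<in> carrier R \<Longrightarrow> b \<in> carrier R \<Longrightarrow> sA (a \<otimes> b) = sA a \<otimes>\<^bsub>WA\<^esub> sA b"
  by (simp add: sA_def cl_conv[symmetric] single_W0 conv_single_single)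

lemma sA_zero [simp]: "sA \<zero> = \<zero>\<^bsub>WA\<^esub>"
proof -
  have "(single \<zero> [] :: weyl_gen list \<Rightarrow> 'a) = (\<lambda>w. \<zero>)" by (auto simp: single_def)
  then show ?thesis by (simp add: sA_def cl_zero)
qed

lemma sA_one [simp]: "sA \<one> = \<one>\<^bsub>WA\<^esub>"
  by (simp add: sA_def cl_one)

lemma sA_gA: "a \<in> carrier R \<Longrightarrow> j < 2 * n \<Longrightarrow> sA a \<otimes>\<^bsub>WA\<^esub> gA j = gA j \<otimes>\<^bsub>WA\<^esub> sA a"
  by (simp add: sA_def gA_def cl_conv[symmetric] single_W0 conv_single_single letter_mem)

lemma relator_zero:
  assumes "r \<in> weyl_relators R n" shows "cl r = \<zero>\<^bsub>WA\<^esub>"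
proof -
  have "r \<in> WI" unfolding weyl_ideal_def using FA.genideal_self[OF relators_closed] assms by auto
  then show ?thesis
    by (simp add: cl_def weyl_algebra_def FactRing_def FA.a_rcos_zero[OF WI.is_ideal])
qed

lemma cl_commutator:
  assumes "i < 2 * n" "j < 2 * n"
  shows "cl (ring_commutator FA (free_alg_gen R (letter i)) (free_alg_gen R (letter j)))
       = gA i \<otimes>\<^bsub>WA\<^esub> gA j \<ominus>\<^bsub>WA\<^esub> gA j \<otimes>\<^bsub>WA\<^esub> gA i"
proof -
  interpret h: ring_hom_ring FA WA cl
    by (rule ring_hom_ringI2[OF FA.ring_axioms A.ring_axioms cl_hom])
  have "single \<one> [letter i] \<in> carrier FA" "single \<one> [letter j] \<in> carrier FA"
    using assms by (auto simp: free_algebra_simps intro!: single_closed letter_mem)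
  then show ?thesis
    by (simp add: ring_commutator_def free_alg_gen_single FA.minus_eq A.minus_eq gA_def)
qed

lemma gA_comm:
  assumes "i < 2 * n" "j < 2 * n" "i \<noteq> n + j" "j \<noteq> n + i"
  shows "gA i \<otimes>\<^bsub>WA\<^esub> gA j = gA j \<otimes>\<^bsub>WA\<^esub> gA i"
proof -
  have eqI: "x = y" if "x \<in> carrier WA" "y \<in> carrier WA" "x \<ominus>\<^bsub>WA\<^esub> y = \<zero>\<^bsub>WA\<^esub>" for x y
    using that by simp
  have comm1: "gA i \<otimes>\<^bsub>WA\<^esub> gA j = gA j \<otimes>\<^bsub>WA\<^esub> gA i"
    if "i < 2 * n" "j < 2 * n" "ring_commutator FA (free_alg_gen R (letter i)) (free_alg_gen R (letter j)) \<in> weyl_relators R n" for i j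
    using relator_zero[OF that(3)] that(1,2) eqI[of "gA i \<otimes>\<^bsub>WA\<^esub> gA j" "gA j \<otimes>\<^bsub>WA\<^esub> gA i"]
    by (simp add: cl_commutator[OF that(1,2)])
  have dx: "gA i \<otimes>\<^bsub>WA\<^esub> gA j = gA j \<otimes>\<^bsub>WA\<^esub> gA i" if "n \<le> i" "i < 2 * n" "j < n" "i \<noteq> n + j" for i j
  proof -
    let ?c = "ring_commutator FA (free_alg_gen R (letter i)) (free_alg_gen R (letter j))"
    have mem: "free_alg_gen R (letter i) \<in> carrier FA" "free_alg_gen R (letter j) \<in> carrier FA"
      using that by (auto simp: free_algebra_simps(1) free_alg_gen_single single_W0 letter_mem)
    have "?c \<ominus>\<^bsub>FA\<^esub> \<zero>\<^bsub>FA\<^esub> \<in> weyl_relators R n"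
      unfolding weyl_relators_def Let_def letter_def using that
      by (intro UN_I[of "Suc (i - n)"] UN_I[of "Suc j"]) auto
    also have "?c \<ominus>\<^bsub>FA\<^esub> \<zero>\<^bsub>FA\<^esub> = ?c"
      using mem by (simp add: ring_commutator_def FA.minus_eq)
    finally show ?thesis using that by (intro comm1) auto
  qed
  consider "i < n" "j < n" | "n \<le> i" "n \<le> j" | "n \<le> i" "j < n" | "i < n" "n \<le> j" by linarith
  then show ?thesis
  proof cases
    case 1
    then have "ring_commutator FA (free_alg_gen R (Gx (Suc i))) (free_alg_gen R (Gx (Suc j))) \<in> weyl_relators R n"
      unfolding weyl_relators_def Let_def by (intro UN_I[of "Suc i"] UN_I[of "Suc j"]) auto
    then show ?thesis using 1 assms by (intro comm1) (auto simp: letter_def)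
  next
    case 2
    then have "i - n < n" "j - n < n" using assms by auto
    then have "ring_commutator FA (free_alg_gen R (Gd (Suc (i - n)))) (free_alg_gen R (Gd (Suc (j - n)))) \<in> weyl_relators R n"
      unfolding weyl_relators_def Let_def by (intro UN_I[of "Suc (i - n)"] UN_I[of "Suc (j - n)"]) auto
    then show ?thesis using 2 assms by (intro comm1) (auto simp: letter_def)
  next
    case 3 then show ?thesis using dx[of i j] assms by auto
  next
    case 4 then show ?thesis using dx[of j i] assms by auto
  qed
qed

lemma A_eq_add: "a \<in> carrier WA \<Longrightarrow> b \<in> carrier WA \<Longrightarrow> a = b \<oplus>\<^bsub>WA\<^esub> (a \<ominus>\<^bsub>WA\<^esub> b)"
  by (simp add: A.minus_eq A.a_lcomm[of b a] A.r_neg)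

lemma gA_comm_pair:
  assumes "l < n"
  shows "gA (n + l) \<otimes>\<^bsub>WA\<^esub> gA l = gA l \<otimes>\<^bsub>WA\<^esub> gA (n + l) \<oplus>\<^bsub>WA\<^esub> \<one>\<^bsub>WA\<^esub>"
proof -
  interpret h: ring_hom_ring FA WA cl
    by (rule ring_hom_ringI2[OF FA.ring_axioms A.ring_axioms cl_hom])
  let ?c = "ring_commutator FA (free_alg_gen R (letter (n + l))) (free_alg_gen R (letter l))"
  have mem: "free_alg_gen R (letter (n + l)) \<in> carrier FA" "free_alg_gen R (letter l) \<in> carrier FA"
    using assms by (auto simp: free_algebra_simps(1) free_alg_gen_single single_W0 letter_mem)
  then have c: "?c \<in> carrier FA" by (simp add: ring_commutator_def)
  have r: "?c \<ominus>\<^bsub>FA\<^esub> \<one>\<^bsub>FA\<^esub> \<in> weyl_relators R n"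
    unfolding weyl_relators_def Let_def letter_def using assms
    by (intro UN_I[of "Suc l"] UN_I[of "Suc l"]) auto
  have "cl ?c \<ominus>\<^bsub>WA\<^esub> \<one>\<^bsub>WA\<^esub> = \<zero>\<^bsub>WA\<^esub>"
    using relator_zero[OF r] c by (simp add: FA.minus_eq A.minus_eq)
  then have "cl ?c = \<one>\<^bsub>WA\<^esub>" using c h.hom_closed by simp
  then have "gA (n + l) \<otimes>\<^bsub>WA\<^esub> gA l \<ominus>\<^bsub>WA\<^esub> gA l \<otimes>\<^bsub>WA\<^esub> gA (n + l) = \<one>\<^bsub>WA\<^esub>"
    using assms by (simp add: cl_commutator)
  then show ?thesis
    using assms A_eq_add[of "gA (n + l) \<otimes>\<^bsub>WA\<^esub> gA l" "gA l \<otimes>\<^bsub>WA\<^esub> gA (n + l)"] by simp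
qed

section \<open>Ordered monomials and left multiplication by a generator\<close>

definition pw :: "nat list \<Rightarrow> (nat \<Rightarrow> nat) \<Rightarrow> (weyl_gen list \<Rightarrow> 'a) set" where
  "pw xs e = foldr (\<lambda>j b. gA j [^]\<^bsub>WA\<^esub> e j \<otimes>\<^bsub>WA\<^esub> b) xs \<one>\<^bsub>WA\<^esub>"

lemma pw_Nil [simp]: "pw [] e = \<one>\<^bsub>WA\<^esub>" by (simp add: pw_def)
lemma pw_Cons [simp]: "pw (j # xs) e = gA j [^]\<^bsub>WA\<^esub> e j \<otimes>\<^bsub>WA\<^esub> pw xs e" by (simp add: pw_def)

lemma pw_closed [simp]: "set xs \<subseteq> {..<2 * n} \<Longrightarrow> pw xs e \<in> carrier WA"
  by (induction xs) auto

lemma pw_append: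
  "set xs \<subseteq> {..<2 * n} \<Longrightarrow> set ys \<subseteq> {..<2 * n} \<Longrightarrow> pw (xs @ ys) e = pw xs e \<otimes>\<^bsub>WA\<^esub> pw ys e"
  by (induction xs) (auto simp: A.m_assoc)

lemma pw_cong: "(\<And>i. i \<in> set xs \<Longrightarrow> e i = e' i) \<Longrightarrow> pw xs e = pw xs e'"
  by (induction xs) auto

lemma pw_commute:
  assumes "set xs \<subseteq> {..<2 * n}" "a \<in> carrier WA" "\<And>i. i \<in> set xs \<Longrightarrow> gA i \<otimes>\<^bsub>WA\<^esub> a = a \<otimes>\<^bsub>WA\<^esub> gA i"
  shows "a \<otimes>\<^bsub>WA\<^esub> pw xs e = pw xs e \<otimes>\<^bsub>WA\<^esub> a"
  using assms
proof (induction xs)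
  case Nil
  then show ?case by simp
next
  case (Cons i xs)
  have p: "a \<otimes>\<^bsub>WA\<^esub> gA i [^]\<^bsub>WA\<^esub> e i = gA i [^]\<^bsub>WA\<^esub> e i \<otimes>\<^bsub>WA\<^esub> a"
    using Cons.prems by (intro A.group_commutes_pow[symmetric]) auto
  have "a \<otimes>\<^bsub>WA\<^esub> (gA i [^]\<^bsub>WA\<^esub> e i \<otimes>\<^bsub>WA\<^esub> pw xs e) = (a \<otimes>\<^bsub>WA\<^esub> gA i [^]\<^bsub>WA\<^esub> e i) \<otimes>\<^bsub>WA\<^esub> pw xs e"
    using Cons.prems by (simp add: A.m_assoc)
  also have "\<dots> = gA i [^]\<^bsub>WA\<^esub> e i \<otimes>\<^bsub>WA\<^esub> (a \<otimes>\<^bsub>WA\<^esub> pw xs e)"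
    using Cons.prems p by (simp add: A.m_assoc)
  also have "\<dots> = gA i [^]\<^bsub>WA\<^esub> e i \<otimes>\<^bsub>WA\<^esub> (pw xs e \<otimes>\<^bsub>WA\<^esub> a)"
    using Cons by simp
  finally show ?case using Cons.prems by (simp add: A.m_assoc)
qed

definition mon :: "(nat \<Rightarrow> nat) \<Rightarrow> (weyl_gen list \<Rightarrow> 'a) set" where
  "mon e = pw [0..<2 * n] e"

lemma mon_closed [simp]: "mon e \<in> carrier WA"
  unfolding mon_def by (rule pw_closed) auto

lemma upt_split: "i < m \<Longrightarrow> [0..<m] = [0..<i] @ i # [Suc i..<m]"
  using upt_add_eq_append[of 0 i "m - i"] upt_conv_Cons[of i m] by simp

text \<open>To reach its own power, \<open>gA j\<close> must pass the letters of smaller index. All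
  of them commute with it except \<open>gA (j - n)\<close> when j stands for a derivation, and the
  hypothesis says that this letter is absent.\<close>

lemma gA_mon_x:
  assumes "j < 2 * n" "n \<le> j \<Longrightarrow> e (j - n) = 0"
  shows "gA j \<otimes>\<^bsub>WA\<^esub> mon e = mon (e(j := Suc (e j)))"
proof -
  let ?L = "pw [0..<j] e" and ?R = "pw [Suc j..<2 * n] e"
  have s1: "set [0..<j] \<subseteq> {..<2 * n}" "set [Suc j..<2 * n] \<subseteq> {..<2 * n}" using assms by auto
  have m: "mon e' = pw [0..<j] e' \<otimes>\<^bsub>WA\<^esub> (gA j [^]\<^bsub>WA\<^esub> e' j \<otimes>\<^bsub>WA\<^esub> pw [Suc j..<2 * n] e')" for e'
    unfolding mon_def upt_split[OF assms(1)] using s1 assms(1) by (subst pw_append) auto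
  have L: "gA j \<otimes>\<^bsub>WA\<^esub> ?L = ?L \<otimes>\<^bsub>WA\<^esub> gA j"
  proof (cases "n \<le> j")
    case False
    then show ?thesis using assms by (intro pw_commute gA_comm) auto
  next
    case True
    have jn: "j - n < j" using True assms(1) by auto
    have eq: "[0..<j] = [0..<j - n] @ (j - n) # [Suc (j - n)..<j]" by (rule upt_split[OF jn])
    \<comment> \<open>The conjugate letter has exponent 0, contributes the factor one and is deleted
      from the index list.\<close>
    have "?L = pw ([0..<j - n] @ [Suc (j - n)..<j]) e"
      unfolding eq using assms True pw_closed[of "[Suc (j - n)..<j]" e]
      by (subst (1 2) pw_append) (auto simp: subset_iff simp del: subset_antisym)
    then show ?thesis
      using assms True jn by (simp only:, intro pw_commute gA_comm) auto
  qed
  have "gA j \<otimes>\<^bsub>WA\<^esub> mon e = (gA j \<otimes>\<^bsub>WA\<^esub> ?L) \<otimes>\<^bsub>WA\<^esub> (gA j [^]\<^bsub>WA\<^esub> e j \<otimes>\<^bsub>WA\<^esub> ?R)"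
    using assms s1 by (simp add: m A.m_assoc del: set_upt)
  also have "\<dots> = ?L \<otimes>\<^bsub>WA\<^esub> ((gA j \<otimes>\<^bsub>WA\<^esub> gA j [^]\<^bsub>WA\<^esub> e j) \<otimes>\<^bsub>WA\<^esub> ?R)"
    using assms s1 by (simp add: L A.m_assoc del: set_upt)
  also have "gA j \<otimes>\<^bsub>WA\<^esub> gA j [^]\<^bsub>WA\<^esub> e j = gA j [^]\<^bsub>WA\<^esub> Suc (e j)"
    using assms A.nat_pow_Suc2 by simp
  also have "?L = pw [0..<j] (e(j := Suc (e j)))" by (rule pw_cong) auto
  also have "?R = pw [Suc j..<2 * n] (e(j := Suc (e j)))" by (rule pw_cong) auto
  finally show ?thesis unfolding m[of "e(j := Suc (e j))"] by (simp only: fun_upd_same)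
qed

text \<open>The commutator of d with x^(m+1) is (m+1) x^m, by induction from the defining
  relation.\<close>

lemma gA_pow_pair:
  assumes "l < n"
  shows "gA (n + l) \<otimes>\<^bsub>WA\<^esub> gA l [^]\<^bsub>WA\<^esub> Suc m =
    gA l [^]\<^bsub>WA\<^esub> Suc m \<otimes>\<^bsub>WA\<^esub> gA (n + l) \<oplus>\<^bsub>WA\<^esub> sA (nc (Suc m)) \<otimes>\<^bsub>WA\<^esub> gA l [^]\<^bsub>WA\<^esub> m"
proof (induction m)
  case 0
  have "gA (n + l) \<in> carrier WA" "gA l \<in> carrier WA" using assms by auto
  then show ?case using assms gA_comm_pair[OF assms] by (simp add: nc_Suc)
next
  case (Suc m)
  let ?d = "gA (n + l)" and ?x = "gA l" and ?s = "sA (nc (Suc m))"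
  have c: "?d \<in> carrier WA" "?x \<in> carrier WA" "?s \<in> carrier WA" using assms by auto
  note cp = A.nat_pow_closed[OF c(2)]
  have "?d \<otimes>\<^bsub>WA\<^esub> ?x [^]\<^bsub>WA\<^esub> Suc (Suc m) = (?d \<otimes>\<^bsub>WA\<^esub> ?x [^]\<^bsub>WA\<^esub> Suc m) \<otimes>\<^bsub>WA\<^esub> ?x"
    using c by (simp add: A.m_assoc)
  also have "\<dots> = ?x [^]\<^bsub>WA\<^esub> Suc m \<otimes>\<^bsub>WA\<^esub> (?d \<otimes>\<^bsub>WA\<^esub> ?x) \<oplus>\<^bsub>WA\<^esub> ?s \<otimes>\<^bsub>WA\<^esub> ?x [^]\<^bsub>WA\<^esub> Suc m"
    unfolding Suc.IH using c cp A.m_assoc A.l_distr A.nat_pow_Suc by (simp add: A.m_assoc A.l_distr)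
  also have "\<dots> = ?x [^]\<^bsub>WA\<^esub> Suc (Suc m) \<otimes>\<^bsub>WA\<^esub> ?d \<oplus>\<^bsub>WA\<^esub> (?x [^]\<^bsub>WA\<^esub> Suc m \<oplus>\<^bsub>WA\<^esub> ?s \<otimes>\<^bsub>WA\<^esub> ?x [^]\<^bsub>WA\<^esub> Suc m)"
    unfolding gA_comm_pair[OF assms] using c cp by (simp add: A.m_assoc A.r_distr A.a_assoc)
  also have "?x [^]\<^bsub>WA\<^esub> Suc m \<oplus>\<^bsub>WA\<^esub> ?s \<otimes>\<^bsub>WA\<^esub> ?x [^]\<^bsub>WA\<^esub> Suc m = sA (nc (Suc (Suc m))) \<otimes>\<^bsub>WA\<^esub> ?x [^]\<^bsub>WA\<^esub> Suc m"
    using c cp[of "Suc m"] unfolding nc_Suc[of "Suc m"] by (simp add: sA_add A.l_distr A.a_comm)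
  finally show ?case .
qed

lemma gA_mon_d:
  assumes "l < n"
  shows "gA (n + l) \<otimes>\<^bsub>WA\<^esub> mon e = mon (e(n + l := Suc (e (n + l))))
      \<oplus>\<^bsub>WA\<^esub> sA (nc (e l)) \<otimes>\<^bsub>WA\<^esub> mon (e(l := e l - 1))"
proof (cases "e l")
  case 0
  then show ?thesis using gA_mon_x[of "n + l" e] assms by simp
next
  case (Suc k)
  let ?j = "n + l"
  let ?L = "pw [0..<l] e" and ?R = "pw [Suc l..<2 * n] e"
  have l2: "l < 2 * n" using assms by simp
  have s1: "set [0..<l] \<subseteq> {..<2 * n}" "set [Suc l..<2 * n] \<subseteq> {..<2 * n}" using assms by auto
  have m: "mon e' = pw [0..<l] e' \<otimes>\<^bsub>WA\<^esub> (gA l [^]\<^bsub>WA\<^esub> e' l \<otimes>\<^bsub>WA\<^esub> pw [Suc l..<2 * n] e')" for e'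
    unfolding mon_def upt_split[OF l2] using s1 l2 by (subst pw_append) auto
  have L: "gA ?j \<otimes>\<^bsub>WA\<^esub> ?L = ?L \<otimes>\<^bsub>WA\<^esub> gA ?j"
    using assms by (intro pw_commute gA_comm) auto
  have c: "gA ?j \<in> carrier WA" "gA l \<in> carrier WA" "?L \<in> carrier WA" "?R \<in> carrier WA" "sA (nc (Suc k)) \<in> carrier WA"
    using assms s1 by (auto simp del: set_upt)
  note cp = A.nat_pow_closed[OF c(2)]
  have sL: "sA (nc (Suc k)) \<otimes>\<^bsub>WA\<^esub> ?L = ?L \<otimes>\<^bsub>WA\<^esub> sA (nc (Suc k))"
    using assms by (intro pw_commute) (simp_all add: sA_gA subset_iff)
  have "gA ?j \<otimes>\<^bsub>WA\<^esub> mon e = ?L \<otimes>\<^bsub>WA\<^esub> ((gA ?j \<otimes>\<^bsub>WA\<^esub> gA l [^]\<^bsub>WA\<^esub> Suc k) \<otimes>\<^bsub>WA\<^esub> ?R)"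
    using c cp L Suc by (simp add: m A.m_assoc[symmetric] del: A.nat_pow_Suc)
  also have "\<dots> = ?L \<otimes>\<^bsub>WA\<^esub> (gA l [^]\<^bsub>WA\<^esub> Suc k \<otimes>\<^bsub>WA\<^esub> (gA ?j \<otimes>\<^bsub>WA\<^esub> ?R))
     \<oplus>\<^bsub>WA\<^esub> sA (nc (Suc k)) \<otimes>\<^bsub>WA\<^esub> (?L \<otimes>\<^bsub>WA\<^esub> (gA l [^]\<^bsub>WA\<^esub> k \<otimes>\<^bsub>WA\<^esub> ?R))"
    unfolding gA_pow_pair[OF assms] using c cp sL
    by (simp add: A.l_distr A.r_distr A.m_assoc[symmetric] del: A.nat_pow_Suc)
  also have "?L \<otimes>\<^bsub>WA\<^esub> (gA l [^]\<^bsub>WA\<^esub> k \<otimes>\<^bsub>WA\<^esub> ?R) = mon (e(l := e l - 1))"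
    unfolding m using Suc pw_cong[of "[0..<l]" e "e(l := k)"] pw_cong[of "[Suc l..<2 * n]" e "e(l := k)"] by auto
  also have "?L \<otimes>\<^bsub>WA\<^esub> (gA l [^]\<^bsub>WA\<^esub> Suc k \<otimes>\<^bsub>WA\<^esub> (gA ?j \<otimes>\<^bsub>WA\<^esub> ?R)) = mon (e(n + l := Suc (e (n + l))))"
  proof -
    let ?e0 = "e(l := 0)"
    have m0: "mon e' = ?R" if "e' = (\<lambda>i. if i \<le> l then 0 else e i)" for e'
    proof -
      have z: "pw xs (\<lambda>i. 0) = \<one>\<^bsub>WA\<^esub>" for xs by (induction xs) auto
      have "pw [0..<l] e' = pw [0..<l] (\<lambda>i. 0)" by (rule pw_cong) (auto simp: that)
      moreover have "pw [Suc l..<2 * n] e' = ?R" by (rule pw_cong) (auto simp: that)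
      ultimately show ?thesis using c by (simp add: m that z)
    qed
    \<comment> \<open>Erasing the exponents up to l makes the right block a monomial of its own, in
      which the conjugate letter x_l is absent, so \<open>gA_mon_x\<close> applies to it.\<close>
    let ?e1 = "\<lambda>i. if i \<le> l then 0 else e i"
    have "gA ?j \<otimes>\<^bsub>WA\<^esub> ?R = mon (?e1(?j := Suc (?e1 ?j)))"
      using gA_mon_x[of ?j ?e1] assms m0 by simp
    also have "\<dots> = pw [Suc l..<2 * n] (e(?j := Suc (e ?j)))"
    proof -
      have z: "pw xs (\<lambda>i. 0) = \<one>\<^bsub>WA\<^esub>" for xs by (induction xs) auto
      have jl: "?j > l" using assms by simp
      have "pw [0..<l] (?e1(?j := Suc (?e1 ?j))) = pw [0..<l] (\<lambda>i. 0)" using jl by (intro pw_cong) auto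
      moreover have "pw [Suc l..<2 * n] (?e1(?j := Suc (?e1 ?j))) = pw [Suc l..<2 * n] (e(?j := Suc (e ?j)))"
        using jl by (intro pw_cong) auto
      moreover have "pw [Suc l..<2 * n] (e(?j := Suc (e ?j))) \<in> carrier WA" using s1 by (intro pw_closed)
      ultimately show ?thesis using jl by (simp add: m z)
    qed
    finally show ?thesis
      using assms Suc pw_cong[of "[0..<l]" e "e(?j := Suc (e ?j))"] by (simp add: m[of "e(n + l := Suc (e (n + l)))"])
  qed
  finally show ?thesis using Suc by (simp add: fun_upd_def)
qed

section \<open>The Weyl algebra on coefficient functions\<close>

text \<open>Realises a coefficient function as a sum of normally ordered monomials. That this is a
  bijection is the Poincare-Birkhoff-Witt theorem for the Weyl algebra.\<close>

definition mu :: "((nat \<Rightarrow> nat) \<Rightarrow> 'a) \<Rightarrow> (weyl_gen list \<Rightarrow> 'a) set" where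
  "mu v = (\<Oplus>\<^bsub>WA\<^esub>e\<in>{e. v e \<noteq> \<zero>}. sA (v e) \<otimes>\<^bsub>WA\<^esub> mon e)"

abbreviation "WF \<equiv> fin_supp exps"

lemma mu_alt:
  assumes "finite B" "{e. v e \<noteq> \<zero>} \<subseteq> B" "v \<in> WF"
  shows "mu v = (\<Oplus>\<^bsub>WA\<^esub>e\<in>B. sA (v e) \<otimes>\<^bsub>WA\<^esub> mon e)"
  unfolding mu_def using assms
  by (intro A.add.finprod_mono_neutral_cong_left) (auto simp: fin_suppD(1))

lemma mu_closed [simp]: "v \<in> WF \<Longrightarrow> mu v \<in> carrier WA"
  unfolding mu_def by (intro A.finsum_closed) (auto simp: fin_suppD(1))

lemma mu_add:
  assumes "v \<in> WF" "w \<in> WF"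
  shows "mu (\<lambda>e. v e \<oplus> w e) = mu v \<oplus>\<^bsub>WA\<^esub> mu w"
proof -
  let ?B = "{e. v e \<noteq> \<zero>} \<union> {e. w e \<noteq> \<zero>}"
  note D = fin_suppD[OF assms(1)] fin_suppD[OF assms(2)]
  have fin: "finite ?B" using D by auto
  have sub: "{e. v e \<oplus> w e \<noteq> \<zero>} \<subseteq> ?B" by auto
  have "mu (\<lambda>e. v e \<oplus> w e) = (\<Oplus>\<^bsub>WA\<^esub>e\<in>?B. sA (v e \<oplus> w e) \<otimes>\<^bsub>WA\<^esub> mon e)"
    by (rule mu_alt[OF fin sub fin_supp_add[OF assms]])
  also have "\<dots> = (\<Oplus>\<^bsub>WA\<^esub>e\<in>?B. sA (v e) \<otimes>\<^bsub>WA\<^esub> mon e \<oplus>\<^bsub>WA\<^esub> sA (w e) \<otimes>\<^bsub>WA\<^esub> mon e)"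
    using D by (intro A.finsum_cong') (auto simp: sA_add A.l_distr)
  also have "\<dots> = (\<Oplus>\<^bsub>WA\<^esub>e\<in>?B. sA (v e) \<otimes>\<^bsub>WA\<^esub> mon e) \<oplus>\<^bsub>WA\<^esub> (\<Oplus>\<^bsub>WA\<^esub>e\<in>?B. sA (w e) \<otimes>\<^bsub>WA\<^esub> mon e)"
    using D by (intro A.finsum_addf) auto
  also have "\<dots> = mu v \<oplus>\<^bsub>WA\<^esub> mu w"
    using assms fin mu_alt[of ?B v] mu_alt[of ?B w] by auto
  finally show ?thesis .
qed

lemma mu_zero [simp]: "mu (\<lambda>e. \<zero>) = \<zero>\<^bsub>WA\<^esub>"
  by (simp add: mu_def)

lemma mu_single:
  assumes "a \<in> carrier R" "e \<in> exps"
  shows "mu (single a e) = sA a \<otimes>\<^bsub>WA\<^esub> mon e"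
proof -
  have "mu (single a e) = (\<Oplus>\<^bsub>WA\<^esub>e'\<in>{e}. sA (single a e e') \<otimes>\<^bsub>WA\<^esub> mon e')"
    using assms by (intro mu_alt single_closed) (auto simp: single_def split: if_splits)
  also have "\<dots> = sA a \<otimes>\<^bsub>WA\<^esub> mon e"
    using assms by (simp add: single_def)
  finally show ?thesis .
qed

lemma mu_smult:
  assumes "v \<in> WF" "a \<in> carrier R"
  shows "mu (\<lambda>e. a \<otimes> v e) = sA a \<otimes>\<^bsub>WA\<^esub> mu v"
  using assms(1)
proof (induction rule: fin_supp_induct)
  case zero
  then show ?case using assms by simp
next
  case (single b e)
  have "(\<lambda>e'. a \<otimes> single b e e') = single (a \<otimes> b) e" using assms by (auto simp: single_def)
  then show ?case using single assms by (simp add: mu_single sA_mult A.m_assoc)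
next
  case (add v w)
  have "(\<lambda>e. a \<otimes> (v e \<oplus> w e)) = (\<lambda>e. a \<otimes> v e \<oplus> a \<otimes> w e)"
    using assms fin_suppD(1)[OF add(1)] fin_suppD(1)[OF add(2)] by (auto simp: r_distr)
  then show ?case using add assms by (simp add: mu_add fin_supp_smult A.r_distr)
qed

lemma upd_exps [simp]: "e \<in> exps \<Longrightarrow> j < 2 * n \<Longrightarrow> e(j := k) \<in> exps"
  by (auto simp: exps_def)

text \<open>The action on symbols was modelled on left multiplication: the correction in
  \<open>gA_mon_d\<close> is the coefficient form of the derivative by x_l.\<close>

lemma mu_lmul:
  assumes "v \<in> WF" "j < 2 * n"
  shows "mu (lmul j v) = gA j \<otimes>\<^bsub>WA\<^esub> mu v"
  using assms(1)
proof (induction rule: fin_supp_induct)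
  case zero
  have "lmul j (\<lambda>e. \<zero>) = (\<lambda>e. \<zero>)" by (auto simp: lmul_def shift_def pd_def fun_eq_iff)
  then show ?case using assms by simp
next
  case (add v w)
  then show ?case using assms by (simp add: lmul_add fin_supp_funs mu_add lmul_fin_supp A.r_distr)
next
  case (single a e)
  have ss: "sA a \<otimes>\<^bsub>WA\<^esub> (sA b \<otimes>\<^bsub>WA\<^esub> m) = sA (b \<otimes> a) \<otimes>\<^bsub>WA\<^esub> m"
    if "b \<in> carrier R" "m \<in> carrier WA" for b m
    using that single by (simp add: A.m_assoc[symmetric] sA_mult[symmetric] m_comm)
  have sw: "gA j \<otimes>\<^bsub>WA\<^esub> (sA a \<otimes>\<^bsub>WA\<^esub> b) = sA a \<otimes>\<^bsub>WA\<^esub> (gA j \<otimes>\<^bsub>WA\<^esub> b)" if "b \<in> carrier WA" for b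
    using that single assms by (simp add: A.m_assoc[symmetric] sA_gA)
  show ?case
  proof (cases "j < n")
    case True
    then show ?thesis using single assms by (simp add: lmul_def shift_single mu_single sw gA_mon_x)
  next
    case False
    then obtain l where l: "j = n + l" "l < n" using assms by (metis add_diff_inverse_nat add_less_cancel_left mult_2)
    have "lmul j (single a e) = (\<lambda>c. single a (e(j := Suc (e j))) c \<oplus> single (nc (e l) \<otimes> a) (e(l := e l - 1)) c)"
      using single l by (simp add: lmul_def shift_single pd_single)
    then show ?thesis
      using single l
      by (simp add: mu_add single_closed mu_single sw[unfolded l] ss gA_mon_d A.r_distr)
  qed
qed

lemma cl_word:
  assumes "set w \<subseteq> weyl_gens n"
  shows "cl (single \<one> w) = mu (act w (single \<one> (\<lambda>_. 0)))"
  using assms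
proof (induction w)
  case Nil
  have "pw xs (\<lambda>i. 0) = \<one>\<^bsub>WA\<^esub>" for xs by (induction xs) auto
  then show ?case by (simp add: mu_single cl_one mon_def)
next
  case (Cons g w)
  have "single \<one> (g # w) = conv (single \<one> [letter (idx g)]) (single \<one> w)"
    using Cons.prems by (simp add: conv_single_single letter_idx)
  then have "cl (single \<one> (g # w)) = gA (idx g) \<otimes>\<^bsub>WA\<^esub> cl (single \<one> w)"
    using Cons.prems by (simp add: cl_conv single_W0 gA_def letter_mem idx_less)
  then show ?case
    using Cons by (simp add: mu_lmul act_fin_supp single_closed idx_less)
qed

text \<open>The normal form of an element is what it makes of the constant symbol 1. This gives
  surjectivity of \<open>mu\<close> with an explicit preimage.\<close>

lemma mu_rho:
  assumes "f \<in> W0"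
  shows "cl f = mu (rho f (single \<one> (\<lambda>_. 0)))" "rho f (single \<one> (\<lambda>_. 0)) \<in> WF"
  using assms
proof (induction rule: fin_supp_induct)
  case zero
  { case 1 then show ?case by (simp add: rho_zero cl_zero) }
  { case 2 then show ?case by (simp add: rho_zero fin_supp_zero) }
next
  case (single a w)
  have o: "single \<one> (\<lambda>_. 0) \<in> WF" by (simp add: single_closed)
  then have a: "act w (single \<one> (\<lambda>_. 0)) \<in> WF" using single by (auto intro: act_fin_supp)
  have r: "rho (single a w) (single \<one> (\<lambda>_. 0)) = (\<lambda>e. a \<otimes> act w (single \<one> (\<lambda>_. 0)) e)"
    using single fin_supp_funs[OF o] by (intro rho_single) auto
  { case 1
    have "single a w = conv (single a []) (single \<one> w)" using single by (simp add: conv_single_single)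
    then have "cl (single a w) = sA a \<otimes>\<^bsub>WA\<^esub> cl (single \<one> w)"
      using single by (simp add: cl_conv single_W0 sA_def)
    then show ?case using single a by (simp add: cl_word r mu_smult) }
  { case 2 then show ?case using a single by (simp add: r fin_supp_smult) }
next
  case (add f g)
  have o: "single \<one> (\<lambda>_. 0) \<in> funs" by (intro fin_supp_funs[of _ exps] single_closed) auto
  { case 1 then show ?case using add o by (simp add: rho_add cl_add mu_add) }
  { case 2 then show ?case using add o by (simp add: rho_add fin_supp_add) }
qed

text \<open>Peels one letter off a monomial. As j is the least index with nonzero exponent, a
  derivation taken off has its conjugate x absent, and \<open>lmul\<close> is a pure shift without
  correction.\<close>

lemma single_lmul:
  assumes "e \<in> exps" "e \<noteq> (\<lambda>_. 0)"
  obtains j e' where "j < 2 * n" "e' \<in> exps" "e = e'(j := Suc (e' j))" "(\<Sum>i<2 * n. e' i) < (\<Sum>i<2 * n. e i)"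
    "lmul j (single \<one> e') = single \<one> e"
proof -
  have ex: "\<exists>j. e j \<noteq> 0" using assms by auto
  define j where "j = (LEAST j. e j \<noteq> 0)"
  have j: "e j \<noteq> 0" unfolding j_def by (rule LeastI_ex[OF ex])
  have lt: "e i = 0" if "i < j" for i using that not_less_Least unfolding j_def by blast
  have j2: "j < 2 * n" using j assms(1) by (auto simp: exps_def intro: leI)
  define e' where "e' = e(j := e j - 1)"
  have e: "e = e'(j := Suc (e' j))" using j by (auto simp: e'_def)
  have sum: "(\<Sum>i<2 * n. e' i) < (\<Sum>i<2 * n. e i)"
    using j j2 by (intro sum_strict_mono_ex1) (auto simp: e'_def)
  have "lmul j (single \<one> e') = single \<one> e"
  proof (cases "j < n")
    case True then show ?thesis using e by (simp add: lmul_def shift_single)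
  next
    case False
    then have "e' (j - n) = 0" using lt[of "j - n"] j j2 by (cases "n = 0") (auto simp: e'_def)
    then have "pd (j - n) (single \<one> e') c = \<zero>" for c
      by (simp add: pd_single) (simp add: single_def)
    then have "lmul j (single \<one> e') = (\<lambda>c. single \<one> (e'(j := Suc (e' j))) c \<oplus> \<zero>)"
      using False by (simp add: lmul_def shift_single)
    then show ?thesis using e by (simp add: single_carrier)
  qed
  moreover have "e' \<in> exps" using assms(1) j2 by (simp add: e'_def)
  ultimately show ?thesis using that[OF j2 _ e sum] by simp
qed

lemma WF_induct [consumes 1, case_names one add smult lmul]:
  assumes v: "v \<in> WF"
    and one: "P (single \<one> (\<lambda>_. 0))"
    and add: "\<And>v w. v \<in> WF \<Longrightarrow> w \<in> WF \<Longrightarrow> P v \<Longrightarrow> P w \<Longrightarrow> P (\<lambda>e. v e \<oplus> w e)"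
    and smult: "\<And>a v. a \<in> carrier R \<Longrightarrow> v \<in> WF \<Longrightarrow> P v \<Longrightarrow> P (\<lambda>e. a \<otimes> v e)"
    and lmul: "\<And>j v. j < 2 * n \<Longrightarrow> v \<in> WF \<Longrightarrow> P v \<Longrightarrow> P (lmul j v)"
  shows "P v"
proof -
  have s: "P (single \<one> e)" if "e \<in> exps" for e
    using that
  proof (induction "\<Sum>i<2 * n. e i" arbitrary: e rule: less_induct)
    case less
    show ?case
    proof (cases "e = (\<lambda>_. 0)")
      case True then show ?thesis using one by simp
    next
      case False
      then obtain j e' where "j < 2 * n" "e' \<in> exps" "(\<Sum>i<2 * n. e' i) < (\<Sum>i<2 * n. e i)" "lmul j (single \<one> e') = single \<one> e"
        using single_lmul[OF less.prems] by metis
      then show ?thesis using less.hyps[of e'] lmul[of j "single \<one> e'"] by (auto simp: single_closed)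
    qed
  qed
  have sa: "P (single a e)" if "a \<in> carrier R" "e \<in> exps" for a e
  proof -
    have "P (\<lambda>c. a \<otimes> single \<one> e c)" using smult[OF that(1) _ s[OF that(2)]] that by (auto simp: single_closed)
    also have "(\<lambda>c. a \<otimes> single \<one> e c) = single a e" using that by (auto simp: single_def)
    finally show ?thesis .
  qed
  show ?thesis using v
  proof (induction rule: fin_supp_induct)
    case zero
    have "P (single \<zero> (\<lambda>_. 0))" by (rule sa) auto
    also have "single \<zero> (\<lambda>_. 0) = (\<lambda>_. \<zero>)" by (auto simp: single_def)
    finally show ?case .
  next
    case (single a e) then show ?case by (rule sa)
  next
    case (add v w) then show ?case by (rule assms(3))
  qed
qed

text \<open>Every symbol v is produced from the symbol 1 by an element representing
  \<open>mu v\<close>. Since the action factors through classes, v can be recovered from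
  \<open>mu v\<close>, which is injectivity.\<close>

lemma mu_lift:
  assumes "v \<in> WF"
  shows "\<exists>f\<in>W0. cl f = mu v \<and> rho f (single \<one> (\<lambda>_. 0)) = v"
  using assms
proof (induction rule: WF_induct)
  case one
  have o: "single \<one> (\<lambda>_. 0) \<in> funs" by (intro fin_supp_funs[of _ exps] single_closed) auto
  have "rho (single \<one> []) (single \<one> (\<lambda>_. 0)) = single \<one> (\<lambda>_. 0)"
    using o by (subst rho_single) (auto simp: funsD)
  then show ?case using mu_rho(1)[of "single \<one> []"] by (intro bexI[of _ "single \<one> []"]) (auto simp: single_W0)
next
  case (add v w)
  then obtain f g where "f \<in> W0" "cl f = mu v" "rho f (single \<one> (\<lambda>_. 0)) = v"
    "g \<in> W0" "cl g = mu w" "rho g (single \<one> (\<lambda>_. 0)) = w" by auto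
  moreover have o: "single \<one> (\<lambda>_. 0) \<in> funs" by (intro fin_supp_funs[of _ exps] single_closed) auto
  ultimately show ?case using add
    by (intro bexI[of _ "\<lambda>w. f w \<oplus> g w"]) (auto simp: cl_add mu_add rho_add fin_supp_add)
next
  case (smult a v)
  then obtain f where f: "f \<in> W0" "cl f = mu v" "rho f (single \<one> (\<lambda>_. 0)) = v" by auto
  have o: "single \<one> (\<lambda>_. 0) \<in> funs" by (intro fin_supp_funs[of _ exps] single_closed) auto
  have "rho (conv (single a []) f) (single \<one> (\<lambda>_. 0)) = (\<lambda>e. a \<otimes> v e)"
    using f o smult by (simp add: rho_conv single_W0 rho_single fin_supp_funs)
  moreover have "cl (conv (single a []) f) = mu (\<lambda>e. a \<otimes> v e)"
    using f smult by (simp add: cl_conv single_W0 mu_smult sA_def)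
  ultimately show ?case using f smult by (intro bexI[of _ "conv (single a []) f"]) (auto simp: conv_fin_supp single_W0)
next
  case (lmul j v)
  then obtain f where f: "f \<in> W0" "cl f = mu v" "rho f (single \<one> (\<lambda>_. 0)) = v" by auto
  have o: "single \<one> (\<lambda>_. 0) \<in> funs" by (intro fin_supp_funs[of _ exps] single_closed) auto
  have "rho (conv (single \<one> [letter j]) f) (single \<one> (\<lambda>_. 0)) = lmul j v"
    using f o lmul by (simp add: rho_conv single_W0 rho_single fin_supp_funs letter_mem funsD)
  moreover have "cl (conv (single \<one> [letter j]) f) = mu (lmul j v)"
    using f lmul by (simp add: cl_conv single_W0 mu_lmul gA_def letter_mem)
  ultimately show ?case using f lmul
    by (intro bexI[of _ "conv (single \<one> [letter j]) f"]) (auto simp: conv_fin_supp single_W0 letter_mem)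
qed

lemma mu_bij: "bij_betw mu WF (carrier WA)"
proof (rule bij_betw_imageI)
  have o: "single \<one> (\<lambda>_. 0) \<in> funs" by (intro fin_supp_funs[of _ exps] single_closed) auto
  show "inj_on mu WF"
  proof (rule inj_onI)
    fix v w assume vw: "v \<in> WF" "w \<in> WF" "mu v = mu w"
    obtain f where f: "f \<in> W0" "cl f = mu v" "rho f (single \<one> (\<lambda>_. 0)) = v"
      using mu_lift[OF vw(1)] by blast
    obtain g where g: "g \<in> W0" "cl g = mu w" "rho g (single \<one> (\<lambda>_. 0)) = w"
      using mu_lift[OF vw(2)] by blast
    show "v = w" using cl_rho[OF f(1) g(1) _ o] f g vw(3) by simp
  qed
  show "mu ` WF = carrier WA"
  proof
    show "mu ` WF \<subseteq> carrier WA" by auto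
    show "carrier WA \<subseteq> mu ` WF"
    proof
      fix a assume "a \<in> carrier WA"
      then obtain f where "f \<in> W0" "a = cl f" using cl_surj by blast
      then show "a \<in> mu ` WF" using mu_rho by blast
    qed
  qed
qed

end

context weyl
begin

text \<open>The product is transported along \<open>mu\<close>, so that elements are functions whose
  coefficients, supports and leading exponents can be inspected, unlike cosets.\<close>

definition W :: "((nat \<Rightarrow> nat) \<Rightarrow> 'a) ring" where
  "W = \<lparr> carrier = WF, monoid.mult = (\<lambda>v w. inv_into WF mu (mu v \<otimes>\<^bsub>WA\<^esub> mu w)),
      one = single \<one> (\<lambda>_. 0), ring.zero = (\<lambda>_. \<zero>), ring.add = (\<lambda>v w e. v e \<oplus> w e) \<rparr>"

lemma W_carrier: "carrier W = WF"
  and W_one: "\<one>\<^bsub>W\<^esub> = single \<one> (\<lambda>_. 0)"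
  and W_zero: "\<zero>\<^bsub>W\<^esub> = (\<lambda>_. \<zero>)"
  and W_add: "v \<oplus>\<^bsub>W\<^esub> w = (\<lambda>e. v e \<oplus> w e)"
  by (simp_all add: W_def)

lemma mu_inv [simp]: "a \<in> carrier WA \<Longrightarrow> mu (inv_into WF mu a) = a"
  using mu_bij by (auto simp: bij_betw_def f_inv_into_f)

lemma inv_mu [simp]: "v \<in> WF \<Longrightarrow> inv_into WF mu (mu v) = v"
  using mu_bij by (auto simp: bij_betw_def)

lemma inv_mu_closed: "a \<in> carrier WA \<Longrightarrow> inv_into WF mu a \<in> WF"
  using mu_bij by (auto simp: bij_betw_def inv_into_into)

lemma mu_one: "mu (single \<one> (\<lambda>_. 0)) = \<one>\<^bsub>WA\<^esub>"
  using cl_word[of "[]"] by (simp add: cl_one)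

lemma inv_mu_iso: "inv_into WF mu \<in> ring_iso WA W"
proof (rule ring_iso_memI)
  show "bij_betw (inv_into WF mu) (carrier WA) (carrier W)"
    unfolding W_carrier by (rule bij_betw_inv_into[OF mu_bij])
  show "inv_into WF mu \<one>\<^bsub>WA\<^esub> = \<one>\<^bsub>W\<^esub>"
    using inv_mu[of "single \<one> (\<lambda>_. 0)"] by (simp add: mu_one W_one single_closed)
  fix a b assume ab: "a \<in> carrier WA" "b \<in> carrier WA"
  show "inv_into WF mu a \<in> carrier W" using ab by (simp add: W_carrier inv_mu_closed)
  show "inv_into WF mu (a \<otimes>\<^bsub>WA\<^esub> b) = inv_into WF mu a \<otimes>\<^bsub>W\<^esub> inv_into WF mu b"
    using ab by (simp add: W_def)
  have "mu (inv_into WF mu a \<oplus>\<^bsub>W\<^esub> inv_into WF mu b) = a \<oplus>\<^bsub>WA\<^esub> b"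
    using ab by (simp add: W_add mu_add inv_mu_closed)
  then show "inv_into WF mu (a \<oplus>\<^bsub>WA\<^esub> b) = inv_into WF mu a \<oplus>\<^bsub>W\<^esub> inv_into WF mu b"
    using ab inv_mu[of "inv_into WF mu a \<oplus>\<^bsub>W\<^esub> inv_into WF mu b"]
    by (simp add: W_add fin_supp_add inv_mu_closed)
qed

lemma W_ring: "ring W"
proof -
  have "inv_into WF mu \<zero>\<^bsub>WA\<^esub> = \<zero>\<^bsub>W\<^esub>"
    using inv_mu[of "\<lambda>_. \<zero>"] fin_supp_zero[of exps] by (simp add: W_zero)
  then show ?thesis
    using A.ring_iso_imp_img_ring[OF inv_mu_iso] by (simp add: W_def)
qed

sublocale W: ring W
  by (rule W_ring)

abbreviation W_mult (infixl "\<star>" 70) where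
  "v \<star> w \<equiv> v \<otimes>\<^bsub>W\<^esub> w"

lemma mu_iso: "mu \<in> ring_iso W WA"
proof (rule ring_iso_memI)
  show "bij_betw mu (carrier W) (carrier WA)" by (simp add: W_carrier mu_bij)
  fix v w assume vw: "v \<in> carrier W" "w \<in> carrier W"
  show "mu (v \<star> w) = mu v \<otimes>\<^bsub>WA\<^esub> mu w" using vw by (simp add: W_carrier) (simp add: W_def)
qed (auto simp: W_carrier mu_add W_add W_one mu_one)

lemma mu_mult: "v \<in> WF \<Longrightarrow> w \<in> WF \<Longrightarrow> mu (v \<star> w) = mu v \<otimes>\<^bsub>WA\<^esub> mu w"
  using ring_iso_memE(2)[OF mu_iso] by (simp add: W_carrier)

lemma mu_eqI: "v \<in> carrier W \<Longrightarrow> w \<in> carrier W \<Longrightarrow> mu v = mu w \<Longrightarrow> v = w"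
  using mu_bij by (auto simp: bij_betw_def inj_on_def W_carrier)

definition gen :: "nat \<Rightarrow> (nat \<Rightarrow> nat) \<Rightarrow> 'a" where
  "gen j = single \<one> ((\<lambda>_. 0)(j := 1))"

definition sc :: "'a \<Rightarrow> (nat \<Rightarrow> nat) \<Rightarrow> 'a" where
  "sc a = single a (\<lambda>_. 0)"

lemma gen_closed [simp]: "j < 2 * n \<Longrightarrow> gen j \<in> carrier W"
  by (simp add: gen_def W_carrier single_closed)

lemma sc_closed [simp]: "a \<in> carrier R \<Longrightarrow> sc a \<in> carrier W"
  by (simp add: sc_def W_carrier single_closed)

lemma sc_one [simp]: "sc \<one> = \<one>\<^bsub>W\<^esub>"
  by (simp add: sc_def W_one)

lemma sc_zero [simp]: "sc \<zero> = \<zero>\<^bsub>W\<^esub>"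
  by (auto simp: sc_def W_zero single_def)

lemma gen_shift: "gen j = shift j \<one>\<^bsub>W\<^esub>"
  by (simp add: gen_def W_one shift_single)

lemma gen_lmul: "j < 2 * n \<Longrightarrow> gen j = lmul j \<one>\<^bsub>W\<^esub>"
proof -
  have "pd i (single \<one> (\<lambda>_. 0)) = (\<lambda>e. \<zero>)" for i
    by (simp add: pd_single) (auto simp: single_def)
  then show ?thesis
    by (auto simp: lmul_def gen_shift W_one shift_single single_carrier fun_eq_iff)
qed

lemma mu_gen: "j < 2 * n \<Longrightarrow> mu (gen j) = gA j"
  by (simp add: gen_lmul W_one mu_lmul single_closed mu_one)

lemma mu_sc: "a \<in> carrier R \<Longrightarrow> mu (sc a) = sA a"
proof -
  assume a: "a \<in> carrier R"
  have "mon (\<lambda>_. 0) = \<one>\<^bsub>WA\<^esub>" using mu_single[of \<one> "\<lambda>_. 0"] mu_one by simp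
  then show ?thesis using a by (simp add: sc_def mu_single)
qed

lemma gen_mult: "j < 2 * n \<Longrightarrow> v \<in> carrier W \<Longrightarrow> gen j \<star> v = lmul j v"
  using W.m_closed[OF gen_closed, of j v]
  by (intro mu_eqI) (auto simp: W_carrier mu_mult mu_lmul lmul_fin_supp mu_gen gen_closed[unfolded W_carrier])

lemma sc_mult: "a \<in> carrier R \<Longrightarrow> v \<in> carrier W \<Longrightarrow> sc a \<star> v = (\<lambda>e. a \<otimes> v e)"
  using W.m_closed[OF sc_closed, of a v]
  by (intro mu_eqI) (auto simp: W_carrier mu_mult mu_smult fin_supp_smult mu_sc sc_closed[unfolded W_carrier])

lemma sc_sc: "a \<in> carrier R \<Longrightarrow> b \<in> carrier R \<Longrightarrow> sc a \<star> sc b = sc (a \<otimes> b)"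
  by (simp add: sc_mult) (auto simp: sc_def single_def)

lemma sc_add: "a \<in> carrier R \<Longrightarrow> b \<in> carrier R \<Longrightarrow> sc (a \<oplus> b) = sc a \<oplus>\<^bsub>W\<^esub> sc b"
  by (auto simp: sc_def W_add single_def)

lemma W_induct [consumes 1, case_names one add sc gen]:
  assumes v: "v \<in> carrier W"
    and one: "P \<one>\<^bsub>W\<^esub>"
    and add: "\<And>v w. v \<in> carrier W \<Longrightarrow> w \<in> carrier W \<Longrightarrow> P v \<Longrightarrow> P w \<Longrightarrow> P (v \<oplus>\<^bsub>W\<^esub> w)"
    and sc: "\<And>a v. a \<in> carrier R \<Longrightarrow> v \<in> carrier W \<Longrightarrow> P v \<Longrightarrow> P (sc a \<star> v)"
    and gen: "\<And>j v. j < 2 * n \<Longrightarrow> v \<in> carrier W \<Longrightarrow> P v \<Longrightarrow> P (gen j \<star> v)"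
  shows "P v"
  using v unfolding W_carrier
proof (induction rule: WF_induct)
  case one then show ?case using assms(2) by (simp add: W_one)
next
  case (add v w) then show ?case using assms(3)[of v w] by (simp add: W_add W_carrier)
next
  case (smult a v) then show ?case using assms(4)[of a v] by (simp add: sc_mult W_carrier)
next
  case (lmul j v) then show ?case using assms(5)[of j v] by (simp add: gen_mult W_carrier)
qed

lemma sc_comm: "a \<in> carrier R \<Longrightarrow> v \<in> carrier W \<Longrightarrow> v \<star> sc a = sc a \<star> v"
proof -
  assume a: "a \<in> carrier R" and v: "v \<in> carrier W"
  have ga: "gen j \<star> sc a = sc a \<star> gen j" if "j < 2 * n" for j
    using a that by (intro mu_eqI) (auto simp: mu_mult[folded W_carrier] mu_gen mu_sc sA_gA)
  show ?thesis using v
  proof (induction rule: W_induct)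
    case one then show ?case using a by simp
  next
    case (add v w) then show ?case using a by (simp add: W.l_distr W.r_distr)
  next
    case (sc b v)
    have "sc b \<star> v \<star> sc a = sc b \<star> (sc a \<star> v)" using sc a by (simp add: W.m_assoc)
    also have "\<dots> = sc a \<star> (sc b \<star> v)"
      using sc a by (simp add: W.m_assoc[symmetric] sc_sc m_comm)
    finally show ?case .
  next
    case (gen j v)
    have "gen j \<star> v \<star> sc a = gen j \<star> (sc a \<star> v)" using gen a by (simp add: W.m_assoc)
    also have "\<dots> = sc a \<star> (gen j \<star> v)"
      using gen a ga by (simp add: W.m_assoc[symmetric])
    finally show ?case .
  qed
qed

lemma funs_W: "v \<in> carrier W \<Longrightarrow> v \<in> funs"
  by (simp add: W_carrier fin_supp_funs)

lemma coeff_closed [simp]: "v \<in> carrier W \<Longrightarrow> v e \<in> carrier R"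
  by (simp add: W_carrier fin_suppD(1))

lemma shift_closed [simp]: "v \<in> carrier W \<Longrightarrow> j < 2 * n \<Longrightarrow> shift j v \<in> carrier W"
  by (simp add: W_carrier shift_fin_supp)

lemma pd_closed [simp]: "v \<in> carrier W \<Longrightarrow> pd j v \<in> carrier W"
  by (simp add: W_carrier pd_fin_supp)

lemma gen_mult_x: "l < n \<Longrightarrow> v \<in> carrier W \<Longrightarrow> gen l \<star> v = shift l v"
  by (simp add: gen_mult lmul_def)

lemma gen_mult_d: "l < n \<Longrightarrow> v \<in> carrier W \<Longrightarrow> gen (n + l) \<star> v = shift (n + l) v \<oplus>\<^bsub>W\<^esub> pd l v"
  by (simp add: gen_mult lmul_def W_add)

lemma shift_Wadd: "v \<in> carrier W \<Longrightarrow> w \<in> carrier W \<Longrightarrow> shift j (v \<oplus>\<^bsub>W\<^esub> w) = shift j v \<oplus>\<^bsub>W\<^esub> shift j w"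
  by (simp add: W_add shift_add funs_W)

lemma pd_Wadd: "v \<in> carrier W \<Longrightarrow> w \<in> carrier W \<Longrightarrow> pd j (v \<oplus>\<^bsub>W\<^esub> w) = pd j v \<oplus>\<^bsub>W\<^esub> pd j w"
  by (simp add: W_add pd_add funs_W)

lemma shift_Wsc: "a \<in> carrier R \<Longrightarrow> v \<in> carrier W \<Longrightarrow> j < 2 * n \<Longrightarrow> shift j (sc a \<star> v) = sc a \<star> shift j v"
  by (simp add: sc_mult shift_smult funs_W)

lemma pd_Wsc: "a \<in> carrier R \<Longrightarrow> v \<in> carrier W \<Longrightarrow> pd j (sc a \<star> v) = sc a \<star> pd j v"
  by (simp add: sc_mult pd_smult funs_W)

lemma pd_one [simp]: "pd j \<one>\<^bsub>W\<^esub> = \<zero>\<^bsub>W\<^esub>"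
  by (simp add: W_one W_zero pd_single) (auto simp: single_def)

lemma pd_shift_W: "v \<in> carrier W \<Longrightarrow> j < 2 * n \<Longrightarrow>
  pd i (shift j v) = (if i = j then shift j (pd j v) \<oplus>\<^bsub>W\<^esub> v else shift j (pd i v))"
  using pd_shift_same[of v j] pd_shift[of i j v] by (auto simp: W_add funs_W)

lemma lt2: "l < n \<Longrightarrow> l < 2 * n" "l < n \<Longrightarrow> n + l < 2 * n"
  by auto

text \<open>Derivations stand on the right in normal order, so multiplying by one from the right
  requires no reordering. For x from the right a correction appears, the derivative by the conjugate
  symbol.\<close>

lemma mult_gen_d:
  assumes "l < n" "v \<in> carrier W"
  shows "v \<star> gen (n + l) = shift (n + l) v"
  using assms(2)
proof (induction rule: W_induct)
  case one
  then show ?case using assms by (simp add: gen_shift[symmetric])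
next
  case (add v w)
  then show ?case using assms by (simp add: W.l_distr shift_Wadd)
next
  case (sc a v)
  then show ?case using assms by (simp add: W.m_assoc shift_Wsc)
next
  case (gen j v)
  have "gen j \<star> v \<star> gen (n + l) = gen j \<star> shift (n + l) v"
    using gen assms by (simp add: W.m_assoc)
  also have "\<dots> = shift (n + l) (gen j \<star> v)"
  proof (cases "j < n")
    case True
    then show ?thesis using gen assms by (simp add: gen_mult_x) (rule shift_shift)
  next
    case False
    then obtain i where i: "j = n + i" "i < n" using gen(1) by (metis add_diff_inverse_nat add_less_cancel_left mult_2)
    then show ?thesis using gen assms
      by (simp add: gen_mult_d shift_Wadd pd_shift_W) (simp add: shift_shift)
  qed
  finally show ?case .
qed

lemma mult_gen_x:
  assumes "l < n" "v \<in> carrier W"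
  shows "v \<star> gen l = shift l v \<oplus>\<^bsub>W\<^esub> pd (n + l) v"
  using assms(2)
proof (induction rule: W_induct)
  case one
  then show ?case using assms by (simp add: gen_shift[symmetric])
next
  case (add v w)
  then show ?case using assms by (simp add: W.l_distr shift_Wadd pd_Wadd W.a_ac)
next
  case (sc a v)
  then show ?case using assms by (simp add: W.m_assoc shift_Wsc pd_Wsc W.r_distr)
next
  case (gen j v)
  have "gen j \<star> v \<star> gen l = gen j \<star> (shift l v \<oplus>\<^bsub>W\<^esub> pd (n + l) v)"
    using gen assms by (simp add: W.m_assoc)
  also have "\<dots> = shift l (gen j \<star> v) \<oplus>\<^bsub>W\<^esub> pd (n + l) (gen j \<star> v)"
  proof (cases "j < n")
    case True
    then show ?thesis using gen assms by (simp add: gen_mult_x shift_Wadd pd_shift_W) (simp add: shift_shift)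
  next
    case False
    then obtain i where i: "j = n + i" "i < n" using gen(1) by (metis add_diff_inverse_nat add_less_cancel_left mult_2)
    show ?thesis using gen assms i
      by (simp add: gen_mult_d shift_Wadd pd_Wadd pd_shift_W shift_shift[of l] pd_pd[of v i] funs_W W.a_ac)
  qed
  finally show ?case .
qed

lemma comm_d: "l < n \<Longrightarrow> v \<in> carrier W \<Longrightarrow> gen (n + l) \<star> v = v \<star> gen (n + l) \<oplus>\<^bsub>W\<^esub> pd l v"
  by (simp add: mult_gen_d gen_mult_d)

lemma comm_x: "l < n \<Longrightarrow> v \<in> carrier W \<Longrightarrow> v \<star> gen l = gen l \<star> v \<oplus>\<^bsub>W\<^esub> pd (n + l) v"
  by (simp add: mult_gen_x gen_mult_x)

lemma index_cases:
  assumes "j < 2 * n"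
  obtains (x) "j < n" | (d) l where "j = n + l" "l < n"
  using assms by (metis add_diff_inverse_nat add_less_cancel_left mult_2)

lemma W_add_cancel:
  "a \<in> carrier W \<Longrightarrow> b \<in> carrier W \<Longrightarrow> c \<in> carrier W \<Longrightarrow> a \<oplus>\<^bsub>W\<^esub> b = a \<oplus>\<^bsub>W\<^esub> c \<Longrightarrow> b = c"
  using W.add.l_cancel by blast

text \<open>Each \<open>pd j\<close> is, up to sign, the commutator with the generator conjugate to
  j, and commutators are derivations. The product here is the noncommutative one.\<close>

lemma pd_mult:
  assumes "j < 2 * n" "v \<in> carrier W" "w \<in> carrier W"
  shows "pd j (v \<star> w) = pd j v \<star> w \<oplus>\<^bsub>W\<^esub> v \<star> pd j w"
  using assms(1)
proof (cases rule: index_cases)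
  case x
  let ?g = "gen (n + j)"
  have g: "?g \<in> carrier W" using x by simp
  have "v \<star> w \<star> ?g \<oplus>\<^bsub>W\<^esub> pd j (v \<star> w) = (?g \<star> v) \<star> w"
    using x assms g comm_d[of j "v \<star> w"] by (simp add: W.m_assoc)
  also have "\<dots> = v \<star> (?g \<star> w) \<oplus>\<^bsub>W\<^esub> pd j v \<star> w"
    using x assms g by (subst comm_d) (auto simp: W.l_distr W.m_assoc)
  also have "\<dots> = v \<star> w \<star> ?g \<oplus>\<^bsub>W\<^esub> (pd j v \<star> w \<oplus>\<^bsub>W\<^esub> v \<star> pd j w)"
    using x assms g by (simp add: comm_d W.r_distr W.m_assoc W.a_ac)
  finally show ?thesis using assms g by (intro W_add_cancel[of _ "pd j (v \<star> w)"]) auto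
next
  case (d l)
  let ?g = "gen l"
  have g: "?g \<in> carrier W" using d by simp
  have "?g \<star> (v \<star> w) \<oplus>\<^bsub>W\<^esub> pd j (v \<star> w) = v \<star> (w \<star> ?g)"
    using d assms g comm_x[of l "v \<star> w"] by (simp add: W.m_assoc)
  also have "\<dots> = (v \<star> ?g) \<star> w \<oplus>\<^bsub>W\<^esub> v \<star> pd j w"
    unfolding d(1) using d(2) assms g by (subst comm_x) (auto simp: W.r_distr W.m_assoc)
  also have "\<dots> = ?g \<star> (v \<star> w) \<oplus>\<^bsub>W\<^esub> (pd j v \<star> w \<oplus>\<^bsub>W\<^esub> v \<star> pd j w)"
    unfolding d(1) using d(2) assms g by (subst comm_x) (auto simp: W.l_distr W.m_assoc W.a_ac)
  finally show ?thesis using assms g by (intro W_add_cancel[of _ "pd j (v \<star> w)"]) auto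
qed

text \<open>The Euler operator z d/dz for the j-th symbol variable z. In the algebra it is
  \<open>gen l\<close> times \<open>pd l\<close>, or \<open>pd (n + l)\<close> times
  \<open>gen (n + l)\<close>: the orders in which normal ordering produces no correction.\<close>

definition euler :: "nat \<Rightarrow> ((nat \<Rightarrow> nat) \<Rightarrow> 'a) \<Rightarrow> (nat \<Rightarrow> nat) \<Rightarrow> 'a" where
  "euler j v = (\<lambda>e. nc (e j) \<otimes> v e)"

lemma shift_pd: "v \<in> carrier W \<Longrightarrow> shift j (pd j v) = euler j v"
  by (auto simp: shift_def pd_def euler_def fun_eq_iff)

lemma euler_x: "l < n \<Longrightarrow> v \<in> carrier W \<Longrightarrow> gen l \<star> pd l v = euler l v"
  by (simp add: gen_mult_x shift_pd)

lemma euler_d: "l < n \<Longrightarrow> v \<in> carrier W \<Longrightarrow> pd (n + l) v \<star> gen (n + l) = euler (n + l) v"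
  by (simp add: mult_gen_d shift_pd)

text \<open>The derivatives are up to sign the commutators with the generators, and generators and
  scalars together generate the algebra.\<close>

lemma central_iff_pd:
  assumes "v \<in> carrier W"
  shows "(\<forall>w\<in>carrier W. v \<star> w = w \<star> v) \<longleftrightarrow> (\<forall>j<2 * n. pd j v = \<zero>\<^bsub>W\<^esub>)"
proof
  assume c: "\<forall>w\<in>carrier W. v \<star> w = w \<star> v"
  show "\<forall>j<2 * n. pd j v = \<zero>\<^bsub>W\<^esub>"
  proof (intro allI impI)
    fix j assume "j < 2 * n"
    then show "pd j v = \<zero>\<^bsub>W\<^esub>"
    proof (cases rule: index_cases)
      case x
      have "v \<star> gen (n + j) = gen (n + j) \<star> v" using c x by auto
      then have "v \<star> gen (n + j) \<oplus>\<^bsub>W\<^esub> pd j v = v \<star> gen (n + j)" using comm_d[OF x assms] by simp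
      then show ?thesis using x assms by simp
    next
      case (d l)
      have "v \<star> gen l = gen l \<star> v" using c d by auto
      then have "gen l \<star> v \<oplus>\<^bsub>W\<^esub> pd j v = gen l \<star> v" using comm_x[OF d(2) assms] d by simp
      then show ?thesis using d assms by simp
    qed
  qed
next
  assume z: "\<forall>j<2 * n. pd j v = \<zero>\<^bsub>W\<^esub>"
  have g: "v \<star> gen j = gen j \<star> v" if "j < 2 * n" for j
    using that
  proof (cases rule: index_cases)
    case x
    then show ?thesis using comm_x[OF x assms] z assms by simp
  next
    case (d l)
    then show ?thesis using comm_d[OF d(2) assms] z assms by simp
  qed
  show "\<forall>w\<in>carrier W. v \<star> w = w \<star> v"
  proof
    fix w assume "w \<in> carrier W"
    then show "v \<star> w = w \<star> v"
    proof (induction rule: W_induct)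
      case one then show ?case using assms by simp
    next
      case (add w w') then show ?case using assms by (simp add: W.l_distr W.r_distr)
    next
      case (sc a w)
      have "v \<star> (sc a \<star> w) = (v \<star> sc a) \<star> w" using sc assms by (simp add: W.m_assoc)
      also have "v \<star> sc a = sc a \<star> v" using sc assms sc_comm by simp
      finally show ?case using sc assms by (simp add: W.m_assoc)
    next
      case (gen j w)
      have "v \<star> (gen j \<star> w) = (v \<star> gen j) \<star> w" using gen assms by (simp add: W.m_assoc)
      then show ?case using gen assms g by (simp add: W.m_assoc)
    qed
  qed
qed

section \<open>Leading terms\<close>

definition tdeg :: "(nat \<Rightarrow> nat) \<Rightarrow> nat" where
  "tdeg e = (\<Sum>i<2 * n. e i)"

text \<open>Graded lexicographic comparison, through the lexicographic order on lists. Degree comes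
  first so that the terms created by normal ordering, which have smaller degree, stay below the
  leading one.\<close>

definition key :: "(nat \<Rightarrow> nat) \<Rightarrow> nat list" where
  "key e = tdeg e # map e [0..<2 * n]"

definition bnd :: "((nat \<Rightarrow> nat) \<Rightarrow> 'a) \<Rightarrow> (nat \<Rightarrow> nat) \<Rightarrow> bool" where
  "bnd v c \<longleftrightarrow> (\<forall>e. v e \<noteq> \<zero> \<longrightarrow> key e \<le> key c)"

lemma map_add_less:
  fixes f g h :: "nat \<Rightarrow> nat"
  shows "map f xs < map g xs \<Longrightarrow> map (\<lambda>i. f i + h i) xs < map (\<lambda>i. g i + h i) xs"
  by (induction xs) auto

lemma tdeg_add: "tdeg (\<lambda>i. e i + c i) = tdeg e + tdeg c"
  by (simp add: tdeg_def sum.distrib)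

lemma key_add_less: "key e < key e' \<Longrightarrow> key (\<lambda>i. e i + c i) < key (\<lambda>i. e' i + c i)"
  using map_add_less[of e "[0..<2 * n]" e' c] by (auto simp: key_def tdeg_add)

lemma key_inj: "e \<in> exps \<Longrightarrow> e' \<in> exps \<Longrightarrow> key e = key e' \<Longrightarrow> e = e'"
proof
  fix i assume "e \<in> exps" "e' \<in> exps" "key e = key e'"
  then show "e i = e' i" by (cases "i < 2 * n") (auto simp: key_def exps_def)
qed

lemma key_add_le: "key e \<le> key e' \<Longrightarrow> key (\<lambda>i. e i + c i) \<le> key (\<lambda>i. e' i + c i)"
proof -
  assume "key e \<le> key e'"
  then consider "key e < key e'" | "key e = key e'" by fastforce
  then show ?thesis
  proof cases
    case 1 then show ?thesis using key_add_less[of e e' c] by simp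
  next
    case 2
    then have "\<forall>i<2 * n. e i = e' i" "tdeg e = tdeg e'" by (auto simp: key_def)
    then have "key (\<lambda>i. e i + c i) = key (\<lambda>i. e' i + c i)" by (auto simp: key_def tdeg_add)
    then show ?thesis by simp
  qed
qed

lemma key_tdeg_le: "key e \<le> key c \<Longrightarrow> tdeg e \<le> tdeg c"
  by (auto simp: key_def)

lemma tdeg_upd: "j < 2 * n \<Longrightarrow> tdeg (e(j := Suc (e j))) = Suc (tdeg e)"
proof -
  assume j: "j < 2 * n"
  have "e(j := Suc (e j)) = (\<lambda>i. e i + (if i = j then 1 else 0))" by auto
  then show ?thesis using j by (simp add: tdeg_def sum.distrib)
qed

lemma upd_add: "e(j := Suc (e j)) = (\<lambda>i. e i + ((\<lambda>_. 0)(j := 1)) i)"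
  by auto

text \<open>The derivative term lives in total degree below that of c, so it affects neither the
  bound nor the top coefficient. The shift translates exponents, and comparison of keys is invariant
  under translation.\<close>

lemma bnd_lmul:
  assumes "bnd v c" "v \<in> carrier W" "j < 2 * n" "c \<in> exps"
  shows "bnd (lmul j v) (c(j := Suc (c j)))" "lmul j v (c(j := Suc (c j))) = v c"
proof -
  have sh: "key e \<le> key (c(j := Suc (c j)))" if "shift j v e \<noteq> \<zero>" for e
  proof -
    have e: "e j \<noteq> 0" "v (e(j := e j - 1)) \<noteq> \<zero>" using that by (auto simp: shift_def split: if_splits)
    then have "key (e(j := e j - 1)) \<le> key c" using assms(1) by (auto simp: bnd_def)
    then have "key ((e(j := e j - 1))(j := Suc ((e(j := e j - 1)) j))) \<le> key (c(j := Suc (c j)))"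
      unfolding upd_add[of "e(j := e j - 1)"] upd_add[of c] by (rule key_add_le)
    then show ?thesis using e by simp
  qed
  have tp: "Suc (tdeg e) \<le> tdeg c" if "pd i v e \<noteq> \<zero>" "i < 2 * n" for e i
  proof -
    have "v (e(i := Suc (e i))) \<noteq> \<zero>" using that assms(2) by (auto simp: pd_def)
    then have "key (e(i := Suc (e i))) \<le> key c" using assms(1) by (auto simp: bnd_def)
    then show ?thesis using key_tdeg_le[of "e(i := Suc (e i))" c] tdeg_upd[OF that(2)] by simp
  qed
  have p0: "pd i v e = \<zero>" if "tdeg c \<le> tdeg e" "i < 2 * n" for e i
    using tp[of i e] that by fastforce
  have kp: "key e \<le> key (c(j := Suc (c j)))" if "pd i v e \<noteq> \<zero>" "i < 2 * n" for e i
    using tp[OF that] tdeg_upd[OF assms(3), of c] by (simp add: key_def)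
  show "bnd (lmul j v) (c(j := Suc (c j)))"
    unfolding bnd_def
  proof (intro allI impI)
    fix e assume ne: "lmul j v e \<noteq> \<zero>"
    show "key e \<le> key (c(j := Suc (c j)))"
    proof (cases "shift j v e \<noteq> \<zero>")
      case True then show ?thesis by (rule sh)
    next
      case False
      then have "pd (j - n) v e \<noteq> \<zero>" using ne assms(2) by (auto simp: lmul_def split: if_splits)
      then show ?thesis using kp assms(3) by auto
    qed
  qed
  have "shift j v (c(j := Suc (c j))) = v c" by (simp add: shift_def)
  moreover have "pd (j - n) v (c(j := Suc (c j))) = \<zero>"
    using assms(3) by (intro p0) (auto simp: tdeg_upd)
  ultimately show "lmul j v (c(j := Suc (c j))) = v c"
    using assms by (auto simp: lmul_def)
qed

lemma single_sc: "a \<in> carrier R \<Longrightarrow> b \<in> exps \<Longrightarrow> single a b = sc a \<star> single \<one> b"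
  by (subst sc_mult) (simp_all add: W_carrier single_closed, auto simp: single_def)

lemma bnd_single_mult:
  assumes w: "bnd w c" "w \<in> carrier W" "c \<in> exps" and b: "b \<in> exps" and a: "a \<in> carrier R"
  shows "bnd (single a b \<star> w) (\<lambda>i. b i + c i)" "(single a b \<star> w) (\<lambda>i. b i + c i) = a \<otimes> w c"
proof -
  have *: "bnd (single \<one> b \<star> w) (\<lambda>i. b i + c i) \<and> (single \<one> b \<star> w) (\<lambda>i. b i + c i) = w c"
    using b
  proof (induction "\<Sum>i<2 * n. b i" arbitrary: b rule: less_induct)
    case less
    show ?case
    proof (cases "b = (\<lambda>_. 0)")
      case True then show ?thesis using w by (simp add: W_one[symmetric])
    next
      case False
      then obtain j e' where e': "j < 2 * n" "e' \<in> exps" "b = e'(j := Suc (e' j))" "(\<Sum>i<2 * n. e' i) < (\<Sum>i<2 * n. b i)"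
        "lmul j (single \<one> e') = single \<one> b"
        using single_lmul[OF less.prems] by metis
      have s: "single \<one> e' \<in> carrier W" using e' by (simp add: W_carrier single_closed)
      have IH: "bnd (single \<one> e' \<star> w) (\<lambda>i. e' i + c i)" "(single \<one> e' \<star> w) (\<lambda>i. e' i + c i) = w c"
        using less.hyps[OF e'(4,2)] by auto
      have eq: "single \<one> b \<star> w = lmul j (single \<one> e' \<star> w)"
      proof -
        have "single \<one> b = gen j \<star> single \<one> e'" using e' s by (simp add: gen_mult)
        then have "single \<one> b \<star> w = gen j \<star> (single \<one> e' \<star> w)"
          using e'(1) s w by (simp only: W.m_assoc gen_closed)
        then show ?thesis using e'(1) s w by (simp only: gen_mult W.m_closed)
      qed
      have up: "(\<lambda>i. b i + c i) = (\<lambda>i. e' i + c i)(j := Suc ((\<lambda>i. e' i + c i) j))"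
        using e'(3) by auto
      have "(\<lambda>i. e' i + c i) \<in> exps" using e'(2) w(3) by (auto simp: exps_def)
      then show ?thesis
        unfolding eq up using bnd_lmul[OF IH(1) _ e'(1)] IH(2) s w by auto
    qed
  qed
  have s: "single \<one> b \<in> carrier W" using b by (simp add: W_carrier single_closed)
  have "single a b \<star> w = sc a \<star> (single \<one> b \<star> w)"
    unfolding single_sc[OF a b] using s a w by (simp add: W.m_assoc)
  then have eq: "single a b \<star> w = (\<lambda>e. a \<otimes> (single \<one> b \<star> w) e)"
    using s a w by (simp add: sc_mult)
  have nz: "(single \<one> b \<star> w) e \<noteq> \<zero>" if "a \<otimes> (single \<one> b \<star> w) e \<noteq> \<zero>" for e
    using that a by auto
  show "bnd (single a b \<star> w) (\<lambda>i. b i + c i)"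
    unfolding eq using * nz by (auto simp: bnd_def)
  show "(single a b \<star> w) (\<lambda>i. b i + c i) = a \<otimes> w c"
    unfolding eq using * by simp
qed

text \<open>Leading parts multiply like commutative polynomials, over any commutative ring and even
  if a coefficient vanishes at the stated bound. Over a domain this makes leading exponents
  additive; with an invertible coefficient it yields divisibility by p.\<close>

lemma bnd_mult:
  assumes w: "bnd w c" "w \<in> carrier W" "c \<in> exps" and b: "b \<in> exps" and v: "v \<in> carrier W" "bnd v b"
  shows "bnd (v \<star> w) (\<lambda>i. b i + c i)" "(v \<star> w) (\<lambda>i. b i + c i) = v b \<otimes> w c"
proof -
  have "bnd (v \<star> w) (\<lambda>i. b i + c i) \<and> (v \<star> w) (\<lambda>i. b i + c i) = v b \<otimes> w c"
    using v unfolding W_carrier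
  proof (induction rule: fin_supp_insert_induct)
    case zero
    have "(\<lambda>x. \<zero>) \<star> w = (\<lambda>x. \<zero>)" using W.l_null[OF w(2)] by (simp add: W_zero)
    then show ?case using w by (simp add: bnd_def)
  next
    case (insert f a x)
    let ?s = "single a x"
    have f: "f \<in> carrier W" and s: "?s \<in> carrier W" using insert by (auto simp: W_carrier single_closed)
    have vw: "(\<lambda>y. f y \<oplus> ?s y) \<star> w = (\<lambda>e. (f \<star> w) e \<oplus> (?s \<star> w) e)"
      using W.l_distr[OF f s w(2)] by (simp add: W_add)
    have bf: "bnd f b" unfolding bnd_def
    proof (intro allI impI)
      fix e assume "f e \<noteq> \<zero>"
      moreover then have "e \<noteq> x" using insert by auto
      ultimately have "f e \<oplus> ?s e \<noteq> \<zero>" using f by (auto simp: single_def)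
      then show "key e \<le> key b" using insert by (auto simp: bnd_def)
    qed
    have kx: "key x \<le> key b"
    proof -
      have "f x \<oplus> ?s x \<noteq> \<zero>" using insert by (auto simp: single_def)
      then show ?thesis using insert by (auto simp: bnd_def)
    qed
    note IH = insert.IH[OF bf]
    note S = bnd_single_mult[OF w insert(4) insert(2)]
    have kxc: "key (\<lambda>i. x i + c i) \<le> key (\<lambda>i. b i + c i)" by (rule key_add_le[OF kx])
    have "bnd ((\<lambda>y. f y \<oplus> ?s y) \<star> w) (\<lambda>i. b i + c i)"
      unfolding bnd_def vw
    proof (intro allI impI)
      fix e assume ne: "(f \<star> w) e \<oplus> (?s \<star> w) e \<noteq> \<zero>"
      show "key e \<le> key (\<lambda>i. b i + c i)"
      proof (cases "(f \<star> w) e = \<zero>")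
        case False then show ?thesis using IH by (auto simp: bnd_def)
      next
        case True
        then have "(?s \<star> w) e \<noteq> \<zero>" using ne by auto
        then have "key e \<le> key (\<lambda>i. x i + c i)" using S(1) by (auto simp: bnd_def)
        then show ?thesis using kxc by simp
      qed
    qed
    moreover have "(?s \<star> w) (\<lambda>i. b i + c i) = ?s b \<otimes> w c"
    proof (cases "x = b")
      case True then show ?thesis using S(2) by (simp add: single_def)
    next
      case False
      then have "key x < key b" using kx key_inj[OF insert(4) b] by fastforce
      then have "key (\<lambda>i. x i + c i) < key (\<lambda>i. b i + c i)" by (rule key_add_less)
      then have "(?s \<star> w) (\<lambda>i. b i + c i) = \<zero>" using S(1) by (force simp: bnd_def)
      then show ?thesis using False w by (simp add: single_def)
    qed
    ultimately show ?case using IH insert w f by (auto simp: vw l_distr single_carrier)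
  qed
  then show "bnd (v \<star> w) (\<lambda>i. b i + c i)" "(v \<star> w) (\<lambda>i. b i + c i) = v b \<otimes> w c" by auto
qed

definition lead :: "((nat \<Rightarrow> nat) \<Rightarrow> 'a) \<Rightarrow> (nat \<Rightarrow> nat) \<Rightarrow> bool" where
  "lead v c \<longleftrightarrow> v c \<noteq> \<zero> \<and> bnd v c"

lemma lead_exps: "v \<in> carrier W \<Longrightarrow> lead v c \<Longrightarrow> c \<in> exps"
  by (auto simp: lead_def W_carrier fin_suppD)

lemma lead_exists:
  assumes "v \<in> carrier W" "v \<noteq> \<zero>\<^bsub>W\<^esub>"
  shows "\<exists>c. lead v c"
proof -
  let ?S = "key ` {e. v e \<noteq> \<zero>}"
  have S: "finite ?S" "?S \<noteq> {}" using assms by (auto simp: W_carrier fin_suppD W_zero)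
  have "Max ?S \<in> ?S" by (rule Max_in[OF S])
  then obtain c where c: "v c \<noteq> \<zero>" "key c = Max ?S" by (auto simp: eq_commute)
  have "bnd v c" unfolding bnd_def c(2) using S by auto
  then show ?thesis using c by (auto simp: lead_def)
qed

lemma lead_unique: "v \<in> carrier W \<Longrightarrow> lead v c \<Longrightarrow> lead v c' \<Longrightarrow> c = c'"
  using lead_exps[of v c] lead_exps[of v c'] by (intro key_inj) (auto simp: lead_def bnd_def intro: antisym)

text \<open>Unspecified at zero, where no leading exponent exists; hence the nonvanishing hypotheses
  in the degree lemmas.\<close>

definition td :: "((nat \<Rightarrow> nat) \<Rightarrow> 'a) \<Rightarrow> nat" where
  "td v = tdeg (SOME c. lead v c)"

lemma td_lead: "v \<in> carrier W \<Longrightarrow> lead v c \<Longrightarrow> td v = tdeg c"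
  unfolding td_def using lead_unique someI[of "lead v" c] by metis

lemma tdeg_le_td:
  assumes "v \<in> carrier W" "v e \<noteq> \<zero>"
  shows "tdeg e \<le> td v"
proof -
  have "v \<noteq> \<zero>\<^bsub>W\<^esub>" using assms by (auto simp: W_zero)
  then obtain c where c: "lead v c" using lead_exists[OF assms(1)] by auto
  then show ?thesis using assms key_tdeg_le[of e c] by (auto simp: td_lead[OF assms(1) c] lead_def bnd_def)
qed

lemma td_pd:
  assumes "v \<in> carrier W" "j < 2 * n" "pd j v \<noteq> \<zero>\<^bsub>W\<^esub>"
  shows "td (pd j v) < td v"
proof -
  obtain c where c: "lead (pd j v) c" using lead_exists[of "pd j v"] assms by auto
  then have "pd j v c \<noteq> \<zero>" by (simp add: lead_def)
  then have "v (c(j := Suc (c j))) \<noteq> \<zero>" using assms by (auto simp: pd_def)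
  then have "tdeg (c(j := Suc (c j))) \<le> td v" using tdeg_le_td assms by blast
  then show ?thesis using td_lead[OF _ c] assms tdeg_upd by simp
qed

lemma td_zero_iff:
  assumes "v \<in> carrier W" "v \<noteq> \<zero>\<^bsub>W\<^esub>"
  shows "td v = 0 \<longleftrightarrow> v = sc (v (\<lambda>_. 0))"
proof
  assume t: "td v = 0"
  show "v = sc (v (\<lambda>_. 0))"
  proof
    fix e
    show "v e = sc (v (\<lambda>_. 0)) e"
    proof (cases "v e = \<zero>")
      case True then show ?thesis by (auto simp: sc_def single_def)
    next
      case False
      then have "tdeg e = 0" "e \<in> exps" using tdeg_le_td[OF assms(1)] t assms(1) by (auto simp: W_carrier fin_suppD)
      then have "e = (\<lambda>_. 0)" by (auto simp: tdeg_def exps_def fun_eq_iff) (metis lessThan_iff not_less)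
      then show ?thesis by (simp add: sc_def single_def)
    qed
  qed
next
  assume v: "v = sc (v (\<lambda>_. 0))"
  obtain c where c: "lead v c" using lead_exists assms by auto
  then have "v c \<noteq> \<zero>" by (simp add: lead_def)
  then have "c = (\<lambda>_. 0)" by (subst (asm) v) (auto simp: sc_def single_def split: if_splits)
  then show "td v = 0" using td_lead[OF assms(1) c] by (simp add: tdeg_def)
qed

end

section \<open>The Weyl algebra over a domain: no zero divisors, additive degree\<close>

locale weyl_domain = weyl R n + domain R for R (structure) and n
begin

lemma lead_mult:
  assumes "v \<in> carrier W" "w \<in> carrier W" "lead v b" "lead w c"
  shows "lead (v \<star> w) (\<lambda>i. b i + c i)"
  using assms bnd_mult[of w c b v] lead_exps[of v b] lead_exps[of w c] integral_iff[of "v b" "w c"]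
  by (auto simp: lead_def)

lemma W_integral:
  assumes "v \<in> carrier W" "w \<in> carrier W" "v \<star> w = \<zero>\<^bsub>W\<^esub>"
  shows "v = \<zero>\<^bsub>W\<^esub> \<or> w = \<zero>\<^bsub>W\<^esub>"
proof (rule ccontr)
  assume "\<not> (v = \<zero>\<^bsub>W\<^esub> \<or> w = \<zero>\<^bsub>W\<^esub>)"
  then obtain b c where "lead v b" "lead w c" using lead_exists assms by metis
  then have "lead (v \<star> w) (\<lambda>i. b i + c i)" using lead_mult assms by blast
  then show False using assms(3) by (auto simp: lead_def W_zero)
qed

lemma W_one_not_zero [simp]: "\<one>\<^bsub>W\<^esub> \<noteq> \<zero>\<^bsub>W\<^esub>"
  by (auto simp: W_one W_zero single_def fun_eq_iff)

lemma W_cancel_right: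
  assumes "v \<in> carrier W" "w \<in> carrier W" "u \<in> carrier W" "v \<star> u = w \<star> u" "u \<noteq> \<zero>\<^bsub>W\<^esub>"
  shows "v = w"
proof -
  have "(v \<ominus>\<^bsub>W\<^esub> w) \<star> u = \<zero>\<^bsub>W\<^esub>" using assms by (simp add: W.minus_eq W.l_distr W.l_minus W.r_neg)
  then show ?thesis using assms W_integral[of "v \<ominus>\<^bsub>W\<^esub> w" u] by auto
qed

lemma W_cancel_left:
  assumes "v \<in> carrier W" "w \<in> carrier W" "u \<in> carrier W" "u \<star> v = u \<star> w" "u \<noteq> \<zero>\<^bsub>W\<^esub>"
  shows "v = w"
proof -
  have "u \<star> (v \<ominus>\<^bsub>W\<^esub> w) = \<zero>\<^bsub>W\<^esub>" using assms by (simp add: W.minus_eq W.r_distr W.r_minus W.r_neg)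
  then show ?thesis using assms W_integral[of u "v \<ominus>\<^bsub>W\<^esub> w"] by auto
qed

lemma td_mult:
  assumes "v \<in> carrier W" "w \<in> carrier W" "v \<noteq> \<zero>\<^bsub>W\<^esub>" "w \<noteq> \<zero>\<^bsub>W\<^esub>"
  shows "td (v \<star> w) = td v + td w"
proof -
  obtain b c where "lead v b" "lead w c" using lead_exists assms by metis
  then show ?thesis using lead_mult[of v w b c] assms by (simp add: td_lead tdeg_add)
qed

end

section \<open>Unique factorisation in polynomial domains\<close>

text \<open>An axiomatic polynomial ring over a field in the variables \<open>var 0, \<dots>, var (N - 1)\<close>:
  \<open>td\<close> is a total degree, \<open>dg j\<close> and \<open>lcf j\<close> are the degree and the leading coefficient
  in the \<open>j\<close>-th variable.\<close>

locale poly_domain = domain Z for Z (structure) +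
  fixes N :: nat and td :: "'a \<Rightarrow> nat" and dg :: "nat \<Rightarrow> 'a \<Rightarrow> nat" and lcf :: "nat \<Rightarrow> 'a \<Rightarrow> 'a" and var :: "nat \<Rightarrow> 'a"
  assumes td_mult: "\<And>a b. a \<in> carrier Z \<Longrightarrow> b \<in> carrier Z \<Longrightarrow> a \<noteq> \<zero> \<Longrightarrow> b \<noteq> \<zero> \<Longrightarrow> td (a \<otimes> b) = td a + td b"
    and td_unit: "\<And>a. a \<in> carrier Z \<Longrightarrow> a \<noteq> \<zero> \<Longrightarrow> td a = 0 \<Longrightarrow> a \<in> Units Z"
    and dg_mult: "\<And>j a b. j < N \<Longrightarrow> a \<in> carrier Z \<Longrightarrow> b \<in> carrier Z \<Longrightarrow> a \<noteq> \<zero> \<Longrightarrow> b \<noteq> \<zero> \<Longrightarrow> dg j (a \<otimes> b) = dg j a + dg j b"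
    and dg_add: "\<And>j a b. j < N \<Longrightarrow> a \<in> carrier Z \<Longrightarrow> b \<in> carrier Z \<Longrightarrow> dg j (a \<oplus> b) \<le> max (dg j a) (dg j b)"
    and dg_zero: "\<And>j. dg j \<zero> = 0"
    and dg_td: "\<And>a. a \<in> carrier Z \<Longrightarrow> a \<noteq> \<zero> \<Longrightarrow> (\<And>j. j < N \<Longrightarrow> dg j a = 0) \<Longrightarrow> td a = 0"
    and var_closed: "\<And>j. j < N \<Longrightarrow> var j \<in> carrier Z"
    and var_nonzero: "\<And>j. j < N \<Longrightarrow> var j \<noteq> \<zero>"
    and dg_var: "\<And>i j. i < N \<Longrightarrow> j < N \<Longrightarrow> dg i (var j) = (if i = j then 1 else 0)"
    and lcf_closed: "\<And>j a. j < N \<Longrightarrow> a \<in> carrier Z \<Longrightarrow> lcf j a \<in> carrier Z"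
    and lcf_nonzero: "\<And>j a. j < N \<Longrightarrow> a \<in> carrier Z \<Longrightarrow> a \<noteq> \<zero> \<Longrightarrow> lcf j a \<noteq> \<zero>"
    and dg_lcf: "\<And>i j a. i < N \<Longrightarrow> j < N \<Longrightarrow> a \<in> carrier Z \<Longrightarrow> dg i (lcf j a) \<le> (if i = j then 0 else dg i a)"
    and lcf_const: "\<And>j a. j < N \<Longrightarrow> a \<in> carrier Z \<Longrightarrow> dg j a = 0 \<Longrightarrow> lcf j a = a"
    and tail: "\<And>j a. j < N \<Longrightarrow> a \<in> carrier Z \<Longrightarrow> 0 < dg j a \<Longrightarrow>
      \<exists>t\<in>carrier Z. a = lcf j a \<otimes> var j [^] dg j a \<oplus> t \<and> dg j t < dg j a"
begin

lemma dg_tail: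
  assumes "j < N" "a \<in> carrier Z" "0 < dg j a"
  shows "dg j (a \<ominus> lcf j a \<otimes> var j [^] dg j a) < dg j a"
proof -
  obtain t where t: "t \<in> carrier Z" "a = lcf j a \<otimes> var j [^] dg j a \<oplus> t" "dg j t < dg j a"
    using tail[OF assms] by blast
  define l where "l = lcf j a \<otimes> var j [^] dg j a"
  have l: "l \<in> carrier Z" unfolding l_def using assms by (intro m_closed lcf_closed nat_pow_closed var_closed)
  have "a \<ominus> l = t" using t l assms(2) unfolding l_def[symmetric] by algebra
  then show ?thesis using t(3) by (simp add: l_def)
qed

definition dv :: "'a \<Rightarrow> 'a \<Rightarrow> bool" where
  "dv a b \<longleftrightarrow> (\<exists>c\<in>carrier Z. b = a \<otimes> c)"

text \<open>Units are replaced by elements of degree 0; the two notions agree by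
  \<open>td_unit\<close> and additivity of \<open>td\<close>.\<close>

definition irr :: "'a \<Rightarrow> bool" where
  "irr f \<longleftrightarrow> f \<in> carrier Z \<and> f \<noteq> \<zero> \<and> 0 < td f \<and>
    (\<forall>u\<in>carrier Z. \<forall>v\<in>carrier Z. f = u \<otimes> v \<longrightarrow> td u = 0 \<or> td v = 0)"

lemma irr_factors: "irr f \<Longrightarrow> f = u \<otimes> v \<Longrightarrow> u \<in> carrier Z \<Longrightarrow> v \<in> carrier Z \<Longrightarrow> td u = 0 \<or> td v = 0"
  unfolding irr_def by metis

text \<open>The polynomials in the variables of J. Primality of irreducibles is proved by enlarging
  J one variable at a time.\<close>

definition sub :: "nat set \<Rightarrow> 'a set" where
  "sub J = {a \<in> carrier Z. \<forall>i<N. i \<notin> J \<longrightarrow> dg i a = 0}"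

lemma subD: "a \<in> sub J \<Longrightarrow> a \<in> carrier Z" "a \<in> sub J \<Longrightarrow> i < N \<Longrightarrow> i \<notin> J \<Longrightarrow> dg i a = 0"
  by (auto simp: sub_def)

lemma dg_one: "j < N \<Longrightarrow> dg j \<one> = 0"
  using dg_mult[of j \<one> \<one>] by simp

lemma dg_minus: "j < N \<Longrightarrow> a \<in> carrier Z \<Longrightarrow> dg j (\<ominus> a) = dg j a"
proof -
  assume j: "j < N" and a: "a \<in> carrier Z"
  have n: "\<ominus> \<one> \<noteq> \<zero>" by (metis add.inv_eq_1_iff one_closed zero_not_one)
  have "dg j (\<ominus> \<one> \<otimes> \<ominus> \<one>) = dg j (\<ominus> \<one>) + dg j (\<ominus> \<one>)" using j n by (intro dg_mult) auto
  then have z: "dg j (\<ominus> \<one>) = 0" using j by (simp add: l_minus r_minus dg_one)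
  show ?thesis
  proof (cases "a = \<zero>")
    case False
    have "dg j (\<ominus> \<one> \<otimes> a) = dg j (\<ominus> \<one>) + dg j a" using j n a False by (intro dg_mult) auto
    then show ?thesis using z a by (simp add: l_minus)
  qed simp
qed

lemma dg_diff: "j < N \<Longrightarrow> a \<in> carrier Z \<Longrightarrow> b \<in> carrier Z \<Longrightarrow> dg j (a \<ominus> b) \<le> max (dg j a) (dg j b)"
  using dg_add[of j a "\<ominus> b"] by (simp add: minus_eq dg_minus)

lemma dg_mult_le: "j < N \<Longrightarrow> a \<in> carrier Z \<Longrightarrow> b \<in> carrier Z \<Longrightarrow> dg j (a \<otimes> b) \<le> dg j a + dg j b"
  by (cases "a = \<zero> \<or> b = \<zero>") (auto simp: dg_mult dg_zero)

lemma var_pow_nonzero: "j < N \<Longrightarrow> var j [^] (d::nat) \<noteq> \<zero>"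
  by (induction d) (auto simp: var_closed var_nonzero integral_iff)

lemma dg_var_pow: "i < N \<Longrightarrow> j < N \<Longrightarrow> dg i (var j [^] (d::nat)) = (if i = j then d else 0)"
  by (induction d) (auto simp: dg_one dg_mult var_closed var_nonzero var_pow_nonzero dg_var)

lemma unit_dg: "j < N \<Longrightarrow> u \<in> Units Z \<Longrightarrow> dg j u = 0"
proof -
  assume j: "j < N" and u: "u \<in> Units Z"
  have "u \<noteq> \<zero>" "inv u \<noteq> \<zero>" using u by (metis Units_r_inv Units_inv_closed Units_closed l_null r_null zero_not_one)+
  then have "dg j (u \<otimes> inv u) = dg j u + dg j (inv u)" using j u by (intro dg_mult) auto
  then show ?thesis using u j by (simp add: dg_one)
qed

lemma td_one: "td \<one> = 0"
  using td_mult[of \<one> \<one>] by simp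

lemma sub_one: "\<one> \<in> sub J" by (auto simp: sub_def dg_one)
lemma sub_zero: "\<zero> \<in> sub J" by (auto simp: sub_def dg_zero)
lemma sub_unit: "u \<in> Units Z \<Longrightarrow> u \<in> sub J" by (auto simp: sub_def unit_dg)

lemma sub_mult: "a \<in> sub J \<Longrightarrow> b \<in> sub J \<Longrightarrow> a \<otimes> b \<in> sub J"
  using dg_mult_le by (fastforce simp: sub_def)

lemma sub_add: "a \<in> sub J \<Longrightarrow> b \<in> sub J \<Longrightarrow> a \<oplus> b \<in> sub J"
  using dg_add by (fastforce simp: sub_def)

lemma sub_diff: "a \<in> sub J \<Longrightarrow> b \<in> sub J \<Longrightarrow> a \<ominus> b \<in> sub J"
  using dg_diff by (fastforce simp: sub_def)

lemma sub_factor: "a \<in> carrier Z \<Longrightarrow> b \<in> carrier Z \<Longrightarrow> a \<otimes> b \<in> sub J \<Longrightarrow> a \<otimes> b \<noteq> \<zero> \<Longrightarrow> a \<in> sub J \<and> b \<in> sub J"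
  by (auto simp: sub_def dg_mult integral_iff)

lemma sub_mono: "J \<subseteq> K \<Longrightarrow> sub J \<subseteq> sub K"
  by (auto simp: sub_def)

lemma sub_lcf: "j < N \<Longrightarrow> a \<in> sub (insert j J) \<Longrightarrow> lcf j a \<in> sub J"
proof -
  assume j: "j < N" and a: "a \<in> sub (insert j J)"
  have "dg i (lcf j a) = 0" if "i < N" "i \<notin> J" for i
    using dg_lcf[OF that(1) j subD(1)[OF a]] subD(2)[OF a that(1)] that by (auto split: if_splits)
  then show ?thesis using a j by (auto simp: sub_def lcf_closed)
qed

lemma sub_var_pow: "j < N \<Longrightarrow> var j [^] (d::nat) \<in> sub (insert j J)"
  by (auto simp: sub_def dg_var_pow var_closed)

lemma tail_identity:
  assumes "x \<in> carrier Z" "c \<in> carrier Z" "y \<in> carrier Z" "q \<in> carrier Z" "t \<in> carrier Z"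
  shows "(x \<ominus> c) \<otimes> y = ((x \<otimes> y \<oplus> q \<oplus> t) \<ominus> c \<otimes> y) \<ominus> (q \<oplus> t)"
  using assms by algebra

text \<open>Splitting both factors into leading term and tail shows that the difference of the two
  candidates, times y^(m+k), is a combination of terms of degree below m+k. A nonzero multiple of
  y^(m+k) has degree at least m+k.\<close>

lemma lcf_mult:
  assumes "j < N" "a \<in> carrier Z" "b \<in> carrier Z" "a \<noteq> \<zero>" "b \<noteq> \<zero>"
  shows "lcf j (a \<otimes> b) = lcf j a \<otimes> lcf j b"
proof -
  define y where "y = var j"
  have y: "y \<in> carrier Z" using assms var_closed by (simp add: y_def)
  let ?a = "lcf j a" and ?b = "lcf j b" and ?c = "lcf j (a \<otimes> b)"
  let ?m = "dg j a" and ?k = "dg j b"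
  have cl: "?a \<in> carrier Z" "?b \<in> carrier Z" "?c \<in> carrier Z" using assms lcf_closed by auto
  have d0: "dg j ?a = 0" "dg j ?b = 0" "dg j ?c = 0" using dg_lcf[of j j] assms by auto
  have dab: "dg j (a \<otimes> b) = ?m + ?k" using assms by (simp add: dg_mult)
  show ?thesis
  proof (cases "?m + ?k = 0")
    case True
    then show ?thesis using assms dab by (simp add: lcf_const)
  next
    case False
    define t s r where "t = a \<ominus> ?a \<otimes> y [^] ?m" and "s = b \<ominus> ?b \<otimes> y [^] ?k" and "r = a \<otimes> b \<ominus> ?c \<otimes> y [^] (?m + ?k)"
    have ts: "t \<in> carrier Z" "s \<in> carrier Z" "r \<in> carrier Z" using cl y assms by (auto simp: t_def s_def r_def)
    \<comment> \<open>The alternative t = 0 covers ?m = 0, where a is its own leading coefficient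
      and no degree lies below.\<close>
    have t: "t = \<zero> \<or> dg j t < ?m" using dg_tail[of j a] assms lcf_const[of j a] cl
      by (cases "?m = 0") (auto simp: t_def y_def)
    have s: "s = \<zero> \<or> dg j s < ?k" using dg_tail[of j b] assms lcf_const[of j b] cl
      by (cases "?k = 0") (auto simp: s_def y_def)
    have r: "dg j r < ?m + ?k" using dg_tail[of j "a \<otimes> b"] False assms dab by (simp add: r_def y_def)
    have ae: "a = ?a \<otimes> y [^] ?m \<oplus> t" and be: "b = ?b \<otimes> y [^] ?k \<oplus> s"
      using assms cl y by (simp_all add: t_def s_def minus_eq a_lcomm[of "_ \<otimes> _"] r_neg)
    have dy: "dg j (x \<otimes> y [^] d) \<le> dg j x + d" if "x \<in> carrier Z" for x and d :: nat
      using dg_mult_le[of j x "y [^] d"] that y assms by (simp add: dg_var_pow y_def)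
    have "(?a \<otimes> ?b \<ominus> ?c) \<otimes> y [^] (?m + ?k) = r \<ominus> (?a \<otimes> y [^] ?m \<otimes> s \<oplus> t \<otimes> b)"
    proof -
      have "a \<otimes> b = ?a \<otimes> y [^] ?m \<otimes> b \<oplus> t \<otimes> b"
        using ae cl y ts assms by (metis l_distr m_closed nat_pow_closed)
      also have "?a \<otimes> y [^] ?m \<otimes> b = ?a \<otimes> y [^] ?m \<otimes> (?b \<otimes> y [^] ?k) \<oplus> ?a \<otimes> y [^] ?m \<otimes> s"
        using be cl y ts assms by (metis r_distr m_closed nat_pow_closed)
      also have "?a \<otimes> y [^] ?m \<otimes> (?b \<otimes> y [^] ?k) = ?a \<otimes> ?b \<otimes> y [^] (?m + ?k)"
        using cl y by (simp add: nat_pow_mult[symmetric] m_ac)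
      finally have ab: "a \<otimes> b = ?a \<otimes> ?b \<otimes> y [^] (?m + ?k) \<oplus> ?a \<otimes> y [^] ?m \<otimes> s \<oplus> t \<otimes> b" .
      have "r = (?a \<otimes> ?b \<otimes> y [^] (?m + ?k) \<oplus> ?a \<otimes> y [^] ?m \<otimes> s \<oplus> t \<otimes> b) \<ominus> ?c \<otimes> y [^] (?m + ?k)"
        using arg_cong[OF ab, of "\<lambda>z. z \<ominus> ?c \<otimes> y [^] (?m + ?k)"] by (simp only: r_def)
      then show ?thesis
        using tail_identity[of "?a \<otimes> ?b" ?c "y [^] (?m + ?k)" "?a \<otimes> y [^] ?m \<otimes> s" "t \<otimes> b"] cl y ts assms by simp
    qed
    moreover have "dg j (r \<ominus> (?a \<otimes> y [^] ?m \<otimes> s \<oplus> t \<otimes> b)) < ?m + ?k"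
    proof -
      have 1: "dg j (?a \<otimes> y [^] ?m \<otimes> s) < ?m + ?k"
      proof (cases "s = \<zero>")
        case True then show ?thesis using False cl y by (simp add: dg_zero)
      next
        case False
        have "dg j (?a \<otimes> y [^] ?m \<otimes> s) \<le> dg j (?a \<otimes> y [^] ?m) + dg j s"
          using cl y ts assms by (intro dg_mult_le) auto
        then show ?thesis using s False dy[OF cl(1), of ?m] d0 by auto
      qed
      have 2: "dg j (t \<otimes> b) < ?m + ?k"
      proof (cases "t = \<zero>")
        case True then show ?thesis using False assms by (simp add: dg_zero)
      next
        case F: False
        have "dg j (t \<otimes> b) \<le> dg j t + ?k"
          using ts assms by (intro dg_mult_le) auto
        then show ?thesis using t F by auto
      qed
      have "dg j (?a \<otimes> y [^] ?m \<otimes> s \<oplus> t \<otimes> b) < ?m + ?k"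
        using dg_add[of j "?a \<otimes> y [^] ?m \<otimes> s" "t \<otimes> b"] 1 2 assms cl y ts by auto
      then show ?thesis using dg_diff[of j r "?a \<otimes> y [^] ?m \<otimes> s \<oplus> t \<otimes> b"] r assms cl y ts by auto
    qed
    ultimately have lt: "dg j ((?a \<otimes> ?b \<ominus> ?c) \<otimes> y [^] (?m + ?k)) < ?m + ?k" by simp
    have "?a \<otimes> ?b \<ominus> ?c = \<zero>"
    proof (rule ccontr)
      assume "?a \<otimes> ?b \<ominus> ?c \<noteq> \<zero>"
      then have "dg j ((?a \<otimes> ?b \<ominus> ?c) \<otimes> y [^] (?m + ?k)) = dg j (?a \<otimes> ?b \<ominus> ?c) + (?m + ?k)"
        using cl y assms var_pow_nonzero[of j] by (subst dg_mult) (auto simp: y_def dg_var_pow)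
      then show False using lt by simp
    qed
    then show ?thesis using cl by (metis m_closed r_right_minus_eq)
  qed
qed

lemma exists_irr:
  assumes "a \<in> carrier Z" "a \<noteq> \<zero>" "0 < td a"
  shows "\<exists>q. irr q \<and> dv q a"
  using assms
proof (induction "td a" arbitrary: a rule: less_induct)
  case less
  show ?case
  proof (cases "irr a")
    case True then show ?thesis using less.prems by (auto simp: dv_def intro!: exI[of _ a] bexI[of _ \<one>])
  next
    case False
    then obtain u v where uv: "u \<in> carrier Z" "v \<in> carrier Z" "a = u \<otimes> v" "td u \<noteq> 0" "td v \<noteq> 0"
      using less.prems by (auto simp: irr_def)
    then have nz: "u \<noteq> \<zero>" "v \<noteq> \<zero>" using less.prems by auto
    then have "td u < td a" using uv td_mult by simp
    then obtain q c where "irr q" "c \<in> carrier Z" "u = q \<otimes> c" using less.hyps[of u] uv nz by (auto simp: dv_def)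
    then show ?thesis using uv by (auto simp: dv_def irr_def m_assoc intro!: exI[of _ q] bexI[of _ "c \<otimes> v"])
  qed
qed

definition prime_in :: "nat set \<Rightarrow> bool" where
  "prime_in J \<longleftrightarrow> (\<forall>f\<in>sub J. irr f \<longrightarrow> (\<forall>g\<in>sub J. \<forall>h\<in>sub J. dv f (g \<otimes> h) \<longrightarrow> dv f g \<or> dv f h))"

lemma dv_add: "a \<in> carrier Z \<Longrightarrow> dv a b \<Longrightarrow> dv a c \<Longrightarrow> dv a (b \<oplus> c)"
  by (auto simp: dv_def) (metis a_closed r_distr)

lemma dv_mult: "a \<in> carrier Z \<Longrightarrow> dv a b \<Longrightarrow> c \<in> carrier Z \<Longrightarrow> dv a (b \<otimes> c)"
  by (auto simp: dv_def m_assoc)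

lemma dv_minus: "a \<in> carrier Z \<Longrightarrow> dv a b \<Longrightarrow> dv a (\<ominus> b)"
  by (auto simp: dv_def) (metis a_inv_closed r_minus)

text \<open>Gauss's lemma. As q does not involve the variable j, it divides the product of the
  leading coefficients, hence one of them. Subtracting that leading term lowers the degree and keeps
  the product divisible by q.\<close>

lemma coefficient_prime:
  assumes P: "prime_in J" and j: "j < N" "j \<notin> J" and q: "q \<in> sub J" "irr q"
    and "g \<in> sub (insert j J)" "h \<in> sub (insert j J)" "dv q (g \<otimes> h)"
  shows "dv q g \<or> dv q h"
  using assms(6-8)
proof (induction "dg j g + dg j h" arbitrary: g h rule: less_induct)
  case less
  have qc: "q \<in> carrier Z" using q by (auto simp: sub_def)
  have step: "dv q g \<or> dv q h"
    if gh: "g \<in> sub (insert j J)" "h \<in> sub (insert j J)" "dv q (g \<otimes> h)" "dv q (lcf j g)"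
      and IH: "\<And>g'. dg j g' < dg j g \<Longrightarrow> g' \<in> sub (insert j J) \<Longrightarrow> dv q (g' \<otimes> h) \<Longrightarrow> dv q g' \<or> dv q h" for g h
  proof (cases "dg j g = 0")
    case True then show ?thesis using gh j by (auto simp: lcf_const subD)
  next
    case False
    let ?l = "lcf j g \<otimes> var j [^] dg j g"
    let ?g = "g \<ominus> ?l"
    have g: "g \<in> carrier Z" and h: "h \<in> carrier Z" using gh subD by auto
    have l: "?l \<in> sub (insert j J)"
      using sub_mono[of J "insert j J"] sub_lcf[OF j(1) gh(1)] sub_var_pow[OF j(1)] by (intro sub_mult) auto
    have lc: "?l \<in> carrier Z" using l subD by auto
    have ql: "dv q ?l" using dv_mult[OF qc gh(4)] j var_closed by auto
    have "?g \<otimes> h = g \<otimes> h \<oplus> \<ominus> (?l \<otimes> h)" using g h lc by (simp add: minus_eq l_distr l_minus)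
    moreover have "dv q (g \<otimes> h \<oplus> \<ominus> (?l \<otimes> h))" by (intro dv_add[OF qc gh(3)] dv_minus[OF qc] dv_mult[OF qc ql h])
    ultimately have "dv q ?g \<or> dv q h"
      using dg_tail[of j g] False j g l gh by (intro IH sub_diff) auto
    moreover have "dv q g" if "dv q ?g"
    proof -
      have "g = ?g \<oplus> ?l" using g lc by (simp add: minus_eq a_assoc l_neg)
      then show ?thesis using dv_add[OF qc that ql] by simp
    qed
    ultimately show ?thesis by auto
  qed
  have cl: "g \<in> carrier Z" "h \<in> carrier Z" using less.prems subD by auto
  show ?case
  proof (cases "g = \<zero> \<or> h = \<zero>")
    case True then show ?thesis using qc by (auto simp: dv_def intro!: bexI[of _ \<zero>])
  next
    case False
    obtain k where k: "k \<in> carrier Z" "g \<otimes> h = q \<otimes> k" using less.prems by (auto simp: dv_def)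
    have nz: "k \<noteq> \<zero>" "q \<noteq> \<zero>" using k False cl q by (auto simp: integral_iff irr_def)
    have "lcf j q = q" using q j by (intro lcf_const) (auto simp: sub_def)
    then have "lcf j g \<otimes> lcf j h = q \<otimes> lcf j k"
      using lcf_mult[of j g h] lcf_mult[of j q k] k False cl nz j qc by simp
    then have "dv q (lcf j g \<otimes> lcf j h)" using lcf_closed[OF j(1) k(1)] by (auto simp: dv_def)
    then have "dv q (lcf j g) \<or> dv q (lcf j h)"
      using P q sub_lcf[OF j(1)] less.prems by (auto simp: prime_in_def)
    then show ?thesis
    proof
      assume *: "dv q (lcf j g)"
      show ?thesis
      proof (rule step[OF less.prems *])
        fix g' assume "dg j g' < dg j g" "g' \<in> sub (insert j J)" "dv q (g' \<otimes> h)"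
        then show "dv q g' \<or> dv q h" using less.hyps[of g' h] less.prems by auto
      qed
    next
      assume *: "dv q (lcf j h)"
      have "dv q h \<or> dv q g"
      proof (rule step[OF less.prems(2,1) _ *])
        show "dv q (h \<otimes> g)" using less.prems cl by (simp add: m_comm)
        fix g' assume "dg j g' < dg j h" "g' \<in> sub (insert j J)" "dv q (g' \<otimes> g)"
        then show "dv q g' \<or> dv q g" using less.hyps[of g g'] less.prems cl subD by (auto simp: m_comm)
      qed
      then show ?thesis by auto
    qed
  qed
qed

text \<open>Division with remainder in the variable j without dividing coefficients; c collects the
  powers of the leading coefficient of e that this costs.\<close>

lemma pseudo_division:
  assumes j: "j < N" "j \<notin> J" and e: "e \<in> sub (insert j J)" "0 < dg j e" and u: "u \<in> sub (insert j J)"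
  shows "\<exists>c\<in>sub J. \<exists>w\<in>sub (insert j J). c \<noteq> \<zero> \<and> dg j (c \<otimes> u \<ominus> w \<otimes> e) < dg j e"
  using u
proof (induction "dg j u" arbitrary: u rule: less_induct)
  case less
  have ec: "e \<in> carrier Z" and uc: "u \<in> carrier Z" using e less.prems subD by auto
  have enz: "e \<noteq> \<zero>" using e dg_zero by auto
  show ?case
  proof (cases "dg j u < dg j e")
    case True
    then show ?thesis using uc ec
      by (intro bexI[of _ \<one>] bexI[of _ \<zero>] conjI) (auto simp: minus_eq sub_one sub_zero)
  next
    case False
    define m k where "m = dg j u" and "k = dg j e"
    define y where "y = var j"
    let ?u = "lcf j u" and ?e = "lcf j e"
    have mk: "k \<le> m" "0 < k" using False e by (auto simp: m_def k_def)
    have y: "y \<in> carrier Z" using j var_closed by (simp add: y_def)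
    have cl: "?u \<in> carrier Z" "?e \<in> carrier Z" using lcf_closed j uc ec by auto
    have sl: "?u \<in> sub J" "?e \<in> sub J" using sub_lcf j less.prems e by auto
    have sl': "?u \<in> sub (insert j J)" "?e \<in> sub (insert j J)" using sl sub_mono[of J "insert j J"] by auto
    have sy: "y [^] (m - k) \<in> sub (insert j J)" using sub_var_pow[OF j(1)] by (simp add: y_def)
    define t s where "t = u \<ominus> ?u \<otimes> y [^] m" and "s = e \<ominus> ?e \<otimes> y [^] k"
    have ts: "t \<in> carrier Z" "s \<in> carrier Z" using cl y uc ec by (auto simp: t_def s_def)
    have dt: "dg j t < m" using dg_tail[of j u] mk j uc by (simp add: t_def m_def y_def)
    have ds: "dg j s < k" using dg_tail[of j e] mk j ec by (simp add: s_def k_def y_def)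
    have ue: "u = ?u \<otimes> y [^] m \<oplus> t" and ee: "e = ?e \<otimes> y [^] k \<oplus> s"
      using uc ec cl y by (simp_all add: t_def s_def minus_eq a_lcomm[of "_ \<otimes> _"] r_neg)
    have d0: "dg j ?u = 0" "dg j ?e = 0" using dg_lcf[of j j] j uc ec by auto
    define u' where "u' = ?e \<otimes> u \<ominus> ?u \<otimes> y [^] (m - k) \<otimes> e"
    have us: "u' \<in> sub (insert j J)" unfolding u'_def using sl' sy less.prems e by (intro sub_diff sub_mult)
    have "u' = ?e \<otimes> t \<ominus> ?u \<otimes> y [^] (m - k) \<otimes> s"
    proof -
      have "?e \<otimes> u = ?e \<otimes> (?u \<otimes> y [^] m) \<oplus> ?e \<otimes> t" using ue cl y ts by (metis r_distr m_closed nat_pow_closed)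
      moreover have "?u \<otimes> y [^] (m - k) \<otimes> e = ?u \<otimes> y [^] (m - k) \<otimes> (?e \<otimes> y [^] k) \<oplus> ?u \<otimes> y [^] (m - k) \<otimes> s"
        using ee cl y ts by (metis r_distr m_closed nat_pow_closed)
      moreover have "?u \<otimes> y [^] (m - k) \<otimes> (?e \<otimes> y [^] k) = ?e \<otimes> (?u \<otimes> y [^] m)"
      proof -
        have "y [^] m = y [^] (m - k) \<otimes> y [^] k" using y mk by (simp add: nat_pow_mult)
        then show ?thesis using cl y by (simp add: m_ac)
      qed
      ultimately show ?thesis unfolding u'_def using cl y ts
        by (simp add: minus_eq minus_add a_ac r_neg r_neg1 r_neg2)
    qed
    moreover have "dg j (?e \<otimes> t) < m" using dg_mult_le[of j ?e t] d0 dt j cl ts by auto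
    moreover have "dg j (?u \<otimes> y [^] (m - k) \<otimes> s) < m"
    proof -
      have "dg j (?u \<otimes> y [^] (m - k)) \<le> m - k"
        using dg_mult_le[of j ?u "y [^] (m - k)"] d0 j cl y by (simp add: y_def dg_var_pow)
      then show ?thesis using dg_mult_le[of j "?u \<otimes> y [^] (m - k)" s] ds mk j cl y ts by auto
    qed
    ultimately have "dg j u' < m"
      using dg_diff[of j "?e \<otimes> t" "?u \<otimes> y [^] (m - k) \<otimes> s"] j cl y ts by auto
    then obtain c w where cw: "c \<in> sub J" "w \<in> sub (insert j J)" "c \<noteq> \<zero>" "dg j (c \<otimes> u' \<ominus> w \<otimes> e) < dg j e"
      using less.hyps[of u'] us by (auto simp: m_def)
    have cc: "c \<in> carrier Z" "w \<in> carrier Z" using cw subD by auto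
    have "c \<otimes> u' \<ominus> w \<otimes> e = (c \<otimes> ?e) \<otimes> u \<ominus> (c \<otimes> (?u \<otimes> y [^] (m - k)) \<oplus> w) \<otimes> e"
      unfolding u'_def using cc cl y uc ec
      by (simp add: minus_eq r_distr l_distr r_minus minus_add m_assoc a_assoc)
    moreover have "c \<otimes> ?e \<noteq> \<zero>" using cw cc cl lcf_nonzero[OF j(1) ec enz] by (simp add: integral_iff)
    moreover have "c \<in> sub (insert j J)" using cw sub_mono[of J "insert j J"] by auto
    ultimately show ?thesis using cw sl sl' sy
      by (intro bexI[of _ "c \<otimes> ?e"] bexI[of _ "c \<otimes> (?u \<otimes> y [^] (m - k)) \<oplus> w"] conjI sub_add sub_mult) auto
  qed
qed

text \<open>Irreducible factors of c are removed one at a time; each divides w or e by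
  \<open>coefficient_prime\<close>. Those taken out of e are collected in d, so e loses only factors
  free of the variable j.\<close>

lemma cancel_coefficient:
  assumes P: "prime_in J" and j: "j < N" "j \<notin> J" and c: "c \<in> sub J" "c \<noteq> \<zero>"
    and uwe: "u \<in> sub (insert j J)" "w \<in> sub (insert j J)" "e \<in> sub (insert j J)" "c \<otimes> u = w \<otimes> e"
  shows "\<exists>w1\<in>sub (insert j J). \<exists>e1\<in>sub (insert j J). \<exists>d\<in>sub J. u = w1 \<otimes> e1 \<and> e = d \<otimes> e1"
  using c uwe
proof (induction "td c" arbitrary: c w e rule: less_induct)
  case less
  have cl: "c \<in> carrier Z" "u \<in> carrier Z" "w \<in> carrier Z" "e \<in> carrier Z" using less.prems subD by auto
  show ?case
  proof (cases "td c = 0")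
    case True
    then have c: "c \<in> Units Z" using td_unit cl less.prems by auto
    have "u = inv c \<otimes> (c \<otimes> u)" using c cl by (simp add: m_assoc[symmetric])
    then have "u = (inv c \<otimes> w) \<otimes> e" using less.prems c cl by (simp add: m_assoc)
    moreover have "inv c \<otimes> w \<in> sub (insert j J)"
      using sub_mult[OF sub_unit less.prems(4), of "inv c"] c by simp
    ultimately show ?thesis using less.prems(5) cl sub_one by (metis l_one)
  next
    case False
    then obtain q c' where q: "irr q" "c' \<in> carrier Z" "c = q \<otimes> c'" using exists_irr[of c] cl less.prems by (auto simp: dv_def)
    have qc: "q \<in> carrier Z" "q \<noteq> \<zero>" using q by (auto simp: irr_def)
    have sq: "q \<in> sub J" "c' \<in> sub J" using sub_factor[of q c' J] q qc less.prems by auto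
    have c'nz: "c' \<noteq> \<zero>" using less.prems q qc by auto
    have lt: "td c' < td c" using q td_mult[of q c'] qc c'nz by (auto simp: irr_def)
    have eq: "w \<otimes> e = q \<otimes> (c' \<otimes> u)" using less.prems q cl qc by (simp add: m_assoc[symmetric])
    then have "dv q w \<or> dv q e"
      using less.prems q sq cl by (intro coefficient_prime[OF P j sq(1) q(1)]) (auto simp: dv_def)
    then show ?thesis
    proof
      assume "dv q w"
      then obtain w' where w': "w' \<in> carrier Z" "w = q \<otimes> w'" by (auto simp: dv_def)
      have sw: "w' \<in> sub (insert j J)"
        using sub_factor[of q w' "insert j J"] w' qc less.prems by (cases "w' = \<zero>") (auto simp: sub_zero integral_iff)
      have "q \<otimes> (c' \<otimes> u) = q \<otimes> (w' \<otimes> e)" using eq w' qc cl by (simp add: m_assoc)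
      then have "c' \<otimes> u = w' \<otimes> e" using qc q cl w' by (simp add: m_lcancel)
      then show ?thesis using less.hyps[OF lt sq(2) c'nz less.prems(3) sw less.prems(5)] by blast
    next
      assume "dv q e"
      then obtain e' where e': "e' \<in> carrier Z" "e = q \<otimes> e'" by (auto simp: dv_def)
      have se: "e' \<in> sub (insert j J)"
        using sub_factor[of q e' "insert j J"] e' qc less.prems by (cases "e' = \<zero>") (auto simp: sub_zero integral_iff)
      have "q \<otimes> (c' \<otimes> u) = q \<otimes> (w \<otimes> e')" using eq e' qc cl by (simp add: m_lcomm)
      then have "c' \<otimes> u = w \<otimes> e'" using qc q cl e' by (simp add: m_lcancel)
      then obtain w1 e1 d where 1: "w1 \<in> sub (insert j J)" "e1 \<in> sub (insert j J)" "d \<in> sub J" "u = w1 \<otimes> e1" "e' = d \<otimes> e1"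
        using less.hyps[OF lt sq(2) c'nz less.prems(3,4) se] by blast
      then have "e = (q \<otimes> d) \<otimes> e1" using e' qc subD by (simp add: m_assoc)
      then show ?thesis using 1 sub_mult[OF sq(1) 1(3)] by blast
    qed
  qed
qed

lemma unit_dg_td: "a \<in> carrier Z \<Longrightarrow> a \<noteq> \<zero> \<Longrightarrow> td a = 0 \<Longrightarrow> j < N \<Longrightarrow> dg j a = 0"
  using td_unit unit_dg by blast

lemma cancel_irr:
  assumes P: "prime_in J" and j: "j < N" "j \<notin> J" and c: "c \<in> sub J" "c \<noteq> \<zero>"
    and f: "f \<in> sub (insert j J)" "irr f" "0 < dg j f"
    and g: "g \<in> sub (insert j J)" "w \<in> sub (insert j J)" "c \<otimes> g = w \<otimes> f"
  shows "dv f g"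
proof -
  obtain w1 e1 d where 1: "w1 \<in> sub (insert j J)" "e1 \<in> sub (insert j J)" "d \<in> sub J" "g = w1 \<otimes> e1" "f = d \<otimes> e1"
    using cancel_coefficient[OF P j c g(1,2) f(1) g(3)] by blast
  have cl: "w1 \<in> carrier Z" "e1 \<in> carrier Z" "d \<in> carrier Z" using 1 subD by auto
  have nz: "e1 \<noteq> \<zero>" "d \<noteq> \<zero>" using f(2) 1(5) cl by (auto simp: irr_def)
  have "td e1 \<noteq> 0"
  proof
    assume "td e1 = 0"
    then have "dg j f = 0" using 1 nz cl j unit_dg_td[of e1 j] by (simp add: dg_mult subD(2)[OF 1(3)])
    then show False using f by simp
  qed
  then have "td d = 0" using irr_factors[OF f(2) 1(5)] cl by simp
  then have d: "d \<in> Units Z" using td_unit cl nz by auto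
  have "g = f \<otimes> (inv d \<otimes> w1)"
  proof -
    have "f \<otimes> (inv d \<otimes> w1) = (d \<otimes> inv d) \<otimes> (w1 \<otimes> e1)"
      unfolding 1(5) using Units_inv_closed[OF d] cl by algebra
    then show ?thesis using d cl 1(4) by simp
  qed
  then show ?thesis using d cl by (auto simp: dv_def)
qed

text \<open>Take e of least degree in j in the ideal of f and g. If that degree were positive, e
  would divide f and g up to factors free of j; irreducibility identifies the essential part e1 of e
  with f up to a unit, and then f divides g.\<close>

lemma elimination_in:
  assumes P: "prime_in J" and j: "j < N" "j \<notin> J"
    and f: "f \<in> sub (insert j J)" "irr f" "0 < dg j f" and g: "g \<in> sub (insert j J)" "\<not> dv f g"
  shows "\<exists>a\<in>sub (insert j J). \<exists>b\<in>sub (insert j J). a \<otimes> f \<oplus> b \<otimes> g \<noteq> \<zero> \<and> dg j (a \<otimes> f \<oplus> b \<otimes> g) = 0"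
proof -
  let ?S = "sub (insert j J)"
  define I where "I = {a \<otimes> f \<oplus> b \<otimes> g | a b. a \<in> ?S \<and> b \<in> ?S}"
  have fc: "f \<in> carrier Z" "f \<noteq> \<zero>" and gc: "g \<in> carrier Z" using f g by (auto simp: irr_def sub_def)
  have IS: "I \<subseteq> ?S" using f g by (auto simp: I_def intro!: sub_add sub_mult)
  have "f = \<one> \<otimes> f \<oplus> \<zero> \<otimes> g" using fc gc by simp
  then have fI: "f \<in> I" unfolding I_def using sub_one sub_zero by blast
  have "g = \<zero> \<otimes> f \<oplus> \<one> \<otimes> g" using fc gc by simp
  then have gI: "g \<in> I" unfolding I_def using sub_one sub_zero by blast
  have comb: "c \<otimes> x \<ominus> w \<otimes> y \<in> I" if xy: "x \<in> I" "y \<in> I" and cw: "c \<in> ?S" "w \<in> ?S" for x y c w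
  proof -
    obtain a b a' b' where ab: "x = a \<otimes> f \<oplus> b \<otimes> g" "y = a' \<otimes> f \<oplus> b' \<otimes> g" "a \<in> ?S" "b \<in> ?S" "a' \<in> ?S" "b' \<in> ?S"
      using xy unfolding I_def by blast
    have cl: "a \<in> carrier Z" "b \<in> carrier Z" "a' \<in> carrier Z" "b' \<in> carrier Z" "c \<in> carrier Z" "w \<in> carrier Z"
      using ab cw subD by auto
    have "c \<otimes> x \<ominus> w \<otimes> y = (c \<otimes> a \<ominus> w \<otimes> a') \<otimes> f \<oplus> (c \<otimes> b \<ominus> w \<otimes> b') \<otimes> g"
      unfolding ab using cl fc gc by (simp add: minus_eq l_distr r_distr l_minus minus_add m_assoc a_ac)
    then show ?thesis unfolding I_def using ab cw by (blast intro: sub_diff sub_mult)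
  qed
  define m where "m = (LEAST m. \<exists>e\<in>I. e \<noteq> \<zero> \<and> dg j e = m)"
  have "\<exists>e\<in>I. e \<noteq> \<zero> \<and> dg j e = m"
    unfolding m_def by (rule LeastI[of _ "dg j f"]) (use fI fc in auto)
  then obtain e where e: "e \<in> I" "e \<noteq> \<zero>" "dg j e = m" by auto
  have min: "m \<le> dg j x" if "x \<in> I" "x \<noteq> \<zero>" for x unfolding m_def using that by (auto intro: Least_le)
  show ?thesis
  proof (cases "m = 0")
    case True then show ?thesis using e by (auto simp: I_def)
  next
    case False
    have eS: "e \<in> ?S" "0 < dg j e" using e IS False by auto
    have ec: "e \<in> carrier Z" using eS subD by auto
    have div: "\<exists>c\<in>sub J. \<exists>w\<in>?S. c \<noteq> \<zero> \<and> c \<otimes> x = w \<otimes> e" if xI: "x \<in> I" for x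
    proof -
      obtain c w where cw: "c \<in> sub J" "w \<in> ?S" "c \<noteq> \<zero>" "dg j (c \<otimes> x \<ominus> w \<otimes> e) < dg j e"
        using pseudo_division[OF j eS, of x] xI IS by blast
      have "c \<in> ?S" using cw sub_mono[of J "insert j J"] by auto
      then have "c \<otimes> x \<ominus> w \<otimes> e = \<zero>" using comb[OF that e(1) _ cw(2)] min[of "c \<otimes> x \<ominus> w \<otimes> e"] cw e by fastforce
      moreover have "c \<otimes> x \<in> carrier Z" "w \<otimes> e \<in> carrier Z" using cw that IS subD ec by auto
      ultimately show ?thesis using cw by (metis r_right_minus_eq)
    qed
    obtain c w where cw: "c \<in> sub J" "w \<in> ?S" "c \<noteq> \<zero>" "c \<otimes> f = w \<otimes> e" using div[OF fI] by blast
    obtain c' w' where cw': "c' \<in> sub J" "w' \<in> ?S" "c' \<noteq> \<zero>" "c' \<otimes> g = w' \<otimes> e" using div[OF gI] by blast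
    obtain w1 e1 d where 1: "w1 \<in> ?S" "e1 \<in> ?S" "d \<in> sub J" "f = w1 \<otimes> e1" "e = d \<otimes> e1"
      using cancel_coefficient[OF P j cw(1,3) f(1) cw(2) eS(1) cw(4)] by blast
    have cl: "w1 \<in> carrier Z" "e1 \<in> carrier Z" "d \<in> carrier Z" "w' \<in> carrier Z" using 1 cw' subD by auto
    have nz: "w1 \<noteq> \<zero>" "e1 \<noteq> \<zero>" "d \<noteq> \<zero>" using fc(2) 1(4,5) e(2) cl by auto
    have "td e1 \<noteq> 0"
    proof
      assume "td e1 = 0"
      then have "dg j e = 0" using 1 nz cl j unit_dg_td[of e1 j] by (simp add: dg_mult subD(2)[OF 1(3)])
      then show False using eS by simp
    qed
    then have "td w1 = 0" using irr_factors[OF f(2) 1(4)] cl by simp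
    then have u: "w1 \<in> Units Z" using td_unit cl nz by auto
    have "e1 = inv w1 \<otimes> f" using u cl 1(4) by (simp add: m_assoc[symmetric])
    then have "c' \<otimes> g = (w' \<otimes> d \<otimes> inv w1) \<otimes> f" using cw'(4) 1(5) cl u fc by (simp add: m_assoc)
    moreover have "w' \<otimes> d \<otimes> inv w1 \<in> ?S"
      using cw'(2) 1(3) sub_mono[of J "insert j J"] sub_unit[OF Units_inv_Units[OF u]] by (blast intro: sub_mult)
    ultimately have "dv f g" using cancel_irr[OF P j cw'(1,3) f g(1)] by blast
    then show ?thesis using g by simp
  qed
qed

text \<open>If f has positive degree in j and does not divide g, elimination puts a nonzero element
  free of j into the ideal of f and g. Its product with h is a multiple of f, and
  \<open>cancel_irr\<close> removes it.\<close>

lemma prime_in_insert: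
  assumes P: "prime_in J" and j: "j < N" "j \<notin> J"
  shows "prime_in (insert j J)"
  unfolding prime_in_def
proof (intro ballI impI)
  let ?S = "sub (insert j J)"
  fix f g h assume f: "f \<in> ?S" "irr f" and gh: "g \<in> ?S" "h \<in> ?S" "dv f (g \<otimes> h)"
  show "dv f g \<or> dv f h"
  proof (cases "dg j f = 0")
    case True
    then have "f \<in> sub J" using f by (auto simp: sub_def)
    then show ?thesis using coefficient_prime[OF P j _ f(2) gh] by auto
  next
    case False
    show ?thesis
    proof (cases "dv f g")
      case nd: False
      obtain a b where ab: "a \<in> ?S" "b \<in> ?S" "a \<otimes> f \<oplus> b \<otimes> g \<noteq> \<zero>" "dg j (a \<otimes> f \<oplus> b \<otimes> g) = 0"
        using elimination_in[OF P j f _ gh(1) nd] False by auto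
      let ?e = "a \<otimes> f \<oplus> b \<otimes> g"
      have cl: "a \<in> carrier Z" "b \<in> carrier Z" "f \<in> carrier Z" "g \<in> carrier Z" "h \<in> carrier Z"
        using ab f gh subD by auto
      have "?e \<in> ?S" using ab f gh by (intro sub_add sub_mult)
      then have e: "?e \<in> sub J" using ab(4) by (auto simp: sub_def)
      obtain k where k: "k \<in> carrier Z" "g \<otimes> h = f \<otimes> k" using gh by (auto simp: dv_def)
      have fnz: "f \<noteq> \<zero>" using f by (auto simp: irr_def)
      have ks: "k \<in> ?S"
      proof (cases "k = \<zero>")
        case True then show ?thesis by (simp add: sub_zero)
      next
        case F: False
        then show ?thesis using sub_factor[of f k "insert j J"] k cl fnz sub_mult[OF gh(1,2)] by (auto simp: integral_iff)
      qed
      have "?e \<otimes> h = a \<otimes> f \<otimes> h \<oplus> b \<otimes> (g \<otimes> h)" using cl by (simp add: l_distr m_assoc)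
      also have "\<dots> = (a \<otimes> h \<oplus> b \<otimes> k) \<otimes> f" unfolding k(2) using cl k(1) using ab by algebra
      finally have "?e \<otimes> h = (a \<otimes> h \<oplus> b \<otimes> k) \<otimes> f" .
      moreover have "a \<otimes> h \<oplus> b \<otimes> k \<in> ?S" using ab gh ks by (intro sub_add sub_mult)
      ultimately have "dv f h" using cancel_irr[OF P j e ab(3) f _ gh(2)] False by auto
      then show ?thesis by simp
    qed simp
  qed
qed

lemma prime_in_all: "finite J \<Longrightarrow> J \<subseteq> {..<N} \<Longrightarrow> prime_in J"
proof (induction J rule: finite_induct)
  case empty
  \<comment> \<open>Without variables every nonzero element has degree 0, so there are no
    irreducibles and the base case is vacuous.\<close>
  have "\<not> irr f" if "f \<in> sub {}" for f
    using that dg_td[of f] by (auto simp: sub_def irr_def)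
  then show ?case by (auto simp: prime_in_def)
next
  case (insert j J)
  then show ?case by (intro prime_in_insert) auto
qed

lemma sub_all: "sub {..<N} = carrier Z"
  by (auto simp: sub_def)

theorem irr_prime:
  assumes "irr f" "g \<in> carrier Z" "h \<in> carrier Z" "dv f (g \<otimes> h)"
  shows "dv f g \<or> dv f h"
  using prime_in_all[of "{..<N}"] assms unfolding prime_in_def sub_all by (auto simp: irr_def)

theorem elimination:
  assumes "irr f" "j < N" "0 < dg j f" "g \<in> carrier Z" "\<not> dv f g"
  shows "\<exists>a\<in>carrier Z. \<exists>b\<in>carrier Z. a \<otimes> f \<oplus> b \<otimes> g \<noteq> \<zero> \<and> dg j (a \<otimes> f \<oplus> b \<otimes> g) = 0"
proof -
  have eq: "insert j ({..<N} - {j}) = {..<N}" using assms by auto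
  show ?thesis
    using elimination_in[of "{..<N} - {j}" j f g, unfolded eq sub_all] assms prime_in_all[of "{..<N} - {j}"]
    by (auto simp: irr_def)
qed

end

section \<open>The Weyl algebra in characteristic \<open>p\<close>\<close>

context weyl
begin

lemma nc_add: "nc (a + b) = nc a \<oplus> nc b"
  by (simp add: nc_def add.nat_pow_mult)

lemma nc_mult: "nc (a * b) = nc a \<otimes> nc b"
proof (induction b)
  case (Suc b)
  have "nc (a * Suc b) = nc (a * b + a)" by (simp add: algebra_simps)
  then show ?case using Suc by (simp add: nc_add nc_Suc r_distr)
qed simp

lemma nc_one: "nc (Suc 0) = \<one>"
  by (simp add: nc_Suc)

text \<open>The inserted 0 gives the zero element degree 0, the value that
  \<open>poly_domain\<close> expects.\<close>

definition mx :: "nat \<Rightarrow> ((nat \<Rightarrow> nat) \<Rightarrow> 'a) \<Rightarrow> nat" where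
  "mx j v = Max (insert 0 ((\<lambda>e. e j) ` {e. v e \<noteq> \<zero>}))"

lemma mx_ge: "v \<in> carrier W \<Longrightarrow> v e \<noteq> \<zero> \<Longrightarrow> e j \<le> mx j v"
  unfolding mx_def by (rule Max_ge) (auto simp: W_carrier fin_suppD)

lemma mx_le: "v \<in> carrier W \<Longrightarrow> (\<And>e. v e \<noteq> \<zero> \<Longrightarrow> e j \<le> d) \<Longrightarrow> mx j v \<le> d"
  unfolding mx_def by (subst Max_le_iff) (auto simp: W_carrier fin_suppD)

lemma mx_zero [simp]: "mx j \<zero>\<^bsub>W\<^esub> = 0"
  by (simp add: mx_def W_zero)

lemma mx_attained: "v \<in> carrier W \<Longrightarrow> 0 < mx j v \<Longrightarrow> \<exists>e. v e \<noteq> \<zero> \<and> e j = mx j v"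
proof -
  assume v: "v \<in> carrier W" and m: "0 < mx j v"
  have "mx j v \<in> insert 0 ((\<lambda>e. e j) ` {e. v e \<noteq> \<zero>})"
    unfolding mx_def using v by (intro Max_in) (auto simp: W_carrier fin_suppD)
  then show ?thesis using m by auto
qed

lemma mx_add: "v \<in> carrier W \<Longrightarrow> w \<in> carrier W \<Longrightarrow> mx j (v \<oplus>\<^bsub>W\<^esub> w) \<le> max (mx j v) (mx j w)"
proof (rule mx_le)
  fix e assume v: "v \<in> carrier W" "w \<in> carrier W" "(v \<oplus>\<^bsub>W\<^esub> w) e \<noteq> \<zero>"
  then have "v e \<noteq> \<zero> \<or> w e \<noteq> \<zero>" by (auto simp: W_add)
  then show "e j \<le> max (mx j v) (mx j w)" using mx_ge v by (metis max.coboundedI1 max.coboundedI2)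
qed auto

lemma lmul_bound:
  assumes "v \<in> carrier W" "i < 2 * n" "\<And>e. v e \<noteq> \<zero> \<Longrightarrow> e j \<le> d" "lmul i v e \<noteq> \<zero>"
  shows "e j \<le> d + (if i = j then 1 else 0)"
proof (cases "shift i v e \<noteq> \<zero>")
  case True
  then have "e i \<noteq> 0" "v (e(i := e i - 1)) \<noteq> \<zero>" by (auto simp: shift_def split: if_splits)
  then have "(e(i := e i - 1)) j \<le> d" using assms(3) by blast
  then show ?thesis by (auto split: if_splits)
next
  case False
  then have "pd (i - n) v e \<noteq> \<zero>" using assms by (auto simp: lmul_def split: if_splits)
  then have "v (e(i - n := Suc (e (i - n)))) \<noteq> \<zero>" using assms(1) by (auto simp: pd_def)
  then have "(e(i - n := Suc (e (i - n)))) j \<le> d" using assms(3) by blast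
  then show ?thesis by (auto split: if_splits)
qed

lemma single_mult_bound:
  assumes w: "w \<in> carrier W" "\<And>e. w e \<noteq> \<zero> \<Longrightarrow> e j \<le> d" and b: "b \<in> exps" and a: "a \<in> carrier R"
    and e: "(single a b \<star> w) e \<noteq> \<zero>"
  shows "e j \<le> b j + d"
proof -
  have *: "e j \<le> b j + d" if "(single \<one> b \<star> w) e \<noteq> \<zero>" for e
    using b that
  proof (induction "\<Sum>i<2 * n. b i" arbitrary: b e rule: less_induct)
    case less
    show ?case
    proof (cases "b = (\<lambda>_. 0)")
      case True then show ?thesis using less.prems w by (simp add: W_one[symmetric])
    next
      case False
      then obtain i e' where e': "i < 2 * n" "e' \<in> exps" "b = e'(i := Suc (e' i))" "(\<Sum>i<2 * n. e' i) < (\<Sum>i<2 * n. b i)"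
        "lmul i (single \<one> e') = single \<one> b"
        using single_lmul[OF less.prems(1)] by metis
      have s: "single \<one> e' \<in> carrier W" using e' by (simp add: W_carrier single_closed)
      have "single \<one> b = gen i \<star> single \<one> e'" using e' s by (simp add: gen_mult)
      then have "single \<one> b \<star> w = gen i \<star> (single \<one> e' \<star> w)"
        using e'(1) s w by (simp only: W.m_assoc gen_closed)
      then have "single \<one> b \<star> w = lmul i (single \<one> e' \<star> w)"
        using e'(1) s w by (simp only: gen_mult W.m_closed)
      then have "e j \<le> e' j + d + (if i = j then 1 else 0)"
        using less.prems(2) less.hyps[OF e'(4,2)] s w e'(1) lmul_bound[of "single \<one> e' \<star> w" i j "e' j + d" e] by simp
      then show ?thesis using e'(3) by auto
    qed
  qed
  have s: "single \<one> b \<in> carrier W" using b by (simp add: W_carrier single_closed)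
  have "single a b \<star> w = sc a \<star> (single \<one> b \<star> w)"
    unfolding single_sc[OF a b] using s a w by (simp add: W.m_assoc)
  then have "a \<otimes> (single \<one> b \<star> w) e \<noteq> \<zero>" using e s a w by (simp add: sc_mult)
  then have "(single \<one> b \<star> w) e \<noteq> \<zero>" using a by auto
  then show ?thesis by (rule *)
qed

text \<open>The corrections of normal ordering only lower exponents, so the degree in each single
  letter is subadditive over any coefficient ring.\<close>

lemma mx_mult_le:
  assumes v: "v \<in> carrier W" and w: "w \<in> carrier W"
  shows "mx j (v \<star> w) \<le> mx j v + mx j w"
proof -
  have "e j \<le> d + mx j w" if "\<And>e. v e \<noteq> \<zero> \<Longrightarrow> e j \<le> d" "(v \<star> w) e \<noteq> \<zero>" for d e
    using v[unfolded W_carrier] that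
  proof (induction arbitrary: e rule: fin_supp_insert_induct)
    case zero
    have "(\<lambda>x. \<zero>) \<star> w = (\<lambda>x. \<zero>)" using W.l_null[OF w] by (simp add: W_zero)
    then show ?case using zero by simp
  next
    case (insert f a x)
    let ?s = "single a x"
    have f: "f \<in> carrier W" and s: "?s \<in> carrier W" using insert by (auto simp: W_carrier single_closed)
    have vw: "(\<lambda>y. f y \<oplus> ?s y) \<star> w = (\<lambda>e. (f \<star> w) e \<oplus> (?s \<star> w) e)"
      using W.l_distr[OF f s w] by (simp add: W_add)
    have bf: "e j \<le> d" if "f e \<noteq> \<zero>" for e
    proof -
      have "e \<noteq> x" using insert that by auto
      then have "f e \<oplus> ?s e \<noteq> \<zero>" using f that by (auto simp: single_def)
      then show ?thesis using insert.prems by auto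
    qed
    have "f x \<oplus> ?s x \<noteq> \<zero>" using insert by (auto simp: single_def)
    then have xd: "x j \<le> d" using insert.prems by auto
    show ?case
    proof (cases "(f \<star> w) e = \<zero>")
      case False then show ?thesis using insert.IH bf by blast
    next
      case True
      then have "(?s \<star> w) e \<noteq> \<zero>" using insert.prems(2) unfolding vw by auto
      then have "e j \<le> x j + mx j w" using single_mult_bound[of w j "mx j w" x a e] w mx_ge[OF w] insert(4,2) by blast
      then show ?thesis using xd by simp
    qed
  qed
  then show ?thesis using v w mx_ge[OF v] by (intro mx_le) auto
qed

lemma shift_funpow: "(shift j ^^ k) v = (\<lambda>e. if e j < k then \<zero> else v (e(j := e j - k)))"
proof (induction k)
  case (Suc k)
  show ?case
  proof
    fix e
    have "(shift j ^^ Suc k) v e = (if e j = 0 then \<zero> else (shift j ^^ k) v (e(j := e j - 1)))"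
      by (simp add: shift_def[of j "(shift j ^^ k) v" e])
    then show "(shift j ^^ Suc k) v e = (if e j < Suc k then \<zero> else v (e(j := e j - Suc k)))"
      by (auto simp: Suc)
  qed
qed auto

end

locale weyl_charp = weyl R n + field R for R (structure) and n +
  fixes p :: nat
  assumes prime_p: "Factorial_Ring.prime p" and char_p: "nc p = \<zero>" and fin_R: "finite (carrier R)"

sublocale weyl_charp \<subseteq> weyl_domain ..

context weyl_charp
begin

lemma p_pos: "0 < p" and p_gt1: "1 < p"
  using prime_p prime_gt_1_nat[of p] by auto

text \<open>If p does not divide k, Bezout makes k invertible modulo p, and \<open>nc k = 0\<close>
  would force 1 = 0.\<close>

lemma nc_eq_zero_iff: "nc k = \<zero> \<longleftrightarrow> p dvd k"
proof
  assume "p dvd k"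
  then show "nc k = \<zero>" by (auto simp: dvd_def nc_mult char_p)
next
  assume k: "nc k = \<zero>"
  show "p dvd k"
  proof (rule ccontr)
    assume nd: "\<not> p dvd k"
    then have "coprime k p" using prime_imp_coprime[OF prime_p nd] by (simp add: coprime_commute)
    moreover have "k \<noteq> 0" using nd by (metis dvd_0_right)
    ultimately obtain x y where "k * x = p * y + 1" using bezout_nat[of k p] by auto
    then have "nc (k * x) = nc (p * y + 1)" by simp
    then have "\<zero> = \<one>" using k char_p by (simp add: nc_mult nc_Suc)
    then show False by simp
  qed
qed

text \<open>Described by supports, the form suited to its polynomial structure; that it is the
  centre is \<open>Zc_central\<close>.\<close>

definition Zc :: "((nat \<Rightarrow> nat) \<Rightarrow> 'a) set" where
  "Zc = {v \<in> carrier W. \<forall>e. v e \<noteq> \<zero> \<longrightarrow> (\<forall>j. p dvd e j)}"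

lemma Zc_W [simp]: "z \<in> Zc \<Longrightarrow> z \<in> carrier W"
  by (simp add: Zc_def)

lemma Zc_iff_pd: "v \<in> carrier W \<Longrightarrow> v \<in> Zc \<longleftrightarrow> (\<forall>j<2 * n. pd j v = \<zero>\<^bsub>W\<^esub>)"
proof
  assume v: "v \<in> carrier W" and z: "v \<in> Zc"
  show "\<forall>j<2 * n. pd j v = \<zero>\<^bsub>W\<^esub>"
  proof (intro allI impI)
    fix j
    show "pd j v = \<zero>\<^bsub>W\<^esub>"
      unfolding W_zero
    proof
      fix e
      show "pd j v e = \<zero>"
      proof (cases "v (e(j := Suc (e j))) = \<zero>")
        case False
        then have "\<forall>i. p dvd (e(j := Suc (e j))) i" using z unfolding Zc_def by blast
        then have "p dvd Suc (e j)" by (auto dest: spec[of _ j])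
        then show ?thesis using v by (simp add: pd_def nc_eq_zero_iff[symmetric])
      qed (simp add: pd_def)
    qed
  qed
next
  assume v: "v \<in> carrier W" and z: "\<forall>j<2 * n. pd j v = \<zero>\<^bsub>W\<^esub>"
  have "p dvd e j" if e: "v e \<noteq> \<zero>" for e j
  proof (cases "e j = 0")
    case False
    have "e \<in> exps" using v e by (auto simp: W_carrier fin_suppD)
    then have j: "j < 2 * n" using False by (auto simp: exps_def intro: leI)
    \<comment> \<open>Read at the exponent lowered by one, the derivative is e_j times the
      coefficient at e, so it vanishes only if p divides e_j.\<close>
    have "pd j v (e(j := e j - 1)) = \<zero>" using z j by (simp add: W_zero)
    then have "nc (Suc ((e(j := e j - 1)) j)) \<otimes> v ((e(j := e j - 1))(j := Suc ((e(j := e j - 1)) j))) = \<zero>"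
      by (simp only: pd_def)
    moreover have "Suc ((e(j := e j - 1)) j) = e j" "(e(j := e j - 1))(j := e j) = e" using False by auto
    ultimately have "nc (e j) \<otimes> v e = \<zero>" by (simp only:)
    then show ?thesis using e v by (simp add: integral_iff nc_eq_zero_iff)
  qed simp
  then show "v \<in> Zc" using v unfolding Zc_def by blast
qed

lemma Zc_central: "v \<in> carrier W \<Longrightarrow> v \<in> Zc \<longleftrightarrow> (\<forall>w\<in>carrier W. v \<star> w = w \<star> v)"
  using Zc_iff_pd central_iff_pd by simp

lemma Zc_comm: "z \<in> Zc \<Longrightarrow> w \<in> carrier W \<Longrightarrow> z \<star> w = w \<star> z"
  using Zc_central[OF Zc_W] by blast

lemma Zc_sc: "a \<in> carrier R \<Longrightarrow> sc a \<in> Zc"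
  using Zc_central[of "sc a"] by (simp add: sc_comm)

lemma Zc_subring: "subring Zc W"
proof (rule W.subringI)
  show "Zc \<subseteq> carrier W" by auto
  show "\<one>\<^bsub>W\<^esub> \<in> Zc" using Zc_sc[of \<one>] by simp
  show "\<ominus>\<^bsub>W\<^esub> h \<in> Zc" if h: "h \<in> Zc" for h
  proof (subst Zc_central)
    show "\<forall>w\<in>carrier W. \<ominus>\<^bsub>W\<^esub> h \<star> w = w \<star> \<ominus>\<^bsub>W\<^esub> h"
      using h by (simp add: W.l_minus W.r_minus Zc_comm[OF h])
  qed (use h in auto)
  show "h1 \<oplus>\<^bsub>W\<^esub> h2 \<in> Zc" if h: "h1 \<in> Zc" "h2 \<in> Zc" for h1 h2
  proof (subst Zc_central)
    show "\<forall>w\<in>carrier W. (h1 \<oplus>\<^bsub>W\<^esub> h2) \<star> w = w \<star> (h1 \<oplus>\<^bsub>W\<^esub> h2)"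
      using h by (simp add: W.l_distr W.r_distr Zc_comm[OF h(1)] Zc_comm[OF h(2)])
  qed (use h in auto)
  fix h1 h2 assume h: "h1 \<in> Zc" "h2 \<in> Zc"
  show "h1 \<star> h2 \<in> Zc"
  proof (subst Zc_central)
    show "\<forall>w\<in>carrier W. h1 \<star> h2 \<star> w = w \<star> (h1 \<star> h2)"
    proof
      fix w assume w: "w \<in> carrier W"
      have "h1 \<star> h2 \<star> w = h1 \<star> (w \<star> h2)" using h w by (simp add: W.m_assoc Zc_comm[of h2 w])
      then show "h1 \<star> h2 \<star> w = w \<star> (h1 \<star> h2)"
        using h w by (simp add: W.m_assoc[symmetric] Zc_comm[of h1 w])
    qed
  qed (use h in auto)
qed

lemmas Zc_closed = subringE[OF Zc_subring]

section \<open>The centre as a polynomial ring\<close>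

abbreviation Zr :: "((nat \<Rightarrow> nat) \<Rightarrow> 'a) ring" where
  "Zr \<equiv> W\<lparr>carrier := Zc\<rparr>"

lemma Zr_domain: "domain Zr"
proof (rule W.subdomain_is_domain)
  show "subdomain Zc W"
    by (intro W.subdomainI W.subcringI[OF Zc_subring] W_one_not_zero) (auto simp: Zc_comm W_integral)
qed

definition y :: "nat \<Rightarrow> (nat \<Rightarrow> nat) \<Rightarrow> 'a" where
  "y j = single \<one> ((\<lambda>_. 0)(j := p))"

lemma y_Zc [simp]: "j < 2 * n \<Longrightarrow> y j \<in> Zc"
  by (auto simp: Zc_def y_def W_carrier single_closed) (auto simp: single_def split: if_splits)

lemma gen_pow: "j < 2 * n \<Longrightarrow> gen j [^]\<^bsub>W\<^esub> k = single \<one> ((\<lambda>_. 0)(j := k))"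
proof (induction k)
  case 0
  have "(\<lambda>_. 0)(j := 0) = (\<lambda>_. 0::nat)" by auto
  then show ?case by (simp add: W_one)
next
  case (Suc k)
  have s: "single \<one> ((\<lambda>_. 0)(j := k)) \<in> carrier W" using Suc by (simp add: W_carrier single_closed)
  show ?case using Suc.prems
  proof (cases rule: index_cases)
    case x
    have "gen j [^]\<^bsub>W\<^esub> Suc k = gen j \<star> gen j [^]\<^bsub>W\<^esub> k" using x by (intro W.nat_pow_Suc2) auto
    also have "\<dots> = shift j (single \<one> ((\<lambda>_. 0)(j := k)))" using Suc x s by (simp only: gen_mult_x)
    finally show ?thesis by (simp only: shift_single fun_upd_same fun_upd_upd)
  next
    case (d l)
    then have "gen j [^]\<^bsub>W\<^esub> Suc k = single \<one> ((\<lambda>_. 0)(j := k)) \<star> gen (n + l)"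
      using Suc by (simp only: W.nat_pow_Suc)
    also have "\<dots> = shift j (single \<one> ((\<lambda>_. 0)(j := k)))" using d s by (simp only: mult_gen_d)
    finally show ?thesis by (simp only: shift_single fun_upd_same fun_upd_upd)
  qed
qed

lemma shift_pow_closed: "j < 2 * n \<Longrightarrow> v \<in> carrier W \<Longrightarrow> (shift j ^^ k) v \<in> carrier W"
  by (induction k) auto

lemma gen_pow_x: "l < n \<Longrightarrow> v \<in> carrier W \<Longrightarrow> gen l [^]\<^bsub>W\<^esub> k \<star> v = (shift l ^^ k) v"
proof (induction k)
  case (Suc k)
  have "gen l [^]\<^bsub>W\<^esub> Suc k \<star> v = gen l \<star> (gen l [^]\<^bsub>W\<^esub> k \<star> v)"
    using Suc.prems by (subst W.nat_pow_Suc2) (auto simp: W.m_assoc)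
  also have "\<dots> = shift l ((shift l ^^ k) v)" using Suc shift_pow_closed[of l v k] by (simp add: gen_mult_x)
  finally show ?case by simp
qed simp

lemma gen_pow_d: "l < n \<Longrightarrow> v \<in> carrier W \<Longrightarrow> v \<star> gen (n + l) [^]\<^bsub>W\<^esub> k = (shift (n + l) ^^ k) v"
proof (induction k)
  case (Suc k)
  have "v \<star> gen (n + l) [^]\<^bsub>W\<^esub> Suc k = (v \<star> gen (n + l) [^]\<^bsub>W\<^esub> k) \<star> gen (n + l)"
    using Suc.prems by (simp add: W.m_assoc)
  also have "\<dots> = shift (n + l) ((shift (n + l) ^^ k) v)" using Suc shift_pow_closed[of "n + l" v k] by (simp add: mult_gen_d)
  finally show ?case by simp
qed simp

lemma y_gen: "j < 2 * n \<Longrightarrow> y j = gen j [^]\<^bsub>W\<^esub> p"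
  by (simp add: gen_pow y_def)

lemma y_pow_mult:
  assumes "j < 2 * n" "v \<in> carrier W"
  shows "y j [^]\<^bsub>W\<^esub> k \<star> v = (\<lambda>e. if e j < p * k then \<zero> else v (e(j := e j - p * k)))"
  using assms(1)
proof (cases rule: index_cases)
  case x
  then show ?thesis using assms gen_pow_x[of j v "p * k"]
    by (simp add: y_gen W.nat_pow_pow shift_funpow)
next
  case (d l)
  have "y j [^]\<^bsub>W\<^esub> k \<in> Zc" by (induction k) (use assms Zc_closed(3) in \<open>auto intro: Zc_closed(6)\<close>)
  then have "y j [^]\<^bsub>W\<^esub> k \<star> v = v \<star> y j [^]\<^bsub>W\<^esub> k" using assms by (simp add: Zc_comm)
  then show ?thesis unfolding d(1) using d assms gen_pow_d[of l v "p * k"]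
    by (simp add: y_gen W.nat_pow_pow shift_funpow)
qed

lemma y_mult:
  assumes "j < 2 * n" "v \<in> carrier W"
  shows "y j \<star> v = (\<lambda>e. if e j < p then \<zero> else v (e(j := e j - p)))"
  using y_pow_mult[OF assms, of "Suc 0"] assms by (simp cong: if_cong)

definition dg :: "nat \<Rightarrow> ((nat \<Rightarrow> nat) \<Rightarrow> 'a) \<Rightarrow> nat" where
  "dg j v = mx j v div p"

lemma mx_dg:
  assumes v: "v \<in> Zc"
  shows "mx j v = p * dg j v"
proof -
  have "p dvd mx j v"
  proof (cases "0 < mx j v")
    case True
    obtain e where e: "v e \<noteq> \<zero>" "e j = mx j v" using mx_attained[OF Zc_W[OF v] True] by blast
    then have "p dvd e j" using v unfolding Zc_def by blast
    then show ?thesis using e by simp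
  qed simp
  then show ?thesis by (simp add: dg_def)
qed

text \<open>The slice of v at its top exponent in the letter j, moved down to exponent 0. On the
  centre this top exponent is \<open>p * dg j v\<close>, matching the power of \<open>y j\<close>
  split off in \<open>lcf_tail\<close>.\<close>

definition lcf :: "nat \<Rightarrow> ((nat \<Rightarrow> nat) \<Rightarrow> 'a) \<Rightarrow> (nat \<Rightarrow> nat) \<Rightarrow> 'a" where
  "lcf j v = (\<lambda>e. if e j = 0 then v (e(j := p * dg j v)) else \<zero>)"

lemma lcf_Zc: "v \<in> Zc \<Longrightarrow> j < 2 * n \<Longrightarrow> lcf j v \<in> Zc"
proof -
  assume v: "v \<in> Zc" and j: "j < 2 * n"
  have V: "v \<in> WF" using v by (simp add: W_carrier[symmetric])
  note D = fin_suppD[OF V]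
  have nz: "e j = 0 \<and> v (e(j := p * dg j v)) \<noteq> \<zero>" if "lcf j v e \<noteq> \<zero>" for e
    using that by (auto simp: lcf_def split: if_splits)
  have "lcf j v \<in> WF"
  proof (rule fin_suppI)
    show "lcf j v e \<in> carrier R" for e using D(1) by (auto simp: lcf_def)
    have "{e. lcf j v e \<noteq> \<zero>} \<subseteq> (\<lambda>e. e(j := 0)) ` {e. v e \<noteq> \<zero>}"
    proof
      fix e assume "e \<in> {e. lcf j v e \<noteq> \<zero>}"
      then show "e \<in> (\<lambda>e. e(j := 0)) ` {e. v e \<noteq> \<zero>}"
        using nz[of e] by (intro image_eqI[of _ _ "e(j := p * dg j v)"]) auto
    qed
    then show "finite {e. lcf j v e \<noteq> \<zero>}" using D(2) by (auto intro: finite_subset)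
    fix e assume "lcf j v e \<noteq> \<zero>"
    then have "e(j := p * dg j v) \<in> exps" using nz D(3) by blast
    then show "e \<in> exps" using j by (auto simp: exps_def split: if_splits)
  qed
  moreover have "p dvd e i" if "lcf j v e \<noteq> \<zero>" for e i
  proof (cases "i = j")
    case True then show ?thesis using nz[OF that] by simp
  next
    case False
    have "\<forall>i. p dvd (e(j := p * dg j v)) i" using nz[OF that] v unfolding Zc_def by blast
    then have "p dvd (e(j := p * dg j v)) i" by blast
    then show ?thesis using False by simp
  qed
  ultimately show ?thesis unfolding Zc_def W_carrier by blast
qed

lemma lcf_nz: "v \<in> Zc \<Longrightarrow> v \<noteq> \<zero>\<^bsub>W\<^esub> \<Longrightarrow> lcf j v \<noteq> \<zero>\<^bsub>W\<^esub>"
proof -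
  assume v: "v \<in> Zc" "v \<noteq> \<zero>\<^bsub>W\<^esub>"
  obtain e where e: "v e \<noteq> \<zero>" "e j = mx j v"
  proof (cases "0 < mx j v")
    case True show ?thesis using mx_attained[OF Zc_W[OF v(1)] True] that by blast
  next
    case False
    obtain e where "v e \<noteq> \<zero>" using v(2) by (auto simp: W_zero)
    moreover then have "e j = mx j v" using mx_ge[of v e j] v False by auto
    ultimately show ?thesis using that by auto
  qed
  have "e(j := p * dg j v) = e" using e mx_dg[OF v(1), of j] by auto
  then have "lcf j v (e(j := 0)) = v e" by (simp add: lcf_def)
  then show ?thesis using e by (auto simp: W_zero)
qed

lemma dg_lcf_le: "v \<in> Zc \<Longrightarrow> j < 2 * n \<Longrightarrow> dg i (lcf j v) \<le> (if i = j then 0 else dg i v)"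
proof -
  assume v: "v \<in> Zc" and j: "j < 2 * n"
  have "mx i (lcf j v) \<le> (if i = j then 0 else mx i v)"
  proof (rule mx_le)
    fix e assume "lcf j v e \<noteq> \<zero>"
    then have e: "e j = 0" "v (e(j := p * dg j v)) \<noteq> \<zero>" by (auto simp: lcf_def split: if_splits)
    then show "e i \<le> (if i = j then 0 else mx i v)" using mx_ge[of v "e(j := p * dg j v)" i] v by auto
  qed (use lcf_Zc v j in auto)
  then show ?thesis using div_le_mono[of _ _ p] by (fastforce simp: dg_def split: if_splits)
qed

lemma lcf_tail:
  assumes "v \<in> Zc" "j < 2 * n" "0 < dg j v"
  shows "\<exists>t\<in>Zc. v = lcf j v \<star> y j [^]\<^bsub>W\<^esub> dg j v \<oplus>\<^bsub>W\<^esub> t \<and> mx j t < mx j v"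
proof -
  define d where "d = dg j v"
  define t where "t = (\<lambda>e. if e j = p * d then \<zero> else v e)"
  have V: "v \<in> WF" using assms by (simp add: W_carrier[symmetric])
  have "t \<in> WF" using fin_suppD[OF V]
    by (intro fin_suppI) (auto simp: t_def intro: rev_finite_subset[OF fin_suppD(2)[OF V]] split: if_splits)
  then have t: "t \<in> Zc" using assms(1) by (auto simp: Zc_def W_carrier t_def)
  have yZ: "y j [^]\<^bsub>W\<^esub> d \<in> carrier W" using assms by simp
  have l: "lcf j v \<in> Zc" using lcf_Zc assms by simp
  have "lcf j v \<star> y j [^]\<^bsub>W\<^esub> d = (\<lambda>e. if e j = p * d then v e else \<zero>)"
  proof -
    have "lcf j v \<star> y j [^]\<^bsub>W\<^esub> d = y j [^]\<^bsub>W\<^esub> d \<star> lcf j v"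
      using Zc_comm[OF l yZ] .
    also have "\<dots> = (\<lambda>e. if e j < p * d then \<zero> else lcf j v (e(j := e j - p * d)))"
      using l assms by (intro y_pow_mult) auto
    also have "\<dots> = (\<lambda>e. if e j = p * d then v e else \<zero>)"
    proof
      fix e
      have "e(j := p * d) = e" if "e j = p * d" using that by auto
      then show "(if e j < p * d then \<zero> else lcf j v (e(j := e j - p * d))) = (if e j = p * d then v e else \<zero>)"
        by (auto simp: lcf_def d_def[symmetric])
    qed
    finally show ?thesis .
  qed
  then have "v = lcf j v \<star> y j [^]\<^bsub>W\<^esub> d \<oplus>\<^bsub>W\<^esub> t"
    using assms by (auto simp: W_add t_def fun_eq_iff)
  moreover have "mx j t < mx j v"
  proof -
    have "mx j t \<le> mx j v - 1"
    proof (rule mx_le)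
      fix e assume "t e \<noteq> \<zero>"
      then have "v e \<noteq> \<zero>" "e j \<noteq> p * d" by (auto simp: t_def split: if_splits)
      then show "e j \<le> mx j v - 1" using mx_ge[of v e j] mx_dg[OF assms(1), of j] assms by (auto simp: d_def)
    qed (use t in auto)
    moreover have "0 < mx j v" using mx_dg[OF assms(1), of j] assms p_pos by simp
    ultimately show ?thesis by simp
  qed
  ultimately show ?thesis using t by (auto simp: d_def)
qed

lemma lcf_tail':
  assumes "v \<in> Zc" "j < 2 * n" "v \<noteq> \<zero>\<^bsub>W\<^esub>"
  shows "\<exists>t\<in>Zc. v = lcf j v \<star> y j [^]\<^bsub>W\<^esub> dg j v \<oplus>\<^bsub>W\<^esub> t \<and> (t = \<zero>\<^bsub>W\<^esub> \<or> mx j t < mx j v)"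
proof (cases "dg j v = 0")
  case True
  then have m: "mx j v = 0" using mx_dg[OF assms(1)] by simp
  have "lcf j v = v"
  proof
    fix e
    show "lcf j v e = v e"
    proof (cases "e j = 0")
      case True
      then have "e(j := 0) = e" by auto
      then show ?thesis using \<open>dg j v = 0\<close> True by (simp add: lcf_def)
    next
      case False
      then show ?thesis using mx_ge[of v e j] m assms(1) by (force simp: lcf_def)
    qed
  qed
  then show ?thesis using True assms Zc_closed(2) by (intro bexI[of _ "\<zero>\<^bsub>W\<^esub>"]) auto
next
  case False
  then show ?thesis using lcf_tail[OF assms(1,2)] by blast
qed

text \<open>Take an exponent occurring in the product of the leading coefficients and raise its
  entry j to the expected degree. There only the product of the leading parts contributes, every
  other term having smaller degree in that letter.\<close>

lemma mx_mult:
  assumes v: "v \<in> Zc" "v \<noteq> \<zero>\<^bsub>W\<^esub>" and w: "w \<in> Zc" "w \<noteq> \<zero>\<^bsub>W\<^esub>" and j: "j < 2 * n"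
  shows "mx j (v \<star> w) = mx j v + mx j w"
proof (rule antisym)
  show "mx j (v \<star> w) \<le> mx j v + mx j w" using v w by (intro mx_mult_le) auto
  let ?a = "lcf j v" and ?b = "lcf j w" and ?d = "dg j v" and ?k = "dg j w" and ?y = "y j"
  obtain t where t: "t \<in> Zc" "v = ?a \<star> ?y [^]\<^bsub>W\<^esub> ?d \<oplus>\<^bsub>W\<^esub> t" "t = \<zero>\<^bsub>W\<^esub> \<or> mx j t < mx j v"
    using lcf_tail'[OF v(1) j v(2)] by blast
  obtain s where s: "s \<in> Zc" "w = ?b \<star> ?y [^]\<^bsub>W\<^esub> ?k \<oplus>\<^bsub>W\<^esub> s" "s = \<zero>\<^bsub>W\<^esub> \<or> mx j s < mx j w"
    using lcf_tail'[OF w(1) j w(2)] by blast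
  have ab: "?a \<in> Zc" "?b \<in> Zc" using lcf_Zc v w j by auto
  have cl: "?a \<in> carrier W" "?b \<in> carrier W" "?y \<in> carrier W" "t \<in> carrier W" "s \<in> carrier W" "v \<in> carrier W" "w \<in> carrier W"
    using ab j t s v w by auto
  have yk: "?y [^]\<^bsub>W\<^esub> k \<in> Zc" for k :: nat
    by (induction k) (use j Zc_closed(3) in \<open>auto intro: Zc_closed(6)\<close>)
  note ycl = Zc_W[OF yk]
  define A where "A = ?a \<star> ?y [^]\<^bsub>W\<^esub> ?d"
  define B where "B = ?b \<star> ?y [^]\<^bsub>W\<^esub> ?k"
  have AB: "A \<in> carrier W" "B \<in> carrier W" using cl ycl by (auto simp: A_def B_def)
  have ABy: "A \<star> B = ?y [^]\<^bsub>W\<^esub> (?d + ?k) \<star> (?a \<star> ?b)"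
  proof -
    have "A \<star> B = ?a \<star> (?y [^]\<^bsub>W\<^esub> ?d \<star> ?b) \<star> ?y [^]\<^bsub>W\<^esub> ?k"
      using cl ycl by (simp add: A_def B_def W.m_assoc)
    also have "\<dots> = ?a \<star> ?b \<star> (?y [^]\<^bsub>W\<^esub> ?d \<star> ?y [^]\<^bsub>W\<^esub> ?k)"
      using cl ycl Zc_comm[OF yk, of ?b ?d] by (simp add: W.m_assoc)
    also have "\<dots> = ?y [^]\<^bsub>W\<^esub> (?d + ?k) \<star> (?a \<star> ?b)"
      using cl ycl Zc_comm[OF yk, of "?a \<star> ?b" "?d + ?k"] by (simp add: W.nat_pow_mult)
    finally show ?thesis .
  qed
  have "v \<star> w = (A \<oplus>\<^bsub>W\<^esub> t) \<star> w" using t by (simp add: A_def)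
  also have "\<dots> = A \<star> (B \<oplus>\<^bsub>W\<^esub> s) \<oplus>\<^bsub>W\<^esub> t \<star> w" using s AB cl by (simp add: B_def[symmetric] W.l_distr)
  finally have vw: "v \<star> w = A \<star> B \<oplus>\<^bsub>W\<^esub> A \<star> s \<oplus>\<^bsub>W\<^esub> t \<star> w" using AB cl by (simp add: W.r_distr)
  have "?a \<star> ?b \<noteq> \<zero>\<^bsub>W\<^esub>" using lcf_nz v w cl W_integral by blast
  then obtain e where e: "(?a \<star> ?b) e \<noteq> \<zero>" by (auto simp: W_zero)
  have m0: "mx j ?a = 0" "mx j ?b = 0"
    using dg_lcf_le[OF v(1) j, of j] dg_lcf_le[OF w(1) j, of j] mx_dg[OF ab(1)] mx_dg[OF ab(2)] by auto
  then have "mx j (?a \<star> ?b) = 0" using mx_mult_le[of ?a ?b j] cl by simp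
  then have ej: "e j = 0" using mx_ge[of "?a \<star> ?b" e j] e cl by simp
  let ?m = "mx j v + mx j w"
  have m: "?m = p * (?d + ?k)" using mx_dg v w by (simp add: algebra_simps)
  define e' where "e' = e(j := ?m)"
  have "e(j := 0) = e" using ej by auto
  then have 1: "(A \<star> B) e' = (?a \<star> ?b) e"
    unfolding ABy using j cl m by (subst y_pow_mult) (auto simp: e'_def)
  have dA: "mx j A \<le> mx j v"
  proof (rule mx_le[OF AB(1)])
    fix e assume e: "A e \<noteq> \<zero>"
    have "A = ?y [^]\<^bsub>W\<^esub> ?d \<star> ?a" using Zc_comm[OF ab(1) ycl] by (simp add: A_def)
    then have "A e = (if e j < p * ?d then \<zero> else ?a (e(j := e j - p * ?d)))"
      by (simp only: y_pow_mult[OF j cl(1)])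
    then have "?a (e(j := e j - p * ?d)) \<noteq> \<zero>" using e by (auto split: if_splits)
    then have "e j - p * ?d = 0" using mx_ge[OF cl(1), of "e(j := e j - p * ?d)" j] m0 by simp
    then show "e j \<le> mx j v" using mx_dg[OF v(1), of j] by simp
  qed
  have 2: "(A \<star> s) e' = \<zero>"
  proof (rule ccontr)
    assume ne: "(A \<star> s) e' \<noteq> \<zero>"
    have "s \<noteq> \<zero>\<^bsub>W\<^esub>"
    proof
      assume "s = \<zero>\<^bsub>W\<^esub>"
      then have "A \<star> s = \<zero>\<^bsub>W\<^esub>" using AB by simp
      then show False using ne by (simp add: W_zero)
    qed
    then have "mx j s < mx j w" using s by simp
    then have "mx j (A \<star> s) < ?m" using mx_mult_le[OF AB(1) cl(5), of j] dA by linarith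
    then show False using mx_ge[of "A \<star> s" e' j] ne AB cl by (simp add: e'_def)
  qed
  have 3: "(t \<star> w) e' = \<zero>"
  proof (rule ccontr)
    assume ne: "(t \<star> w) e' \<noteq> \<zero>"
    have "t \<noteq> \<zero>\<^bsub>W\<^esub>"
    proof
      assume "t = \<zero>\<^bsub>W\<^esub>"
      then have "t \<star> w = \<zero>\<^bsub>W\<^esub>" using cl by simp
      then show False using ne by (simp add: W_zero)
    qed
    then have "mx j t < mx j v" using t by simp
    then have "mx j (t \<star> w) < ?m" using mx_mult_le[OF cl(4) cl(7), of j] by linarith
    then show False using mx_ge[of "t \<star> w" e' j] ne cl by (simp add: e'_def)
  qed
  have "(v \<star> w) e' = (?a \<star> ?b) e"
    unfolding vw using 1 2 3 cl by (simp add: W_add)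
  then show "?m \<le> mx j (v \<star> w)" using e mx_ge[of "v \<star> w" e' j] cl by (simp add: e'_def)
qed

lemma td_unit_W:
  assumes "v \<in> Zc" "v \<noteq> \<zero>\<^bsub>W\<^esub>" "td v = 0"
  shows "\<exists>w\<in>Zc. v \<star> w = \<one>\<^bsub>W\<^esub>"
proof -
  let ?c = "v (\<lambda>_. 0)"
  have v: "v = sc ?c" using td_zero_iff[of v] assms by simp
  have "?c \<noteq> \<zero>" using v assms(2) by auto
  then have c: "?c \<in> Units R" using assms field_Units by simp
  have "v \<star> sc (inv ?c) = sc (?c \<otimes> inv ?c)" using v c sc_sc by (metis Units_closed Units_inv_closed)
  then show ?thesis using c Zc_sc[of "inv ?c"] by (intro bexI[of _ "sc (inv ?c)"]) auto
qed

text \<open>Makes primality of irreducibles and elimination available in the centre. Degrees in one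
  variable count powers of \<open>y j\<close>, whereas \<open>td\<close> counts total degree in the
  original generators.\<close>

sublocale PZ: poly_domain Zr "2 * n" td dg lcf y
proof -
  interpret Zr: domain Zr by (rule Zr_domain)
  have pw: "y j [^]\<^bsub>Zr\<^esub> k = y j [^]\<^bsub>W\<^esub> k" for j and k :: nat by (simp add: nat_pow_def)
  show "poly_domain Zr (2 * n) td dg lcf y"
  proof (unfold_locales, goal_cases)
    case (1 a b) then show ?case by (simp add: td_mult)
  next
    case (2 a)
    then obtain w where "w \<in> Zc" "a \<star> w = \<one>\<^bsub>W\<^esub>" using td_unit_W by auto
    then show ?case using 2 Zc_comm[of a w] by (auto simp: Units_def intro!: bexI[of _ w])
  next
    case (3 j a b)
    then have "p * dg j (a \<star> b) = p * (dg j a + dg j b)"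
      using mx_mult[of a b j] mx_dg Zc_closed(6) by (simp add: algebra_simps)
    then show ?case using p_pos by simp
  next
    case (4 j a b)
    then have "mx j (a \<oplus>\<^bsub>W\<^esub> b) \<le> max (mx j a) (mx j b)" by (intro mx_add) auto
    then have "mx j (a \<oplus>\<^bsub>W\<^esub> b) div p \<le> max (mx j a) (mx j b) div p" by (rule div_le_mono)
    then show ?case by (auto simp: dg_def max_def split: if_splits)
  next
    case (5 j) then show ?case by (simp add: dg_def)
  next
    case (6 a)
    have "mx j a = 0" if "j < 2 * n" for j using 6 that mx_dg[of a j] by simp
    then have "e j = 0" if "a e \<noteq> \<zero>" "j < 2 * n" for e j using 6 that mx_ge[of a e j] by simp
    moreover obtain c where c: "lead a c" using lead_exists[of a] 6 by auto
    ultimately have "tdeg c = 0" by (simp add: tdeg_def lead_def)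
    then show ?case using td_lead[OF _ c] 6 by simp
  next
    case (7 j) then show ?case by simp
  next
    case (8 j)
    have "y j ((\<lambda>_. 0)(j := p)) = \<one>" by (simp add: y_def single_def)
    then show ?case by (auto simp: W_zero)
  next
    case (9 i j)
    have "{e. y j e \<noteq> \<zero>} = {(\<lambda>_. 0)(j := p)}" by (auto simp: y_def single_def)
    then show ?case using p_pos by (simp add: dg_def mx_def)
  next
    case (10 j a) then show ?case by (simp add: lcf_Zc)
  next
    case (11 j a) then show ?case by (simp add: lcf_nz)
  next
    case (12 i j a) then show ?case using dg_lcf_le by simp
  next
    case (13 j a)
    show ?case
    proof (cases "a = \<zero>\<^bsub>W\<^esub>")
      case True then show ?thesis by (simp add: lcf_def W_zero)
    next
      case False
      then obtain t where t: "t \<in> Zc" "a = lcf j a \<star> y j [^]\<^bsub>W\<^esub> dg j a \<oplus>\<^bsub>W\<^esub> t" "t = \<zero>\<^bsub>W\<^esub> \<or> mx j t < mx j a"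
        using lcf_tail'[of a j] 13 by auto
      then have "t = \<zero>\<^bsub>W\<^esub>" using 13 mx_dg[of a j] by simp
      moreover have "lcf j a \<in> carrier W" using lcf_Zc 13 by simp
      ultimately show ?thesis using t 13 by simp
    qed
  next
    case (14 j a)
    then obtain t where t: "t \<in> Zc" "a = lcf j a \<star> y j [^]\<^bsub>W\<^esub> dg j a \<oplus>\<^bsub>W\<^esub> t" "mx j t < mx j a"
      using lcf_tail[of a j] by auto
    moreover have "dg j t < dg j a" using t(3) mx_dg[OF t(1), of j] mx_dg[of a j] 14 by simp
    ultimately show ?case by (auto simp: pw)
  qed
qed

end

section \<open>Frobenius and \<open>p\<close>-th roots\<close>

lemma (in cring) binomial_theorem:
  assumes a: "a \<in> carrier R" and b: "b \<in> carrier R"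
  shows "(a \<oplus> b) [^] (m::nat) = (\<Oplus>i\<in>{..m}. ([(m choose i)] \<cdot> \<one>) \<otimes> (a [^] i \<otimes> b [^] (m - i)))"
proof (induction m)
  case 0
  then show ?case using a b by simp
next
  case (Suc m)
  define c where "c m i = [(m choose i)] \<cdot> \<one>" for m i :: nat
  have c [simp]: "c m i \<in> carrier R" for m i by (simp add: c_def)
  have cS: "c (Suc m) (Suc i) = c m i \<oplus> c m (Suc i)" for i by (simp add: c_def add.nat_pow_mult)
  have c0: "c k 0 = \<one>" for k by (simp add: c_def)
  have cm: "c m (Suc m) = \<zero>" by (simp add: c_def binomial_eq_0)
  let ?f = "\<lambda>i. c m i \<otimes> (a [^] i \<otimes> b [^] (m - i))"
  let ?g = "\<lambda>i. c m i \<otimes> (a [^] i \<otimes> b [^] (Suc m - i))"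
  have "(a \<oplus> b) [^] Suc m = (\<Oplus>i\<in>{..m}. ?f i) \<otimes> a \<oplus> (\<Oplus>i\<in>{..m}. ?f i) \<otimes> b"
    using Suc a b by (simp add: c_def r_distr)
  also have "(\<Oplus>i\<in>{..m}. ?f i) \<otimes> a = (\<Oplus>i\<in>{..m}. ?f i \<otimes> a)" using a b by (intro finsum_ldistr) auto
  also have "\<dots> = (\<Oplus>i\<in>{..m}. c m i \<otimes> (a [^] Suc i \<otimes> b [^] (m - i)))" using a b by (intro finsum_cong') (auto simp: m_ac)
  also have "(\<Oplus>i\<in>{..m}. ?f i) \<otimes> b = (\<Oplus>i\<in>{..m}. ?f i \<otimes> b)" using a b by (intro finsum_ldistr) auto
  also have "\<dots> = (\<Oplus>i\<in>{..m}. ?g i)" using a b by (intro finsum_cong') (auto simp: m_ac Suc_diff_le)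
  also have "\<dots> = (\<Oplus>i\<in>{..Suc m}. ?g i)" using a b cm by (subst finsum_Suc) auto
  also have "\<dots> = (\<Oplus>i\<in>{..m}. ?g (Suc i)) \<oplus> ?g 0" using a b by (intro finsum_Suc2) auto
  also have "(\<Oplus>i\<in>{..m}. c m i \<otimes> (a [^] Suc i \<otimes> b [^] (m - i))) \<oplus> ((\<Oplus>i\<in>{..m}. ?g (Suc i)) \<oplus> ?g 0)
    = (\<Oplus>i\<in>{..m}. c m i \<otimes> (a [^] Suc i \<otimes> b [^] (m - i)) \<oplus> ?g (Suc i)) \<oplus> ?g 0"
    using a b by (subst finsum_addf) (auto simp: a_assoc)
  also have "(\<Oplus>i\<in>{..m}. c m i \<otimes> (a [^] Suc i \<otimes> b [^] (m - i)) \<oplus> ?g (Suc i))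
    = (\<Oplus>i\<in>{..m}. c (Suc m) (Suc i) \<otimes> (a [^] Suc i \<otimes> b [^] (Suc m - Suc i)))"
    using a b by (intro finsum_cong') (auto simp: cS l_distr)
  also have "\<dots> \<oplus> ?g 0 = (\<Oplus>i\<in>{..Suc m}. c (Suc m) i \<otimes> (a [^] i \<otimes> b [^] (Suc m - i)))"
    using a b by (subst finsum_Suc2) (auto simp: c0)
  finally show ?case by (simp add: c_def)
qed

lemma (in cring) freshman:
  assumes p: "Factorial_Ring.prime (p::nat)" "[p] \<cdot> \<one> = \<zero>" and a: "a \<in> carrier R" and b: "b \<in> carrier R"
  shows "(a \<oplus> b) [^] p = a [^] p \<oplus> b [^] p"
proof -
  have p0: "0 < p" using p(1) by (simp add: prime_gt_0_nat)
  have z: "[(p choose i)] \<cdot> \<one> = \<zero>" if "i \<noteq> 0" "i \<noteq> p" "i \<le> p" for i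
  proof -
    have "p dvd (p choose i)" using that p(1) by (intro dvd_choose_prime) auto
    then obtain k where "p choose i = p * k" by (auto simp: dvd_def)
    then show ?thesis using p(2) add.nat_pow_pow[of \<one> k p] by simp
  qed
  have "(a \<oplus> b) [^] p = (\<Oplus>i\<in>{..p}. ([(p choose i)] \<cdot> \<one>) \<otimes> (a [^] i \<otimes> b [^] (p - i)))"
    by (rule binomial_theorem[OF a b])
  also have "\<dots> = (\<Oplus>i\<in>{0, p}. ([(p choose i)] \<cdot> \<one>) \<otimes> (a [^] i \<otimes> b [^] (p - i)))"
    using a b z by (intro add.finprod_mono_neutral_cong_right) auto
  also have "\<dots> = a [^] p \<oplus> b [^] p" using a b p0 by (simp add: a_comm)
  finally show ?thesis .
qed

context weyl_charp
begin

text \<open>Frobenius is additive with trivial kernel, hence injective, and an injective self-map of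
  a finite set is onto.\<close>

lemma perfect: "a \<in> carrier R \<Longrightarrow> \<exists>b\<in>carrier R. b [^] p = a"
proof -
  assume a: "a \<in> carrier R"
  have char: "[p] \<cdot> \<one> = \<zero>" using char_p by (simp add: nc_def)
  have "inj_on (\<lambda>b. b [^] p) (carrier R)"
  proof (rule inj_onI)
    fix b c assume bc: "b \<in> carrier R" "c \<in> carrier R" "b [^] p = c [^] p"
    define d where "d = b \<ominus> c"
    have d: "d \<in> carrier R" "c \<oplus> d = b" using bc by (auto simp: d_def minus_eq a_lcomm[of c b] r_neg)
    have "c [^] p \<oplus> d [^] p = c [^] p" using freshman[OF prime_p char bc(2) d(1)] d bc by simp
    then have "d [^] p = \<zero>" using bc d by simp
    moreover have "d [^] k = \<zero> \<Longrightarrow> d = \<zero>" for k :: nat using d by (induction k) (auto simp: integral_iff)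
    ultimately have "d = \<zero>" by blast
    then show "b = c" using d bc by simp
  qed
  then have "(\<lambda>b. b [^] p) ` carrier R = carrier R"
    using fin_R by (intro endo_inj_surj) auto
  then show ?thesis using a by (metis (no_types, lifting) imageE)
qed

lemma Zr_freshman: "z \<in> Zc \<Longrightarrow> w \<in> Zc \<Longrightarrow> (z \<oplus>\<^bsub>W\<^esub> w) [^]\<^bsub>W\<^esub> p = z [^]\<^bsub>W\<^esub> p \<oplus>\<^bsub>W\<^esub> w [^]\<^bsub>W\<^esub> p"
proof -
  assume zw: "z \<in> Zc" "w \<in> Zc"
  have "[k] \<cdot>\<^bsub>Zr\<^esub> \<one>\<^bsub>Zr\<^esub> = sc (nc k)" for k :: nat
    by (induction k) (auto simp: nc_Suc sc_add add_pow_def nat_pow_def)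
  then have "[p] \<cdot>\<^bsub>Zr\<^esub> \<one>\<^bsub>Zr\<^esub> = \<zero>\<^bsub>Zr\<^esub>" by (simp add: char_p)
  then have "(z \<oplus>\<^bsub>Zr\<^esub> w) [^]\<^bsub>Zr\<^esub> p = z [^]\<^bsub>Zr\<^esub> p \<oplus>\<^bsub>Zr\<^esub> w [^]\<^bsub>Zr\<^esub> p"
    using zw by (intro PZ.freshman prime_p) auto
  then show ?thesis by (simp add: nat_pow_def)
qed

lemma Zc_pow: "z \<in> Zc \<Longrightarrow> z [^]\<^bsub>W\<^esub> (k::nat) \<in> Zc"
  by (induction k) (auto intro: Zc_closed)

lemma zmon_step:
  assumes "e \<in> exps" "\<forall>j. p dvd e j" "e \<noteq> (\<lambda>_. 0)"
  obtains j e' where "j < 2 * n" "e' \<in> exps" "\<forall>j. p dvd e' j" "e = e'(j := e' j + p)" "tdeg e' < tdeg e"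
    "single \<one> e = y j \<star> single \<one> e'"
proof -
  obtain j where j: "e j \<noteq> 0" using assms by auto
  then have j2: "j < 2 * n" using assms by (auto simp: exps_def intro: leI)
  have pj: "p \<le> e j" using assms(2) j by (auto intro: dvd_imp_le)
  define e' where "e' = e(j := e j - p)"
  have e': "e' \<in> exps" "\<forall>i. p dvd e' i" using assms(1,2) j2 by (auto simp: e'_def dvd_diff_nat)
  have ee: "e = e'(j := e' j + p)" using pj by (auto simp: e'_def)
  have td: "tdeg e' < tdeg e" unfolding tdeg_def
    using j2 j p_pos by (intro sum_strict_mono_ex1) (auto simp: e'_def)
  have s: "single \<one> e' \<in> carrier W" using e' by (simp add: W_carrier single_closed)
  have "y j \<star> single \<one> e' = single \<one> e"
  proof
    fix c
    have "(if c j < p then \<zero> else single \<one> e' (c(j := c j - p))) = single \<one> e c"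
    proof (cases "c j < p")
      case True then show ?thesis using pj by (auto simp: single_def)
    next
      case False
      have "c = e" if eq: "c(j := c j - p) = e'"
      proof
        fix i
        show "c i = e i" using fun_cong[OF eq, of i] pj False by (cases "i = j") (simp_all add: e'_def)
      qed
      then have "c(j := c j - p) = e' \<longleftrightarrow> c = e" unfolding e'_def by blast
      then show ?thesis using False by (simp add: single_def)
    qed
    then show "(y j \<star> single \<one> e') c = single \<one> e c" using y_mult[OF j2 s] by simp
  qed
  then show ?thesis using that[OF j2 e'(1,2) ee td] by simp
qed

lemma Zc_fin_supp: "z \<in> Zc \<longleftrightarrow> z \<in> fin_supp {e \<in> exps. \<forall>j. p dvd e j}"
  unfolding Zc_def W_carrier fin_supp_def by blast

lemma Zc_induct [consumes 1, case_names one add sc y]: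
  assumes z: "z \<in> Zc"
    and one: "P \<one>\<^bsub>W\<^esub>"
    and add: "\<And>v w. v \<in> Zc \<Longrightarrow> w \<in> Zc \<Longrightarrow> P v \<Longrightarrow> P w \<Longrightarrow> P (v \<oplus>\<^bsub>W\<^esub> w)"
    and sc: "\<And>a v. a \<in> carrier R \<Longrightarrow> v \<in> Zc \<Longrightarrow> P v \<Longrightarrow> P (sc a \<star> v)"
    and y: "\<And>j v. j < 2 * n \<Longrightarrow> v \<in> Zc \<Longrightarrow> P v \<Longrightarrow> P (y j \<star> v)"
  shows "P z"
proof -
  have s: "single \<one> e \<in> Zc \<and> P (single \<one> e)" if "e \<in> exps" "\<forall>j. p dvd e j" for e
    using that
  proof (induction "tdeg e" arbitrary: e rule: less_induct)
    case less
    show ?case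
    proof (cases "e = (\<lambda>_. 0)")
      case True then show ?thesis using one Zc_closed(3) by (simp add: W_one)
    next
      case False
      then obtain j e' where "j < 2 * n" "e' \<in> exps" "\<forall>j. p dvd e' j" "tdeg e' < tdeg e" "single \<one> e = y j \<star> single \<one> e'"
        using zmon_step[OF less.prems] by metis
      then show ?thesis using less.hyps[of e'] y[of j "single \<one> e'"] by (auto intro: Zc_closed(6))
    qed
  qed
  have sa: "P (single a e)" if "a \<in> carrier R" "e \<in> exps" "\<forall>j. p dvd e j" for a e
    using sc[OF that(1), of "single \<one> e"] s[OF that(2,3)] single_sc[OF that(1,2)] by simp
  show ?thesis using z unfolding Zc_fin_supp
  proof (induction rule: fin_supp_induct)
    case zero
    have "P (single \<zero> (\<lambda>_. 0))" by (rule sa) auto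
    also have "single \<zero> (\<lambda>_. 0) = (\<lambda>_. \<zero>)" by (auto simp: single_def)
    finally show ?case .
  next
    case (single a e) then show ?case using sa by auto
  next
    case (add v w) then show ?case using assms(3)[of v w] by (simp add: Zc_fin_supp W_add)
  qed
qed

text \<open>The left factor is a product of p-th powers of generators, which are central, so no
  reordering terms arise.\<close>

lemma zmon_mult:
  assumes "b \<in> exps" "\<forall>j. p dvd b j" "c \<in> exps"
  shows "single \<one> b \<star> single \<one> c = single \<one> (\<lambda>i. b i + c i)"
  using assms(1,2)
proof (induction "tdeg b" arbitrary: b rule: less_induct)
  case less
  have c: "single \<one> c \<in> carrier W" using assms by (simp add: W_carrier single_closed)
  show ?case
  proof (cases "b = (\<lambda>_. 0)")
    case True then show ?thesis using c by (simp add: W_one[symmetric])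
  next
    case False
    then obtain j e' where e': "j < 2 * n" "e' \<in> exps" "\<forall>j. p dvd e' j" "b = e'(j := e' j + p)" "tdeg e' < tdeg b" "single \<one> b = y j \<star> single \<one> e'"
      using zmon_step[OF less.prems] by metis
    have s: "single \<one> e' \<in> carrier W" using e' by (simp add: W_carrier single_closed)
    have ec: "(\<lambda>i. e' i + c i) \<in> exps" using e' assms by (auto simp: exps_def)
    have s2: "single \<one> (\<lambda>i. e' i + c i) \<in> carrier W" using ec by (simp add: W_carrier single_closed)
    have "single \<one> b \<star> single \<one> c = y j \<star> single \<one> (\<lambda>i. e' i + c i)"
      using e' s c less.hyps[OF e'(5,2,3)] by (simp add: W.m_assoc)
    also have "\<dots> = single \<one> (\<lambda>i. b i + c i)"
    proof
      fix d
      have "(if d j < p then \<zero> else single \<one> (\<lambda>i. e' i + c i) (d(j := d j - p))) = single \<one> (\<lambda>i. b i + c i) d"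
        using e'(4) by (auto simp: single_def fun_eq_iff split: if_splits)
      then show "(y j \<star> single \<one> (\<lambda>i. e' i + c i)) d = single \<one> (\<lambda>i. b i + c i) d" using y_mult[OF e'(1) s2] by simp
    qed
    finally show ?thesis .
  qed
qed

text \<open>The square \<open>p * p\<close> appears because the root has to be central as well:
  after division by p the exponents must still be multiples of p. Coefficients have roots by
  perfectness, and p-th powers are additive on the commutative centre.\<close>

lemma pth_root:
  assumes "z \<in> carrier W" "\<And>e j. z e \<noteq> \<zero> \<Longrightarrow> p * p dvd e j"
  shows "\<exists>w\<in>Zc. z = w [^]\<^bsub>W\<^esub> p"
proof -
  have "z \<in> fin_supp {e \<in> exps. \<forall>j. p * p dvd e j}"
    using assms unfolding W_carrier fin_supp_def by blast
  then show ?thesis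
  proof (induction rule: fin_supp_induct)
    case zero
    have "\<zero>\<^bsub>W\<^esub> = \<zero>\<^bsub>W\<^esub> [^]\<^bsub>W\<^esub> p" using p_pos by (simp add: W.nat_pow_zero)
    then show ?case using Zc_closed(2) by (auto simp: W_zero)
  next
    case (add v w)
    then obtain v' w' where "v' \<in> Zc" "v = v' [^]\<^bsub>W\<^esub> p" "w' \<in> Zc" "w = w' [^]\<^bsub>W\<^esub> p" by auto
    then show ?case using Zr_freshman[of v' w'] Zc_closed(7) by (auto simp: W_add intro!: bexI[of _ "v' \<oplus>\<^bsub>W\<^esub> w'"])
  next
    case (single a e)
    then have e: "e \<in> exps" "\<And>j. p * p dvd e j" by auto
    obtain b where b: "b \<in> carrier R" "b [^] p = a" using perfect single by blast
    define c where "c = (\<lambda>i. e i div p)"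
    have pc: "p * c i = e i" for i using e(2)[of i] by (auto simp: c_def dvd_def)
    have "p dvd c j" for j
    proof -
      have "p * p dvd p * c j" using e(2)[of j] by (simp add: pc)
      then show ?thesis using p_pos by simp
    qed
    then have c: "c \<in> exps" "\<forall>j. p dvd c j" using e(1) by (simp_all add: exps_def c_def)
    have sZ: "single \<one> c \<in> Zc" using c by (auto simp: Zc_fin_supp single_closed)
    have pow: "(sc b \<star> single \<one> c) [^]\<^bsub>W\<^esub> k = sc (b [^] k) \<star> single \<one> (\<lambda>i. k * c i)" for k :: nat
    proof (induction k)
      case 0 then show ?case by (simp add: W_one[symmetric])
    next
      case (Suc k)
      have kc: "(\<lambda>i. k * c i) \<in> exps" "\<forall>j. p dvd k * c j" using c by (auto simp: exps_def)
      have s1: "single \<one> (\<lambda>i. k * c i) \<in> Zc" using kc by (auto simp: Zc_fin_supp single_closed)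
      have "(sc b \<star> single \<one> c) [^]\<^bsub>W\<^esub> Suc k = sc (b [^] k) \<star> (single \<one> (\<lambda>i. k * c i) \<star> sc b) \<star> single \<one> c"
        using Suc b s1 sZ by (simp add: W.m_assoc)
      also have "\<dots> = (sc (b [^] k) \<star> sc b) \<star> (single \<one> (\<lambda>i. k * c i) \<star> single \<one> c)"
        using b s1 sZ by (simp add: sc_comm[OF b(1) Zc_W[OF s1]] W.m_assoc)
      also have "\<dots> = sc (b [^] Suc k) \<star> single \<one> (\<lambda>i. Suc k * c i)"
        using b zmon_mult[OF kc c(1)] by (simp add: sc_sc add.commute)
      finally show ?case .
    qed
    have "single a e = (sc b \<star> single \<one> c) [^]\<^bsub>W\<^esub> p"
    proof -
      have "(\<lambda>i. p * c i) = e" using pc by (intro ext)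
      then show ?thesis using pow[of p] b(2) single_sc[OF single(1) e(1)] by (simp only:)
    qed
    then show ?case using Zc_closed(6)[OF Zc_sc[OF b(1)] sZ] by blast
  qed
qed

section \<open>Elements dividing central elements\<close>

text \<open>For finite C this space is finite, as the field is, and its cardinality takes the place
  of a dimension.\<close>

definition box :: "(nat \<Rightarrow> nat) set \<Rightarrow> ((nat \<Rightarrow> nat) \<Rightarrow> 'a) set" where
  "box C = {v \<in> carrier W. \<forall>e. v e \<noteq> \<zero> \<longrightarrow> e \<in> C}"

lemma card_box:
  assumes C: "finite C" "C \<subseteq> exps"
  shows "finite (box C)" "card (box C) = card (carrier R) ^ card C"
proof -
  have bij: "bij_betw (\<lambda>v. restrict v C) (box C) (C \<rightarrow>\<^sub>E carrier R)"
  proof (rule bij_betwI[where g = "\<lambda>f e. if e \<in> C then f e else \<zero>"])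
    show "(\<lambda>v. restrict v C) \<in> box C \<rightarrow> C \<rightarrow>\<^sub>E carrier R" by (auto simp: box_def)
    show "(\<lambda>f e. if e \<in> C then f e else \<zero>) \<in> (C \<rightarrow>\<^sub>E carrier R) \<rightarrow> box C"
    proof
      fix f assume f: "f \<in> C \<rightarrow>\<^sub>E carrier R"
      have "{e. (if e \<in> C then f e else \<zero>) \<noteq> \<zero>} \<subseteq> C" by auto
      then have "(\<lambda>e. if e \<in> C then f e else \<zero>) \<in> fin_supp exps"
        using f C by (intro fin_suppI) (auto intro: finite_subset split: if_splits)
      then show "(\<lambda>e. if e \<in> C then f e else \<zero>) \<in> box C" by (auto simp: box_def W_carrier split: if_splits)
    qed
    show "(\<lambda>e. if e \<in> C then restrict v C e else \<zero>) = v" if "v \<in> box C" for v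
    proof
      fix e
      have "e \<in> C \<or> v e = \<zero>" using that unfolding box_def by blast
      then show "(if e \<in> C then restrict v C e else \<zero>) = v e" by auto
    qed
    show "restrict (\<lambda>e. if e \<in> C then f e else \<zero>) C = f" if "f \<in> C \<rightarrow>\<^sub>E carrier R" for f
      using that by (auto simp: fun_eq_iff PiE_def extensional_def)
  qed
  have "finite (C \<rightarrow>\<^sub>E carrier R)" using C fin_R by (intro finite_PiE) auto
  then show "finite (box C)" using bij bij_betw_finite by blast
  show "card (box C) = card (carrier R) ^ card C"
    using bij_betw_same_card[OF bij] C by (simp add: card_funcsetE)
qed

definition cube :: "nat \<Rightarrow> (nat \<Rightarrow> nat) set" where
  "cube m = {e \<in> exps. \<forall>j<2 * n. e j < m}"

lemma card_cube: "finite (cube m)" "card (cube m) = m ^ (2 * n)"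
proof -
  have bij: "bij_betw (\<lambda>e. restrict e {..<2 * n}) (cube m) ({..<2 * n} \<rightarrow>\<^sub>E {..<m})"
  proof (rule bij_betwI[where g = "\<lambda>f i. if i < 2 * n then f i else 0"])
    show "(\<lambda>f i. if i < 2 * n then f i else 0) \<in> ({..<2 * n} \<rightarrow>\<^sub>E {..<m}) \<rightarrow> cube m"
      by (auto simp: cube_def exps_def PiE_def Pi_def)
    fix e assume "e \<in> cube m"
    then show "(\<lambda>i. if i < 2 * n then restrict e {..<2 * n} i else 0) = e"
      by (auto simp: cube_def exps_def fun_eq_iff)
  next
    fix f assume "f \<in> {..<2 * n} \<rightarrow>\<^sub>E {..<m}"
    then show "restrict (\<lambda>i. if i < 2 * n then f i else 0) {..<2 * n} = f"
      by (auto simp: fun_eq_iff PiE_def extensional_def restrict_def)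
  qed (auto simp: cube_def)
  have "finite ({..<2 * n} \<rightarrow>\<^sub>E {..<m})" by (intro finite_PiE) auto
  then show "finite (cube m)" using bij bij_betw_finite by blast
  show "card (cube m) = m ^ (2 * n)"
    using bij_betw_same_card[OF bij] by (simp add: card_funcsetE)
qed

text \<open>Bernoulli's inequality (1 - e/A)^N >= 1 - N e/A, cleared of denominators.\<close>

lemma power_diff_bound:
  fixes A e N :: nat
  assumes "e \<le> A"
  shows "A ^ N \<le> (A - e) ^ N + N * e * A ^ (N - 1)"
proof (induction N)
  case (Suc N)
  have "A ^ Suc N \<le> A * ((A - e) ^ N + N * e * A ^ (N - 1))" using Suc by simp
  also have "\<dots> = (A - e + e) * (A - e) ^ N + N * e * (A * A ^ (N - 1))" using assms by (simp add: algebra_simps)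
  also have "\<dots> \<le> (A - e) ^ Suc N + e * A ^ N + N * e * A ^ N"
  proof -
    have "e * (A - e) ^ N \<le> e * A ^ N" by (intro mult_left_mono power_mono) auto
    moreover have "N * e * (A * A ^ (N - 1)) \<le> N * e * A ^ N" by (cases N) auto
    moreover have "(A - e + e) * (A - e) ^ N = (A - e) ^ Suc N + e * (A - e) ^ N" by (simp add: distrib_right)
    ultimately show ?thesis by linarith
  qed
  finally show ?case by (simp add: algebra_simps)
qed simp

text \<open>A pigeonhole argument. Products s w and central elements z both fit into a cube of
  exponents of side pT, but for large T they have more parameters together than the cube. A
  coincidence s w + z = s w' + z' makes s (w - w') central.\<close>

lemma central_multiple:
  assumes s: "s \<in> carrier W" "s \<noteq> \<zero>\<^bsub>W\<^esub>"
  shows "\<exists>s'\<in>carrier W. s \<star> s' \<in> Zc \<and> s \<star> s' \<noteq> \<zero>\<^bsub>W\<^esub>"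
proof -
  let ?N = "2 * n"
  define d where "d = (\<Sum>j<?N. mx j s)"
  \<comment> \<open>With N = 2n, shrinking the side of the cube from pT to pT - d loses at most N d
    (pT)^(N-1) exponents. T is large enough for this to stay below the T^N exponents of central
    elements.\<close>
  define T where "T = ?N * d * p ^ (?N - 1) + d + 1"
  define m where "m = p * T - d"
  have dT: "d \<le> p * T"
  proof -
    have "d \<le> T" by (simp add: T_def)
    then show ?thesis using p_pos by (metis Suc_leI le_trans mult_le_mono1 nat_mult_1 One_nat_def)
  qed
  have count: "(p * T) ^ ?N < m ^ ?N + T ^ ?N"
  proof (cases "n = 0")
    case False
    then obtain N' where N': "?N = Suc N'" by (cases ?N) auto
    have "?N * d * (p * T) ^ (?N - 1) = (?N * d * p ^ (?N - 1)) * T ^ N'" by (simp add: N' power_mult_distrib)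
    also have "\<dots> < T * T ^ N'" by (intro mult_strict_right_mono) (auto simp: T_def)
    finally have "?N * d * (p * T) ^ (?N - 1) < T ^ ?N" by (simp add: N')
    then show ?thesis using power_diff_bound[OF dT, of ?N] by (simp add: m_def)
  qed simp
  define C where "C = cube (p * T)"
  define C1 where "C1 = cube m"
  define C2 where "C2 = (\<lambda>e i. p * e i) ` cube T"
  have inj: "inj_on (\<lambda>e i. p * e i) (cube T)" using p_pos by (auto simp: inj_on_def fun_eq_iff)
  have C2s: "C2 \<subseteq> exps" "finite C2" "card C2 = T ^ ?N"
    using card_cube[of T] card_image[OF inj] by (auto simp: C2_def cube_def exps_def)
  have Cs: "C \<subseteq> exps" "finite C" "card C = (p * T) ^ ?N" "C1 \<subseteq> exps" "finite C1" "card C1 = m ^ ?N"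
    using card_cube by (auto simp: C_def C1_def cube_def)
  define h where "h = (\<lambda>(w, z). s \<star> w \<oplus>\<^bsub>W\<^esub> z)"
  have box2Z: "box C2 \<subseteq> Zc"
  proof
    fix v assume v: "v \<in> box C2"
    have "p dvd e j" if "v e \<noteq> \<zero>" for e j
    proof -
      have "e \<in> C2" using v that unfolding box_def by blast
      then show ?thesis by (auto simp: C2_def)
    qed
    then show "v \<in> Zc" using v unfolding Zc_def box_def by blast
  qed
  have hB: "h ` (box C1 \<times> box C2) \<subseteq> box C"
  proof
    fix u assume "u \<in> h ` (box C1 \<times> box C2)"
    then obtain w z where wz: "w \<in> box C1" "z \<in> box C2" "u = s \<star> w \<oplus>\<^bsub>W\<^esub> z" by (auto simp: h_def)
    then have cl: "w \<in> carrier W" "z \<in> carrier W" by (auto simp: box_def)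
    have uW: "u \<in> carrier W" using wz cl s by simp
    have "e \<in> C" if ue: "u e \<noteq> \<zero>" for e
    proof -
      have e: "e \<in> exps" using uW ue by (auto simp: W_carrier fin_suppD)
      have "(s \<star> w) e \<noteq> \<zero> \<or> z e \<noteq> \<zero>" using ue wz cl s by (auto simp: W_add)
      then show ?thesis
      proof
        assume z: "z e \<noteq> \<zero>"
        then have "e \<in> C2" using wz by (auto simp: box_def)
        then show ?thesis using p_pos e by (auto simp: C_def cube_def C2_def)
      next
        assume ne: "(s \<star> w) e \<noteq> \<zero>"
        have "e j < p * T" if j: "j < ?N" for j
        proof -
          have nz: "w \<noteq> \<zero>\<^bsub>W\<^esub>"
          proof
            assume "w = \<zero>\<^bsub>W\<^esub>"
            then have "s \<star> w = \<zero>\<^bsub>W\<^esub>" using s by simp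
            then show False using ne by (simp add: W_zero)
          qed
          then obtain c where c: "w c \<noteq> \<zero>" by (auto simp: W_zero)
          have wm: "c j < m" if "w c \<noteq> \<zero>" for c
            using wz(1) that j unfolding box_def C1_def cube_def by blast
          have mp: "0 < m" using wm[OF c] by simp
          have "mx j w \<le> m - 1"
          proof (rule mx_le[OF cl(1)])
            fix c assume "w c \<noteq> \<zero>"
            then show "c j \<le> m - 1" using wm[of c] by simp
          qed
          moreover have "mx j s \<le> d" unfolding d_def using j by (intro member_le_sum) auto
          moreover have "e j \<le> mx j s + mx j w"
            using mx_mult_le[OF s(1) cl(1), of j] mx_ge[of "s \<star> w" e j] ne s cl by simp
          ultimately show ?thesis using mp by (simp add: m_def)
        qed
        then show ?thesis using e by (auto simp: C_def cube_def)
      qed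
    qed
    then show "u \<in> box C" using uW by (auto simp: box_def)
  qed
  have q: "1 < card (carrier R)"
  proof -
    have "card {\<zero>, \<one>} \<le> card (carrier R)" using fin_R by (intro card_mono) auto
    then show ?thesis by simp
  qed
  have "\<not> inj_on h (box C1 \<times> box C2)"
  proof
    assume "inj_on h (box C1 \<times> box C2)"
    then have "card (box C1 \<times> box C2) \<le> card (box C)"
      using hB card_box(1)[of C] Cs by (intro card_inj_on_le[of h]) auto
    then have "card (carrier R) ^ (m ^ ?N + T ^ ?N) \<le> card (carrier R) ^ ((p * T) ^ ?N)"
      using card_box Cs C2s by (simp add: card_cartesian_product power_add)
    then show False using count q power_strict_increasing[OF count q] by simp
  qed
  then obtain w z w' z' where wz: "w \<in> box C1" "z \<in> box C2" "w' \<in> box C1" "z' \<in> box C2" "(w, z) \<noteq> (w', z')"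
    "s \<star> w \<oplus>\<^bsub>W\<^esub> z = s \<star> w' \<oplus>\<^bsub>W\<^esub> z'"
    by (auto simp: inj_on_def h_def)
  then have cl: "w \<in> carrier W" "z \<in> carrier W" "w' \<in> carrier W" "z' \<in> carrier W" by (auto simp: box_def)
  have zZ: "z \<in> Zc" "z' \<in> Zc" using wz box2Z by auto
  have eq: "s \<star> (w \<ominus>\<^bsub>W\<^esub> w') = z' \<ominus>\<^bsub>W\<^esub> z"
  proof -
    define a b where "a = s \<star> w" and "b = s \<star> w'"
    have ab: "a \<in> carrier W" "b \<in> carrier W" using cl s by (auto simp: a_def b_def)
    have "a \<ominus>\<^bsub>W\<^esub> b = (a \<oplus>\<^bsub>W\<^esub> z) \<ominus>\<^bsub>W\<^esub> (b \<oplus>\<^bsub>W\<^esub> z)"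
      using ab cl(2) by algebra
    also have "\<dots> = (b \<oplus>\<^bsub>W\<^esub> z') \<ominus>\<^bsub>W\<^esub> (b \<oplus>\<^bsub>W\<^esub> z)" using wz(6) by (simp add: a_def b_def)
    also have "\<dots> = z' \<ominus>\<^bsub>W\<^esub> z"
      using ab cl(2,4) by algebra
    finally show ?thesis using cl s by (simp add: a_def b_def W.minus_eq W.r_distr W.r_minus)
  qed
  have "z' \<ominus>\<^bsub>W\<^esub> z \<in> Zc" using zZ Zc_closed(5,7) by (simp add: W.minus_eq)
  moreover have "w \<noteq> w'"
  proof
    assume "w = w'"
    then have "z = z'"
      using wz(6) W_add_cancel[OF W.m_closed[OF s(1) cl(3)] cl(2,4)] by (simp only:)
    then show False using \<open>w = w'\<close> wz(5) by simp
  qed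
  then have "w \<ominus>\<^bsub>W\<^esub> w' \<noteq> \<zero>\<^bsub>W\<^esub>" using cl by simp
  then have "s \<star> (w \<ominus>\<^bsub>W\<^esub> w') \<noteq> \<zero>\<^bsub>W\<^esub>"
    using W_integral[OF s(1) W.minus_closed[OF cl(1,3)]] s(2) by blast
  ultimately show ?thesis using W.minus_closed[OF cl(1,3)] unfolding eq[symmetric] by blast
qed

section \<open>Division by a central element\<close>

lemma euler_closed [simp]: "v \<in> carrier W \<Longrightarrow> j < 2 * n \<Longrightarrow> euler j v \<in> carrier W"
  by (simp add: shift_pd[symmetric])

lemma euler_central:
  assumes "f \<in> Zc" "w \<in> carrier W" "j < 2 * n"
  shows "euler j (f \<star> w) = f \<star> euler j w"
proof -
  have pf: "pd i f = \<zero>\<^bsub>W\<^esub>" if "i < 2 * n" for i using Zc_iff_pd[of f] assms that by auto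
  have pfw: "pd j (f \<star> w) = f \<star> pd j w" using assms by (simp add: pd_mult pf)
  show ?thesis using assms(3)
  proof (cases rule: index_cases)
    case x
    have "euler j (f \<star> w) = gen j \<star> (f \<star> pd j w)" using x assms by (simp add: euler_x[symmetric] pfw)
    also have "\<dots> = (gen j \<star> f) \<star> pd j w" using x assms by (simp add: W.m_assoc)
    also have "\<dots> = f \<star> (gen j \<star> pd j w)" using x assms Zc_comm[of f "gen j"] by (simp add: W.m_assoc[symmetric])
    finally show ?thesis using x assms by (simp add: euler_x)
  next
    case (d l)
    have "euler j (f \<star> w) = f \<star> pd j w \<star> gen j"
      using d assms euler_d[of l "f \<star> w"] pfw by simp
    then show ?thesis using d assms euler_d[of l w] by (simp add: W.m_assoc)
  qed
qed

lemma euler_add: "v \<in> carrier W \<Longrightarrow> w \<in> carrier W \<Longrightarrow> euler j (v \<oplus>\<^bsub>W\<^esub> w) = euler j v \<oplus>\<^bsub>W\<^esub> euler j w"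
  by (auto simp: euler_def W_add r_distr)

text \<open>The exponent is the order of the unit group. It turns \<open>nc k\<close> into the
  indicator of p not dividing k, so the corresponding power of an Euler operator is a
  projection.\<close>

lemma nc_unit_pow: "\<exists>m::nat. 0 < m \<and> (\<forall>k. nc k [^] m = (if p dvd k then \<zero> else \<one>))"
proof -
  let ?m = "card (Units R)"
  have fin: "finite (Units R)" using fin_R by (rule finite_subset[rotated]) auto
  have m: "0 < ?m" using fin Units_one_closed by (auto simp: card_gt_0_iff)
  have "nc k [^] ?m = (if p dvd k then \<zero> else \<one>)" for k
  proof (cases "p dvd k")
    case True
    then have "nc k = \<zero>" by (simp add: nc_eq_zero_iff)
    then show ?thesis using True m by (simp add: nat_pow_zero)
  next
    case False
    then have "nc k \<in> Units R" using field_Units by (simp add: nc_eq_zero_iff)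
    then show ?thesis using False units_power_order_eq_one[OF fin] by simp
  qed
  then show ?thesis using m by blast
qed

text \<open>The m-th power of the Euler operator in the letter j projects onto the monomials whose
  j-th exponent is not divisible by p, and it commutes with multiplication by the central f. As
  \<open>euler j b\<close> is a multiple of f, so is this projection of b; removing it for every j
  leaves a central element.\<close>

lemma central_part:
  assumes f: "f \<in> Zc" and b: "b \<in> carrier W"
    and pd: "\<And>j. j < 2 * n \<Longrightarrow> \<exists>w\<in>carrier W. pd j b = f \<star> w"
  shows "\<exists>z\<in>Zc. \<exists>w\<in>carrier W. b = z \<oplus>\<^bsub>W\<^esub> f \<star> w"
proof -
  obtain m :: nat where m: "0 < m" "\<And>k. nc k [^] m = (if p dvd k then \<zero> else \<one>)" using nc_unit_pow by blast
  \<comment> \<open>The part of b that remains after treating the first k letters: the terms whose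
    exponents in them are divisible by p.\<close>
  define bk where "bk = (\<lambda>k e. if \<forall>j<k. p dvd e j then b e else \<zero>)"
  have bkW: "bk k \<in> carrier W" for k
    using b unfolding W_carrier by (intro fin_suppI) (auto simp: bk_def fin_suppD intro: rev_finite_subset[OF fin_suppD(2)[OF b[unfolded W_carrier]]] split: if_splits)
  have epow: "(euler j ^^ i) v = (\<lambda>e. nc (e j) [^] i \<otimes> v e)" if "v \<in> carrier W" for j i v
    using that by (induction i) (auto simp: euler_def fun_eq_iff m_ac)
  have ecl: "(euler j ^^ i) v \<in> carrier W" if "v \<in> carrier W" "j < 2 * n" for j i v
    using that by (induction i) auto
  have eadd: "(euler j ^^ i) (v \<oplus>\<^bsub>W\<^esub> w) = (euler j ^^ i) v \<oplus>\<^bsub>W\<^esub> (euler j ^^ i) w"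
    if "v \<in> carrier W" "w \<in> carrier W" "j < 2 * n" for j i v w
    using that by (induction i) (auto simp: euler_add ecl)
  have ecen: "(euler j ^^ i) (f \<star> w) = f \<star> (euler j ^^ i) w" if "w \<in> carrier W" "j < 2 * n" for j i w
    using that by (induction i) (auto simp: euler_central f ecl)
  have eb: "\<exists>w\<in>carrier W. euler j b = f \<star> w" if "j < 2 * n" for j
  proof -
    obtain w where w: "w \<in> carrier W" "pd j b = f \<star> w" using pd \<open>j < 2 * n\<close> by blast
    show ?thesis using \<open>j < 2 * n\<close>
    proof (cases rule: index_cases)
      case x
      have "euler j b = (gen j \<star> f) \<star> w" using x b w f by (simp add: euler_x[symmetric] W.m_assoc)
      also have "\<dots> = f \<star> (gen j \<star> w)" using x w f Zc_comm[of f "gen j"] by (simp add: W.m_assoc[symmetric])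
      finally show ?thesis using x w by (intro bexI[of _ "gen j \<star> w"]) auto
    next
      case (d l)
      have "euler j b = f \<star> (w \<star> gen j)" using d b w f euler_d[of l b] by (simp add: W.m_assoc)
      then show ?thesis using d w by (intro bexI[of _ "w \<star> gen j"]) auto
    qed
  qed
  have ebm: "\<exists>w\<in>carrier W. (euler j ^^ m) b = f \<star> w" if j: "j < 2 * n" for j
  proof -
    obtain w where w: "w \<in> carrier W" "euler j b = f \<star> w" using eb j by blast
    have "(euler j ^^ m) b = (euler j ^^ (m - 1)) (euler j b)" using m(1) by (cases m) (auto simp: funpow_swap1)
    also have "\<dots> = f \<star> (euler j ^^ (m - 1)) w" using w j by (simp add: ecen)
    finally show ?thesis using ecl w j by blast
  qed
  have main: "\<exists>w\<in>carrier W. b = bk k \<oplus>\<^bsub>W\<^esub> f \<star> w" if "k \<le> 2 * n" for k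
    using that
  proof (induction k)
    case 0
    have "bk 0 = b" by (simp add: bk_def)
    then show ?case using b f by (intro bexI[of _ "\<zero>\<^bsub>W\<^esub>"]) auto
  next
    case (Suc k)
    then obtain w where w: "w \<in> carrier W" "b = bk k \<oplus>\<^bsub>W\<^esub> f \<star> w" by auto
    have k: "k < 2 * n" using Suc by simp
    obtain u where u: "u \<in> carrier W" "(euler k ^^ m) b = f \<star> u" using ebm[OF k] by blast
    have "f \<star> u = (euler k ^^ m) (bk k) \<oplus>\<^bsub>W\<^esub> f \<star> (euler k ^^ m) w"
      using w u k f bkW eadd[of "bk k" "f \<star> w" k m] ecen by simp
    then have e1: "(euler k ^^ m) (bk k) = f \<star> (u \<ominus>\<^bsub>W\<^esub> (euler k ^^ m) w)"
      using ecl[OF bkW k, of m] ecl[OF w(1) k, of m] u f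
      by (simp add: W.minus_eq W.r_distr W.r_minus W.a_assoc W.r_neg)
    \<comment> \<open>The projection selects exactly the terms by which \<open>bk k\<close> and
      \<open>bk (Suc k)\<close> differ.\<close>
    have "bk k = bk (Suc k) \<oplus>\<^bsub>W\<^esub> (euler k ^^ m) (bk k)"
    proof
      fix e
      show "bk k e = (bk (Suc k) \<oplus>\<^bsub>W\<^esub> (euler k ^^ m) (bk k)) e"
      proof -
        have "(euler k ^^ m) (bk k) e = (if p dvd e k then \<zero> else bk k e)"
          using bkW by (simp add: epow[OF bkW] m(2))
        then have "(bk (Suc k) \<oplus>\<^bsub>W\<^esub> (euler k ^^ m) (bk k)) e = bk (Suc k) e \<oplus> (if p dvd e k then \<zero> else bk k e)"
          by (simp add: W_add)
        then show ?thesis using b by (auto simp: bk_def less_Suc_eq)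
      qed
    qed
    then have "b = bk (Suc k) \<oplus>\<^bsub>W\<^esub> f \<star> (u \<ominus>\<^bsub>W\<^esub> (euler k ^^ m) w) \<oplus>\<^bsub>W\<^esub> f \<star> w"
      using w(2) e1 by simp
    also have "\<dots> = bk (Suc k) \<oplus>\<^bsub>W\<^esub> f \<star> ((u \<ominus>\<^bsub>W\<^esub> (euler k ^^ m) w) \<oplus>\<^bsub>W\<^esub> w)"
      using bkW f u w ecl[OF w(1) k, of m] by (simp add: W.r_distr W.a_assoc)
    finally show ?case using u w ecl[OF w(1) k, of m] by (intro bexI[of _ "(u \<ominus>\<^bsub>W\<^esub> (euler k ^^ m) w) \<oplus>\<^bsub>W\<^esub> w"]) auto
  qed
  have "bk (2 * n) \<in> Zc"
  proof -
    have "p dvd e j" if ne: "bk (2 * n) e \<noteq> \<zero>" for e j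
    proof (cases "j < 2 * n")
      case True then show ?thesis using ne by (auto simp: bk_def split: if_splits)
    next
      case False
      have "e \<in> exps" using ne bkW[of "2 * n"] by (auto simp: W_carrier fin_suppD)
      then show ?thesis using False by (auto simp: exps_def)
    qed
    then show ?thesis using bkW unfolding Zc_def by blast
  qed
  then show ?thesis using main[of "2 * n"] by blast
qed

end

section \<open>Endomorphisms in characteristic \<open>p\<close>\<close>

lemma (in cring) minors_identity:
  assumes cl: "r \<in> carrier R" "s \<in> carrier R" "t \<in> carrier R" "a \<in> carrier R" "b \<in> carrier R" "c \<in> carrier R"
    "d \<in> carrier R" "m \<in> carrier R"
    and eq: "a \<otimes> t = r \<otimes> m"
  shows "(a \<otimes> s \<oplus> r \<otimes> c) \<otimes> (b \<otimes> t \<oplus> r \<otimes> d) = r \<otimes> (s \<otimes> b \<otimes> m \<oplus> a \<otimes> s \<otimes> d \<oplus> c \<otimes> (b \<otimes> t \<oplus> r \<otimes> d))"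
proof -
  have "(a \<otimes> s \<oplus> r \<otimes> c) \<otimes> (b \<otimes> t \<oplus> r \<otimes> d) = s \<otimes> b \<otimes> (a \<otimes> t) \<oplus> r \<otimes> (a \<otimes> s \<otimes> d \<oplus> c \<otimes> (b \<otimes> t \<oplus> r \<otimes> d))"
    using cl by algebra
  also have "\<dots> = r \<otimes> (s \<otimes> b \<otimes> m \<oplus> a \<otimes> s \<otimes> d \<oplus> c \<otimes> (b \<otimes> t \<oplus> r \<otimes> d))"
    unfolding eq using cl by algebra
  finally show ?thesis .
qed

text \<open>\<open>delta j\<close> is, up to a unit, the partial derivative on the centre by the \<open>j\<close>-th central
  variable \<open>y j\<close>, and \<open>D j\<close> is a derivation that is \<open>phi\<close>-related to it. The existence of
  the \<open>D j\<close> replaces the invertibility of the Jacobian matrix of \<open>phi\<close> on the centre.\<close>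

locale charp_endo = weyl_charp R n p for R (structure) and n p +
  fixes phi :: "((nat \<Rightarrow> nat) \<Rightarrow> 'a) \<Rightarrow> (nat \<Rightarrow> nat) \<Rightarrow> 'a"
    and delta D :: "nat \<Rightarrow> ((nat \<Rightarrow> nat) \<Rightarrow> 'a) \<Rightarrow> (nat \<Rightarrow> nat) \<Rightarrow> 'a" and \<kappa> :: "nat \<Rightarrow> 'a"
  assumes phi_hom: "phi \<in> ring_hom W W"
    and phi_sc: "\<And>a. a \<in> carrier R \<Longrightarrow> phi (sc a) = sc a"
    and phi_Zc: "\<And>z. z \<in> Zc \<Longrightarrow> phi z \<in> Zc"
    and delta_closed: "\<And>j v. j < 2 * n \<Longrightarrow> v \<in> carrier W \<Longrightarrow> delta j v \<in> carrier W"
    and delta_add: "\<And>j v w. j < 2 * n \<Longrightarrow> v \<in> carrier W \<Longrightarrow> w \<in> carrier W \<Longrightarrow> delta j (v \<oplus>\<^bsub>W\<^esub> w) = delta j v \<oplus>\<^bsub>W\<^esub> delta j w"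
    and delta_mult: "\<And>j v w. j < 2 * n \<Longrightarrow> v \<in> carrier W \<Longrightarrow> w \<in> carrier W \<Longrightarrow>
      delta j (v \<star> w) = delta j v \<star> w \<oplus>\<^bsub>W\<^esub> v \<star> delta j w"
    and delta_sc: "\<And>j a. j < 2 * n \<Longrightarrow> a \<in> carrier R \<Longrightarrow> delta j (sc a) = \<zero>\<^bsub>W\<^esub>"
    and delta_y: "\<And>i j. i < 2 * n \<Longrightarrow> j < 2 * n \<Longrightarrow> delta i (y j) = (if i = j then sc (\<kappa> i) else \<zero>\<^bsub>W\<^esub>)"
    and \<kappa>: "\<And>i. i < 2 * n \<Longrightarrow> \<kappa> i \<in> carrier R" "\<And>i. i < 2 * n \<Longrightarrow> \<kappa> i \<noteq> \<zero>"
    and D_closed: "\<And>j v. j < 2 * n \<Longrightarrow> v \<in> carrier W \<Longrightarrow> D j v \<in> carrier W"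
    and D_add: "\<And>j v w. j < 2 * n \<Longrightarrow> v \<in> carrier W \<Longrightarrow> w \<in> carrier W \<Longrightarrow> D j (v \<oplus>\<^bsub>W\<^esub> w) = D j v \<oplus>\<^bsub>W\<^esub> D j w"
    and D_mult: "\<And>j v w. j < 2 * n \<Longrightarrow> v \<in> carrier W \<Longrightarrow> w \<in> carrier W \<Longrightarrow>
      D j (v \<star> w) = D j v \<star> w \<oplus>\<^bsub>W\<^esub> v \<star> D j w"
    and D_phi: "\<And>j v. j < 2 * n \<Longrightarrow> v \<in> carrier W \<Longrightarrow> phi (delta j v) = D j (phi v)"
begin

sublocale phi: ring_hom_ring W W phi
  by (rule ring_hom_ringI2[OF W.ring_axioms W.ring_axioms phi_hom])

text \<open>A derivation that kills scalars is determined on the centre by its values on the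
  \<open>y j\<close>. The formula is \<kappa> times the partial derivative by y_j, in exponents of
  the original generators, which move in steps of p.\<close>

lemma delta_formula:
  assumes "z \<in> Zc" "j < 2 * n"
  shows "delta j z = (\<lambda>e. \<kappa> j \<otimes> (nc (Suc (e j div p)) \<otimes> z (e(j := e j + p))))"
  using assms(1)
proof (induction rule: Zc_induct)
  case one
  have "delta j \<one>\<^bsub>W\<^esub> = \<zero>\<^bsub>W\<^esub>" using delta_sc[of j \<one>] assms by simp
  moreover have "\<one>\<^bsub>W\<^esub> (e(j := e j + p)) = \<zero>" for e :: "nat \<Rightarrow> nat"
    using p_pos by (auto simp: W_one single_def dest!: fun_cong[of _ _ j])
  ultimately show ?case using \<kappa>[OF assms(2)] by (simp only: W_zero nc_closed r_null)
next
  case (add v w)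
  then show ?case using assms \<kappa> by (simp add: delta_add) (auto simp: W_add r_distr fun_eq_iff)
next
  case (sc a v)
  have "delta j (sc a \<star> v) = sc a \<star> delta j v"
    using sc(1,2) assms(2) delta_closed by (simp add: delta_mult delta_sc)
  also have "\<dots> = (\<lambda>e. a \<otimes> delta j v e)" by (rule sc_mult[OF sc(1) delta_closed[OF assms(2) Zc_W[OF sc(2)]]])
  also have "\<dots> = (\<lambda>e. \<kappa> j \<otimes> (nc (Suc (e j div p)) \<otimes> (a \<otimes> v (e(j := e j + p)))))"
  proof
    fix e
    have "a \<otimes> (\<kappa> j \<otimes> (nc (Suc (e j div p)) \<otimes> v (e(j := e j + p)))) = \<kappa> j \<otimes> (nc (Suc (e j div p)) \<otimes> (a \<otimes> v (e(j := e j + p))))"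
      using sc assms \<kappa> coeff_closed[OF Zc_W[OF sc(2)]] by (simp add: m_lcomm)
    then show "a \<otimes> delta j v e = \<kappa> j \<otimes> (nc (Suc (e j div p)) \<otimes> (a \<otimes> v (e(j := e j + p))))"
      unfolding sc(3) .
  qed
  finally show ?case unfolding sc_mult[OF sc(1) Zc_W[OF sc(2)]] .
next
  case (y i v)
  have vc: "v \<in> carrier W" using y by simp
  have yi: "y i \<star> v = (\<lambda>e. if e i < p then \<zero> else v (e(i := e i - p)))" using y_mult y vc by blast
  have dv: "delta j v \<in> carrier W" using delta_closed assms vc by simp
  have yd: "y i \<star> delta j v = (\<lambda>e. if e i < p then \<zero> else delta j v (e(i := e i - p)))" using y_mult y dv by blast
  have eq: "delta j (y i \<star> v) = delta j (y i) \<star> v \<oplus>\<^bsub>W\<^esub> y i \<star> delta j v"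
    using delta_mult y assms vc by simp
  show ?case
  proof (cases "i = j")
    case False
    have "delta j (y i \<star> v) = y i \<star> delta j v"
      using eq False y assms dv vc by (simp add: delta_y)
    also have "\<dots> = (\<lambda>e. \<kappa> j \<otimes> (nc (Suc (e j div p)) \<otimes> (y i \<star> v) (e(j := e j + p))))"
      unfolding yd yi unfolding y.IH using False \<kappa> assms by (auto simp: fun_eq_iff fun_upd_twist)
    finally show ?thesis .
  next
    case True
    have "delta j (y i \<star> v) = (\<lambda>e. \<kappa> j \<otimes> v e \<oplus> (y i \<star> delta j v) e)"
      using eq True y assms dv vc \<kappa> by (simp add: delta_y sc_mult) (simp add: W_add)
    also have "\<dots> = (\<lambda>e. \<kappa> j \<otimes> (nc (Suc (e j div p)) \<otimes> (y i \<star> v) (e(j := e j + p))))"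
    proof
      fix e
      show "\<kappa> j \<otimes> v e \<oplus> (y i \<star> delta j v) e = \<kappa> j \<otimes> (nc (Suc (e j div p)) \<otimes> (y i \<star> v) (e(j := e j + p)))"
      proof (cases "e j < p")
        case lt: True
        then show ?thesis unfolding yd yi using True \<kappa> assms vc by (simp add: nc_Suc)
      next
        case ge: False
        have d: "Suc ((e j - p) div p) = e j div p" using ge p_pos by (simp add: le_div_geq)
        have u: "(e(j := e j - p))(j := (e(j := e j - p)) j + p) = e" using ge by auto
        have "(y i \<star> delta j v) e = \<kappa> j \<otimes> (nc (Suc ((e(j := e j - p)) j div p)) \<otimes> v ((e(j := e j - p))(j := (e(j := e j - p)) j + p)))"
          unfolding yd unfolding y.IH using ge True by simp
        also have "\<dots> = \<kappa> j \<otimes> (nc (e j div p) \<otimes> v e)" unfolding u using d by simp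
        finally have 1: "(y i \<star> delta j v) e = \<kappa> j \<otimes> (nc (e j div p) \<otimes> v e)" .
        have 2: "(y i \<star> v) (e(j := e j + p)) = v e" unfolding yi using True by simp
        show ?thesis unfolding 1 2 using \<kappa> assms vc by (simp add: nc_Suc l_distr r_distr a_comm)
      qed
    qed
    finally show ?thesis .
  qed
qed

lemma delta_supp: "z \<in> Zc \<Longrightarrow> j < 2 * n \<Longrightarrow> delta j z e \<noteq> \<zero> \<Longrightarrow> z (e(j := e j + p)) \<noteq> \<zero>"
  using \<kappa> by (auto simp: delta_formula)

lemma delta_Zc:
  assumes "z \<in> Zc" "j < 2 * n"
  shows "delta j z \<in> Zc"
proof -
  have "p dvd e i" if ne: "delta j z e \<noteq> \<zero>" for e i
  proof -
    have "\<forall>i. p dvd (e(j := e j + p)) i" using delta_supp[OF assms ne] assms(1) unfolding Zc_def by blast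
    then have "p dvd (e(j := e j + p)) i" by blast
    then show ?thesis by (cases "i = j") auto
  qed
  then show ?thesis using delta_closed[OF assms(2) Zc_W[OF assms(1)]] unfolding Zc_def by blast
qed

lemma td_delta:
  assumes "z \<in> Zc" "j < 2 * n" "delta j z \<noteq> \<zero>\<^bsub>W\<^esub>"
  shows "td (delta j z) < td z"
proof -
  have dc: "delta j z \<in> carrier W" using delta_Zc assms by simp
  obtain c where c: "lead (delta j z) c" using lead_exists[OF dc assms(3)] by blast
  then have "z (c(j := c j + p)) \<noteq> \<zero>" using delta_supp assms by (simp add: lead_def)
  then have "tdeg (c(j := c j + p)) \<le> td z" using tdeg_le_td assms by simp
  moreover have "tdeg c < tdeg (c(j := c j + p))" unfolding tdeg_def
    using assms(2) p_pos by (intro sum_strict_mono_ex1) auto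
  ultimately show ?thesis using td_lead[OF dc c] by simp
qed

lemma dg_delta:
  assumes "z \<in> Zc" "j < 2 * n" "dg i z = 0"
  shows "dg i (delta j z) = 0"
proof -
  have "mx i (delta j z) \<le> 0"
  proof (rule mx_le)
    fix e assume "delta j z e \<noteq> \<zero>"
    then have "(e(j := e j + p)) i \<le> mx i z"
      by (intro mx_ge[OF Zc_W[OF assms(1)]] delta_supp[OF assms(1,2)])
    then show "e i \<le> 0" using assms mx_dg[OF assms(1), of i] by (auto split: if_splits)
  qed (use delta_Zc assms in auto)
  then show ?thesis by (simp add: dg_def)
qed

lemma delta_const:
  assumes "z \<in> Zc" "j < 2 * n" "dg j z = 0"
  shows "delta j z = \<zero>\<^bsub>W\<^esub>"
proof (rule ccontr)
  assume "delta j z \<noteq> \<zero>\<^bsub>W\<^esub>"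
  then obtain e where "delta j z e \<noteq> \<zero>" by (auto simp: W_zero)
  then have "z (e(j := e j + p)) \<noteq> \<zero>" using delta_supp assms by blast
  then have "(e(j := e j + p)) j \<le> mx j z" by (rule mx_ge[OF Zc_W[OF assms(1)]])
  then show False using assms mx_dg[OF assms(1), of j] p_pos by simp
qed

text \<open>Vanishing partial derivatives force the exponent of each y_j to be divisible by p, which
  is p * p in the original generators, the hypothesis of \<open>pth_root\<close>.\<close>

lemma delta_zero_root:
  assumes "z \<in> Zc" "\<And>j. j < 2 * n \<Longrightarrow> delta j z = \<zero>\<^bsub>W\<^esub>"
  shows "\<exists>w\<in>Zc. z = w [^]\<^bsub>W\<^esub> p"
proof (rule pth_root)
  fix e j assume ze: "z e \<noteq> \<zero>"
  have pe: "p dvd e j" using assms(1) ze unfolding Zc_def by blast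
  show "p * p dvd e j"
  proof (cases "e j = 0")
    case False
    have "e \<in> exps" using assms(1) ze by (auto simp: Zc_def W_carrier fin_suppD)
    then have j: "j < 2 * n" using False by (auto simp: exps_def intro: leI)
    have le: "p \<le> e j" using pe False by (auto intro: dvd_imp_le)
    let ?e = "e(j := e j - p)"
    have u: "?e(j := ?e j + p) = e" using le by auto
    have d: "Suc (?e j div p) = e j div p" using le p_pos by (simp add: le_div_geq)
    have "delta j z ?e = \<zero>" using assms(2)[OF j] by (simp add: W_zero)
    then have "\<kappa> j \<otimes> (nc (e j div p) \<otimes> z e) = \<zero>" by (simp only: delta_formula[OF assms(1) j] u d)
    then have "nc (e j div p) = \<zero>" using \<kappa>[OF j] ze assms(1) by (simp add: integral_iff)
    then have "p dvd e j div p" by (simp add: nc_eq_zero_iff)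
    then obtain k where "e j div p = p * k" by (auto simp: dvd_def)
    then have "e j = p * p * k" using pe by (metis dvd_mult_div_cancel mult.assoc)
    then show ?thesis by simp
  qed simp
qed (use assms in simp)

lemma W_pow_zero: "v \<in> carrier W \<Longrightarrow> v [^]\<^bsub>W\<^esub> (k::nat) = \<zero>\<^bsub>W\<^esub> \<Longrightarrow> v = \<zero>\<^bsub>W\<^esub>"
proof (induction k)
  case (Suc k) then show ?case using W_integral[of "v [^]\<^bsub>W\<^esub> k" v] by auto
qed simp

lemma td_pow: "v \<in> carrier W \<Longrightarrow> v \<noteq> \<zero>\<^bsub>W\<^esub> \<Longrightarrow> td (v [^]\<^bsub>W\<^esub> (k::nat)) = k * td v"
proof (induction k)
  case 0 then show ?case using PZ.td_one by simp
next
  case (Suc k)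
  then have "v [^]\<^bsub>W\<^esub> k \<noteq> \<zero>\<^bsub>W\<^esub>" using W_pow_zero by blast
  then have "td (v [^]\<^bsub>W\<^esub> k \<star> v) = td (v [^]\<^bsub>W\<^esub> k) + td v"
    by (intro td_mult W.nat_pow_closed Suc.prems)
  then show ?case using Suc by simp
qed

lemma dg_pow: "v \<in> Zc \<Longrightarrow> v \<noteq> \<zero>\<^bsub>W\<^esub> \<Longrightarrow> j < 2 * n \<Longrightarrow> dg j (v [^]\<^bsub>W\<^esub> (k::nat)) = k * dg j v"
proof (induction k)
  case 0 then show ?case using PZ.dg_one by simp
next
  case (Suc k)
  then have "v [^]\<^bsub>W\<^esub> k \<noteq> \<zero>\<^bsub>W\<^esub>" using W_pow_zero[OF Zc_W] by blast
  then have "dg j (v [^]\<^bsub>W\<^esub> k \<star> v) = dg j (v [^]\<^bsub>W\<^esub> k) + dg j v"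
    using PZ.dg_mult[of j "v [^]\<^bsub>W\<^esub> k" v] Suc.prems Zc_pow[OF Suc.prems(1), of k]
    by simp
  then show ?case using Suc by simp
qed

text \<open>Descent on the degree of a kernel element. Its commutators with generators, and then its
  images under the \<open>delta j\<close>, lie in the kernel with smaller degree, so they vanish and
  it is a p-th power of a central element. The root lies in the kernel and has smaller degree,
  unless it is a scalar, and scalars are fixed.\<close>

lemma phi_inj:
  assumes "v \<in> carrier W" "phi v = \<zero>\<^bsub>W\<^esub>"
  shows "v = \<zero>\<^bsub>W\<^esub>"
  using assms
proof (induction "td v" arbitrary: v rule: less_induct)
  case less
  show ?case
  proof (rule ccontr)
    assume nz: "v \<noteq> \<zero>\<^bsub>W\<^esub>"
    have pdz: "pd j v = \<zero>\<^bsub>W\<^esub>" if j: "j < 2 * n" for j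
    proof -
      have "phi (pd j v) = \<zero>\<^bsub>W\<^esub>" using j
      proof (cases rule: index_cases)
        case x
        have "phi (gen (n + j) \<star> v) = phi (v \<star> gen (n + j) \<oplus>\<^bsub>W\<^esub> pd j v)" using comm_d[OF x less.prems(1)] by simp
        then show ?thesis using x less.prems by simp
      next
        case (d l)
        have "phi (v \<star> gen l) = phi (gen l \<star> v \<oplus>\<^bsub>W\<^esub> pd j v)" using comm_x[OF d(2) less.prems(1)] d by simp
        then show ?thesis using d less.prems by simp
      qed
      then show ?thesis using less.hyps[of "pd j v"] td_pd[OF less.prems(1) j] less.prems by auto
    qed
    then have vZ: "v \<in> Zc" using Zc_iff_pd less.prems by simp
    have dz: "delta j v = \<zero>\<^bsub>W\<^esub>" if j: "j < 2 * n" for j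
    proof -
      have "D j \<zero>\<^bsub>W\<^esub> \<oplus>\<^bsub>W\<^esub> D j \<zero>\<^bsub>W\<^esub> = D j \<zero>\<^bsub>W\<^esub>" using D_add[OF j, of "\<zero>\<^bsub>W\<^esub>" "\<zero>\<^bsub>W\<^esub>"] by simp
      then have "D j \<zero>\<^bsub>W\<^esub> = \<zero>\<^bsub>W\<^esub>" using D_closed[OF j, of "\<zero>\<^bsub>W\<^esub>"] by simp
      then have "phi (delta j v) = \<zero>\<^bsub>W\<^esub>" using D_phi[OF j] less.prems by simp
      then show ?thesis using less.hyps[of "delta j v"] td_delta[OF vZ j] delta_Zc[OF vZ j] by auto
    qed
    obtain w where w: "w \<in> Zc" "v = w [^]\<^bsub>W\<^esub> p" using delta_zero_root[OF vZ dz] by blast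
    have "phi w [^]\<^bsub>W\<^esub> p = \<zero>\<^bsub>W\<^esub>" using w less.prems(2) phi.hom_nat_pow[of w p] by simp
    then have pw: "phi w = \<zero>\<^bsub>W\<^esub>" using W_pow_zero w by simp
    have wnz: "w \<noteq> \<zero>\<^bsub>W\<^esub>" using nz w p_pos by (auto simp: W.nat_pow_zero)
    show False
    proof (cases "td w = 0")
      case True
      then have "w = sc (w (\<lambda>_. 0))" using td_zero_iff[of w] w wnz by simp
      then have "phi w = w" using phi_sc[of "w (\<lambda>_. 0)"] w by simp
      then show False using pw wnz by simp
    next
      case False
      then have "td w < td v" using w wnz p_gt1 td_pow[of w p] by simp
      then show False using less.hyps[of w] w pw wnz by simp
    qed
  qed
qed

lemma phi_eq: "v \<in> carrier W \<Longrightarrow> w \<in> carrier W \<Longrightarrow> phi v = phi w \<Longrightarrow> v = w"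
  using phi_inj[of "v \<ominus>\<^bsub>W\<^esub> w"] by (simp add: W.minus_eq phi.hom_a_inv W.r_neg)
    (metis W.a_inv_closed W.minus_equality W.minus_minus W.a_comm)

text \<open>Differentiating z w = w z and cancelling the terms in which z commutes leaves the
  commutator of D_j z with w.\<close>

lemma D_Zc:
  assumes "z \<in> Zc" "j < 2 * n"
  shows "D j z \<in> Zc"
proof (subst Zc_central)
  show "D j z \<in> carrier W" using D_closed assms by simp
  show "\<forall>w\<in>carrier W. D j z \<star> w = w \<star> D j z"
  proof
    fix w assume w: "w \<in> carrier W"
    have cl: "D j z \<in> carrier W" "D j w \<in> carrier W" "z \<in> carrier W" using D_closed assms w by auto
    have "D j (z \<star> w) = D j (w \<star> z)" using Zc_comm[OF assms(1) w] by simp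
    then have "z \<star> D j w \<oplus>\<^bsub>W\<^esub> D j z \<star> w = z \<star> D j w \<oplus>\<^bsub>W\<^esub> w \<star> D j z"
      using assms w cl by (simp add: D_mult Zc_comm[OF assms(1), of "D j w"] W.a_comm)
    then show "D j z \<star> w = w \<star> D j z"
      using W_add_cancel[of "z \<star> D j w" "D j z \<star> w" "w \<star> D j z"] cl w by simp
  qed
qed

lemma dvZ: "PZ.dv a b \<longleftrightarrow> (\<exists>c\<in>Zc. b = a \<star> c)"
  by (simp add: PZ.dv_def)

lemma irrZ: "PZ.irr f \<Longrightarrow> f \<in> Zc" "PZ.irr f \<Longrightarrow> f \<noteq> \<zero>\<^bsub>W\<^esub>" "PZ.irr f \<Longrightarrow> 0 < td f"
  by (auto simp: PZ.irr_def)

lemma irr_not_dv_one: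
  assumes "PZ.irr r" shows "\<not> PZ.dv r \<one>\<^bsub>W\<^esub>"
proof
  assume "PZ.dv r \<one>\<^bsub>W\<^esub>"
  then obtain c where c: "c \<in> Zc" "\<one>\<^bsub>W\<^esub> = r \<star> c" by (auto simp: dvZ)
  then have "c \<noteq> \<zero>\<^bsub>W\<^esub>" using irrZ[OF assms] by auto
  then have "td \<one>\<^bsub>W\<^esub> = td r + td c" using c irrZ[OF assms] td_mult[of r c] by simp
  then show False using PZ.td_one irrZ[OF assms] by simp
qed

text \<open>The contraction of a principal prime of the target is principal: otherwise it contains two
  coprime elements, hence one that is free of some variable in which the first is not constant,
  and the \<open>2\<times>2\<close> minors of their gradients lead to an infinite descent.\<close>

lemma contraction_principal:
  assumes r: "PZ.irr r" and f: "PZ.irr f" "PZ.dv r (phi f)" and h: "h \<in> Zc" "PZ.dv r (phi h)"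
  shows "PZ.dv f h"
proof -
  define P where "P = {h \<in> Zc. PZ.dv r (phi h)}"
  have rZ: "r \<in> Zc" "r \<noteq> \<zero>\<^bsub>W\<^esub>" using irrZ[OF r] by auto
  have PZc: "a \<in> Zc" if "a \<in> P" for a using that by (simp add: P_def)
  have Padd: "a \<oplus>\<^bsub>W\<^esub> b \<in> P" if "a \<in> P" "b \<in> P" for a b
    using that PZ.dv_add[of r "phi a" "phi b"] rZ Zc_closed(7) by (auto simp: P_def)
  have Pmult: "c \<star> a \<in> P" if "a \<in> P" "c \<in> Zc" for a c
  proof -
    have ac: "a \<in> Zc" using that by (simp add: P_def)
    have "PZ.dv r (phi a \<star> phi c)"
      using that PZ.dv_mult[of r "phi a" "phi c"] rZ phi_Zc by (simp add: P_def)
    moreover have "phi a \<star> phi c = phi (c \<star> a)"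
      using that ac Zc_comm[of c a] by simp
    ultimately show ?thesis using that ac Zc_closed(6) by (simp add: P_def)
  qed
  have Pprime: "a \<in> P \<or> b \<in> P" if "a \<in> Zc" "b \<in> Zc" "a \<star> b \<in> P" for a b
    using that PZ.irr_prime[OF r, of "phi a" "phi b"] phi_Zc by (auto simp: P_def)
  have P1: "\<one>\<^bsub>W\<^esub> \<notin> P" using irr_not_dv_one[OF r] by (simp add: P_def)
  have Punit: "0 < td a" if "a \<in> P" "a \<noteq> \<zero>\<^bsub>W\<^esub>" for a
  proof (rule ccontr)
    assume "\<not> 0 < td a"
    moreover note a = \<open>a \<in> P\<close> \<open>a \<noteq> \<zero>\<^bsub>W\<^esub>\<close>
    ultimately obtain w where w: "w \<in> Zc" "a \<star> w = \<one>\<^bsub>W\<^esub>" using td_unit_W[OF PZc] by blast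
    then show False using P1 Pmult[OF a(1) w(1)] Zc_comm[of w a] a PZc by auto
  qed
  have Ppow: "a \<in> P" if "a \<in> Zc" "a [^]\<^bsub>W\<^esub> k \<in> P" for a and k :: nat
    using that
  proof (induction k)
    case 0 then show ?case using P1 by simp
  next
    case (Suc k) then show ?case using Pprime[of "a [^]\<^bsub>W\<^esub> k" a] Zc_pow by auto
  qed
  \<comment> \<open>The common end of two descents: an element of P killed by all derivations has a
    p-th root in P, of smaller degree. Minimality is asked against such roots alone because it is
    applied to elements that are minimal in two different senses.\<close>
  have root: False if e: "e \<in> P" "e \<noteq> \<zero>\<^bsub>W\<^esub>" "\<And>i. i < 2 * n \<Longrightarrow> delta i e = \<zero>\<^bsub>W\<^esub>"
    and min: "\<And>w. w \<in> P \<Longrightarrow> w \<noteq> \<zero>\<^bsub>W\<^esub> \<Longrightarrow> e = w [^]\<^bsub>W\<^esub> p \<Longrightarrow> td e \<le> td w" for e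
  proof -
    obtain w where w: "w \<in> Zc" "e = w [^]\<^bsub>W\<^esub> p" using delta_zero_root[OF PZc[OF e(1)] e(3)] by blast
    have wP: "w \<in> P" using Ppow[OF w(1)] w e by blast
    have wnz: "w \<noteq> \<zero>\<^bsub>W\<^esub>" using w e(2) p_pos by (auto simp: W.nat_pow_zero)
    have "p * td w \<le> td w" using min[OF wP wnz w(2)] td_pow[of w p] w wnz by simp
    then show False using Punit[OF wP wnz] p_gt1 by simp
  qed
  have fP: "f \<in> P" "f \<noteq> \<zero>\<^bsub>W\<^esub>" using f irrZ[OF f(1)] by (auto simp: P_def)
  define m where "m = (LEAST m. \<exists>q\<in>P. q \<noteq> \<zero>\<^bsub>W\<^esub> \<and> td q = m)"
  have "\<exists>q\<in>P. q \<noteq> \<zero>\<^bsub>W\<^esub> \<and> td q = m" unfolding m_def by (rule LeastI[of _ "td f"]) (use fP in auto)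
  then obtain q where q: "q \<in> P" "q \<noteq> \<zero>\<^bsub>W\<^esub>" "td q = m" by blast
  have qmin: "td q \<le> td a" if "a \<in> P" "a \<noteq> \<zero>\<^bsub>W\<^esub>" for a
    unfolding q(3) m_def using that by (auto intro: Least_le)
  have qZ: "q \<in> Zc" using PZc q by blast
  have qirr: "PZ.irr q"
    unfolding PZ.irr_def
  proof (intro conjI ballI impI)
    fix u v assume uv: "u \<in> carrier Zr" "v \<in> carrier Zr" "q = u \<otimes>\<^bsub>Zr\<^esub> v"
    then have uv': "u \<in> Zc" "v \<in> Zc" "q = u \<star> v" by auto
    have nz: "u \<noteq> \<zero>\<^bsub>W\<^esub>" "v \<noteq> \<zero>\<^bsub>W\<^esub>" using uv' q(2) by auto
    have "td q = td u + td v" using uv' nz td_mult by simp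
    moreover have "u \<in> P \<or> v \<in> P" using Pprime uv' q(1) by blast
    ultimately show "td u = 0 \<or> td v = 0" using qmin nz by fastforce
  qed (use qZ q Punit in auto)
  \<comment> \<open>q has least degree in P, so by \<open>root\<close> some derivative of q is
    nonzero. That derivative has smaller degree and hence lies outside P.\<close>
  obtain j where j: "j < 2 * n" "delta j q \<noteq> \<zero>\<^bsub>W\<^esub>"
    using root[OF q(1,2)] qmin by blast
  have djq: "delta j q \<in> Zc" "delta j q \<notin> P"
    using delta_Zc[OF qZ j(1)] td_delta[OF qZ j] qmin[of "delta j q"] j(2) by auto
  have dgq: "0 < dg j q" using delta_const[OF qZ j(1)] j(2) by auto
  have all: "PZ.dv q a" if a: "a \<in> P" for a
  proof (rule ccontr)
    assume nd: "\<not> PZ.dv q a"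
    \<comment> \<open>If q does not divide a, elimination produces nonzero elements of P free of the
      variable j. Let e be one of least degree: \<open>delta j\<close> kills e but not q.\<close>
    define E where "E = {e \<in> P. e \<noteq> \<zero>\<^bsub>W\<^esub> \<and> dg j e = 0}"
    obtain b c where bc: "b \<in> Zc" "c \<in> Zc" "b \<star> q \<oplus>\<^bsub>W\<^esub> c \<star> a \<noteq> \<zero>\<^bsub>W\<^esub>" "dg j (b \<star> q \<oplus>\<^bsub>W\<^esub> c \<star> a) = 0"
      using PZ.elimination[OF qirr j(1) dgq _ nd] PZc[OF a] by auto
    then have "b \<star> q \<oplus>\<^bsub>W\<^esub> c \<star> a \<in> E" using Padd Pmult q(1) a by (auto simp: E_def)
    then have ex: "\<exists>e. e \<in> E" by blast
    obtain e where e: "e \<in> E" "\<And>w. w \<in> E \<Longrightarrow> td e \<le> td w"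
      using ex arg_min_natI[of "\<lambda>e. e \<in> E" _ td] arg_min_nat_le[of "\<lambda>e. e \<in> E" _ td] by metis
    have eP: "e \<in> P" "e \<noteq> \<zero>\<^bsub>W\<^esub>" "dg j e = 0" using e by (auto simp: E_def)
    have eZ: "e \<in> Zc" using PZc eP by blast
    have dje: "delta j e = \<zero>\<^bsub>W\<^esub>" using delta_const[OF eZ j(1) eP(3)] .
    obtain s where s: "s \<in> Zc" "phi q = r \<star> s" using q(1) by (auto simp: P_def dvZ)
    obtain t where t: "t \<in> Zc" "phi e = r \<star> t" using eP(1) by (auto simp: P_def dvZ)
    have D0: "D j r \<star> t \<oplus>\<^bsub>W\<^esub> r \<star> D j t = \<zero>\<^bsub>W\<^esub>"
      using D_phi[OF j(1), of e] eZ t rZ j by (simp add: dje D_mult)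
    define M where "M = \<ominus>\<^bsub>W\<^esub> (D j t)"
    have Dt: "D j t \<in> Zc" "D j r \<in> Zc" "D j s \<in> Zc" using D_Zc t rZ s j by auto
    have M: "M \<in> Zc" "D j r \<star> t = r \<star> M"
      using D0 Dt t rZ Zc_closed(5)[OF Dt(1)] W.minus_equality[OF D0]
      by (auto simp: M_def W.r_minus)
    have "delta i e = \<zero>\<^bsub>W\<^esub>" if i: "i < 2 * n" for i
    proof (rule ccontr)
      assume nz: "delta i e \<noteq> \<zero>\<^bsub>W\<^esub>"
      have die: "delta i e \<in> Zc" using delta_Zc[OF eZ i] .
      have Di: "D i r \<in> Zc" "D i t \<in> Zc" using D_Zc rZ t i by auto
      \<comment> \<open>As \<open>delta j e\<close> vanishes, this product is a full 2x2 minor of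
        the gradients of q and e. Its image is a multiple of r, so it lies in P. The first factor
        does not, hence the second does, against the choice of e.\<close>
      have "phi (delta j q \<star> delta i e) = D j (phi q) \<star> D i (phi e)"
        using djq die D_phi i j qZ eZ by simp
      also have "\<dots> = (D j r \<star> s \<oplus>\<^bsub>W\<^esub> r \<star> D j s) \<star> (D i r \<star> t \<oplus>\<^bsub>W\<^esub> r \<star> D i t)"
        unfolding s(2) t(2) using rZ s t i j by (simp add: D_mult)
      also have "\<dots> = r \<star> (s \<star> D i r \<star> M \<oplus>\<^bsub>W\<^esub> D j r \<star> s \<star> D i t \<oplus>\<^bsub>W\<^esub> D j s \<star> (D i r \<star> t \<oplus>\<^bsub>W\<^esub> r \<star> D i t))"
        using PZ.minors_identity[of r s t "D j r" "D i r" "D j s" "D i t" M] rZ s t Dt Di M by simp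
      finally have "PZ.dv r (phi (delta j q \<star> delta i e))"
        using rZ s t Dt Di M unfolding dvZ by (blast intro: Zc_closed(6,7))
      then have "delta j q \<star> delta i e \<in> P" using djq die Zc_closed(6) by (auto simp: P_def)
      then have "delta i e \<in> P" using Pprime djq die by blast
      then have "delta i e \<in> E" using nz dg_delta[OF eZ i eP(3)] by (simp add: E_def)
      then show False using e(2)[of "delta i e"] td_delta[OF eZ i nz] by simp
    qed
    then show False
    proof (intro root[OF eP(1,2)])
      fix w assume w: "w \<in> P" "w \<noteq> \<zero>\<^bsub>W\<^esub>" "e = w [^]\<^bsub>W\<^esub> p"
      then have "dg j w = 0" using dg_pow[of w j p] PZc j eP(3) p_pos by simp
      then show "td e \<le> td w" using e(2)[of w] w by (simp add: E_def)
    qed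
  qed
  \<comment> \<open>q generates P; the irreducible f lies in P, so it is q times a unit and
    generates P as well.\<close>
  obtain c where c: "c \<in> Zc" "f = q \<star> c" using all[OF fP(1)] by (auto simp: dvZ)
  have "td q = 0 \<or> td c = 0" using PZ.irr_factors[OF f(1), of q c] c qZ by simp
  then have tc: "td c = 0" using Punit q by fastforce
  have "c \<noteq> \<zero>\<^bsub>W\<^esub>" using c fP(2) qZ by auto
  then obtain c' where c': "c' \<in> Zc" "c \<star> c' = \<one>\<^bsub>W\<^esub>" using td_unit_W c tc by blast
  have "h \<in> P" using h by (simp add: P_def)
  then obtain k where k: "k \<in> Zc" "h = q \<star> k" using all by (auto simp: dvZ)
  have "f \<star> (c' \<star> k) = q \<star> ((c \<star> c') \<star> k)" using c c'(1) k qZ by (simp add: W.m_assoc)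
  then have "h = f \<star> (c' \<star> k)" using c' k by simp
  then show ?thesis unfolding dvZ using Zc_closed(6)[OF c'(1) k(1)] by blast
qed

lemma central_cofactor:
  assumes "r \<in> Zc" "r \<noteq> \<zero>\<^bsub>W\<^esub>" "u \<in> carrier W" "r \<star> u \<in> Zc"
  shows "u \<in> Zc"
proof (subst Zc_central[OF assms(3)], rule ballI)
  fix w assume w: "w \<in> carrier W"
  have "r \<star> (u \<star> w) = (r \<star> u) \<star> w" using assms w by (simp add: W.m_assoc)
  also have "\<dots> = w \<star> (r \<star> u)" by (rule Zc_comm[OF assms(4) w])
  also have "\<dots> = (w \<star> r) \<star> u" using assms w by (simp add: W.m_assoc)
  also have "w \<star> r = r \<star> w" using Zc_comm[OF assms(1) w] by simp
  also have "r \<star> w \<star> u = r \<star> (w \<star> u)" using assms w by (simp add: W.m_assoc)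
  finally show "u \<star> w = w \<star> u" using W_cancel_left[of "u \<star> w" "w \<star> u" r] assms w by simp
qed

text \<open>Derivatives of b are commutators with generators, so their images are again multiples of
  r, and by induction on degree they are multiples of f. By \<open>central_part\<close>, b is
  central up to a multiple of f, and the central part falls under the commutative statement.\<close>

lemma ideal_contraction:
  assumes r: "PZ.irr r" and f: "PZ.irr f" "PZ.dv r (phi f)"
    and b: "b \<in> carrier W" "\<exists>t\<in>carrier W. phi b = r \<star> t"
  shows "\<exists>w\<in>carrier W. b = f \<star> w"
  using b
proof (induction "td b" arbitrary: b rule: less_induct)
  case less
  have fZ: "f \<in> Zc" and rZ: "r \<in> Zc" "r \<noteq> \<zero>\<^bsub>W\<^esub>" using irrZ f(1) r by auto
  have b: "b \<in> carrier W" using less.prems by simp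
  obtain t where t: "t \<in> carrier W" "phi b = r \<star> t" using less.prems by blast
  have comm: "a \<star> (r \<star> c) = r \<star> (a \<star> c)" if "a \<in> carrier W" "c \<in> carrier W" for a c
  proof -
    have "a \<star> (r \<star> c) = (a \<star> r) \<star> c" using that rZ by (simp add: W.m_assoc)
    also have "a \<star> r = r \<star> a" using Zc_comm[OF rZ(1) that(1)] by simp
    finally show ?thesis using that rZ by (simp add: W.m_assoc)
  qed
  have diff: "c = r \<star> (u \<ominus>\<^bsub>W\<^esub> v)"
    if "r \<star> u = r \<star> v \<oplus>\<^bsub>W\<^esub> c" "u \<in> carrier W" "v \<in> carrier W" "c \<in> carrier W" for u v c
  proof -
    have "r \<star> (u \<ominus>\<^bsub>W\<^esub> v) = r \<star> u \<ominus>\<^bsub>W\<^esub> r \<star> v"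
      using that(2,3) rZ by (simp add: W.minus_eq W.r_distr W.r_minus)
    also have "\<dots> = c" unfolding that(1)
      using that(2-4) rZ W.a_comm[of "r \<star> v" c] by (simp add: W.minus_eq W.a_assoc W.r_neg)
    finally show ?thesis by simp
  qed
  have "\<exists>w\<in>carrier W. pd j b = f \<star> w" if j: "j < 2 * n" for j
  proof (cases "pd j b = \<zero>\<^bsub>W\<^esub>")
    case True then show ?thesis using fZ by (intro bexI[of _ "\<zero>\<^bsub>W\<^esub>"]) auto
  next
    case False
    have "\<exists>u\<in>carrier W. phi (pd j b) = r \<star> u" using j
    proof (cases rule: index_cases)
      case x
      let ?g = "phi (gen (n + j))"
      have g: "?g \<in> carrier W" using x by simp
      have "?g \<star> phi b = phi b \<star> ?g \<oplus>\<^bsub>W\<^esub> phi (pd j b)"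
        using arg_cong[OF comm_d[OF x b], of phi] b x by simp
      then have "r \<star> (?g \<star> t) = r \<star> (t \<star> ?g) \<oplus>\<^bsub>W\<^esub> phi (pd j b)"
        using t g comm rZ by (simp add: W.m_assoc)
      then have "phi (pd j b) = r \<star> (?g \<star> t \<ominus>\<^bsub>W\<^esub> t \<star> ?g)"
        using t g b by (intro diff) auto
      then show ?thesis using t g by blast
    next
      case (d l)
      let ?g = "phi (gen l)"
      have g: "?g \<in> carrier W" using d by simp
      have "phi b \<star> ?g = ?g \<star> phi b \<oplus>\<^bsub>W\<^esub> phi (pd j b)"
        using arg_cong[OF comm_x[OF d(2) b], of phi] b d by simp
      then have "r \<star> (t \<star> ?g) = r \<star> (?g \<star> t) \<oplus>\<^bsub>W\<^esub> phi (pd j b)"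
        using t g comm rZ by (simp add: W.m_assoc)
      then have "phi (pd j b) = r \<star> (t \<star> ?g \<ominus>\<^bsub>W\<^esub> ?g \<star> t)"
        using t g b by (intro diff) auto
      then show ?thesis using t g by blast
    qed
    then show ?thesis using less.hyps[OF td_pd[OF b j False]] b by simp
  qed
  then obtain z w where zw: "z \<in> Zc" "w \<in> carrier W" "b = z \<oplus>\<^bsub>W\<^esub> f \<star> w"
    using central_part[OF fZ b] by blast
  obtain s where s: "s \<in> Zc" "phi f = r \<star> s" using f(2) by (auto simp: dvZ)
  have "r \<star> t = phi z \<oplus>\<^bsub>W\<^esub> r \<star> (s \<star> phi w)"
    using zw t s rZ fZ by (simp add: W.m_assoc)
  then have pz: "phi z = r \<star> (t \<ominus>\<^bsub>W\<^esub> s \<star> phi w)"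
    using t s zw rZ by (simp add: W.minus_eq W.r_distr W.r_minus W.a_assoc W.r_neg)
  have "t \<ominus>\<^bsub>W\<^esub> s \<star> phi w \<in> carrier W" using t s zw by simp
  moreover have "r \<star> (t \<ominus>\<^bsub>W\<^esub> s \<star> phi w) \<in> Zc" using phi_Zc[OF zw(1)] unfolding pz .
  ultimately have "t \<ominus>\<^bsub>W\<^esub> s \<star> phi w \<in> Zc" by (rule central_cofactor[OF rZ])
  then have "PZ.dv r (phi z)" using pz unfolding dvZ by blast
  then obtain z' where z': "z' \<in> Zc" "z = f \<star> z'"
    using contraction_principal[OF r f zw(1)] by (auto simp: dvZ)
  have "b = f \<star> (z' \<oplus>\<^bsub>W\<^esub> w)"
    by (rule trans[OF zw(3)], subst z'(2), rule W.r_distr[symmetric, OF Zc_W[OF z'(1)] zw(2) Zc_W[OF fZ]])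
  moreover have "z' \<oplus>\<^bsub>W\<^esub> w \<in> carrier W" by (rule W.a_closed[OF Zc_W[OF z'(1)] zw(2)])
  ultimately show ?case by blast
qed

text \<open>One irreducible factor f of c is cancelled at a time. The image of f is no scalar, as
  phi is injective and fixes scalars, so an irreducible r divides it. Then r divides
  \<open>phi b\<close>, and \<open>ideal_contraction\<close> extracts the factor f from b.\<close>

lemma cancel_central_denominator:
  assumes "c \<in> Zc" "c \<noteq> \<zero>\<^bsub>W\<^esub>" "a \<in> carrier W" "b \<in> carrier W" "a \<star> phi c = phi b"
  shows "\<exists>b'\<in>carrier W. a = phi b'"
  using assms
proof (induction "td c" arbitrary: a b c rule: less_induct)
  case less
  show ?case
  proof (cases "td c = 0")
    case True
    then obtain w where w: "w \<in> Zc" "c \<star> w = \<one>\<^bsub>W\<^esub>" using td_unit_W less.prems by blast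
    have "a = a \<star> phi (c \<star> w)" using w less.prems by simp
    also have "\<dots> = phi b \<star> phi w" using w(1) less.prems by (simp add: W.m_assoc[symmetric])
    finally show ?thesis using w less.prems by (intro bexI[of _ "b \<star> w"]) auto
  next
    case False
    then obtain f c' where fc: "PZ.irr f" "c' \<in> Zc" "c = f \<star> c'"
      using PZ.exists_irr[of c] less.prems by (auto simp: dvZ)
    have fZ: "f \<in> Zc" "f \<noteq> \<zero>\<^bsub>W\<^esub>" "0 < td f" using irrZ fc by auto
    have c'nz: "c' \<noteq> \<zero>\<^bsub>W\<^esub>" using less.prems fc fZ by auto
    have lt: "td c' < td c" using fc fZ c'nz td_mult[of f c'] by simp
    have pfZ: "phi f \<in> Zc" using phi_Zc fZ by simp
    have pfnz: "phi f \<noteq> \<zero>\<^bsub>W\<^esub>" using phi_inj[of f] fZ by auto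
    have "0 < td (phi f)"
    proof (rule ccontr)
      assume "\<not> 0 < td (phi f)"
      then have t0: "td (phi f) = 0" by simp
      define c0 where "c0 = phi f (\<lambda>_. 0)"
      have c0: "c0 \<in> carrier R" "phi f = sc c0"
        unfolding c0_def by (rule coeff_closed[OF Zc_W[OF pfZ]], rule iffD1[OF td_zero_iff[OF Zc_W[OF pfZ] pfnz] t0])
      have "phi f = phi (sc c0)" unfolding phi_sc[OF c0(1)] by (rule c0(2))
      then have f: "f = sc c0" by (rule phi_eq[OF Zc_W[OF fZ(1)] sc_closed[OF c0(1)]])
      have "sc c0 (\<lambda>_. 0) = c0" by (simp add: sc_def single_def)
      then have "td f = 0" using td_zero_iff[OF sc_closed[OF c0(1)]] fZ(2) unfolding f by simp
      then show False using fZ by simp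
    qed
    then obtain r where r: "PZ.irr r" "PZ.dv r (phi f)" using PZ.exists_irr[of "phi f"] pfZ pfnz by auto
    then obtain s where s: "s \<in> Zc" "phi f = r \<star> s" by (auto simp: dvZ)
    define a1 where "a1 = a \<star> phi c'"
    have a1: "a1 \<in> carrier W" using less.prems fc by (simp add: a1_def)
    have rZ: "r \<in> Zc" using irrZ r by simp
    have eq: "phi f \<star> a1 = phi b"
    proof -
      have "phi f \<star> a1 = (a \<star> phi f) \<star> phi c'"
        using less.prems fc fZ Zc_comm[OF pfZ, of a] Zc_comm[OF pfZ, of a1] a1 pfZ
        by (simp add: a1_def W.m_assoc[symmetric])
      then show ?thesis using less.prems fc fZ by (simp add: W.m_assoc)
    qed
    have "phi b = r \<star> (s \<star> a1)" using eq s rZ a1 by (simp add: W.m_assoc)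
    moreover have "s \<star> a1 \<in> carrier W" using s a1 by simp
    ultimately have "\<exists>w\<in>carrier W. b = f \<star> w"
      by (intro ideal_contraction[OF r(1) fc(1) r(2) less.prems(4)] bexI)
    then obtain b1 where b1: "b1 \<in> carrier W" "b = f \<star> b1" by blast
    have "a1 = phi b1" using W_cancel_left[of a1 "phi b1" "phi f"] eq b1 a1 fZ pfnz by simp
    then show ?thesis using less.hyps[OF lt fc(2) c'nz less.prems(3) b1(1)] by (simp add: a1_def)
  qed
qed

text \<open>Multiplying the relation on the right by \<open>phi s'\<close>, where s s' is central
  and nonzero, makes the denominator central.\<close>

theorem left_multiple:
  assumes "g \<in> carrier W" "s \<in> carrier W" "b \<in> carrier W" "phi s \<noteq> \<zero>\<^bsub>W\<^esub>" "g \<star> phi s = phi b"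
  shows "\<exists>c\<in>carrier W. b = c \<star> s"
proof -
  have "s \<noteq> \<zero>\<^bsub>W\<^esub>" using assms by auto
  then obtain s' where s': "s' \<in> carrier W" "s \<star> s' \<in> Zc" "s \<star> s' \<noteq> \<zero>\<^bsub>W\<^esub>" using central_multiple assms by blast
  have "g \<star> phi (s \<star> s') = phi (b \<star> s')"
    using assms s' by (simp add: W.m_assoc[symmetric])
  then obtain c where c: "c \<in> carrier W" "g = phi c"
    using cancel_central_denominator[OF s'(2,3) assms(1), of "b \<star> s'"] s' assms by auto
  have "phi (c \<star> s) = phi b" using c assms by simp
  then have "b = c \<star> s" by (intro phi_eq[OF assms(3) W.m_closed[OF c(1) assms(2)]]) (rule sym)
  then show ?thesis using c by blast
qed

end

section \<open>Zariski's lemma\<close>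

text \<open>Inverting the single element g makes every nonzero element of S invertible; a domain
  with such an element is called a G-domain. The property is passed down from a field to its subring
  of integers, where it fails in characteristic zero.\<close>

definition (in ring) denominator :: "'a set \<Rightarrow> 'a \<Rightarrow> bool" where
  "denominator S g \<longleftrightarrow> g \<in> S \<and> g \<noteq> \<zero> \<and> (\<forall>u\<in>S - {\<zero>}. \<exists>i::nat. \<exists>v\<in>S. u \<otimes> v = g [^] i)"

locale ring_adjunction = field R for R (structure) +
  fixes D t
  assumes subring_D: "subring D R" and t_closed [simp]: "t \<in> carrier R"
begin

lemma D_closed [simp]:
  "c \<in> D \<Longrightarrow> c \<in> carrier R" "\<zero> \<in> D" "\<one> \<in> D" "c \<in> D \<Longrightarrow> \<ominus> c \<in> D"
  "c \<in> D \<Longrightarrow> d \<in> D \<Longrightarrow> c \<otimes> d \<in> D" "c \<in> D \<Longrightarrow> d \<in> D \<Longrightarrow> c \<oplus> d \<in> D"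
  using subringE[OF subring_D] by auto

lemma D_pow [simp]: "c \<in> D \<Longrightarrow> c [^] (i::nat) \<in> D"
  by (induction i) auto

lemma pow_nonzero: "c \<in> carrier R \<Longrightarrow> c \<noteq> \<zero> \<Longrightarrow> c [^] (i::nat) \<noteq> \<zero>"
  by (induction i) (auto simp: integral_iff)

text \<open>The values at t of polynomials over D of degree less than k. Unless powers of t are
  independent, an element may have several such expressions.\<close>

primrec below :: "nat \<Rightarrow> 'a set" where
  "below 0 = {\<zero>}"
| "below (Suc k) = {m \<oplus> c \<otimes> t [^] k | m c. m \<in> below k \<and> c \<in> D}"

lemma belowI: "m \<in> below k \<Longrightarrow> c \<in> D \<Longrightarrow> m \<oplus> c \<otimes> t [^] k \<in> below (Suc k)"
  by auto

lemma below_closed [simp]: "x \<in> below k \<Longrightarrow> x \<in> carrier R"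
  by (induction k arbitrary: x) auto

lemma below_Suc: "x \<in> below k \<Longrightarrow> x \<in> below (Suc k)"
  using belowI[of x k \<zero>] by simp

lemma below_mono: "k \<le> l \<Longrightarrow> x \<in> below k \<Longrightarrow> x \<in> below l"
  by (induction l rule: dec_induct) (auto simp del: below.simps intro: below_Suc)

lemma below_zero [simp]: "\<zero> \<in> below k"
  using below_mono[of 0 k] by simp

lemma below_add [simp]: "x \<in> below k \<Longrightarrow> y \<in> below k \<Longrightarrow> x \<oplus> y \<in> below k"
proof (induction k arbitrary: x y)
  case (Suc k)
  then obtain m c m' c' where *: "m \<in> below k" "c \<in> D" "m' \<in> below k" "c' \<in> D"
    "x = m \<oplus> c \<otimes> t [^] k" "y = m' \<oplus> c' \<otimes> t [^] k" by auto
  have "x \<oplus> y = (m \<oplus> m') \<oplus> (c \<oplus> c') \<otimes> t [^] k"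
    unfolding *(5,6) using *(1-4) by (simp add: l_distr a_ac)
  then show ?case using belowI[OF Suc.IH[OF *(1,3)]] * by simp
qed simp

lemma below_scale [simp]: "d \<in> D \<Longrightarrow> x \<in> below k \<Longrightarrow> d \<otimes> x \<in> below k"
proof (induction k arbitrary: x)
  case (Suc k)
  then obtain m c where *: "m \<in> below k" "c \<in> D" "x = m \<oplus> c \<otimes> t [^] k" by auto
  have "d \<otimes> x = d \<otimes> m \<oplus> (d \<otimes> c) \<otimes> t [^] k"
    unfolding *(3) using * Suc.prems by (simp add: r_distr m_assoc)
  then show ?case using belowI[OF Suc.IH[OF Suc.prems(1) *(1)]] * Suc.prems by simp
qed simp

lemma below_minus [simp]: "x \<in> below k \<Longrightarrow> \<ominus> x \<in> below k"
  using below_scale[of "\<ominus> \<one>" x k] by (simp add: l_minus)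

lemma below_t: "x \<in> below k \<Longrightarrow> t \<otimes> x \<in> below (Suc k)"
proof (induction k arbitrary: x)
  case 0 then show ?case using below_zero[of "Suc 0"] by (simp del: below.simps(2))
next
  case (Suc k)
  then obtain m c where *: "m \<in> below k" "c \<in> D" "x = m \<oplus> c \<otimes> t [^] k" by auto
  have "t \<otimes> x = t \<otimes> m \<oplus> c \<otimes> t [^] Suc k"
    unfolding *(3) using * by (simp add: r_distr m_ac)
  then show ?case using belowI[OF Suc.IH[OF *(1)] *(2)] by simp
qed

lemma below_const: "c \<in> D \<Longrightarrow> 0 < k \<Longrightarrow> c \<in> below k"
  using below_mono[of "Suc 0" k c] belowI[of \<zero> 0 c] by simp

lemma below_pow: "x \<in> below e \<Longrightarrow> t [^] (k::nat) \<otimes> x \<in> below (e + k)"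
proof (induction k)
  case (Suc k)
  have "t [^] Suc k \<otimes> x = t \<otimes> (t [^] k \<otimes> x)" using Suc.prems by (simp add: m_ac)
  then show ?case using below_t[OF Suc.IH[OF Suc.prems]] by (simp del: below.simps)
qed simp

lemma below_mult: "x \<in> below k \<Longrightarrow> y \<in> below l \<Longrightarrow> x \<otimes> y \<in> below (k + l)"
proof (induction k arbitrary: x)
  case 0 then show ?case by simp
next
  case (Suc k)
  then obtain m c where *: "m \<in> below k" "c \<in> D" "x = m \<oplus> c \<otimes> t [^] k" by auto
  have "x \<otimes> y = m \<otimes> y \<oplus> c \<otimes> (t [^] k \<otimes> y)"
    unfolding *(3) using * Suc.prems by (simp add: l_distr m_assoc)
  moreover have "m \<otimes> y \<oplus> c \<otimes> (t [^] k \<otimes> y) \<in> below (k + l)"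
    using Suc.IH[OF *(1) Suc.prems(2)] below_pow[OF Suc.prems(2), of k] *(2) by (simp add: add.commute)
  ultimately show ?case using below_Suc by (simp del: below.simps)
qed

lemma horner: "x \<in> below (Suc k) \<Longrightarrow> \<exists>c\<in>D. \<exists>m\<in>below k. x = c \<oplus> t \<otimes> m"
proof (induction k arbitrary: x)
  case 0
  then obtain c where "c \<in> D" "x = c" by auto
  then show ?case by (intro bexI[of _ c] bexI[of _ \<zero>]) auto
next
  case (Suc k)
  then obtain m c where *: "m \<in> below (Suc k)" "c \<in> D" "x = m \<oplus> c \<otimes> t [^] Suc k"
    unfolding below.simps(2)[of "Suc k"] by auto
  obtain c' m' where m: "c' \<in> D" "m' \<in> below k" "m = c' \<oplus> t \<otimes> m'" using Suc.IH[OF *(1)] by blast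
  have "x = c' \<oplus> t \<otimes> (m' \<oplus> c \<otimes> t [^] k)"
    unfolding *(3) m(3) using * m by (simp add: r_distr m_ac a_assoc)
  then show ?case using m(1) belowI[OF m(2) *(2)] by blast
qed

lemma top_coefficient:
  "x \<in> below k \<Longrightarrow> x \<noteq> \<zero> \<Longrightarrow> \<exists>j<k. \<exists>c\<in>D - {\<zero>}. \<exists>m\<in>below j. x = m \<oplus> c \<otimes> t [^] j"
proof (induction k)
  case (Suc k)
  then obtain m c where *: "m \<in> below k" "c \<in> D" "x = m \<oplus> c \<otimes> t [^] k" by auto
  show ?case
  proof (cases "c = \<zero>")
    case True
    then have "x \<in> below k" using * by simp
    then show ?thesis using Suc.IH Suc.prems by (meson less_SucI)
  next
    case False
    then show ?thesis using * by blast
  qed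
qed simp

definition adj :: "'a set" where
  "adj = (\<Union>k. below k)"

lemma adj_closed: "x \<in> adj \<Longrightarrow> x \<in> carrier R"
  by (auto simp: adj_def)

lemma D_adj: "c \<in> D \<Longrightarrow> c \<in> adj"
  using below_const[of c 1] by (auto simp: adj_def simp del: below.simps)

lemma t_adj: "t \<in> adj"
  using below_t[OF below_const[of \<one> 1]] by (auto simp: adj_def simp del: below.simps)

lemma adj_subring: "subring adj R"
proof (rule subringI)
  fix x y assume "x \<in> adj" "y \<in> adj"
  then obtain k l where kl: "x \<in> below k" "y \<in> below l" by (auto simp: adj_def)
  then show "x \<otimes> y \<in> adj" using below_mult[of x k y l] by (auto simp: adj_def)
  have "x \<in> below (max k l)" "y \<in> below (max k l)" using kl below_mono by (meson max.cobounded1 max.cobounded2)+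
  then show "x \<oplus> y \<in> adj" using below_add[of x "max k l" y] unfolding adj_def by blast
next
  show "\<ominus> x \<in> adj" if "x \<in> adj" for x using that below_minus unfolding adj_def by blast
qed (use D_adj adj_closed in auto)

lemma adj_pow: "x \<in> adj \<Longrightarrow> x [^] (i::nat) \<in> adj"
  by (induction i) (simp_all add: D_adj subringE(6)[OF adj_subring])

text \<open>Linear independence of 1, t, ..., t^(d-1) over D, phrased through the top
  coefficient.\<close>

definition indep :: "nat \<Rightarrow> bool" where
  "indep d \<longleftrightarrow> (\<forall>k<d. \<forall>c\<in>D. \<forall>m\<in>below k. m \<oplus> c \<otimes> t [^] k = \<zero> \<longrightarrow> c = \<zero>)"

lemma indepD: "indep d \<Longrightarrow> k < d \<Longrightarrow> c \<in> D \<Longrightarrow> m \<in> below k \<Longrightarrow> m \<oplus> c \<otimes> t [^] k = \<zero> \<Longrightarrow> c = \<zero>"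
  unfolding indep_def by blast

text \<open>Independence read at the constant term: a nonzero m has a nonzero top coefficient, which
  t m carries at one power higher, so m = 0 and c = 0.\<close>

lemma indep_const:
  assumes "indep d" "Suc k \<le> d" "c \<in> D" "m \<in> below k" "c \<oplus> t \<otimes> m = \<zero>"
  shows "c = \<zero>"
proof (cases "m = \<zero>")
  case True
  then show ?thesis using assms by simp
next
  case False
  then obtain j c' m' where j: "j < k" "c' \<in> D" "c' \<noteq> \<zero>" "m' \<in> below j" "m = m' \<oplus> c' \<otimes> t [^] j"
    using top_coefficient[OF assms(4)] by blast
  have "(c \<oplus> t \<otimes> m') \<oplus> c' \<otimes> t [^] Suc j = c \<oplus> t \<otimes> m"
    unfolding j(5) using j assms by (simp add: r_distr m_ac a_assoc)
  moreover have "c \<oplus> t \<otimes> m' \<in> below (Suc j)"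
    by (rule below_add[OF below_const[OF assms(3)] below_t[OF j(4)]]) simp
  ultimately have "c' = \<zero>" using indepD[OF assms(1), of "Suc j" c'] j assms by simp
  then show ?thesis using j by simp
qed

lemma one_minus_pow:
  assumes "u \<in> adj"
  shows "\<exists>y\<in>adj. (\<one> \<ominus> u) [^] (i::nat) = \<one> \<oplus> u \<otimes> y"
proof (induction i)
  case 0 then show ?case using D_adj[of \<zero>] assms adj_closed by (intro bexI[of _ \<zero>]) auto
next
  case (Suc i)
  then obtain y where y: "y \<in> adj" "(\<one> \<ominus> u) [^] i = \<one> \<oplus> u \<otimes> y" by blast
  have c: "u \<in> carrier R" "y \<in> carrier R" using assms y adj_closed by auto
  have "(\<one> \<ominus> u) [^] Suc i = \<one> \<oplus> u \<otimes> (y \<otimes> (\<one> \<ominus> u) \<ominus> \<one>)"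
    unfolding nat_pow_Suc y(2) using c by algebra
  moreover have "y \<otimes> (\<one> \<ominus> u) \<ominus> \<one> \<in> adj"
    using assms y D_adj[of \<one>] subringE[OF adj_subring] by (simp add: minus_eq)
  ultimately show ?case by blast
qed

text \<open>If \<open>t\<close> were transcendental, then \<open>1 + t g\<close> would be a non-constant unit of \<open>D[t]\<close>.\<close>

lemma not_transcendental:
  assumes g: "denominator adj g"
  shows "\<exists>d. \<not> indep d"
proof (rule ccontr)
  assume "\<nexists>d. \<not> indep d"
  then have ind: "indep d" for d by blast
  note ad = subringE[OF adj_subring]
  have gc: "g \<in> adj" "g \<noteq> \<zero>" "g \<in> carrier R" using g adj_closed by (auto simp: denominator_def)
  define u where "u = \<one> \<oplus> t \<otimes> g"
  have u: "u \<in> adj" "u \<in> carrier R" using gc t_adj ad D_adj[of \<one>] adj_closed by (auto simp: u_def)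
  obtain k where k: "g \<in> below k" using gc by (auto simp: adj_def)
  have "u \<noteq> \<zero>" using indep_const[OF ind le_refl, of \<one> g k] k by (auto simp: u_def)
  then obtain i v where v: "v \<in> adj" "u \<otimes> v = g [^] (i::nat)" using g u unfolding denominator_def by blast
  have vc: "v \<in> carrier R" using v adj_closed by simp
  obtain y where y: "y \<in> adj" "(\<one> \<ominus> u) [^] i = \<one> \<oplus> u \<otimes> y" using one_minus_pow[OF u(1)] by blast
  have yc: "y \<in> carrier R" using y adj_closed by simp
  have tp: "(\<ominus> t) [^] i \<in> adj" for i :: nat by (rule adj_pow) (simp add: t_adj ad(5))
  define w where "w = (\<ominus> t) [^] i \<otimes> v \<ominus> y"
  have w: "w \<in> adj" unfolding w_def minus_eq using tp v y ad by simp
  have wc: "w \<in> carrier R" using w adj_closed by simp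
  \<comment> \<open>Modulo u the element (-t) g is 1, so (-t)^i g^i is 1 plus a multiple of u. Since
    g^i = u v, this makes w an inverse of u in D[t].\<close>
  have "\<one> \<ominus> u = (\<ominus> t) \<otimes> g" unfolding u_def using gc by (simp add: minus_eq minus_add l_minus r_neg2)
  then have "(\<one> \<ominus> u) [^] i = (\<ominus> t) [^] i \<otimes> (u \<otimes> v)" using gc by (simp add: v(2) nat_pow_distrib)
  then have *: "(\<ominus> t) [^] i \<otimes> (u \<otimes> v) = \<one> \<oplus> u \<otimes> y" using y by simp
  have tc: "(\<ominus> t) [^] i \<in> carrier R" by simp
  have "u \<otimes> w = (\<ominus> t) [^] i \<otimes> (u \<otimes> v) \<ominus> u \<otimes> y" unfolding w_def using u vc yc tc by algebra
  also have "\<dots> = \<one>" unfolding * using u yc by algebra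
  finally have uw: "u \<otimes> w = \<one>" .
  obtain j c m where j: "c \<in> D" "c \<noteq> \<zero>" "m \<in> below j" "g = m \<oplus> c \<otimes> t [^] j"
    using top_coefficient[OF k gc(2)] by blast
  have wnz: "w \<noteq> \<zero>" using uw u by auto
  obtain l where "w \<in> below l" using w by (auto simp: adj_def)
  then obtain l c' m' where l: "c' \<in> D" "c' \<noteq> \<zero>" "m' \<in> below l" "w = m' \<oplus> c' \<otimes> t [^] l"
    using top_coefficient[OF _ wnz] by blast
  define q where "q = \<one> \<oplus> t \<otimes> m"
  have q: "q \<in> below (Suc j)" unfolding q_def
    by (rule below_add[OF below_const below_t[OF j(3)]]) auto
  have tj: "t [^] Suc j \<in> carrier R" "t [^] l \<in> carrier R" by auto
  have uq: "u = q \<oplus> c \<otimes> t [^] Suc j" unfolding u_def j(4) q_def using j by (simp add: r_distr m_ac a_assoc)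
  \<comment> \<open>All of u w except the product of the leading terms. That product sits at the
    positive power Suc j + l of t with coefficient c c', which u w = 1 does not permit.\<close>
  define M where "M = q \<otimes> m' \<oplus> (c \<otimes> (t [^] Suc j \<otimes> m') \<oplus> c' \<otimes> (t [^] l \<otimes> q))"
  have M: "M \<in> below (Suc j + l)"
  proof -
    have "t [^] Suc j \<otimes> m' \<in> below (Suc j + l)" "t [^] l \<otimes> q \<in> below (Suc j + l)"
      using below_pow[OF l(3), of "Suc j"] below_pow[OF q, of l] by (simp_all only: add.commute)
    then have "c \<otimes> (t [^] Suc j \<otimes> m') \<in> below (Suc j + l)" "c' \<otimes> (t [^] l \<otimes> q) \<in> below (Suc j + l)"
      using j(1) l(1) below_scale by blast+
    then show ?thesis unfolding M_def using below_mult[OF q l(3)] by (simp only: below_add)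
  qed
  have "u \<otimes> w = M \<oplus> (c \<otimes> c') \<otimes> (t [^] Suc j \<otimes> t [^] l)"
    unfolding uq l(4) M_def using below_closed[OF q] D_closed(1)[OF l(1)] D_closed(1)[OF j(1)] below_closed[OF l(3)] tj
    by algebra
  then have e: "\<one> = M \<oplus> (c \<otimes> c') \<otimes> t [^] (Suc j + l)" using uw by (simp only: nat_pow_mult t_closed)
  have z: "(M \<oplus> \<ominus> \<one>) \<oplus> (c \<otimes> c') \<otimes> t [^] (Suc j + l) = \<zero>"
  proof -
    have cl: "M \<in> carrier R" "(c \<otimes> c') \<otimes> t [^] (Suc j + l) \<in> carrier R"
      using below_closed[OF M] j l by (auto simp del: nat_pow_Suc)
    have "(M \<oplus> \<ominus> \<one>) \<oplus> (c \<otimes> c') \<otimes> t [^] (Suc j + l) = (M \<oplus> (c \<otimes> c') \<otimes> t [^] (Suc j + l)) \<oplus> \<ominus> \<one>"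
      using cl by (simp only: a_ac one_closed a_inv_closed a_closed)
    then show ?thesis unfolding e[symmetric] by (simp add: r_neg)
  qed
  have "M \<oplus> \<ominus> \<one> \<in> below (Suc j + l)" using M below_const[of "\<ominus> \<one>" "Suc j + l"] by (intro below_add) auto
  then have "c \<otimes> c' = \<zero>" using indepD[OF ind lessI _ _ z] j l by simp
  then show False using j l integral[of c c'] by simp
qed

lemma algebraic_relation:
  assumes "\<not> indep d"
  obtains \<delta> a q where "0 < \<delta>" "indep \<delta>" "a \<in> D" "a \<noteq> \<zero>" "q \<in> below \<delta>" "q \<oplus> a \<otimes> t [^] \<delta> = \<zero>"
proof -
  define d' where "d' = (LEAST d. \<not> indep d)"
  have "\<not> indep d'" unfolding d'_def by (rule LeastI) (rule assms)
  then obtain k a q where k: "k < d'" "a \<in> D" "q \<in> below k" "q \<oplus> a \<otimes> t [^] k = \<zero>" "a \<noteq> \<zero>"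
    unfolding indep_def by blast
  have "indep k" using k(1) not_less_Least unfolding d'_def by blast
  moreover have "0 < k" using k by (cases k) auto
  ultimately show ?thesis using that k by blast
qed

context
  fixes \<delta> a q
  assumes \<delta>: "0 < \<delta>" "indep \<delta>" and a: "a \<in> D" "a \<noteq> \<zero>" and q: "q \<in> below \<delta>" "q \<oplus> a \<otimes> t [^] \<delta> = \<zero>"
begin

lemma leading_term: "a \<otimes> t [^] \<delta> = \<ominus> q"
  using q a by (metis D_closed(1) below_closed m_closed minus_equality nat_pow_closed t_closed a_comm)

lemma reduce_below_Suc: "x \<in> below (Suc \<delta>) \<Longrightarrow> a \<otimes> x \<in> below \<delta>"
proof -
  assume "x \<in> below (Suc \<delta>)"
  then obtain m c where *: "m \<in> below \<delta>" "c \<in> D" "x = m \<oplus> c \<otimes> t [^] \<delta>" by auto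
  have "a \<otimes> x = a \<otimes> m \<oplus> c \<otimes> (a \<otimes> t [^] \<delta>)"
    unfolding *(3) using * a by (simp add: r_distr m_ac)
  then show ?thesis unfolding leading_term using * a q by simp
qed

text \<open>In Horner form each step creates at most the power t^\<delta>, and one factor a removes
  it by the relation for a t^\<delta>.\<close>

lemma reduce_below: "x \<in> below k \<Longrightarrow> \<exists>i::nat. a [^] i \<otimes> x \<in> below \<delta>"
proof (induction k arbitrary: x)
  case (Suc k)
  obtain c m where *: "c \<in> D" "m \<in> below k" "x = c \<oplus> t \<otimes> m" using horner[OF Suc.prems] by blast
  obtain i :: nat where i: "a [^] i \<otimes> m \<in> below \<delta>" using Suc.IH[OF *(2)] by blast
  have cl: "a [^] i \<in> carrier R" using a by simp
  have "a [^] Suc i \<otimes> x = (a [^] Suc i \<otimes> c) \<oplus> a \<otimes> (t \<otimes> (a [^] i \<otimes> m))"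
    unfolding *(3) using * a by (simp add: r_distr m_ac)
  moreover have "a [^] Suc i \<otimes> c \<in> below \<delta>" using * a \<delta> by (intro below_const) (auto simp del: nat_pow_Suc)
  ultimately have "a [^] Suc i \<otimes> x \<in> below \<delta>" using reduce_below_Suc[OF below_t[OF i]] by simp
  then show ?case by blast
qed (use a in auto)

lemma pseudo_division:
  assumes "c \<in> D" "m \<in> below e" "x \<in> below (e + k)"
  shows "\<exists>i::nat. \<exists>s\<in>below k. c [^] i \<otimes> x \<ominus> s \<otimes> (m \<oplus> c \<otimes> t [^] e) \<in> below e"
  using assms(3)
proof (induction k arbitrary: x)
  case 0
  then show ?case using assms by (intro exI[of _ 0]) (simp add: minus_eq)
next
  case (Suc k)
  define r where "r = m \<oplus> c \<otimes> t [^] e"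
  have r: "r \<in> carrier R" using assms by (simp add: r_def)
  obtain x' c' where x': "x' \<in> below (e + k)" "c' \<in> D" "x = x' \<oplus> c' \<otimes> t [^] (e + k)" using Suc.prems by auto
  define z where "z = c \<otimes> x' \<oplus> \<ominus> (c' \<otimes> (t [^] k \<otimes> m))"
  have z: "z \<in> below (e + k)"
    unfolding z_def using x' assms below_pow[OF assms(2), of k] by simp
  obtain i s where i: "s \<in> below k" "c [^] (i::nat) \<otimes> z \<ominus> s \<otimes> r \<in> below e"
    using Suc.IH[OF z] unfolding r_def by blast
  have tt: "t [^] e \<in> carrier R" "t [^] k \<in> carrier R" "c [^] i \<in> carrier R" "t [^] (e + k) = t [^] e \<otimes> t [^] k"
    using assms by (auto simp: nat_pow_mult)
  have cl: "c \<in> carrier R" "c' \<in> carrier R" "x' \<in> carrier R" "m \<in> carrier R" "s \<in> carrier R"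
    using assms x' i below_closed D_closed(1) by auto
  have "z = c \<otimes> x \<ominus> (c' \<otimes> t [^] k) \<otimes> r"
    unfolding z_def x'(3) r_def tt(4) using tt(1,2) cl by algebra
  then have "c [^] i \<otimes> z \<ominus> s \<otimes> r = c [^] Suc i \<otimes> x \<ominus> (s \<oplus> (c [^] i \<otimes> c') \<otimes> t [^] k) \<otimes> r"
    unfolding nat_pow_Suc x'(3) tt(4) using r tt(1-3) cl by algebra
  moreover have "s \<oplus> (c [^] i \<otimes> c') \<otimes> t [^] k \<in> below (Suc k)"
    using i x' assms by (intro belowI) auto
  ultimately show ?case using i(2) unfolding r_def by (intro exI[of _ "Suc i"]) auto
qed

text \<open>A nonzero multiple of \<open>g\<close> of least degree \<open>e\<close> must be constant: otherwise
  pseudo-dividing the relation for \<open>t\<close> by it leaves a nonzero multiple of smaller degree.\<close>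

lemma multiple_in_D:
  assumes "g \<in> adj" "g \<noteq> \<zero>"
  shows "\<exists>w\<in>adj. g \<otimes> w \<in> D - {\<zero>}"
proof -
  note ad = subringE[OF adj_subring]
  define P where "P e \<longleftrightarrow> (\<exists>w\<in>adj. \<exists>c\<in>D - {\<zero>}. \<exists>m\<in>below e. g \<otimes> w = m \<oplus> c \<otimes> t [^] e)" for e :: nat
  have top: "\<exists>j<k. P j" if "w \<in> adj" "g \<otimes> w \<in> below k" "g \<otimes> w \<noteq> \<zero>" for w k
    using top_coefficient[OF that(2,3)] that(1) unfolding P_def by blast
  obtain k where "g \<in> below k" using assms by (auto simp: adj_def)
  then obtain i where i: "a [^] (i::nat) \<otimes> g \<in> below \<delta>" using reduce_below by blast
  have gc: "g \<in> carrier R" using assms adj_closed by simp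
  have ai: "a [^] i \<noteq> \<zero>" "a [^] i \<in> D" using a by (auto simp: pow_nonzero)
  have "\<exists>j<\<delta>. P j"
  proof (rule top)
    show "g \<otimes> a [^] i \<in> below \<delta>" using i gc ai(2) by (simp add: m_comm)
    show "g \<otimes> a [^] i \<noteq> \<zero>" using integral[OF _ gc D_closed(1)[OF ai(2)]] ai(1) assms(2) by blast
  qed (rule D_adj[OF ai(2)])
  then obtain e0 where e0: "e0 < \<delta>" "P e0" by blast
  define e where "e = (LEAST e. P e)"
  have Pe: "P e" unfolding e_def by (rule LeastI) (rule e0)
  have ed: "e < \<delta>" using Least_le[of P, OF e0(2)] e0(1) unfolding e_def by simp
  obtain w c m where w: "w \<in> adj" "c \<in> D" "c \<noteq> \<zero>" "m \<in> below e" "g \<otimes> w = m \<oplus> c \<otimes> t [^] e"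
    using Pe unfolding P_def by blast
  show ?thesis
  proof (cases "e = 0")
    case True
    then have "g \<otimes> w = c" using w by simp
    then show ?thesis using w by blast
  next
    case False
    define r where "r = m \<oplus> c \<otimes> t [^] e"
    define k where "k = \<delta> - e"
    have k: "k < \<delta>" "\<delta> = e + k" using False ed by (auto simp: k_def)
    have tt: "t [^] e \<in> carrier R" "t [^] k \<in> carrier R" "t [^] \<delta> = t [^] e \<otimes> t [^] k"
      unfolding k(2) by (auto simp: nat_pow_mult)
    have cl: "c \<in> carrier R" "a \<in> carrier R" "m \<in> carrier R" "w \<in> carrier R" "r \<in> carrier R" "q \<in> carrier R"
      using w a adj_closed q by (auto simp: r_def simp del: below.simps)
    define x where "x = (a \<otimes> t [^] k) \<otimes> r"
    have "x = a \<otimes> (t [^] k \<otimes> m) \<oplus> c \<otimes> (a \<otimes> t [^] \<delta>)"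
      unfolding x_def r_def tt(3) using cl(1-4) tt(1,2) by algebra
    then have "x \<in> below (e + k)"
      unfolding leading_term using w a q below_pow[OF w(4), of k] k(2) by simp
    then obtain i s where s: "s \<in> below k" "c [^] (i::nat) \<otimes> x \<ominus> s \<otimes> r \<in> below e"
      using pseudo_division[OF w(2,4)] unfolding r_def by blast
    \<comment> \<open>Pseudo-division gives c^i x - s r = v r, and v has the coefficient c^i a at
      t^k. As k < \<delta>, independence makes v nonzero, so v r is a nonzero multiple of g of
      degree below e.\<close>
    define v where "v = \<ominus> s \<oplus> (c [^] i \<otimes> a) \<otimes> t [^] k"
    have ci: "c [^] i \<in> carrier R" "c [^] i \<in> D" "c [^] i \<noteq> \<zero>" using w by (auto simp: pow_nonzero)
    have sc: "s \<in> carrier R" using s below_closed by blast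
    have vb: "v \<in> below (Suc k)" unfolding v_def using s ci a by (intro belowI below_minus) auto
    have vc: "v \<in> carrier R" using vb by (rule below_closed)
    have "v \<noteq> \<zero>"
    proof
      assume "v = \<zero>"
      then have "c [^] i \<otimes> a = \<zero>"
        using indepD[OF \<delta>(2) k(1), of "c [^] i \<otimes> a" "\<ominus> s"] s ci a unfolding v_def by simp
      then show False using ci a integral[of "c [^] i" a] by auto
    qed
    moreover have "r \<noteq> \<zero>" using indepD[OF \<delta>(2) ed w(2,4)] w(3) unfolding r_def by blast
    ultimately have nz: "v \<otimes> r \<noteq> \<zero>" using integral vc cl by blast
    have "v \<otimes> r = c [^] i \<otimes> x \<ominus> s \<otimes> r"
      unfolding v_def x_def using ci(1) sc cl tt by algebra
    then have vr: "v \<otimes> r \<in> below e" using s by simp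
    have gwv: "g \<otimes> (w \<otimes> v) = v \<otimes> r" unfolding r_def w(5)[symmetric] using gc cl vc by (simp add: m_ac)
    have "w \<otimes> v \<in> adj" using w(1) vb ad(6) unfolding adj_def by blast
    then obtain j where "j < e" "P j" using top[of "w \<otimes> v" e] vr nz unfolding gwv by blast
    then show ?thesis using not_less_Least unfolding e_def by blast
  qed
qed

text \<open>Let b be a nonzero multiple of g in D. A relation u v = g^i in D[t] is multiplied by w^i
  and a power of a until the cofactor of u has degree below \<delta>. Comparing constant
  coefficients gives a relation inside D, which is completed to a power of a b.\<close>

lemma denominator_descends:
  assumes "denominator adj g"
  shows "\<exists>h. denominator D h"
proof -
  have g: "g \<in> adj" "g \<noteq> \<zero>" "g \<in> carrier R" using assms adj_closed by (auto simp: denominator_def)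
  obtain w where w: "w \<in> adj" "g \<otimes> w \<in> D" "g \<otimes> w \<noteq> \<zero>" using multiple_in_D g by blast
  define b where "b = g \<otimes> w"
  have b: "b \<in> D" "b \<noteq> \<zero>" using w by (auto simp: b_def)
  have wc: "w \<in> carrier R" using w adj_closed by simp
  have "\<exists>i::nat. \<exists>v\<in>D. u \<otimes> v = (a \<otimes> b) [^] i" if u: "u \<in> D" "u \<noteq> \<zero>" for u
  proof -
    obtain i v where v: "v \<in> adj" "u \<otimes> v = g [^] (i::nat)"
      using assms D_adj[OF u(1)] u(2) unfolding denominator_def by blast
    have vc: "v \<in> carrier R" using v adj_closed by simp
    have wi: "w [^] i \<in> adj" by (rule adj_pow[OF w(1)])
    have "v \<otimes> w [^] i \<in> adj" using v wi subringE[OF adj_subring] by simp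
    then obtain l where "v \<otimes> w [^] i \<in> below l" by (auto simp: adj_def)
    then obtain j where j: "a [^] (j::nat) \<otimes> (v \<otimes> w [^] i) \<in> below \<delta>" using reduce_below by blast
    obtain \<delta>' where \<delta>': "\<delta> = Suc \<delta>'" using \<delta>(1) by (cases \<delta>) auto
    obtain c m where c: "c \<in> D" "m \<in> below \<delta>'" "a [^] j \<otimes> (v \<otimes> w [^] i) = c \<oplus> t \<otimes> m"
      using horner j unfolding \<delta>' by blast
    have cl: "c \<in> carrier R" "u \<in> carrier R" "m \<in> carrier R" "a [^] j \<in> carrier R" "b [^] i \<in> carrier R"
      using c u a b below_closed D_closed(1) by auto
    have "u \<otimes> (c \<oplus> t \<otimes> m) = a [^] j \<otimes> (u \<otimes> v \<otimes> w [^] i)"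
      unfolding c(3)[symmetric] using u vc wc a by (simp add: m_ac)
    also have "\<dots> = a [^] j \<otimes> b [^] i" unfolding v(2) b_def using g wc by (simp add: nat_pow_distrib)
    finally have e: "u \<otimes> (c \<oplus> t \<otimes> m) = a [^] j \<otimes> b [^] i" .
    have "(u \<otimes> c \<ominus> a [^] j \<otimes> b [^] i) \<oplus> t \<otimes> (u \<otimes> m) = u \<otimes> (c \<oplus> t \<otimes> m) \<ominus> a [^] j \<otimes> b [^] i"
      using cl t_closed by algebra
    also have "\<dots> = \<zero>" unfolding e using cl by (simp add: minus_eq r_neg)
    finally have "u \<otimes> c \<ominus> a [^] j \<otimes> b [^] i = \<zero>"
      using indep_const[OF \<delta>(2), of \<delta>' _ "u \<otimes> m"] c u a b unfolding \<delta>' by (simp add: minus_eq)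
    then have uc: "u \<otimes> c = a [^] j \<otimes> b [^] i" using cl by simp
    have "u \<otimes> (c \<otimes> (a [^] i \<otimes> b [^] j)) = (u \<otimes> c) \<otimes> (a [^] i \<otimes> b [^] j)"
      using u c a b by (simp add: m_assoc)
    also have "\<dots> = (a \<otimes> b) [^] (i + j)"
      unfolding uc using a b by (simp add: nat_pow_distrib nat_pow_mult[symmetric] m_ac)
    finally show ?thesis using c a b by (intro exI[of _ "i + j"] bexI[of _ "c \<otimes> (a [^] i \<otimes> b [^] j)"]) auto
  qed
  moreover have "a \<otimes> b \<noteq> \<zero>" using a b integral[of a b] by auto
  ultimately show ?thesis using a b unfolding denominator_def by (intro exI[of _ "a \<otimes> b"]) auto
qed

text \<open>Multiplication by a is injective on the finite ring D, so a is invertible in D and the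
  power of a in \<open>reduce_below\<close> can be undone: all of D[t] lies in the finite set
  \<open>below \<delta>\<close>.\<close>

lemma finite_adj:
  assumes "finite D"
  shows "finite adj"
proof -
  have fin: "finite (below k)" for k
  proof (induction k)
    case (Suc k)
    have "below (Suc k) = (\<lambda>(m, c). m \<oplus> c \<otimes> t [^] k) ` (below k \<times> D)" by auto
    then show ?case using Suc assms by simp
  qed simp
  have inj: "inj_on (\<lambda>c. a \<otimes> c) D" using a m_lcancel by (intro inj_onI) auto
  have "(\<lambda>c. a \<otimes> c) ` D = D" using a by (intro endo_inj_surj[OF assms _ inj]) auto
  then obtain b where b: "b \<in> D" "a \<otimes> b = \<one>" by (metis D_closed(3) imageE)
  have "x \<in> below \<delta>" if x: "x \<in> adj" for x
  proof -
    obtain k where k: "x \<in> below k" using x by (auto simp: adj_def)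
    then obtain i where i: "a [^] (i::nat) \<otimes> x \<in> below \<delta>" using reduce_below by blast
    have "b [^] i \<otimes> (a [^] i \<otimes> x) = (a \<otimes> b) [^] i \<otimes> x" using a b(1) below_closed[OF k] by (simp add: nat_pow_distrib m_ac)
    then have "b [^] i \<otimes> (a [^] i \<otimes> x) = x" unfolding b(2) using below_closed[OF k] by simp
    then show ?thesis using below_scale[OF _ i, of "b [^] i"] b by simp
  qed
  then show ?thesis using fin[of \<delta>] by (meson finite_subset subsetI)
qed

end

lemma descent:
  assumes "denominator adj g"
  shows "(\<exists>h. denominator D h) \<and> (finite D \<longrightarrow> finite adj)"
proof -
  obtain d where "\<not> indep d" using not_transcendental[OF assms] by blast
  then obtain \<delta> a q where "0 < \<delta>" "indep \<delta>" "a \<in> D" "a \<noteq> \<zero>" "q \<in> below \<delta>" "q \<oplus> a \<otimes> t [^] \<delta> = \<zero>"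
    by (rule algebraic_relation)
  then show ?thesis using denominator_descends assms finite_adj by blast
qed

end

section \<open>Finiteness of finitely generated fields\<close>

context field
begin

text \<open>Generators are adjoined one by one. Existence of a denominator travels down the tower
  from the whole field, where 1 is one; finiteness travels up.\<close>

lemma finite_generation_descent:
  assumes "finite T" "T \<subseteq> carrier R" "subring D R"
    and "\<And>S. subring S R \<Longrightarrow> D \<union> T \<subseteq> S \<Longrightarrow> carrier R \<subseteq> S"
  shows "(\<exists>g. denominator D g) \<and> (finite D \<longrightarrow> finite (carrier R))"
  using assms
proof (induction T arbitrary: D rule: finite_induct)
  case empty
  then have D: "D = carrier R" using subringE(1) by blast
  have "\<exists>i::nat. \<exists>v\<in>D. u \<otimes> v = \<one> [^] i" if "u \<in> D - {\<zero>}" for u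
    using that field_Units by (intro exI[of _ 0] bexI[of _ "inv u"]) (auto simp: D)
  then have "denominator D \<one>" by (auto simp: denominator_def D)
  then show ?case using D by auto
next
  case (insert t T)
  interpret ring_adjunction R D t
    by (intro ring_adjunction.intro ring_adjunction_axioms.intro field_axioms) (use insert in auto)
  have "(\<exists>g. denominator adj g) \<and> (finite adj \<longrightarrow> finite (carrier R))"
  proof (rule insert.IH)
    fix S assume "subring S R" "adj \<union> T \<subseteq> S"
    then show "carrier R \<subseteq> S" using insert.prems(3)[of S] D_adj t_adj by blast
  qed (use insert.prems adj_subring in auto)
  then show ?case using descent by blast
qed

definition integers :: "'a set" where
  "integers = range (\<lambda>z::int. [z] \<cdot>\<^bsub>R\<^esub> \<one>)"

lemma int_mult: "([(z::int)] \<cdot>\<^bsub>R\<^esub> \<one>) \<otimes> ([(w::int)] \<cdot>\<^bsub>R\<^esub> \<one>) = [(z * w)] \<cdot>\<^bsub>R\<^esub> \<one>"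
  by (simp add: add_pow_ldistr_int add.int_pow_pow mult.commute)

lemma int_add: "([(z::int)] \<cdot>\<^bsub>R\<^esub> \<one>) \<oplus> ([(w::int)] \<cdot>\<^bsub>R\<^esub> \<one>) = [(z + w)] \<cdot>\<^bsub>R\<^esub> \<one>"
  by (simp add: add.int_pow_mult)

lemma integers_subring: "subring integers R"
proof (rule subringI)
  show "\<one> \<in> integers" unfolding integers_def by (rule image_eqI[of _ _ 1]) (auto simp: add.int_pow_1)
next
  fix x assume "x \<in> integers"
  then obtain z :: int where "x = [z] \<cdot>\<^bsub>R\<^esub> \<one>" by (auto simp: integers_def)
  then have "\<ominus> x = [(- z)] \<cdot>\<^bsub>R\<^esub> \<one>" by (simp add: add.int_pow_neg)
  then show "\<ominus> x \<in> integers" by (auto simp: integers_def)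
qed (auto simp: integers_def int_mult int_add)

lemma int_pow: "([(z::int)] \<cdot>\<^bsub>R\<^esub> \<one>) [^] (i::nat) = [(z ^ i)] \<cdot>\<^bsub>R\<^esub> \<one>"
  by (induction i) (auto simp: int_mult mult.commute add.int_pow_1)

lemma nat_eq_int: "[(k::nat)] \<cdot>\<^bsub>R\<^esub> \<one> = [(int k)] \<cdot>\<^bsub>R\<^esub> \<one>"
  by (simp add: add_pow_def int_pow_int)

text \<open>Otherwise the integers embed, and a prime larger than the absolute value of the integer
  behind g would divide a power of that integer.\<close>

lemma positive_char_of_denominator:
  assumes "denominator integers g"
  shows "\<exists>k::nat. 0 < k \<and> [k] \<cdot>\<^bsub>R\<^esub> \<one> = \<zero>"
proof (rule ccontr)
  assume no: "\<nexists>k::nat. 0 < k \<and> [k] \<cdot>\<^bsub>R\<^esub> \<one> = \<zero>"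
  have z0: "z = 0" if "[(z::int)] \<cdot>\<^bsub>R\<^esub> \<one> = \<zero>" for z
  proof (rule ccontr)
    assume "z \<noteq> 0"
    have "[(\<bar>z\<bar>)] \<cdot>\<^bsub>R\<^esub> \<one> = \<zero>" using that by (cases "0 \<le> z") (auto simp: add.int_pow_neg)
    then have "[(nat \<bar>z\<bar>)] \<cdot>\<^bsub>R\<^esub> \<one> = \<zero>" by (simp add: nat_eq_int)
    then show False using no \<open>z \<noteq> 0\<close> by (metis zero_less_abs_iff zero_less_nat_eq)
  qed
  obtain m where m: "g = [(m::int)] \<cdot>\<^bsub>R\<^esub> \<one>" using assms by (auto simp: denominator_def integers_def)
  have "m \<noteq> 0"
  proof
    assume "m = 0"
    then have "g = \<zero>" unfolding m using nat_eq_int[of 0] by simp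
    then show False using assms by (simp add: denominator_def)
  qed
  obtain p :: nat where p: "Factorial_Ring.prime p" "nat \<bar>m\<bar> < p" using bigger_prime by blast
  have "[(int p)] \<cdot>\<^bsub>R\<^esub> \<one> \<noteq> \<zero>" using z0[of "int p"] p by auto
  then obtain i v where v: "v \<in> integers" "([(int p)] \<cdot>\<^bsub>R\<^esub> \<one>) \<otimes> v = g [^] (i::nat)"
    using assms unfolding denominator_def integers_def by blast
  then obtain w :: int where w: "v = [w] \<cdot>\<^bsub>R\<^esub> \<one>" by (auto simp: integers_def)
  have "[(int p * w)] \<cdot>\<^bsub>R\<^esub> \<one> = [(m ^ i)] \<cdot>\<^bsub>R\<^esub> \<one>" using v(2) unfolding m w int_pow int_mult .
  then have "[(int p * w + - (m ^ i))] \<cdot>\<^bsub>R\<^esub> \<one> = \<zero>"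
    unfolding int_add[symmetric] by (simp add: add.int_pow_neg r_neg)
  then have "int p * w = m ^ i" using z0[of "int p * w + - (m ^ i)"] by simp
  then have "int p dvd m ^ i" by (metis dvd_triv_left)
  then have "int p dvd m" using p(1) by (meson prime_dvd_power prime_nat_int_transfer)
  then have "int p \<le> \<bar>m\<bar>" using \<open>m \<noteq> 0\<close> dvd_imp_le_int[of m "int p"] by simp
  then show False using p by simp
qed

lemma finite_of_finite_generation:
  assumes "finite T" "T \<subseteq> carrier R" "\<And>S. subring S R \<Longrightarrow> T \<subseteq> S \<Longrightarrow> carrier R \<subseteq> S"
  shows "finite (carrier R)"
proof -
  have *: "(\<exists>g. denominator integers g) \<and> (finite integers \<longrightarrow> finite (carrier R))"
    by (rule finite_generation_descent[OF assms(1,2) integers_subring]) (use assms(3) in auto)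
  then obtain k :: nat where k: "0 < k" "[k] \<cdot>\<^bsub>R\<^esub> \<one> = \<zero>" using positive_char_of_denominator by blast
  have "[z] \<cdot>\<^bsub>R\<^esub> \<one> = [(z mod int k)] \<cdot>\<^bsub>R\<^esub> \<one>" for z :: int
  proof -
    have "[z] \<cdot>\<^bsub>R\<^esub> \<one> = ([(int k)] \<cdot>\<^bsub>R\<^esub> \<one>) \<otimes> ([(z div int k)] \<cdot>\<^bsub>R\<^esub> \<one>) \<oplus> [(z mod int k)] \<cdot>\<^bsub>R\<^esub> \<one>"
      unfolding int_mult int_add by simp
    then show ?thesis using k by (simp add: nat_eq_int)
  qed
  then have "integers \<subseteq> (\<lambda>z. [z] \<cdot>\<^bsub>R\<^esub> \<one>) ` {0..<int k}"
    unfolding integers_def using k(1) by (auto intro!: image_eqI[of _ _ "_ mod int k"])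
  then have "finite integers" by (rule finite_subset) simp
  then show ?thesis using * by blast
qed

lemma prime_char_of_finite:
  assumes "finite (carrier R)"
  shows "\<exists>p::nat. Factorial_Ring.prime p \<and> [p] \<cdot>\<^bsub>R\<^esub> \<one> = \<zero>"
proof -
  have "\<not> inj (\<lambda>k::nat. [k] \<cdot>\<^bsub>R\<^esub> \<one>)"
  proof
    have "range (\<lambda>k::nat. [k] \<cdot>\<^bsub>R\<^esub> \<one>) \<subseteq> carrier R" by auto
    then have "finite (range (\<lambda>k::nat. [k] \<cdot>\<^bsub>R\<^esub> \<one>))" using assms by (rule finite_subset)
    moreover assume "inj (\<lambda>k::nat. [k] \<cdot>\<^bsub>R\<^esub> \<one>)"
    ultimately show False using finite_imageD infinite_UNIV_nat by blast
  qed
  then obtain i j :: nat where ij: "i < j" "[i] \<cdot>\<^bsub>R\<^esub> \<one> = [j] \<cdot>\<^bsub>R\<^esub> \<one>"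
    unfolding inj_def by (metis linorder_neqE_nat)
  have "[i] \<cdot>\<^bsub>R\<^esub> \<one> \<oplus> [(j - i)] \<cdot>\<^bsub>R\<^esub> \<one> = [j] \<cdot>\<^bsub>R\<^esub> \<one>" using ij(1) by (simp add: add.nat_pow_mult)
  then have ex: "0 < j - i \<and> [(j - i)] \<cdot>\<^bsub>R\<^esub> \<one> = \<zero>"
    unfolding ij(2)[symmetric] using ij(1) add.l_cancel_one'[of "[i] \<cdot>\<^bsub>R\<^esub> \<one>" "[(j - i)] \<cdot>\<^bsub>R\<^esub> \<one>"] by simp
  define p where "p = (LEAST k::nat. 0 < k \<and> [k] \<cdot>\<^bsub>R\<^esub> \<one> = \<zero>)"
  have p: "0 < p" "[p] \<cdot>\<^bsub>R\<^esub> \<one> = \<zero>" using LeastI[of "\<lambda>k::nat. 0 < k \<and> [k] \<cdot>\<^bsub>R\<^esub> \<one> = \<zero>", OF ex] unfolding p_def by auto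
  have least: "p \<le> k" if "0 < k" "[k] \<cdot>\<^bsub>R\<^esub> \<one> = \<zero>" for k :: nat
    unfolding p_def by (rule Least_le) (use that in simp)
  have "p \<noteq> 1" using p by (auto simp: add.nat_pow_eone)
  moreover have "a = 1 \<or> b = 1" if ab: "p = a * b" for a b
  proof -
    have "([a] \<cdot>\<^bsub>R\<^esub> \<one>) \<otimes> ([b] \<cdot>\<^bsub>R\<^esub> \<one>) = \<zero>" using p(2) unfolding ab by (simp add: add_pow_ldistr add.nat_pow_pow mult.commute)
    then have "[a] \<cdot>\<^bsub>R\<^esub> \<one> = \<zero> \<or> [b] \<cdot>\<^bsub>R\<^esub> \<one> = \<zero>" using integral by simp
    moreover have "0 < a" "0 < b" using ab p(1) by auto
    ultimately have "p \<le> a \<or> p \<le> b" using least by blast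
    then show ?thesis using ab \<open>0 < a\<close> \<open>0 < b\<close> by auto
  qed
  ultimately have "Factorial_Ring.prime p" using p(1)
    by (metis One_nat_def Suc_lessI nat_neq_iff prime_nat_iff dvd_def mult.right_neutral nat_mult_eq_cancel1)
  then show ?thesis using p by blast
qed

end

section \<open>Maximal ideals and finite residue fields\<close>

lemma (in cring) exists_maximalideal:
  assumes "\<one> \<noteq> \<zero>"
  shows "\<exists>M. maximalideal M R"
proof -
  define \<A> where "\<A> = {I. ideal I R \<and> \<one> \<notin> I}"
  have "\<exists>M\<in>\<A>. \<forall>J\<in>\<A>. M \<subseteq> J \<longrightarrow> J = M"
  proof (rule subset_Zorn_nonempty)
    show "\<A> \<noteq> {}" using zeroideal assms unfolding \<A>_def by auto
    fix C assume C: "C \<noteq> {}" "subset.chain \<A> C"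
    then have "subset.chain {I. ideal I R} C" by (auto simp: \<A>_def subset.chain_def)
    from chain_Union_is_ideal[OF this] C show "\<Union> C \<in> \<A>" by (auto simp: \<A>_def subset.chain_def)
  qed
  then obtain M where M: "ideal M R" "\<one> \<notin> M" "\<And>J. ideal J R \<Longrightarrow> \<one> \<notin> J \<Longrightarrow> M \<subseteq> J \<Longrightarrow> J = M"
    unfolding \<A>_def by blast
  have "maximalideal M R"
  proof (rule maximalidealI[OF M(1)])
    show "carrier R \<noteq> M" using M(2) by auto
    fix J assume J: "ideal J R" "M \<subseteq> J" "J \<subseteq> carrier R"
    show "J = M \<or> J = carrier R" using M(3)[OF J(1) _ J(2)] ideal.one_imp_carrier[OF J(1)] by blast
  qed
  then show ?thesis by blast
qed

text \<open>Modulo a maximal ideal, the subring generated by T becomes a field that is finitely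
  generated as a ring, hence finite. Its elements are cosets, hence the carrier type
  \<open>'a set\<close>.\<close>

lemma (in field) finite_residue_field:
  assumes T: "finite T" "T \<subseteq> carrier R"
  shows "\<exists>(F :: 'a set ring) h. field F \<and> finite (carrier F)
    \<and> h \<in> ring_hom (R\<lparr>carrier := generate_ring R T\<rparr>) F \<and> carrier F = h ` generate_ring R T"
proof -
  define A where "A = R\<lparr>carrier := generate_ring R T\<rparr>"
  have sub: "subring (generate_ring R T) R" using generate_ring_is_subring[OF T(2)] .
  have "subcring (generate_ring R T) R" using sub subcringI' by blast
  then interpret A: cring A unfolding A_def using subcring_iff[OF subringE(1)[OF sub]] by simp
  have "\<one>\<^bsub>A\<^esub> \<noteq> \<zero>\<^bsub>A\<^esub>" by (simp add: A_def)
  then obtain M where M: "maximalideal M A" using A.exists_maximalideal by blast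
  then interpret M: maximalideal M A .
  define F where "F = A Quot M"
  define h where "h = (\<lambda>x. M +>\<^bsub>A\<^esub> x)"
  interpret F: field F unfolding F_def by (rule M.quotient_is_field[OF A.is_cring])
  have h: "h \<in> ring_hom A F" unfolding h_def F_def by (rule M.rcos_ring_hom)
  have sur: "carrier F = h ` carrier A" by (auto simp: F_def h_def FactRing_def A_RCOSETS_def')
  have "finite (carrier F)"
  proof (rule F.finite_of_finite_generation)
    show "finite (h ` T)" using T by simp
    have TA: "T \<subseteq> carrier A" unfolding A_def by (auto intro: generate_ring.incl)
    then show "h ` T \<subseteq> carrier F" using sur by auto
    fix S assume S: "subring S F" "h ` T \<subseteq> S"
    note SE = subringE[OF S(1)]
    have "subring {x \<in> carrier A. h x \<in> S} R"
    proof (rule subringI)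
      show "{x \<in> carrier A. h x \<in> S} \<subseteq> carrier R" using subringE(1)[OF sub] by (auto simp: A_def)
      show "\<one> \<in> {x \<in> carrier A. h x \<in> S}" using ring_hom_one[OF h] A.one_closed SE(3) by (simp add: A_def)
      fix x y assume xy: "x \<in> {x \<in> carrier A. h x \<in> S}" "y \<in> {x \<in> carrier A. h x \<in> S}"
      have "h (x \<otimes>\<^bsub>A\<^esub> y) \<in> S" "h (x \<oplus>\<^bsub>A\<^esub> y) \<in> S" using xy ring_hom_mult[OF h] ring_hom_add[OF h] SE by auto
      moreover have "x \<otimes>\<^bsub>A\<^esub> y \<in> carrier A" "x \<oplus>\<^bsub>A\<^esub> y \<in> carrier A" using xy by auto
      ultimately show "x \<otimes> y \<in> {x \<in> carrier A. h x \<in> S}" "x \<oplus> y \<in> {x \<in> carrier A. h x \<in> S}" by (auto simp: A_def)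
    next
      fix x assume x: "x \<in> {x \<in> carrier A. h x \<in> S}"
      have m: "\<ominus> x \<in> carrier A" using x subringE(5)[OF sub] by (simp add: A_def)
      have xR: "x \<in> carrier R" using x subringE(1)[OF sub] by (auto simp: A_def)
      have "x \<oplus>\<^bsub>A\<^esub> \<ominus> x = \<zero>\<^bsub>A\<^esub>" using xR by (simp add: A_def r_neg)
      then have "\<ominus> x = \<ominus>\<^bsub>A\<^esub> x" using A.minus_equality[of "\<ominus> x" x] x m A.a_comm[of x "\<ominus> x"] by simp
      moreover have "h (\<ominus>\<^bsub>A\<^esub> x) = \<ominus>\<^bsub>F\<^esub> h x"
        using ring_hom_cring.hom_a_inv[OF ring_hom_cring.intro[OF A.is_cring F.is_cring ring_hom_cring_axioms.intro[OF h]]] x by simp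
      ultimately show "\<ominus> x \<in> {x \<in> carrier A. h x \<in> S}" using x m SE by simp
    qed
    then have "generate_ring R T \<subseteq> {x \<in> carrier A. h x \<in> S}"
      using S(2) TA by (intro generate_ring_min_subring1[OF T(2)]) auto
    then show "carrier F \<subseteq> S" unfolding sur by (auto simp: A_def)
  qed
  then show ?thesis using F.field_axioms h sur unfolding A_def by auto
qed

section \<open>Commutators divisible by \<open>p\<close>\<close>

context weyl
begin

lemma pd_gen: "i < 2 * n \<Longrightarrow> pd j (gen i) = (if i = j then \<one>\<^bsub>W\<^esub> else \<zero>\<^bsub>W\<^esub>)"
proof -
  have "single \<zero> c = \<zero>\<^bsub>W\<^esub>" for c :: "nat \<Rightarrow> nat" by (auto simp: single_def W_zero)
  moreover have "((\<lambda>_. 0)(j := 1))(j := 0) = (\<lambda>_. 0 :: nat)" by auto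
  ultimately show ?thesis by (auto simp: gen_def pd_single nc_Suc W_one)
qed

lemma pd_gen_pow:
  assumes "i < 2 * n" "j < 2 * n"
  shows "pd j (gen i [^]\<^bsub>W\<^esub> k) = (if i = j then sc (nc k) \<star> gen i [^]\<^bsub>W\<^esub> (k - 1) else \<zero>\<^bsub>W\<^esub>)"
proof (induction k)
  case 0 then show ?case using assms by simp
next
  case (Suc k)
  have g: "gen i \<in> carrier W" "gen i [^]\<^bsub>W\<^esub> k \<in> carrier W" using assms by auto
  have "pd j (gen i [^]\<^bsub>W\<^esub> Suc k) = pd j (gen i [^]\<^bsub>W\<^esub> k) \<star> gen i \<oplus>\<^bsub>W\<^esub> gen i [^]\<^bsub>W\<^esub> k \<star> pd j (gen i)"
    using pd_mult[OF assms(2) g(2,1)] by simp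
  also have "\<dots> = (if i = j then sc (nc (Suc k)) \<star> gen i [^]\<^bsub>W\<^esub> k else \<zero>\<^bsub>W\<^esub>)"
  proof (cases "i = j")
    case True
    have "(sc (nc k) \<star> gen i [^]\<^bsub>W\<^esub> (k - 1)) \<star> gen i = sc (nc k) \<star> gen i [^]\<^bsub>W\<^esub> k"
    proof (cases k)
      case (Suc k') then show ?thesis using g by (simp add: W.m_assoc)
    qed (use g in simp)
    then show ?thesis unfolding Suc.IH pd_gen[OF assms(1)] using True g
      by (simp add: nc_Suc sc_add W.l_distr)
  next
    case False
    then show ?thesis unfolding Suc.IH pd_gen[OF assms(1)] using g by simp
  qed
  finally show ?case by simp
qed

lemma gen_pow_coeff: "l < n \<Longrightarrow> (gen l [^]\<^bsub>W\<^esub> k) ((\<lambda>_. 0)(l := k)) = \<one>"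
proof (induction k)
  case 0
  then show ?case by (simp add: W_one single_def)
next
  case (Suc k)
  have "gen l [^]\<^bsub>W\<^esub> Suc k = shift l (gen l [^]\<^bsub>W\<^esub> k)"
    using Suc.prems by (simp only: W.nat_pow_Suc2 gen_closed lt2 gen_mult_x W.nat_pow_closed)
  then have "(gen l [^]\<^bsub>W\<^esub> Suc k) ((\<lambda>_. 0)(l := Suc k)) = (gen l [^]\<^bsub>W\<^esub> k) (((\<lambda>_. 0)(l := Suc k))(l := k))"
    by (simp add: shift_def)
  also have "\<dots> = \<one>" unfolding fun_upd_upd by (rule Suc.IH[OF Suc.prems])
  finally show ?case .
qed

text \<open>The coefficient of x^m in d^k x^q is q!/m!; multiplying by m! states this without a
  division.\<close>

lemma contraction_coeff:
  assumes "l < n" "m + k = q"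
  shows "nc (fact m) \<otimes> (gen (n + l) [^]\<^bsub>W\<^esub> k \<star> gen l [^]\<^bsub>W\<^esub> q) ((\<lambda>_. 0)(l := m)) = nc (fact q)"
  using assms(2)
proof (induction k arbitrary: m)
  case 0
  have "gen (n + l) [^]\<^bsub>W\<^esub> (0::nat) \<star> gen l [^]\<^bsub>W\<^esub> q = gen l [^]\<^bsub>W\<^esub> q" using assms(1) by (simp add: lt2)
  moreover have "m = q" using 0 by simp
  ultimately show ?case using gen_pow_coeff[OF assms(1), of q] by (simp only: r_one nc_closed)
next
  case (Suc k)
  define v where "v = gen (n + l) [^]\<^bsub>W\<^esub> k \<star> gen l [^]\<^bsub>W\<^esub> q"
  have v: "v \<in> carrier W" using assms by (simp add: v_def lt2)
  have "gen (n + l) [^]\<^bsub>W\<^esub> Suc k \<star> gen l [^]\<^bsub>W\<^esub> q = gen (n + l) \<star> v"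
    unfolding v_def using assms(1) by (simp only: W.nat_pow_Suc2 W.m_assoc gen_closed lt2 W.nat_pow_closed)
  also have "\<dots> = shift (n + l) v \<oplus>\<^bsub>W\<^esub> pd l v" by (rule gen_mult_d[OF assms(1) v])
  finally have e: "(gen (n + l) [^]\<^bsub>W\<^esub> Suc k \<star> gen l [^]\<^bsub>W\<^esub> q) ((\<lambda>_. 0)(l := m))
      = nc (Suc m) \<otimes> v ((\<lambda>_. 0)(l := Suc m))"
    using assms(1) coeff_closed[OF v] by (simp add: W_add shift_def pd_def)
  have "nc (fact m) \<otimes> (nc (Suc m) \<otimes> v ((\<lambda>_. 0)(l := Suc m))) = nc (fact (Suc m)) \<otimes> v ((\<lambda>_. 0)(l := Suc m))"
    using coeff_closed[OF v] by (simp add: m_assoc[symmetric] nc_mult[symmetric] mult.commute del: mult_Suc)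
  also have "\<dots> = nc (fact q)" unfolding v_def by (rule Suc.IH) (use Suc.prems in simp)
  finally show ?case unfolding e .
qed

end

section \<open>Elements central modulo p, and commutators divided by p\<close>

locale weyl_mod = weyl_domain R n for R (structure) and n +
  fixes p :: nat
  assumes p_pos: "0 < p" and p_nz: "nc p \<noteq> \<zero>"
begin

abbreviation "P \<equiv> sc (nc p)"

lemma P_lcomm: "v \<in> carrier W \<Longrightarrow> w \<in> carrier W \<Longrightarrow> v \<star> (P \<star> w) = P \<star> (v \<star> w)"
  using sc_comm[OF nc_closed, of v p] by (simp add: W.m_assoc[symmetric])

lemma P_cancel: "v \<in> carrier W \<Longrightarrow> w \<in> carrier W \<Longrightarrow> P \<star> v = P \<star> w \<Longrightarrow> v = w"
proof -
  assume vw: "v \<in> carrier W" "w \<in> carrier W" "P \<star> v = P \<star> w"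
  have "P (\<lambda>_. 0) = nc p" by (simp add: sc_def single_def)
  then have "P \<noteq> \<zero>\<^bsub>W\<^esub>" using p_nz by (auto simp: W_zero)
  then show ?thesis using W_cancel_left[OF vw(1,2) _ vw(3)] by simp
qed

text \<open>States that w is [Y, v]/p, in additive form; w is unique because P is a nonzero element
  of a domain.\<close>

definition quotrel where
  "quotrel Y v w \<longleftrightarrow> w \<in> carrier W \<and> Y \<star> v = v \<star> Y \<oplus>\<^bsub>W\<^esub> P \<star> w"

definition central_mod where
  "central_mod Y \<longleftrightarrow> Y \<in> carrier W \<and> (\<forall>v\<in>carrier W. \<exists>w. quotrel Y v w)"

text \<open>\<open>quo Y v\<close> is \<open>[Y, v] / p\<close>.\<close>

definition quo where
  "quo Y v = (SOME w. quotrel Y v w)"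

lemma quotrel_unique:
  "Y \<in> carrier W \<Longrightarrow> v \<in> carrier W \<Longrightarrow> quotrel Y v w \<Longrightarrow> quotrel Y v w' \<Longrightarrow> w = w'"
  unfolding quotrel_def using W_add_cancel[of "v \<star> Y" "P \<star> w" "P \<star> w'"] P_cancel[of w w'] by simp

lemma quo_eqI: "Y \<in> carrier W \<Longrightarrow> v \<in> carrier W \<Longrightarrow> quotrel Y v w \<Longrightarrow> quo Y v = w"
  unfolding quo_def using quotrel_unique by (metis someI)

lemma quotrel_quo: "central_mod Y \<Longrightarrow> v \<in> carrier W \<Longrightarrow> quotrel Y v (quo Y v)"
  unfolding quo_def central_mod_def by (metis someI_ex)

lemma quo_closed [simp]: "central_mod Y \<Longrightarrow> v \<in> carrier W \<Longrightarrow> quo Y v \<in> carrier W"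
  using quotrel_quo by (simp add: quotrel_def)

lemma quotrel_add:
  assumes "Y \<in> carrier W" "v \<in> carrier W" "w \<in> carrier W" "quotrel Y v a" "quotrel Y w b"
  shows "quotrel Y (v \<oplus>\<^bsub>W\<^esub> w) (a \<oplus>\<^bsub>W\<^esub> b)"
  using assms unfolding quotrel_def by (simp add: W.r_distr W.l_distr W.a_ac)

lemma quotrel_mult:
  assumes Y: "Y \<in> carrier W" and v: "v \<in> carrier W" and w: "w \<in> carrier W" and "quotrel Y v a" "quotrel Y w b"
  shows "quotrel Y (v \<star> w) (a \<star> w \<oplus>\<^bsub>W\<^esub> v \<star> b)"
proof -
  have a: "a \<in> carrier W" "Y \<star> v = v \<star> Y \<oplus>\<^bsub>W\<^esub> P \<star> a"
    and b: "b \<in> carrier W" "Y \<star> w = w \<star> Y \<oplus>\<^bsub>W\<^esub> P \<star> b"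
    using assms(4,5) by (auto simp: quotrel_def)
  have "Y \<star> (v \<star> w) = (Y \<star> v) \<star> w" using Y v w by (simp add: W.m_assoc)
  also have "\<dots> = v \<star> (Y \<star> w) \<oplus>\<^bsub>W\<^esub> P \<star> (a \<star> w)"
    unfolding a(2) using Y v w a(1) by (simp add: W.l_distr W.m_assoc)
  also have "\<dots> = (v \<star> w) \<star> Y \<oplus>\<^bsub>W\<^esub> P \<star> (v \<star> b) \<oplus>\<^bsub>W\<^esub> P \<star> (a \<star> w)"
    unfolding b(2) using Y v w b(1) a(1) by (simp add: W.r_distr W.m_assoc P_lcomm)
  finally show ?thesis using Y v w a(1) b(1) unfolding quotrel_def
    by (simp add: W.r_distr W.a_assoc W.a_comm[of "P \<star> (v \<star> b)"])
qed

lemma quotrel_sc: "Y \<in> carrier W \<Longrightarrow> a \<in> carrier R \<Longrightarrow> quotrel Y (sc a) \<zero>\<^bsub>W\<^esub>"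
  by (simp add: quotrel_def sc_comm)

lemma quotrel_one: "Y \<in> carrier W \<Longrightarrow> quotrel Y \<one>\<^bsub>W\<^esub> \<zero>\<^bsub>W\<^esub>"
  by (simp add: quotrel_def)

text \<open>As [Y, -] is a derivation, divisibility of its values by p spreads from the generators
  to everything.\<close>

lemma central_modI:
  assumes Y: "Y \<in> carrier W" and "\<And>j. j < 2 * n \<Longrightarrow> \<exists>w. quotrel Y (gen j) w"
  shows "central_mod Y"
  unfolding central_mod_def
proof (intro conjI ballI Y)
  fix v assume "v \<in> carrier W"
  then show "\<exists>w. quotrel Y v w"
  proof (induction rule: W_induct)
    case one then show ?case using quotrel_one[OF Y] by blast
  next
    case (add v w) then show ?case using quotrel_add[OF Y] by blast
  next
    case (sc a v)
    obtain b where "quotrel Y v b" using sc(3) by (elim exE)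
    then show ?case using quotrel_mult[OF Y sc_closed[OF sc(1)] sc(2) quotrel_sc[OF Y sc(1)]] by (intro exI)
  next
    case (gen j v)
    obtain a b where "quotrel Y (gen j) a" "quotrel Y v b" using assms(2)[OF gen(1)] gen(3) by (elim exE) blast
    then show ?case using quotrel_mult[OF Y gen_closed[OF gen(1)] gen(2)] by (intro exI)
  qed
qed

lemma quo_add:
  "central_mod Y \<Longrightarrow> v \<in> carrier W \<Longrightarrow> w \<in> carrier W \<Longrightarrow> quo Y (v \<oplus>\<^bsub>W\<^esub> w) = quo Y v \<oplus>\<^bsub>W\<^esub> quo Y w"
  by (intro quo_eqI quotrel_add quotrel_quo) (auto simp: central_mod_def)

lemma quo_mult:
  "central_mod Y \<Longrightarrow> v \<in> carrier W \<Longrightarrow> w \<in> carrier W \<Longrightarrow>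
    quo Y (v \<star> w) = quo Y v \<star> w \<oplus>\<^bsub>W\<^esub> v \<star> quo Y w"
  by (intro quo_eqI quotrel_mult quotrel_quo) (auto simp: central_mod_def)

lemma quo_sc: "central_mod Y \<Longrightarrow> a \<in> carrier R \<Longrightarrow> quo Y (sc a) = \<zero>\<^bsub>W\<^esub>"
  by (intro quo_eqI quotrel_sc) (auto simp: central_mod_def)

lemma quo_scale: "central_mod Y \<Longrightarrow> a \<in> carrier R \<Longrightarrow> v \<in> carrier W \<Longrightarrow> quo Y (sc a \<star> v) = sc a \<star> quo Y v"
  by (simp add: quo_mult quo_sc)

text \<open>The index of the canonically conjugate generator: the commutator with the p-th power of
  \<open>gen (pair i)\<close> differentiates by \<open>gen i\<close>.\<close>

definition pair :: "nat \<Rightarrow> nat" where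
  "pair j = (if j < n then n + j else j - n)"

lemma pair_less [simp]: "j < 2 * n \<Longrightarrow> pair j < 2 * n"
  by (auto simp: pair_def)

lemma quotrel_gen:
  assumes "i < 2 * n" "j < 2 * n"
  shows "quotrel (gen (pair i) [^]\<^bsub>W\<^esub> p) (gen j)
    (if i = j then (if i < n then gen (pair i) [^]\<^bsub>W\<^esub> (p - 1) else \<ominus>\<^bsub>W\<^esub> (gen (pair i) [^]\<^bsub>W\<^esub> (p - 1))) else \<zero>\<^bsub>W\<^esub>)"
  using assms(2)
proof (cases rule: index_cases)
  case x
  have y: "gen (pair i) [^]\<^bsub>W\<^esub> p \<in> carrier W" using assms by simp
  have "pair i = n + j \<longleftrightarrow> i = j" using x assms by (auto simp: pair_def)
  then show ?thesis unfolding quotrel_def comm_x[OF x y] using x assms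
    by (simp add: pd_gen_pow)
next
  case (d l)
  have y: "gen (pair i) [^]\<^bsub>W\<^esub> p \<in> carrier W" using assms by simp
  have il: "pair i = l \<longleftrightarrow> i = j" "i = j \<Longrightarrow> \<not> i < n" using d assms by (auto simp: pair_def)
  have c: "gen j \<star> gen (pair i) [^]\<^bsub>W\<^esub> p = gen (pair i) [^]\<^bsub>W\<^esub> p \<star> gen j \<oplus>\<^bsub>W\<^esub> pd l (gen (pair i) [^]\<^bsub>W\<^esub> p)"
    using comm_d[OF d(2) y] d by simp
  show ?thesis unfolding quotrel_def c using d il assms
    by (simp add: pd_gen_pow W.r_minus W.a_assoc W.r_neg)
qed

lemma central_mod_gen: "i < 2 * n \<Longrightarrow> central_mod (gen (pair i) [^]\<^bsub>W\<^esub> p)"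
  by (rule central_modI) (use quotrel_gen in auto)

lemma quo_gen:
  "i < 2 * n \<Longrightarrow> j < 2 * n \<Longrightarrow> quo (gen (pair i) [^]\<^bsub>W\<^esub> p) (gen j) =
    (if i = j then (if i < n then gen (pair i) [^]\<^bsub>W\<^esub> (p - 1) else \<ominus>\<^bsub>W\<^esub> (gen (pair i) [^]\<^bsub>W\<^esub> (p - 1))) else \<zero>\<^bsub>W\<^esub>)"
  by (rule quo_eqI) (auto simp: quotrel_gen simp del: if_split)

text \<open>The constant term of d^p x^p in normal form is p!, that of x^p d^p is 0, and division by
  p leaves (p-1)!. Exchanging the two elements gives the sign.\<close>

lemma quo_pow_const:
  assumes "i < 2 * n"
  shows "quo (gen (pair i) [^]\<^bsub>W\<^esub> p) (gen i [^]\<^bsub>W\<^esub> p) (\<lambda>_. 0) = (if i < n then nc (fact (p - 1)) else \<ominus> nc (fact (p - 1)))"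
proof -
  have main: "w (\<lambda>_. 0) = nc (fact (p - 1))"
    if l: "l < n" and w: "quotrel (gen (n + l) [^]\<^bsub>W\<^esub> p) (gen l [^]\<^bsub>W\<^esub> p) w" for l w
  proof -
    have wc: "w \<in> carrier W" using w by (simp add: quotrel_def)
    have z: "(\<lambda>_. 0 :: nat)(l := 0) = (\<lambda>_. 0)" by auto
    have g: "gen l \<in> carrier W" "gen (n + l) \<in> carrier W" using l by auto
    obtain p' where p': "p = Suc p'" using p_pos by (cases p) auto
    have "gen l [^]\<^bsub>W\<^esub> p \<star> gen (n + l) [^]\<^bsub>W\<^esub> p = gen l \<star> (gen l [^]\<^bsub>W\<^esub> p' \<star> gen (n + l) [^]\<^bsub>W\<^esub> p)"
      using g unfolding p' by (simp only: W.nat_pow_Suc2 W.m_assoc W.nat_pow_closed W.m_closed)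
    also have "\<dots> = shift l (gen l [^]\<^bsub>W\<^esub> p' \<star> gen (n + l) [^]\<^bsub>W\<^esub> p)"
      using g by (intro gen_mult_x[OF l]) auto
    finally have 0: "(gen l [^]\<^bsub>W\<^esub> p \<star> gen (n + l) [^]\<^bsub>W\<^esub> p) (\<lambda>_. 0) = \<zero>" by (simp add: shift_def)
    have cl: "(gen (n + l) [^]\<^bsub>W\<^esub> p \<star> gen l [^]\<^bsub>W\<^esub> p) \<in> carrier W" using g by simp
    have "nc (fact p) = (gen (n + l) [^]\<^bsub>W\<^esub> p \<star> gen l [^]\<^bsub>W\<^esub> p) (\<lambda>_. 0)"
      using contraction_coeff[OF l, of 0 p p] coeff_closed[OF cl] unfolding z by (simp add: nc_one)
    also have "\<dots> = (gen l [^]\<^bsub>W\<^esub> p \<star> gen (n + l) [^]\<^bsub>W\<^esub> p \<oplus>\<^bsub>W\<^esub> P \<star> w) (\<lambda>_. 0)"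
      using w unfolding quotrel_def by (simp only: simp_thms)
    also have "\<dots> = nc p \<otimes> w (\<lambda>_. 0)" using 0 wc unfolding W_add sc_mult[OF nc_closed wc] by simp
    finally have "nc p \<otimes> nc (fact (p - 1)) = nc p \<otimes> w (\<lambda>_. 0)"
      using p_pos by (simp add: fact_reduce[of p] nc_mult)
    then show ?thesis using m_lcancel[OF p_nz nc_closed nc_closed coeff_closed[OF wc]] by simp
  qed
  have q: "quotrel (gen (pair i) [^]\<^bsub>W\<^esub> p) (gen i [^]\<^bsub>W\<^esub> p) (quo (gen (pair i) [^]\<^bsub>W\<^esub> p) (gen i [^]\<^bsub>W\<^esub> p))"
    using assms by (intro quotrel_quo central_mod_gen) auto
  show ?thesis using assms
  proof (cases rule: index_cases)
    case x
    then show ?thesis using main[OF x] q by (simp add: pair_def)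
  next
    case (d l)
    define w where "w = quo (gen l [^]\<^bsub>W\<^esub> p) (gen (n + l) [^]\<^bsub>W\<^esub> p)"
    have q': "quotrel (gen l [^]\<^bsub>W\<^esub> p) (gen (n + l) [^]\<^bsub>W\<^esub> p) w" using q d by (simp add: pair_def w_def)
    have wc: "w \<in> carrier W" using q' by (simp add: quotrel_def)
    have g: "gen l [^]\<^bsub>W\<^esub> p \<star> gen (n + l) [^]\<^bsub>W\<^esub> p \<in> carrier W" "gen (n + l) [^]\<^bsub>W\<^esub> p \<star> gen l [^]\<^bsub>W\<^esub> p \<in> carrier W"
      using d by auto
    have "quotrel (gen (n + l) [^]\<^bsub>W\<^esub> p) (gen l [^]\<^bsub>W\<^esub> p) (\<ominus>\<^bsub>W\<^esub> w)"
      using q' wc g unfolding quotrel_def by (simp add: W.r_minus W.a_assoc W.r_neg)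
    from main[OF d(2) this] have m: "(\<ominus>\<^bsub>W\<^esub> w) (\<lambda>_. 0) = nc (fact (p - 1))" .
    have "(w \<oplus>\<^bsub>W\<^esub> \<ominus>\<^bsub>W\<^esub> w) (\<lambda>_. 0) = \<zero>" using wc by (simp add: W.r_neg) (simp add: W_zero)
    then have "w (\<lambda>_. 0) \<oplus> nc (fact (p - 1)) = \<zero>" unfolding W_add m .
    then have "w (\<lambda>_. 0) = \<ominus> nc (fact (p - 1))" using minus_equality[of "w (\<lambda>_. 0)"] coeff_closed[OF wc] by simp
    then show ?thesis using d by (simp add: pair_def w_def)
  qed
qed

text \<open>u1 keeps the coefficients of u that p does not divide. If it were nonzero, u1 t would be
  a multiple of p whose leading coefficient is that of u1 times an invertible element, so p would
  divide the leading coefficient of u1.\<close>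

lemma P_dvd_cancel:
  assumes u: "u \<in> carrier W" and t: "t \<in> carrier W" "lead t c" "t c \<otimes> a = \<one>" "a \<in> carrier R"
    and w: "w \<in> carrier W" "u \<star> t = P \<star> w"
  shows "\<exists>w\<in>carrier W. u = P \<star> w"
proof -
  define dvp where "dvp b \<longleftrightarrow> (\<exists>d\<in>carrier R. b = nc p \<otimes> d)" for b
  define u2 where "u2 = (\<lambda>e. if dvp (u e) then (SOME d. d \<in> carrier R \<and> u e = nc p \<otimes> d) else \<zero>)"
  have ch: "u2 e \<in> carrier R \<and> u e = nc p \<otimes> u2 e" if "dvp (u e)" for e
    using that someI_ex[of "\<lambda>d. d \<in> carrier R \<and> u e = nc p \<otimes> d"] by (auto simp: dvp_def u2_def)
  have u2: "u2 \<in> carrier W" unfolding W_carrier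
  proof (rule fin_suppI)
    show u2c: "u2 e \<in> carrier R" for e using ch[of e] by (cases "dvp (u e)") (auto simp: u2_def)
    have sub: "u e \<noteq> \<zero>" if "u2 e \<noteq> \<zero>" for e
    proof -
      have "dvp (u e)" using that unfolding u2_def by (metis (full_types))
      then show ?thesis using ch[of e] that p_nz u2c[of e] integral_iff[of "nc p" "u2 e"] by auto
    qed
    show "finite {e. u2 e \<noteq> \<zero>}" by (rule finite_subset[of _ "{e. u e \<noteq> \<zero>}"]) (use sub u in \<open>auto simp: W_carrier fin_suppD\<close>)
    show "e \<in> exps" if "u2 e \<noteq> \<zero>" for e using sub[OF that] u by (auto simp: W_carrier fin_suppD)
  qed
  define u1 where "u1 = u \<ominus>\<^bsub>W\<^esub> P \<star> u2"
  have u1: "u1 \<in> carrier W" using u u2 by (simp add: u1_def)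
  have uu: "u = u1 \<oplus>\<^bsub>W\<^esub> P \<star> u2" unfolding u1_def using u u2 by (simp add: W.minus_eq W.a_assoc W.l_neg)
  have ue: "u e = u1 e \<oplus> nc p \<otimes> u2 e" for e
    using fun_cong[OF uu, of e] unfolding W_add sc_mult[OF nc_closed u2] .
  have "u1 = \<zero>\<^bsub>W\<^esub>"
  proof (rule ccontr)
    assume "u1 \<noteq> \<zero>\<^bsub>W\<^esub>"
    then obtain b where b: "lead u1 b" using lead_exists[OF u1] by blast
    have nz: "u1 b \<noteq> \<zero>" using b by (simp add: lead_def)
    have "u1 \<star> t \<oplus>\<^bsub>W\<^esub> P \<star> (u2 \<star> t) = P \<star> w"
      using w(2) uu u1 u2 t by (simp add: W.l_distr W.m_assoc)
    then have "u1 \<star> t = P \<star> (w \<ominus>\<^bsub>W\<^esub> u2 \<star> t)"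
      using w(1) u1 u2 t by (metis W.add.inv_solve_right W.m_closed W.minus_eq W.r_distr W.r_minus W.a_inv_closed sc_closed nc_closed)
    moreover have "w \<ominus>\<^bsub>W\<^esub> u2 \<star> t \<in> carrier W" using w u2 t by simp
    ultimately obtain w' where w': "w' \<in> carrier W" "u1 \<star> t = P \<star> w'" by blast
    have "u1 b \<otimes> t c = (u1 \<star> t) (\<lambda>i. b i + c i)"
      using bnd_mult(2)[of t c b u1] t u1 b lead_exps by (simp add: lead_def)
    also have "\<dots> = nc p \<otimes> w' (\<lambda>i. b i + c i)" unfolding w'(2) sc_mult[OF nc_closed w'(1)] by simp
    finally have "u1 b \<otimes> (t c \<otimes> a) = nc p \<otimes> (w' (\<lambda>i. b i + c i) \<otimes> a)"
      using coeff_closed[OF u1] coeff_closed[OF w'(1)] coeff_closed[OF t(1)] t(4) by (metis m_assoc nc_closed)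
    then have "u1 b = nc p \<otimes> (w' (\<lambda>i. b i + c i) \<otimes> a)" unfolding t(3) using coeff_closed[OF u1] by simp
    then have "u b = nc p \<otimes> (w' (\<lambda>i. b i + c i) \<otimes> a \<oplus> u2 b)"
      unfolding ue using coeff_closed[OF w'(1)] coeff_closed[OF u2] t(4) by (simp add: r_distr)
    moreover have "w' (\<lambda>i. b i + c i) \<otimes> a \<oplus> u2 b \<in> carrier R"
      using coeff_closed[OF w'(1)] coeff_closed[OF u2] t(4) by simp
    ultimately have "dvp (u b)" unfolding dvp_def by blast
    then have "u1 b \<oplus> u b = u b" using ue[of b] ch[of b] by simp
    then show False using nz coeff_closed[OF u1, of b] coeff_closed[OF u, of b] by simp
  qed
  then show ?thesis using uu u2 by auto
qed

end

section \<open>Change of coefficients\<close>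

locale weyl_map = A: weyl A n + B: weyl B n + ring_hom_cring A B h
  for A :: "('a, 'c) ring_scheme" and B :: "('b, 'd) ring_scheme" and n h
begin

definition hm :: "((nat \<Rightarrow> nat) \<Rightarrow> 'a) \<Rightarrow> (nat \<Rightarrow> nat) \<Rightarrow> 'b" where
  "hm v = (\<lambda>e. h (v e))"

lemma h_nc: "h (A.nc k) = B.nc k"
  by (induction k) (simp_all add: A.nc_Suc B.nc_Suc)

lemma hm_closed [simp]: "v \<in> carrier A.W \<Longrightarrow> hm v \<in> carrier B.W"
proof -
  assume v: "v \<in> carrier A.W"
  then have "{e. h (v e) \<noteq> \<zero>\<^bsub>B\<^esub>} \<subseteq> {e. v e \<noteq> \<zero>\<^bsub>A\<^esub>}" by auto
  then show ?thesis using v unfolding A.W_carrier B.W_carrier hm_def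
    by (intro B.fin_suppI) (auto simp: A.fin_suppD(1) dest: A.fin_suppD(3) intro: finite_subset A.fin_suppD(2))
qed

lemma hm_lmul: "v \<in> carrier A.W \<Longrightarrow> hm (A.lmul j v) = B.lmul j (hm v)"
proof
  fix e assume v: "v \<in> carrier A.W"
  have s: "h (A.shift j v e) = B.shift j (hm v) e" by (simp add: A.shift_def B.shift_def hm_def)
  have p: "h (A.pd i v e) = B.pd i (hm v) e" for i using v by (simp add: A.pd_def B.pd_def hm_def h_nc)
  have "A.shift j v e \<in> carrier A" "A.pd i v e \<in> carrier A" for i using A.funs_W[OF v] A.shift_funs A.pd_funs A.funsD by blast+
  then show "hm (A.lmul j v) e = B.lmul j (hm v) e" using s p by (simp add: A.lmul_def B.lmul_def hm_def)
qed

lemma hm_single: "hm (A.single a c) = B.single (h a) c"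
  by (auto simp: hm_def A.single_def B.single_def)

lemma hm_sc: "hm (A.sc a) = B.sc (h a)" and hm_gen: "hm (A.gen j) = B.gen j" and hm_one: "hm \<one>\<^bsub>A.W\<^esub> = \<one>\<^bsub>B.W\<^esub>"
  by (simp_all add: A.sc_def B.sc_def A.gen_def B.gen_def A.W_one B.W_one hm_single)

lemma hm_add: "v \<in> carrier A.W \<Longrightarrow> w \<in> carrier A.W \<Longrightarrow> hm (v \<oplus>\<^bsub>A.W\<^esub> w) = hm v \<oplus>\<^bsub>B.W\<^esub> hm w"
  by (simp add: hm_def A.W_add B.W_add)

lemma hm_scale: "a \<in> carrier A \<Longrightarrow> v \<in> carrier A.W \<Longrightarrow> hm (A.sc a \<otimes>\<^bsub>A.W\<^esub> v) = B.sc (h a) \<otimes>\<^bsub>B.W\<^esub> hm v"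
  using hm_closed[of v] by (simp add: A.sc_mult B.sc_mult) (simp add: hm_def)

text \<open>Multiplication is built from scalars and \<open>lmul\<close>, whose only constants are
  integers, and these are preserved by every ring homomorphism.\<close>

lemma hm_mult:
  assumes "v \<in> carrier A.W" "w \<in> carrier A.W"
  shows "hm (v \<otimes>\<^bsub>A.W\<^esub> w) = hm v \<otimes>\<^bsub>B.W\<^esub> hm w"
  using assms(1)
proof (induction rule: A.W_induct)
  case one then show ?case using assms by (simp add: hm_one)
next
  case (add v v') then show ?case using assms by (simp add: A.W.l_distr B.W.l_distr hm_add)
next
  case (sc a v) then show ?case using assms by (simp add: A.W.m_assoc B.W.m_assoc hm_scale)
next
  case (gen j v)
  then show ?case using assms hm_lmul[of "v \<otimes>\<^bsub>A.W\<^esub> w" j] hm_lmul[of v j]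
    by (simp add: A.W.m_assoc A.gen_mult[symmetric] B.gen_mult[symmetric] B.W.m_assoc)
qed

lemma hm_hom: "hm \<in> ring_hom A.W B.W"
  by (rule ring_hom_memI) (auto simp: hm_mult hm_add hm_one)

sublocale hm: ring_hom_ring A.W B.W hm
  by (rule ring_hom_ringI2[OF A.W.ring_axioms B.W.ring_axioms hm_hom])

lemma hm_surj:
  assumes "carrier B = h ` carrier A" "g \<in> carrier B.W"
  shows "\<exists>v\<in>carrier A.W. hm v = g"
proof -
  have "\<exists>a\<in>carrier A. h a = g e \<and> (g e = \<zero>\<^bsub>B\<^esub> \<longrightarrow> a = \<zero>\<^bsub>A\<^esub>)" for e
    using assms B.coeff_closed[OF assms(2), of e] by (cases "g e = \<zero>\<^bsub>B\<^esub>") auto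
  then obtain v where v: "\<And>e. v e \<in> carrier A" "\<And>e. h (v e) = g e" "\<And>e. g e = \<zero>\<^bsub>B\<^esub> \<Longrightarrow> v e = \<zero>\<^bsub>A\<^esub>" by metis
  have "v \<in> carrier A.W" unfolding A.W_carrier
  proof (rule A.fin_suppI)
    have "{e. v e \<noteq> \<zero>\<^bsub>A\<^esub>} \<subseteq> {e. g e \<noteq> \<zero>\<^bsub>B\<^esub>}" using v(3) by auto
    then show "finite {e. v e \<noteq> \<zero>\<^bsub>A\<^esub>}" using assms(2) by (auto simp: B.W_carrier B.fin_suppD(2) intro: finite_subset)
    show "e \<in> A.exps" if "v e \<noteq> \<zero>\<^bsub>A\<^esub>" for e
      using that v(3)[of e] B.fin_suppD(3)[of g B.exps e] assms(2) by (auto simp: B.W_carrier A.exps_def B.exps_def)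
  qed (rule v(1))
  moreover have "hm v = g" using v(2) by (auto simp: hm_def)
  ultimately show ?thesis by blast
qed

text \<open>The operator induced on the target of \<open>hm\<close>, evaluated at an arbitrary
  preimage; \<open>T_kernel\<close> makes the choice immaterial.\<close>

definition descend :: "(((nat \<Rightarrow> nat) \<Rightarrow> 'a) \<Rightarrow> 'e) \<Rightarrow> ((nat \<Rightarrow> nat) \<Rightarrow> 'b) \<Rightarrow> 'e" where
  "descend T g = T (SOME f. f \<in> carrier A.W \<and> hm f = g)"

context
  fixes T
  assumes T_closed: "\<And>v. v \<in> carrier A.W \<Longrightarrow> T v \<in> carrier B.W"
    and T_add: "\<And>v w. v \<in> carrier A.W \<Longrightarrow> w \<in> carrier A.W \<Longrightarrow> T (v \<oplus>\<^bsub>A.W\<^esub> w) = T v \<oplus>\<^bsub>B.W\<^esub> T w"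
    and T_scale: "\<And>a v. a \<in> carrier A \<Longrightarrow> v \<in> carrier A.W \<Longrightarrow> T (A.sc a \<otimes>\<^bsub>A.W\<^esub> v) = B.sc (h a) \<otimes>\<^bsub>B.W\<^esub> T v"
begin

lemma T_zero: "T \<zero>\<^bsub>A.W\<^esub> = \<zero>\<^bsub>B.W\<^esub>"
  using T_scale[of "\<zero>\<^bsub>A\<^esub>" "\<zero>\<^bsub>A.W\<^esub>"] T_closed[of "\<zero>\<^bsub>A.W\<^esub>"] by simp

text \<open>A kernel element is a sum of terms a m with h a = 0, and T turns such a scalar into 0.
  Compatibility with all scalars is what lets the derivations pass to a residue field whose defining
  ideal may be larger than that of p.\<close>

lemma T_kernel:
  assumes "v \<in> carrier A.W" "hm v = \<zero>\<^bsub>B.W\<^esub>"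
  shows "T v = \<zero>\<^bsub>B.W\<^esub>"
proof -
  have "(\<forall>e. h (v e) = \<zero>\<^bsub>B\<^esub>) \<longrightarrow> T v = \<zero>\<^bsub>B.W\<^esub>"
    using assms(1) unfolding A.W_carrier
  proof (induction rule: A.fin_supp_insert_induct)
    case zero then show ?case using T_zero by (simp add: A.W_zero)
  next
    case (insert f a x)
    show ?case
    proof
      assume h0: "\<forall>e. h (f e \<oplus>\<^bsub>A\<^esub> A.single a x e) = \<zero>\<^bsub>B\<^esub>"
      have ha: "h a = \<zero>\<^bsub>B\<^esub>" using h0[rule_format, of x] insert by (simp add: A.single_def)
      have "h (f e) = \<zero>\<^bsub>B\<^esub>" for e
      proof (cases "e = x")
        case False
        then show ?thesis using h0[rule_format, of e] A.fin_suppD(1)[OF insert(1)] by (simp add: A.single_def)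
      qed (use insert in simp)
      then have Tf: "T f = \<zero>\<^bsub>B.W\<^esub>" using insert by simp
      have cl: "f \<in> carrier A.W" "A.single \<one>\<^bsub>A\<^esub> x \<in> carrier A.W" "A.single a x \<in> carrier A.W"
        using insert by (auto simp: A.W_carrier A.single_closed)
      have "T (A.single a x) = \<zero>\<^bsub>B.W\<^esub>"
        unfolding A.single_sc[OF insert(2,4)] T_scale[OF insert(2) cl(2)] ha using T_closed[OF cl(2)] by simp
      then have "T (f \<oplus>\<^bsub>A.W\<^esub> A.single a x) = \<zero>\<^bsub>B.W\<^esub>" unfolding T_add[OF cl(1,3)] Tf by simp
      then show "T (\<lambda>y. f y \<oplus>\<^bsub>A\<^esub> A.single a x y) = \<zero>\<^bsub>B.W\<^esub>" by (simp add: A.W_add)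
    qed
  qed
  moreover have "h (v e) = \<zero>\<^bsub>B\<^esub>" for e using fun_cong[OF assms(2), of e] by (simp add: hm_def B.W_zero)
  ultimately show ?thesis by blast
qed

lemma descend:
  assumes v: "v \<in> carrier A.W"
  shows "descend T (hm v) = T v"
proof -
  define f where "f = (SOME f. f \<in> carrier A.W \<and> hm f = hm v)"
  have f: "f \<in> carrier A.W" "hm f = hm v"
    using someI[of "\<lambda>f. f \<in> carrier A.W \<and> hm f = hm v" v] v by (auto simp: f_def)
  have "hm (f \<ominus>\<^bsub>A.W\<^esub> v) = \<zero>\<^bsub>B.W\<^esub>" using f v by (simp add: A.W.minus_eq B.W.r_neg)
  then have k: "T (f \<ominus>\<^bsub>A.W\<^esub> v) = \<zero>\<^bsub>B.W\<^esub>" using f v by (intro T_kernel) auto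
  have "f = (f \<ominus>\<^bsub>A.W\<^esub> v) \<oplus>\<^bsub>A.W\<^esub> v" using f v by (simp add: A.W.minus_eq A.W.a_assoc A.W.l_neg)
  then have "T f = T (f \<ominus>\<^bsub>A.W\<^esub> v) \<oplus>\<^bsub>B.W\<^esub> T v" using T_add[of "f \<ominus>\<^bsub>A.W\<^esub> v" v] f v by simp
  then show ?thesis using k T_closed[OF v] by (simp add: descend_def f_def)
qed

end

end

section \<open>Reduction of an endomorphism modulo \<open>p\<close>\<close>

context weyl_charp
begin

lemma mx_sc: "a \<in> carrier R \<Longrightarrow> mx q (sc a) = 0"
proof -
  assume a: "a \<in> carrier R"
  have "mx q (sc a) \<le> 0" by (rule mx_le[OF sc_closed[OF a]]) (auto simp: sc_def single_def split: if_splits)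
  then show ?thesis by simp
qed

lemma mx_minus: "v \<in> carrier W \<Longrightarrow> mx q (\<ominus>\<^bsub>W\<^esub> v) \<le> mx q v"
proof -
  assume v: "v \<in> carrier W"
  have "sc (\<ominus> \<one>) \<star> v \<oplus>\<^bsub>W\<^esub> v = (sc (\<ominus> \<one>) \<oplus>\<^bsub>W\<^esub> sc \<one>) \<star> v"
    using v by (subst W.l_distr) simp_all
  also have "sc (\<ominus> \<one>) \<oplus>\<^bsub>W\<^esub> sc \<one> = sc (\<ominus> \<one> \<oplus> \<one>)" by (subst sc_add) simp_all
  finally have "sc (\<ominus> \<one>) \<star> v \<oplus>\<^bsub>W\<^esub> v = \<zero>\<^bsub>W\<^esub>" using v by (simp add: l_neg)
  then have "\<ominus>\<^bsub>W\<^esub> v = sc (\<ominus> \<one>) \<star> v"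
    using W.minus_equality[of "sc (\<ominus> \<one>) \<star> v" v] v by simp
  then show ?thesis using mx_mult_le[of "sc (\<ominus> \<one>)" v q] v by (simp add: mx_sc)
qed

lemma mx_gen: "j < 2 * n \<Longrightarrow> mx q (gen j) \<le> (if q = j then 1 else 0)"
  by (rule mx_le[OF gen_closed]) (auto simp: gen_def single_def split: if_splits)

lemma mx_pow: "v \<in> carrier W \<Longrightarrow> mx q (v [^]\<^bsub>W\<^esub> (k::nat)) \<le> k * mx q v"
proof (induction k)
  case 0 then show ?case using mx_sc[of \<one> q] by simp
next
  case (Suc k)
  then show ?case using mx_mult_le[of "v [^]\<^bsub>W\<^esub> k" v q] by simp
qed

lemma central_of_gens:
  assumes u: "u \<in> carrier W" and "\<And>l. l < 2 * n \<Longrightarrow> u \<star> gen l = gen l \<star> u"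
  shows "u \<in> Zc"
proof -
  have "u \<star> w = w \<star> u" if "w \<in> carrier W" for w
    using that
  proof (induction rule: W_induct)
    case (add v w) then show ?case using u by (simp add: W.l_distr W.r_distr)
  next
    case (sc a v)
    have "u \<star> (sc a \<star> v) = sc a \<star> (u \<star> v)"
      using sc_comm[OF sc(1) u] sc(1,2) u by (simp add: W.m_assoc[symmetric])
    then show ?case unfolding sc(3) using sc(1,2) u by (simp add: W.m_assoc)
  next
    case (gen j v)
    have "u \<star> (gen j \<star> v) = gen j \<star> (u \<star> v)"
      using assms(2)[OF gen(1)] gen(1,2) u by (simp add: W.m_assoc[symmetric])
    then show ?case unfolding gen(3) using gen(1,2) u by (simp add: W.m_assoc)
  qed (use u in simp)
  then show ?thesis using Zc_central[OF u] by blast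
qed

lemma Zc_small_const:
  assumes "z \<in> Zc" "\<And>q. mx q z < p"
  shows "z = sc (z (\<lambda>_. 0))"
proof
  fix e
  have "e = (\<lambda>_. 0)" if nz: "z e \<noteq> \<zero>"
  proof
    fix q
    have "e q < p" using mx_ge[OF Zc_W[OF assms(1)] nz, of q] assms(2)[of q] by simp
    moreover have "p dvd e q" using assms(1) nz unfolding Zc_def by blast
    ultimately show "e q = 0" by (meson dvd_imp_le neq0_conv not_less)
  qed
  then show "z e = sc (z (\<lambda>_. 0)) e" by (auto simp: sc_def single_def)
qed

end

text \<open>The stage for one prime: A stands for a coefficient ring in which p is nonzero, h for
  its map onto a finite residue field. By \<open>unit\<close> the leading coefficients of the
  \<open>psi (s l)\<close> are invertible, so these denominators stay nonzero after
  reduction.\<close>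

locale reduced_endo = weyl_map A F n h + A: weyl_mod A n p + B: weyl_charp F n p
  for A :: "('a, 'c) ring_scheme" and F :: "('b, 'd) ring_scheme" and n h p +
  fixes psi :: "((nat \<Rightarrow> nat) \<Rightarrow> 'a) \<Rightarrow> (nat \<Rightarrow> nat) \<Rightarrow> 'a" and s b :: "nat \<Rightarrow> (nat \<Rightarrow> nat) \<Rightarrow> 'a"
  assumes psi_hom: "psi \<in> ring_hom A.W A.W"
    and psi_sc: "\<And>a. a \<in> carrier A \<Longrightarrow> psi (A.sc a) = A.sc a"
    and h_surj: "carrier F = h ` carrier A"
    and sb_closed: "\<And>l. l < 2 * n \<Longrightarrow> s l \<in> carrier A.W" "\<And>l. l < 2 * n \<Longrightarrow> b l \<in> carrier A.W"
    and rel: "\<And>l. l < 2 * n \<Longrightarrow> A.gen l \<otimes>\<^bsub>A.W\<^esub> psi (s l) = psi (b l)"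
    and unit: "\<And>l. l < 2 * n \<Longrightarrow> \<exists>c. \<exists>a\<in>carrier A. A.lead (psi (s l)) c \<and> psi (s l) c \<otimes>\<^bsub>A\<^esub> a = \<one>\<^bsub>A\<^esub>"
begin

sublocale psi: ring_hom_ring A.W A.W psi
  by (rule ring_hom_ringI2[OF A.W.ring_axioms A.W.ring_axioms psi_hom])

lemma lift:
  assumes "g \<in> carrier B.W"
  obtains v where "v \<in> carrier A.W" "g = hm v"
  using hm_surj[OF h_surj assms] by blast

lemma psi_quotrel:
  assumes "Y \<in> carrier A.W" "v \<in> carrier A.W" "A.quotrel Y v w"
  shows "A.quotrel (psi Y) (psi v) (psi w)"
proof -
  have w: "w \<in> carrier A.W" "Y \<otimes>\<^bsub>A.W\<^esub> v = v \<otimes>\<^bsub>A.W\<^esub> Y \<oplus>\<^bsub>A.W\<^esub> A.P \<otimes>\<^bsub>A.W\<^esub> w" using assms by (auto simp: A.quotrel_def)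
  have "psi Y \<otimes>\<^bsub>A.W\<^esub> psi v = psi (v \<otimes>\<^bsub>A.W\<^esub> Y \<oplus>\<^bsub>A.W\<^esub> A.P \<otimes>\<^bsub>A.W\<^esub> w)"
    unfolding w(2)[symmetric] using assms(1,2) by simp
  also have "\<dots> = psi v \<otimes>\<^bsub>A.W\<^esub> psi Y \<oplus>\<^bsub>A.W\<^esub> A.P \<otimes>\<^bsub>A.W\<^esub> psi w"
    using assms(1,2) w(1) psi_sc[OF A.nc_closed] by simp
  finally show ?thesis using w(1) unfolding A.quotrel_def by simp
qed

abbreviation Y where "Y j \<equiv> A.gen (A.pair j) [^]\<^bsub>A.W\<^esub> p"

text \<open>Birationality enters here: with g = \<open>A.gen l\<close>, both t =
  \<open>psi (s l)\<close> and g t = \<open>psi (b l)\<close> are images, so their commutators with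
  \<open>psi (Y j)\<close> are divisible by p. Then so is the commutator with g times t, and t is
  cancelled by its invertible leading coefficient.\<close>

lemma psi_Y_central:
  assumes j: "j < 2 * n"
  shows "A.central_mod (psi (Y j))"
proof (rule A.central_modI)
  have Y: "Y j \<in> carrier A.W" using j by simp
  then show Z: "psi (Y j) \<in> carrier A.W" by simp
  fix l assume l: "l < 2 * n"
  define Z where "Z = psi (Y j)"
  define g where "g = A.gen l"
  define t where "t = psi (s l)"
  have cl: "Z \<in> carrier A.W" "g \<in> carrier A.W" "t \<in> carrier A.W"
    using Z l sb_closed[OF l] by (auto simp: Z_def g_def t_def)
  have cm: "A.central_mod (Y j)" by (rule A.central_mod_gen[OF j])
  obtain u1 where u1: "u1 \<in> carrier A.W" "Z \<otimes>\<^bsub>A.W\<^esub> t = t \<otimes>\<^bsub>A.W\<^esub> Z \<oplus>\<^bsub>A.W\<^esub> A.P \<otimes>\<^bsub>A.W\<^esub> u1"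
    using psi_quotrel[OF Y _ A.quotrel_quo[OF cm]] sb_closed[OF l] unfolding Z_def t_def A.quotrel_def by blast
  obtain u2 where u2: "u2 \<in> carrier A.W" "Z \<otimes>\<^bsub>A.W\<^esub> (g \<otimes>\<^bsub>A.W\<^esub> t) = (g \<otimes>\<^bsub>A.W\<^esub> t) \<otimes>\<^bsub>A.W\<^esub> Z \<oplus>\<^bsub>A.W\<^esub> A.P \<otimes>\<^bsub>A.W\<^esub> u2"
    using psi_quotrel[OF Y _ A.quotrel_quo[OF cm]] sb_closed[OF l] unfolding Z_def t_def g_def rel[OF l] A.quotrel_def by blast
  define u where "u = Z \<otimes>\<^bsub>A.W\<^esub> g \<ominus>\<^bsub>A.W\<^esub> g \<otimes>\<^bsub>A.W\<^esub> Z"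
  have u: "u \<in> carrier A.W" using cl by (simp add: u_def)
  have "u \<otimes>\<^bsub>A.W\<^esub> t = Z \<otimes>\<^bsub>A.W\<^esub> (g \<otimes>\<^bsub>A.W\<^esub> t) \<ominus>\<^bsub>A.W\<^esub> g \<otimes>\<^bsub>A.W\<^esub> (Z \<otimes>\<^bsub>A.W\<^esub> t)"
    unfolding u_def using cl by (simp add: A.W.minus_eq A.W.l_distr A.W.l_minus A.W.m_assoc)
  also have "g \<otimes>\<^bsub>A.W\<^esub> (Z \<otimes>\<^bsub>A.W\<^esub> t) = (g \<otimes>\<^bsub>A.W\<^esub> t) \<otimes>\<^bsub>A.W\<^esub> Z \<oplus>\<^bsub>A.W\<^esub> A.P \<otimes>\<^bsub>A.W\<^esub> (g \<otimes>\<^bsub>A.W\<^esub> u1)"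
    unfolding u1(2) using cl u1(1) by (simp add: A.W.r_distr A.W.m_assoc A.P_lcomm)
  also have "Z \<otimes>\<^bsub>A.W\<^esub> (g \<otimes>\<^bsub>A.W\<^esub> t) \<ominus>\<^bsub>A.W\<^esub> ((g \<otimes>\<^bsub>A.W\<^esub> t) \<otimes>\<^bsub>A.W\<^esub> Z \<oplus>\<^bsub>A.W\<^esub> A.P \<otimes>\<^bsub>A.W\<^esub> (g \<otimes>\<^bsub>A.W\<^esub> u1)) = A.P \<otimes>\<^bsub>A.W\<^esub> (u2 \<ominus>\<^bsub>A.W\<^esub> g \<otimes>\<^bsub>A.W\<^esub> u1)"
  proof -
    have *: "(x \<oplus>\<^bsub>A.W\<^esub> y) \<ominus>\<^bsub>A.W\<^esub> (x \<oplus>\<^bsub>A.W\<^esub> z) = y \<ominus>\<^bsub>A.W\<^esub> z"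
      if "x \<in> carrier A.W" "y \<in> carrier A.W" "z \<in> carrier A.W" for x y z
      using that by (simp add: A.W.minus_eq A.W.minus_add A.W.a_comm[of x y] A.W.a_assoc A.W.r_neg2)
    show ?thesis unfolding u2(2) using cl u1(1) u2(1)
      by (subst *) (simp_all add: A.W.minus_eq A.W.r_distr A.W.r_minus)
  qed
  finally have ut: "u \<otimes>\<^bsub>A.W\<^esub> t = A.P \<otimes>\<^bsub>A.W\<^esub> (u2 \<ominus>\<^bsub>A.W\<^esub> g \<otimes>\<^bsub>A.W\<^esub> u1)" .
  obtain c a where ca: "A.lead t c" "a \<in> carrier A" "t c \<otimes>\<^bsub>A\<^esub> a = \<one>\<^bsub>A\<^esub>" using unit[OF l] unfolding t_def by blast
  have "\<exists>w\<in>carrier A.W. u = A.P \<otimes>\<^bsub>A.W\<^esub> w"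
    by (rule A.P_dvd_cancel[OF u cl(3) ca(1,3,2) _ ut]) (use cl u1 u2 in simp)
  then obtain w where w: "w \<in> carrier A.W" "u = A.P \<otimes>\<^bsub>A.W\<^esub> w" by blast
  have "Z \<otimes>\<^bsub>A.W\<^esub> g = g \<otimes>\<^bsub>A.W\<^esub> Z \<oplus>\<^bsub>A.W\<^esub> u"
    unfolding u_def using cl by (simp add: A.W.minus_eq A.W.a_lcomm[of "g \<otimes>\<^bsub>A.W\<^esub> Z"] A.W.r_neg)
  then show "\<exists>w. A.quotrel (psi (Y j)) (A.gen l) w"
    using w unfolding A.quotrel_def Z_def g_def by blast
qed

section \<open>The reduced endomorphism and the reduced derivations\<close>

definition psibar where "psibar = descend (\<lambda>v. hm (psi v))"

lemma psibar: "v \<in> carrier A.W \<Longrightarrow> psibar (hm v) = hm (psi v)"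
  unfolding psibar_def by (rule descend) (auto simp: hm_sc psi_sc)

lemma psibar_hom: "psibar \<in> ring_hom B.W B.W"
proof (rule ring_hom_memI)
  fix x y assume x: "x \<in> carrier B.W" and y: "y \<in> carrier B.W"
  obtain v where v: "v \<in> carrier A.W" "x = hm v" by (rule lift[OF x])
  obtain w where w: "w \<in> carrier A.W" "y = hm w" by (rule lift[OF y])
  have "hm v \<otimes>\<^bsub>B.W\<^esub> hm w = hm (v \<otimes>\<^bsub>A.W\<^esub> w)" "hm v \<oplus>\<^bsub>B.W\<^esub> hm w = hm (v \<oplus>\<^bsub>A.W\<^esub> w)" using v w by auto
  then show "psibar (x \<otimes>\<^bsub>B.W\<^esub> y) = psibar x \<otimes>\<^bsub>B.W\<^esub> psibar y" "psibar (x \<oplus>\<^bsub>B.W\<^esub> y) = psibar x \<oplus>\<^bsub>B.W\<^esub> psibar y"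
    using psibar[OF v(1)] psibar[OF w(1)] psibar[of "v \<otimes>\<^bsub>A.W\<^esub> w"] psibar[of "v \<oplus>\<^bsub>A.W\<^esub> w"] v w by simp_all
  show "psibar x \<in> carrier B.W" using v psibar[OF v(1)] by simp
next
  show "psibar \<one>\<^bsub>B.W\<^esub> = \<one>\<^bsub>B.W\<^esub>" using psibar[of "\<one>\<^bsub>A.W\<^esub>"] by simp
qed

sublocale pb: ring_hom_ring B.W B.W psibar
  by (rule ring_hom_ringI2[OF B.W.ring_axioms B.W.ring_axioms psibar_hom])

lemma psibar_sc:
  assumes "a \<in> carrier F"
  shows "psibar (B.sc a) = B.sc a"
proof -
  obtain a' where a': "a' \<in> carrier A" "a = h a'" using assms h_surj by blast
  then show ?thesis using psibar[of "A.sc a'"] by (simp add: psi_sc hm_sc)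
qed

definition der where "der Z = descend (\<lambda>v. hm (A.quo Z v))"

lemma der: "A.central_mod Z \<Longrightarrow> v \<in> carrier A.W \<Longrightarrow> der Z (hm v) = hm (A.quo Z v)"
  unfolding der_def by (rule descend) (auto simp: A.quo_add A.quo_scale hm_sc)

lemma der_closed:
  assumes "A.central_mod Z" "x \<in> carrier B.W"
  shows "der Z x \<in> carrier B.W"
proof -
  obtain v where "v \<in> carrier A.W" "x = hm v" by (rule lift[OF assms(2)])
  then show ?thesis using assms der by simp
qed

lemma der_add:
  assumes Z: "A.central_mod Z" and x: "x \<in> carrier B.W" and y: "y \<in> carrier B.W"
  shows "der Z (x \<oplus>\<^bsub>B.W\<^esub> y) = der Z x \<oplus>\<^bsub>B.W\<^esub> der Z y"
proof -
  obtain v where v: "v \<in> carrier A.W" "x = hm v" by (rule lift[OF x])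
  obtain w where w: "w \<in> carrier A.W" "y = hm w" by (rule lift[OF y])
  have e: "x \<oplus>\<^bsub>B.W\<^esub> y = hm (v \<oplus>\<^bsub>A.W\<^esub> w)" using v w by simp
  show ?thesis unfolding e der[OF Z A.W.a_closed[OF v(1) w(1)]] A.quo_add[OF Z v(1) w(1)]
    unfolding v(2) w(2) der[OF Z v(1)] der[OF Z w(1)] using v(1) w(1) Z by simp
qed

lemma der_mult:
  assumes Z: "A.central_mod Z" and x: "x \<in> carrier B.W" and y: "y \<in> carrier B.W"
  shows "der Z (x \<otimes>\<^bsub>B.W\<^esub> y) = der Z x \<otimes>\<^bsub>B.W\<^esub> y \<oplus>\<^bsub>B.W\<^esub> x \<otimes>\<^bsub>B.W\<^esub> der Z y"
proof -
  obtain v where v: "v \<in> carrier A.W" "x = hm v" by (rule lift[OF x])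
  obtain w where w: "w \<in> carrier A.W" "y = hm w" by (rule lift[OF y])
  have e: "x \<otimes>\<^bsub>B.W\<^esub> y = hm (v \<otimes>\<^bsub>A.W\<^esub> w)" using v w by simp
  show ?thesis unfolding e der[OF Z A.W.m_closed[OF v(1) w(1)]] A.quo_mult[OF Z v(1) w(1)]
    unfolding v(2) w(2) der[OF Z v(1)] der[OF Z w(1)] using v(1) w(1) Z by simp
qed

lemma der_sc:
  assumes "A.central_mod Z" "a \<in> carrier F"
  shows "der Z (B.sc a) = \<zero>\<^bsub>B.W\<^esub>"
proof -
  obtain a' where a': "a' \<in> carrier A" "a = h a'" using assms h_surj by blast
  then show ?thesis using der[OF assms(1), of "A.sc a'"] assms by (simp add: A.quo_sc hm_sc)
qed

lemma der_psibar:
  assumes Z: "A.central_mod Z" "A.central_mod (psi Z)" and x: "x \<in> carrier B.W"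
  shows "psibar (der Z x) = der (psi Z) (psibar x)"
proof -
  obtain v where v: "v \<in> carrier A.W" "x = hm v" by (rule lift[OF x])
  have Zc: "Z \<in> carrier A.W" using Z by (simp add: A.central_mod_def)
  have q: "A.quo Z v \<in> carrier A.W" using Z v by simp
  have "A.quo (psi Z) (psi v) = psi (A.quo Z v)"
    using Zc v psi_quotrel[OF Zc v(1) A.quotrel_quo[OF Z(1) v(1)]] by (intro A.quo_eqI) auto
  moreover have "psibar (der Z x) = hm (psi (A.quo Z v))" unfolding v(2) der[OF Z(1) v(1)] by (rule psibar[OF q])
  moreover have "der (psi Z) (psibar x) = hm (A.quo (psi Z) (psi v))"
    unfolding v(2) psibar[OF v(1)] by (rule der[OF Z(2)]) (use v in simp)
  ultimately show ?thesis by simp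
qed

lemma der_Zc:
  assumes Z: "A.central_mod Z" and z: "z \<in> B.Zc"
  shows "der Z z \<in> B.Zc"
proof -
  have zW: "z \<in> carrier B.W" using z by simp
  have "der Z z \<otimes>\<^bsub>B.W\<^esub> w = w \<otimes>\<^bsub>B.W\<^esub> der Z z" if w: "w \<in> carrier B.W" for w
  proof -
    have d: "der Z z \<in> carrier B.W" "der Z w \<in> carrier B.W" using der_closed Z zW w by auto
    have "der Z (z \<otimes>\<^bsub>B.W\<^esub> w) = der Z (w \<otimes>\<^bsub>B.W\<^esub> z)" unfolding B.Zc_comm[OF z w] ..
    then have "der Z z \<otimes>\<^bsub>B.W\<^esub> w \<oplus>\<^bsub>B.W\<^esub> z \<otimes>\<^bsub>B.W\<^esub> der Z w = der Z w \<otimes>\<^bsub>B.W\<^esub> z \<oplus>\<^bsub>B.W\<^esub> w \<otimes>\<^bsub>B.W\<^esub> der Z z"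
      unfolding der_mult[OF Z zW w] der_mult[OF Z w zW] .
    also have "\<dots> = w \<otimes>\<^bsub>B.W\<^esub> der Z z \<oplus>\<^bsub>B.W\<^esub> z \<otimes>\<^bsub>B.W\<^esub> der Z w"
      unfolding B.Zc_comm[OF z d(2)] using d zW w by (intro B.W.a_comm) auto
    finally have "der Z z \<otimes>\<^bsub>B.W\<^esub> w \<oplus>\<^bsub>B.W\<^esub> z \<otimes>\<^bsub>B.W\<^esub> der Z w = w \<otimes>\<^bsub>B.W\<^esub> der Z z \<oplus>\<^bsub>B.W\<^esub> z \<otimes>\<^bsub>B.W\<^esub> der Z w" .
    then show ?thesis using d zW w by (subst (asm) B.W.add.r_cancel) auto
  qed
  then show ?thesis using B.Zc_central[OF der_closed[OF Z zW]] by blast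
qed

text \<open>The value of [Y_i, -]/p on the i-th central variable. It is nonzero because p does not
  divide (p-1)!.\<close>

definition \<kappa> where
  "\<kappa> i = (if i < n then B.nc (fact (p - 1)) else \<ominus>\<^bsub>F\<^esub> B.nc (fact (p - 1)))"

lemma \<kappa>: "\<kappa> i \<in> carrier F" "\<kappa> i \<noteq> \<zero>\<^bsub>F\<^esub>"
proof -
  show "\<kappa> i \<in> carrier F" by (simp add: \<kappa>_def)
  have "\<not> p dvd fact (p - 1)" using B.prime_p B.p_pos by (simp add: prime_dvd_fact_iff)
  then have "B.nc (fact (p - 1)) \<noteq> \<zero>\<^bsub>F\<^esub>" by (simp add: B.nc_eq_zero_iff)
  then show "\<kappa> i \<noteq> \<zero>\<^bsub>F\<^esub>" by (simp add: \<kappa>_def)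
qed

lemma der_pow_mx:
  assumes Z: "A.central_mod Z" and g: "g \<in> carrier B.W"
  shows "B.mx q (der Z (g [^]\<^bsub>B.W\<^esub> Suc k)) \<le> k * B.mx q g + B.mx q (der Z g)"
proof (induction k)
  case 0 then show ?case using g by simp
next
  case (Suc k)
  define v where "v = g [^]\<^bsub>B.W\<^esub> Suc k"
  have v: "v \<in> carrier B.W" unfolding v_def using g by (simp del: B.W.nat_pow_Suc)
  have d: "der Z v \<in> carrier B.W" "der Z g \<in> carrier B.W" using der_closed Z v g by auto
  have "der Z (g [^]\<^bsub>B.W\<^esub> Suc (Suc k)) = der Z v \<otimes>\<^bsub>B.W\<^esub> g \<oplus>\<^bsub>B.W\<^esub> v \<otimes>\<^bsub>B.W\<^esub> der Z g"
    using der_mult[OF Z v g] unfolding v_def by simp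
  then have "B.mx q (der Z (g [^]\<^bsub>B.W\<^esub> Suc (Suc k))) \<le> max (B.mx q (der Z v) + B.mx q g) (B.mx q v + B.mx q (der Z g))"
    using B.mx_add[of "der Z v \<otimes>\<^bsub>B.W\<^esub> g" "v \<otimes>\<^bsub>B.W\<^esub> der Z g" q] B.mx_mult_le[OF d(1) g, of q] B.mx_mult_le[OF v d(2), of q] d v g
    by simp
  moreover have "B.mx q v \<le> Suc k * B.mx q g" unfolding v_def by (rule B.mx_pow[OF g])
  ultimately show ?case using Suc.IH unfolding v_def[symmetric] by simp
qed

lemma der_pow_zero:
  assumes Z: "A.central_mod Z" and g: "g \<in> carrier B.W" "der Z g = \<zero>\<^bsub>B.W\<^esub>"
  shows "der Z (g [^]\<^bsub>B.W\<^esub> (k::nat)) = \<zero>\<^bsub>B.W\<^esub>"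
proof (induction k)
  case 0 then show ?case using der_sc[OF Z, of "\<one>\<^bsub>F\<^esub>"] by simp
next
  case (Suc k) then show ?case using der_mult[OF Z _ g(1), of "g [^]\<^bsub>B.W\<^esub> k"] g by simp
qed

lemma hm_pow: "v \<in> carrier A.W \<Longrightarrow> hm (v [^]\<^bsub>A.W\<^esub> (k::nat)) = hm v [^]\<^bsub>B.W\<^esub> k"
  by (induction k) (auto simp: hm_one)

text \<open>For i = j the value is central, and a degree estimate shows that all its exponents are
  below p. Hence it is a scalar, and the constant coefficient is already known from
  \<open>quo_pow_const\<close>.\<close>

lemma der_y:
  assumes i: "i < 2 * n" and j: "j < 2 * n"
  shows "der (Y i) (B.y j) = (if i = j then B.sc (\<kappa> i) else \<zero>\<^bsub>B.W\<^esub>)"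
proof -
  have Z: "A.central_mod (Y i)" by (rule A.central_mod_gen[OF i])
  have y: "B.y j = B.gen j [^]\<^bsub>B.W\<^esub> p" by (rule B.y_gen[OF j])
  have g: "B.gen j \<in> carrier B.W" "A.gen j \<in> carrier A.W" using j by auto
  have dg: "der (Y i) (B.gen j) = hm (A.quo (Y i) (A.gen j))"
    using der[OF Z g(2)] by (simp add: hm_gen)
  show ?thesis
  proof (cases "i = j")
    case False
    have "der (Y i) (B.gen j) = \<zero>\<^bsub>B.W\<^esub>" unfolding dg A.quo_gen[OF i j] using False by simp
    then show ?thesis unfolding y using False der_pow_zero[OF Z g(1)] by simp
  next
    case True
    define v where "v = B.gen (A.pair i) [^]\<^bsub>B.W\<^esub> (p - 1)"
    have pi: "A.pair i < 2 * n" using i by simp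
    have v: "v \<in> carrier B.W" unfolding v_def using B.gen_closed[OF pi] by simp
    have ag: "A.gen (A.pair i) [^]\<^bsub>A.W\<^esub> (p - 1) \<in> carrier A.W" using A.gen_closed[OF pi] by simp
    have "hm (A.gen (A.pair i) [^]\<^bsub>A.W\<^esub> (p - 1)) = v" unfolding v_def using hm_pow[OF A.gen_closed[OF pi]] by (simp add: hm_gen)
    then have "der (Y i) (B.gen j) = (if i < n then v else \<ominus>\<^bsub>B.W\<^esub> v)"
      unfolding dg A.quo_gen[OF i j] using True ag by simp
    then have m1: "B.mx q (der (Y i) (B.gen j)) \<le> B.mx q v" for q using B.mx_minus[OF v] by simp
    have m2: "B.mx q v \<le> (if q = A.pair i then p - 1 else 0)" for q
      using B.mx_pow[OF B.gen_closed[OF pi], of q "p - 1"] B.mx_gen[OF pi, of q] unfolding v_def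
      by (auto split: if_splits dest: order_trans[OF _ mult_le_mono2])
    define z where "z = der (Y i) (B.y j)"
    have z: "z \<in> B.Zc" unfolding z_def by (rule der_Zc[OF Z]) (use j B.PZ.var_closed in simp)
    obtain p' where p': "p = Suc p'" using B.p_pos by (cases p) auto
    \<comment> \<open>By the product rule p-1 factors \<open>gen j\<close> remain, and [Y, gen j]/p
      contributes p-1 to the conjugate letter only. The two letters differ, so neither exponent
      reaches p.\<close>
    have "B.mx q z < p" for q
    proof -
      have "B.mx q z \<le> p' * B.mx q (B.gen j) + B.mx q (der (Y i) (B.gen j))"
        using der_pow_mx[OF Z g(1), of q p'] unfolding z_def y p'[symmetric] .
      also have "\<dots> \<le> p' * (if q = j then 1 else 0) + (if q = A.pair i then p - 1 else 0)"
        using B.mx_gen[OF j, of q] m1[of q] m2[of q] by (intro add_mono mult_le_mono2) auto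
      also have "\<dots> < p" using True i p' by (auto simp: A.pair_def)
      finally show ?thesis .
    qed
    then have zc: "z = B.sc (z (\<lambda>_. 0))" by (rule B.Zc_small_const[OF z])
    have gp: "A.gen j [^]\<^bsub>A.W\<^esub> p \<in> carrier A.W" using g by simp
    have "z = hm (A.quo (Y i) (A.gen j [^]\<^bsub>A.W\<^esub> p))"
      unfolding z_def y using der[OF Z gp] hm_pow[OF g(2)] by (simp add: hm_gen)
    then have "z (\<lambda>_. 0) = h (A.quo (Y i) (A.gen j [^]\<^bsub>A.W\<^esub> p) (\<lambda>_. 0))" by (simp add: hm_def)
    also have "\<dots> = \<kappa> i"
      using A.quo_pow_const[OF i] True by (simp add: \<kappa>_def h_nc)
    finally show ?thesis using zc True unfolding z_def by simp
  qed
qed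

lemma rel_bar: "l < 2 * n \<Longrightarrow> B.gen l \<otimes>\<^bsub>B.W\<^esub> psibar (hm (s l)) = psibar (hm (b l))"
  and psibar_s: "l < 2 * n \<Longrightarrow> psibar (hm (s l)) \<noteq> \<zero>\<^bsub>B.W\<^esub>"
proof -
  assume l: "l < 2 * n"
  show "B.gen l \<otimes>\<^bsub>B.W\<^esub> psibar (hm (s l)) = psibar (hm (b l))"
    unfolding psibar[OF sb_closed(1)[OF l]] psibar[OF sb_closed(2)[OF l]] rel[OF l, symmetric]
    using l sb_closed[OF l] by (simp add: hm_gen)
  obtain c a where ca: "a \<in> carrier A" "psi (s l) c \<otimes>\<^bsub>A\<^esub> a = \<one>\<^bsub>A\<^esub>" using unit[OF l] by blast
  have pc: "psi (s l) c \<in> carrier A" using A.coeff_closed[of "psi (s l)" c] sb_closed[OF l] by simp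
  have "h (psi (s l) c) \<otimes>\<^bsub>F\<^esub> h a = h (psi (s l) c \<otimes>\<^bsub>A\<^esub> a)" using ca(1) pc by simp
  then have "h (psi (s l) c) \<otimes>\<^bsub>F\<^esub> h a = \<one>\<^bsub>F\<^esub>" using ca(2) by simp
  then have "h (psi (s l) c) \<noteq> \<zero>\<^bsub>F\<^esub>" using ca(1) by auto
  then show "psibar (hm (s l)) \<noteq> \<zero>\<^bsub>B.W\<^esub>"
    unfolding psibar[OF sb_closed(1)[OF l]] by (auto simp: hm_def B.W_zero dest: fun_cong)
qed

text \<open>The image of z commutes with every image, in particular with t =
  \<open>psibar (hm (s l))\<close> and with g t. Hence its commutator with the generator g, times t,
  is zero, and t cancels.\<close>

lemma psibar_Zc:
  assumes z: "z \<in> B.Zc"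
  shows "psibar z \<in> B.Zc"
proof (rule B.central_of_gens)
  have zW: "z \<in> carrier B.W" using z by simp
  show u: "psibar z \<in> carrier B.W" using zW by simp
  fix l assume l: "l < 2 * n"
  define t where "t = psibar (hm (s l))"
  have t: "t \<in> carrier B.W" "t \<noteq> \<zero>\<^bsub>B.W\<^esub>" using psibar_s[OF l] sb_closed[OF l] by (auto simp: t_def)
  have g: "B.gen l \<in> carrier B.W" using l by simp
  have comm: "psibar z \<otimes>\<^bsub>B.W\<^esub> psibar w = psibar w \<otimes>\<^bsub>B.W\<^esub> psibar z" if w: "w \<in> carrier B.W" for w
    using arg_cong[OF B.Zc_comm[OF z w], of psibar] zW w by simp
  have "psibar z \<otimes>\<^bsub>B.W\<^esub> (B.gen l \<otimes>\<^bsub>B.W\<^esub> t) = (B.gen l \<otimes>\<^bsub>B.W\<^esub> t) \<otimes>\<^bsub>B.W\<^esub> psibar z"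
    unfolding t_def rel_bar[OF l] by (rule comm) (use sb_closed[OF l] in simp)
  also have "\<dots> = B.gen l \<otimes>\<^bsub>B.W\<^esub> (psibar z \<otimes>\<^bsub>B.W\<^esub> t)"
    using comm[of "hm (s l)"] sb_closed[OF l] g t u unfolding t_def by (simp add: B.W.m_assoc)
  finally have eq: "(psibar z \<otimes>\<^bsub>B.W\<^esub> B.gen l) \<otimes>\<^bsub>B.W\<^esub> t = (B.gen l \<otimes>\<^bsub>B.W\<^esub> psibar z) \<otimes>\<^bsub>B.W\<^esub> t"
    using g t u by (simp add: B.W.m_assoc)
  show "psibar z \<otimes>\<^bsub>B.W\<^esub> B.gen l = B.gen l \<otimes>\<^bsub>B.W\<^esub> psibar z"
    by (rule B.W_cancel_right[OF _ _ t(1) eq t(2)]) (use g u in simp_all)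
qed

lemma charp_endo: "charp_endo F n p psibar (\<lambda>j. der (Y j)) (\<lambda>j. der (psi (Y j))) \<kappa>"
proof (intro charp_endo.intro charp_endo_axioms.intro B.weyl_charp_axioms psibar_hom psibar_sc psibar_Zc)
qed (use A.central_mod_gen psi_Y_central der_closed der_add der_mult der_sc der_y \<kappa> der_psibar in \<open>simp_all\<close>)

lemma left_multiple_bar: "l < 2 * n \<Longrightarrow> \<exists>c\<in>carrier B.W. hm (b l) = c \<otimes>\<^bsub>B.W\<^esub> hm (s l)"
  using charp_endo.left_multiple[OF charp_endo, of "B.gen l" "hm (s l)" "hm (b l)"] rel_bar psibar_s sb_closed by simp

section \<open>Leading exponents under reduction\<close>

lemma hm_lead:
  assumes v: "v \<in> carrier A.W" "A.lead v e" "a \<in> carrier A" "v e \<otimes>\<^bsub>A\<^esub> a = \<one>\<^bsub>A\<^esub>"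
  shows "B.lead (hm v) e"
proof -
  have "h (v e) \<otimes>\<^bsub>F\<^esub> h a = h (v e \<otimes>\<^bsub>A\<^esub> a)" using v(3) A.coeff_closed[OF v(1), of e] by simp
  then have "h (v e) \<otimes>\<^bsub>F\<^esub> h a = \<one>\<^bsub>F\<^esub>" unfolding v(4) by simp
  then have "h (v e) \<noteq> \<zero>\<^bsub>F\<^esub>" using v by auto
  moreover have "v x \<noteq> \<zero>\<^bsub>A\<^esub>" if "h (v x) \<noteq> \<zero>\<^bsub>F\<^esub>" for x using that by auto
  ultimately show ?thesis using v(2) by (auto simp: B.lead_def A.lead_def B.bnd_def A.bnd_def hm_def)
qed

text \<open>After reduction b is a left multiple of s, hence so is the remainder r. Reduction keeps
  the leading exponents of r and s, their coefficients being invertible, and leading exponents are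
  additive.\<close>

lemma remainder_lead:
  assumes l: "l < 2 * n" and c: "c \<in> carrier A.W" and r: "r \<in> carrier A.W" "b l = c \<otimes>\<^bsub>A.W\<^esub> s l \<oplus>\<^bsub>A.W\<^esub> r"
    and e: "A.lead r e" "\<exists>a\<in>carrier A. r e \<otimes>\<^bsub>A\<^esub> a = \<one>\<^bsub>A\<^esub>"
    and d: "A.lead (s l) d" "\<exists>a\<in>carrier A. s l d \<otimes>\<^bsub>A\<^esub> a = \<one>\<^bsub>A\<^esub>"
  shows "\<exists>e'. e = (\<lambda>i. e' i + d i)"
proof -
  note sl = sb_closed(1)[OF l]
  have le: "B.lead (hm r) e" "B.lead (hm (s l)) d" using hm_lead r sl e d by blast+
  obtain c' where c': "c' \<in> carrier B.W" "hm (b l) = c' \<otimes>\<^bsub>B.W\<^esub> hm (s l)" using left_multiple_bar[OF l] by blast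
  define x where "x = c' \<ominus>\<^bsub>B.W\<^esub> hm c"
  have x: "x \<in> carrier B.W" using c c' by (simp add: x_def)
  have "hm r = x \<otimes>\<^bsub>B.W\<^esub> hm (s l)"
  proof -
    have cl: "hm c \<otimes>\<^bsub>B.W\<^esub> hm (s l) \<in> carrier B.W" "hm r \<in> carrier B.W" using c sl r by auto
    have "x \<otimes>\<^bsub>B.W\<^esub> hm (s l) = c' \<otimes>\<^bsub>B.W\<^esub> hm (s l) \<ominus>\<^bsub>B.W\<^esub> hm c \<otimes>\<^bsub>B.W\<^esub> hm (s l)"
      unfolding x_def using c c' sl by (simp add: B.W.minus_eq B.W.l_distr B.W.l_minus)
    also have "\<dots> = (hm c \<otimes>\<^bsub>B.W\<^esub> hm (s l) \<oplus>\<^bsub>B.W\<^esub> hm r) \<ominus>\<^bsub>B.W\<^esub> hm c \<otimes>\<^bsub>B.W\<^esub> hm (s l)"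
      unfolding c'(2)[symmetric] r(2) using c sl r(1) by simp
    also have "\<dots> = hm r" using cl B.W.a_comm[OF cl] by (simp add: B.W.minus_eq B.W.a_assoc B.W.r_neg)
    finally show ?thesis by simp
  qed
  moreover have "hm r \<noteq> \<zero>\<^bsub>B.W\<^esub>" using le(1) by (auto simp: B.lead_def B.W_zero)
  ultimately have xnz: "x \<noteq> \<zero>\<^bsub>B.W\<^esub>" using sl by auto
  then obtain e' where e': "B.lead x e'" using B.lead_exists[OF x] by blast
  have "B.lead (hm r) (\<lambda>i. e' i + d i)"
    unfolding \<open>hm r = x \<otimes>\<^bsub>B.W\<^esub> hm (s l)\<close> by (rule B.lead_mult[OF x _ e' le(2)]) (use sl in simp)
  from B.lead_unique[OF hm_closed[OF r(1)] le(1) this] show ?thesis by (rule exI[of _ e'])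
qed

end

section \<open>Characteristic zero\<close>

locale weyl_zero = weyl R n + field R for R (structure) and n +
  assumes char_zero: "0 < k \<Longrightarrow> nc k \<noteq> \<zero>"

sublocale weyl_zero \<subseteq> weyl_domain ..

section \<open>Weyl algebras over a subring of the field\<close>

locale coeff_subring = weyl_zero R n for R (structure) and n +
  fixes S
  assumes subring_S: "subring S R"
begin

abbreviation "A \<equiv> R\<lparr>carrier := S\<rparr>"

lemma S_closed: "S \<subseteq> carrier R"
  by (rule subringE(1)[OF subring_S])

lemma A_cring: "cring A"
  using subring_S subcringI' subcring_iff[OF S_closed] by blast

lemma A_domain: "domain A"
proof (intro domain.intro[OF A_cring] domain_axioms.intro)
  fix a b assume "a \<otimes>\<^bsub>A\<^esub> b = \<zero>\<^bsub>A\<^esub>" "a \<in> carrier A" "b \<in> carrier A"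
  then show "a = \<zero>\<^bsub>A\<^esub> \<or> b = \<zero>\<^bsub>A\<^esub>" using integral[of a b] S_closed by auto
qed simp

text \<open>The inclusion is a change of coefficients that is the identity on functions, so every
  compatibility between the two Weyl algebras is an instance of \<open>weyl_map\<close>.\<close>

sublocale inc: weyl_map A R n "\<lambda>x. x"
proof (intro weyl_map.intro ring_hom_cring.intro ring_hom_cring_axioms.intro)
  show "weyl A" by (intro weyl.intro A_cring)
  show "(\<lambda>x. x) \<in> ring_hom A R" using S_closed by (intro ring_hom_memI) auto
qed (intro weyl.intro A_cring is_cring)+

lemma inc_hm: "inc.hm v = v"
  by (simp add: inc.hm_def)

lemma sub_carrier: "v \<in> carrier inc.A.W \<longleftrightarrow> v \<in> carrier W \<and> range v \<subseteq> S"
proof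
  assume v: "v \<in> carrier inc.A.W"
  then show "v \<in> carrier W \<and> range v \<subseteq> S" using inc.hm_closed[OF v] inc.A.coeff_closed[OF v] by (auto simp: inc_hm)
next
  assume v: "v \<in> carrier W \<and> range v \<subseteq> S"
  then show "v \<in> carrier inc.A.W" unfolding inc.A.W_carrier W_carrier
    by (intro inc.A.fin_suppI) (auto simp: fin_suppD inc.A.exps_def exps_def dest: fin_suppD(3))
qed

lemma sub_ops:
  "v \<in> carrier inc.A.W \<Longrightarrow> w \<in> carrier inc.A.W \<Longrightarrow> v \<otimes>\<^bsub>inc.A.W\<^esub> w = v \<otimes>\<^bsub>W\<^esub> w"
  "v \<in> carrier inc.A.W \<Longrightarrow> w \<in> carrier inc.A.W \<Longrightarrow> v \<oplus>\<^bsub>inc.A.W\<^esub> w = v \<oplus>\<^bsub>W\<^esub> w"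
  "\<one>\<^bsub>inc.A.W\<^esub> = \<one>\<^bsub>W\<^esub>" "inc.A.gen j = gen j" "inc.A.sc a = sc a" "inc.A.nc k = nc k"
  using inc.hm_mult[of v w] inc.hm_add[of v w] inc.hm_one inc.hm_gen[of j] inc.hm_sc[of a] inc.h_nc[of k]
  by (simp_all add: inc_hm)

lemma sub_lead: "inc.A.lead v c \<longleftrightarrow> lead v c"
  by (simp add: inc.A.lead_def lead_def inc.A.bnd_def bnd_def)

lemma sub_endo:
  assumes phi: "phi \<in> ring_hom W W" "\<And>a. a \<in> carrier R \<Longrightarrow> phi (sc a) = sc a"
    and g: "\<And>j. j < 2 * n \<Longrightarrow> range (phi (gen j)) \<subseteq> S"
  shows "phi \<in> ring_hom inc.A.W inc.A.W"
proof -
  interpret phi: ring_hom_ring W W phi by (rule ring_hom_ringI2[OF W.ring_axioms W.ring_axioms phi(1)])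
  have W: "v \<in> carrier W" if "v \<in> carrier inc.A.W" for v using that by (simp add: sub_carrier)
  have cl: "phi v \<in> carrier inc.A.W" if "v \<in> carrier inc.A.W" for v
    using that
  proof (induction rule: inc.A.W_induct)
    case one then show ?case using inc.A.W.one_closed by (simp add: sub_ops(3))
  next
    case (add v w)
    then have "phi (v \<oplus>\<^bsub>inc.A.W\<^esub> w) = phi v \<oplus>\<^bsub>inc.A.W\<^esub> phi w" using W by (simp add: sub_ops(2))
    then show ?case using add by simp
  next
    case (sc a v)
    have a: "a \<in> carrier R" using sc S_closed by auto
    have sa: "sc a \<in> carrier inc.A.W" using inc.A.sc_closed[OF sc(1)] by (simp only: sub_ops(5))
    have "phi (inc.A.sc a \<otimes>\<^bsub>inc.A.W\<^esub> v) = sc a \<otimes>\<^bsub>inc.A.W\<^esub> phi v"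
      unfolding sub_ops(5) sub_ops(1)[OF sa sc(2)] sub_ops(1)[OF sa sc(3)] using W[OF sc(2)] a by (simp add: phi(2))
    then show ?case using inc.A.W.m_closed[OF sa sc(3)] by simp
  next
    case (gen j v)
    have gj: "gen j \<in> carrier inc.A.W" using inc.A.gen_closed[OF gen(1)] by (simp only: sub_ops(4))
    have pg: "phi (gen j) \<in> carrier inc.A.W" using g[OF gen(1)] gen(1) by (simp add: sub_carrier)
    have "phi (inc.A.gen j \<otimes>\<^bsub>inc.A.W\<^esub> v) = phi (gen j) \<otimes>\<^bsub>inc.A.W\<^esub> phi v"
      unfolding sub_ops(4) sub_ops(1)[OF gj gen(2)] sub_ops(1)[OF pg gen(3)] using W[OF gen(2)] gen(1) by simp
    then show ?case using inc.A.W.m_closed[OF pg gen(3)] by simp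
  qed
  show ?thesis
    by (rule ring_hom_memI) (auto simp: cl W sub_ops(1-3))
qed

end

locale zero_endo = weyl_zero R n for R (structure) and n +
  fixes phi
  assumes phi_hom: "phi \<in> ring_hom W W" and phi_sc: "\<And>a. a \<in> carrier R \<Longrightarrow> phi (sc a) = sc a"
begin

sublocale phi: ring_hom_ring W W phi
  by (rule ring_hom_ringI2[OF W.ring_axioms W.ring_axioms phi_hom])

text \<open>The argument behind simplicity in characteristic zero: derivatives of a kernel element
  are commutators, so they vanish by induction on degree. An element with vanishing derivatives is a
  scalar, which phi fixes.\<close>

lemma kernel_zero: "v \<in> carrier W \<Longrightarrow> phi v = \<zero>\<^bsub>W\<^esub> \<Longrightarrow> v = \<zero>\<^bsub>W\<^esub>"
proof (induction "td v" arbitrary: v rule: less_induct)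
  case less
  note v = less.prems(1)
  have k: "phi (pd j v) = \<zero>\<^bsub>W\<^esub>" if "j < 2 * n" for j
    using that
  proof (cases rule: index_cases)
    case x
    then show ?thesis using arg_cong[OF comm_d[OF x v], of phi] v less.prems(2) by simp
  next
    case (d l)
    then show ?thesis using arg_cong[OF comm_x[OF d(2) v], of phi] v less.prems(2) by simp
  qed
  have p0: "pd j v = \<zero>\<^bsub>W\<^esub>" if j: "j < 2 * n" for j
    using less.hyps[OF td_pd[OF v j]] k[OF j] v by auto
  have e0: "e = (\<lambda>_. 0)" if nz: "v e \<noteq> \<zero>" for e
  proof (rule ccontr)
    assume "e \<noteq> (\<lambda>_. 0)"
    then obtain j where ej: "e j \<noteq> 0" by auto
    have "e \<in> exps" using nz v by (auto simp: W_carrier fin_suppD)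
    then have j: "j < 2 * n" using ej by (auto simp: exps_def intro: leI)
    have "pd j v (e(j := e j - 1)) = nc (e j) \<otimes> v e" using ej by (simp add: pd_def)
    then have "nc (e j) \<otimes> v e = \<zero>" unfolding p0[OF j] by (simp add: W_zero)
    then show False using nz char_zero[of "e j"] ej coeff_closed[OF v, of e] integral_iff[of "nc (e j)" "v e"] by simp
  qed
  define a where "a = v (\<lambda>_. 0)"
  have a: "a \<in> carrier R" unfolding a_def by (rule coeff_closed[OF v])
  have va: "v = sc a"
  proof
    fix e show "v e = sc a e" using e0[of e] by (cases "e = (\<lambda>_. 0)") (simp_all add: sc_def single_def a_def, blast)
  qed
  show ?case using less.prems(2) unfolding va phi_sc[OF a] .
qed

lemma phi_inj: "inj_on phi (carrier W)"
proof (rule inj_onI)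
  fix v w assume vw: "v \<in> carrier W" "w \<in> carrier W" "phi v = phi w"
  then have "phi (v \<ominus>\<^bsub>W\<^esub> w) = \<zero>\<^bsub>W\<^esub>" by (simp add: W.minus_eq W.r_neg)
  then show "v = w" using kernel_zero[of "v \<ominus>\<^bsub>W\<^esub> w"] vw by simp
qed

lemma finite_tdeg: "finite {e \<in> exps. tdeg e \<le> d}"
proof (rule finite_subset)
  show "{e \<in> exps. tdeg e \<le> d} \<subseteq> (\<lambda>xs i. if i < 2 * n then xs ! i else 0) ` {xs. set xs \<subseteq> {..d} \<and> length xs = 2 * n}"
  proof
    fix e assume e: "e \<in> {e \<in> exps. tdeg e \<le> d}"
    have "e i \<le> d" if "i < 2 * n" for i
      using member_le_sum[of i "{..<2 * n}" e] that e by (simp add: tdeg_def)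
    then show "e \<in> (\<lambda>xs i. if i < 2 * n then xs ! i else 0) ` {xs. set xs \<subseteq> {..d} \<and> length xs = 2 * n}"
      using e by (intro image_eqI[of _ _ "map e [0..<2 * n]"]) (auto simp: exps_def fun_eq_iff)
  qed
qed (use finite_lists_length_eq[of "{..d}" "2 * n"] in auto)

text \<open>A remainder with smallest leading key is taken. If its leading exponent were d plus
  another exponent, subtracting a monomial times s would cancel the leading term.\<close>

lemma division:
  assumes s: "s \<in> carrier W" "lead s d" and b: "b \<in> carrier W" and no: "\<And>c. c \<in> carrier W \<Longrightarrow> b \<noteq> c \<otimes>\<^bsub>W\<^esub> s"
  obtains c r e where "c \<in> carrier W" "r \<in> carrier W" "b = c \<otimes>\<^bsub>W\<^esub> s \<oplus>\<^bsub>W\<^esub> r" "lead r e" "\<nexists>e'. e = (\<lambda>i. e' i + d i)"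
proof -
  define Q where "Q k \<longleftrightarrow> (\<exists>c\<in>carrier W. \<exists>r\<in>carrier W. \<exists>e. b = c \<otimes>\<^bsub>W\<^esub> s \<oplus>\<^bsub>W\<^esub> r \<and> lead r e \<and> k = key e)" for k
  have "b \<noteq> \<zero>\<^bsub>W\<^esub>" using no[of "\<zero>\<^bsub>W\<^esub>"] s by simp
  then obtain e0 where e0: "lead b e0" using lead_exists[OF b] by blast
  have Q0: "Q (key e0)" unfolding Q_def using b s e0
    by (intro bexI[of _ "\<zero>\<^bsub>W\<^esub>"] bexI[of _ b] exI[of _ e0]) auto
  \<comment> \<open>Only keys up to that of b compete. They form a finite set, since the total
    degree is bounded; the lexicographic order on lists as such is not well founded.\<close>
  define M where "M = {k. Q k \<and> k \<le> key e0}"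
  have "M \<subseteq> key ` {e \<in> exps. tdeg e \<le> tdeg e0}"
    unfolding M_def Q_def using lead_exps key_tdeg_le by fastforce
  then have fin: "finite M" using finite_tdeg finite_surj by blast
  have ne: "M \<noteq> {}" using Q0 by (auto simp: M_def)
  have "Min M \<in> M" by (rule Min_in[OF fin ne])
  then obtain c r e where c: "c \<in> carrier W" "r \<in> carrier W" "b = c \<otimes>\<^bsub>W\<^esub> s \<oplus>\<^bsub>W\<^esub> r" "lead r e" "Min M = key e" "key e \<le> key e0"
    unfolding M_def Q_def by auto
  have min: "key e \<le> k" if "Q k" for k
    using Min_le[OF fin, of k] that c(5,6) unfolding M_def by (cases "k \<le> key e0") auto
  have "\<nexists>e'. e = (\<lambda>i. e' i + d i)"
  proof
    assume "\<exists>e'. e = (\<lambda>i. e' i + d i)"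
    then obtain e' where e': "e = (\<lambda>i. e' i + d i)" by blast
    have ee: "e \<in> exps" "d \<in> exps" using lead_exps c s by auto
    then have e'x: "e' \<in> exps" unfolding exps_def e' by auto
    have sd: "s d \<noteq> \<zero>" "s d \<in> carrier R" "bnd s d" using s coeff_closed[OF s(1)] by (auto simp: lead_def)
    have re: "r e \<in> carrier R" "bnd r e" using c coeff_closed[OF c(2)] by (auto simp: lead_def)
    define a where "a = r e \<otimes> inv (s d)"
    have inv: "inv (s d) \<in> carrier R" "inv (s d) \<otimes> s d = \<one>" using field_Units sd by auto
    have a: "a \<in> carrier R" "a \<otimes> s d = r e" unfolding a_def using inv re sd by (auto simp: m_assoc)
    define m where "m = single a e'"
    have m: "m \<in> carrier W" unfolding m_def using a e'x by (simp add: W_carrier single_closed)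
    have bm: "bnd (m \<otimes>\<^bsub>W\<^esub> s) e" "(m \<otimes>\<^bsub>W\<^esub> s) e = r e"
      using bnd_single_mult[OF sd(3) s(1) ee(2) e'x a(1)] a(2) unfolding m_def e' by auto
    define r' where "r' = r \<ominus>\<^bsub>W\<^esub> m \<otimes>\<^bsub>W\<^esub> s"
    have r': "r' \<in> carrier W" unfolding r'_def using c m s by simp
    have rr: "r = m \<otimes>\<^bsub>W\<^esub> s \<oplus>\<^bsub>W\<^esub> r'"
      unfolding r'_def using c m s by (simp add: W.minus_eq W.a_lcomm[of "m \<otimes>\<^bsub>W\<^esub> s"] W.r_neg)
    have eq: "b = (c \<oplus>\<^bsub>W\<^esub> m) \<otimes>\<^bsub>W\<^esub> s \<oplus>\<^bsub>W\<^esub> r'"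
      using c(3) rr c(1) m s r' by (simp add: W.l_distr W.a_assoc)
    have "r' \<noteq> \<zero>\<^bsub>W\<^esub>"
    proof
      assume "r' = \<zero>\<^bsub>W\<^esub>"
      then have "b = (c \<oplus>\<^bsub>W\<^esub> m) \<otimes>\<^bsub>W\<^esub> s" using eq c(1) m s by simp
      then show False using no[of "c \<oplus>\<^bsub>W\<^esub> m"] c(1) m by simp
    qed
    then obtain f where f: "lead r' f" using lead_exists[OF r'] by blast
    have rfe: "r x = (m \<otimes>\<^bsub>W\<^esub> s) x \<oplus> r' x" for x using fun_cong[OF rr, of x] unfolding W_add .
    have cl: "(m \<otimes>\<^bsub>W\<^esub> s) x \<in> carrier R" "r' x \<in> carrier R" for x using coeff_closed m s r' by auto
    have "r' e = \<zero>" using rfe[of e] cl[of e] re(1) unfolding bm(2) by simp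
    then have "f \<noteq> e" using f by (auto simp: lead_def)
    moreover have "key f \<le> key e"
    proof (cases "r f = \<zero>")
      case True
      then have "(m \<otimes>\<^bsub>W\<^esub> s) f \<noteq> \<zero>" using rfe[of f] cl[of f] f by (auto simp: lead_def)
      then show ?thesis using bm(1) by (simp add: bnd_def)
    qed (use re(2) in \<open>simp add: bnd_def\<close>)
    moreover have "Q (key f)" unfolding Q_def
      by (rule bexI[of _ "c \<oplus>\<^bsub>W\<^esub> m"], rule bexI[of _ r'], rule exI[of _ f]) (use eq f c(1) m r' in blast)+
    then have "key e \<le> key f" by (rule min)
    ultimately show False using key_inj[OF ee(1) lead_exps[OF r' f]] by auto
  qed
  then show ?thesis using that c by blast
qed

theorem left_multiple_zero:
  assumes sb: "\<And>l. l < 2 * n \<Longrightarrow> s l \<in> carrier W" "\<And>l. l < 2 * n \<Longrightarrow> b l \<in> carrier W"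
    and nz: "\<And>l. l < 2 * n \<Longrightarrow> phi (s l) \<noteq> \<zero>\<^bsub>W\<^esub>"
    and rel: "\<And>l. l < 2 * n \<Longrightarrow> gen l \<otimes>\<^bsub>W\<^esub> phi (s l) = phi (b l)"
    and l: "l < 2 * n"
  shows "\<exists>c\<in>carrier W. b l = c \<otimes>\<^bsub>W\<^esub> s l"
proof (rule ccontr)
  assume no: "\<not> ?thesis"
  have "s l \<noteq> \<zero>\<^bsub>W\<^esub>" using nz[OF l] by auto
  then obtain d where d: "lead (s l) d" using lead_exists[OF sb(1)[OF l]] by blast
  obtain c r e where c: "c \<in> carrier W" "r \<in> carrier W" "b l = c \<otimes>\<^bsub>W\<^esub> s l \<oplus>\<^bsub>W\<^esub> r" "lead r e"
    and ne: "\<nexists>e'. e = (\<lambda>i. e' i + d i)"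
    using division[OF sb(1)[OF l] d sb(2)[OF l]] no by blast
  have "\<exists>f. lead (phi (s i)) f" if "i < 2 * n" for i using lead_exists[of "phi (s i)"] nz that sb by simp
  then obtain f where f: "\<And>i. i < 2 * n \<Longrightarrow> lead (phi (s i)) (f i)" by metis
  \<comment> \<open>Data of all generators enter, not only those of l, since centrality in the
    reduced algebra is tested against every generator.\<close>
  define T where "T = (\<Union>i\<in>{..<2 * n}. range (phi (gen i)) \<union> range (s i) \<union> range (b i) \<union> {inv (phi (s i) (f i))})
    \<union> range c \<union> range r \<union> {inv (r e), inv (s l d)}"
  have fin: "finite (range v)" if "v \<in> carrier W" for v
  proof (rule finite_subset)
    show "range v \<subseteq> insert \<zero> (v ` {x. v x \<noteq> \<zero>})" by auto
  qed (use that in \<open>simp add: W_carrier fin_suppD\<close>)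
  have unit: "inv a \<in> carrier R" "a \<otimes> inv a = \<one>" if "a \<in> carrier R" "a \<noteq> \<zero>" for a using field_Units that by auto
  have nzs: "phi (s i) (f i) \<noteq> \<zero>" "phi (s i) (f i) \<in> carrier R" if "i < 2 * n" for i
    using f[OF that] coeff_closed[of "phi (s i)"] sb(1)[OF that] by (auto simp: lead_def)
  have rnz: "r e \<noteq> \<zero>" "r e \<in> carrier R" using c(4) coeff_closed[OF c(2)] by (auto simp: lead_def)
  have snz: "s l d \<noteq> \<zero>" "s l d \<in> carrier R" using d coeff_closed[OF sb(1)[OF l]] by (auto simp: lead_def)
  have Tfin: "finite T" unfolding T_def using fin sb c by simp
  have rc: "range v \<subseteq> carrier R" if "v \<in> carrier W" for v using coeff_closed[OF that] by auto
  have "\<And>i. i < 2 * n \<Longrightarrow> range (phi (gen i)) \<subseteq> carrier R \<and> range (s i) \<subseteq> carrier R \<and> range (b i) \<subseteq> carrier R \<and> inv (phi (s i) (f i)) \<in> carrier R"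
    using rc sb unit nzs by simp
  then have Tc: "T \<subseteq> carrier R" unfolding T_def using rc c rnz snz unit by blast
  define S where "S = generate_ring R T"
  have TS: "T \<subseteq> S" unfolding S_def by (auto intro: generate_ring.incl)
  interpret S: coeff_subring R n S
    by (intro coeff_subring.intro coeff_subring_axioms.intro weyl_zero_axioms)
      (unfold S_def, rule generate_ring_is_subring[OF Tc])
  obtain F :: "'a set ring" and h where F: "field F" "finite (carrier F)" "h \<in> ring_hom S.A F" "carrier F = h ` S"
    using finite_residue_field[OF Tfin Tc] unfolding S_def by blast
  interpret F: field F by (rule F(1))
  obtain p :: nat where p: "Factorial_Ring.prime p" "[p] \<cdot>\<^bsub>F\<^esub> \<one>\<^bsub>F\<^esub> = \<zero>\<^bsub>F\<^esub>" using F.prime_char_of_finite[OF F(2)] by blast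
  have p0: "0 < p" using p(1) by (simp add: prime_gt_0_nat)
  have wF: "weyl F" by (intro weyl.intro F.is_cring)
  have pn: "weyl.nc F p = \<zero>\<^bsub>F\<^esub>" using p(2) weyl.nc_def[OF wF] by simp
  have sub: "v \<in> carrier S.inc.A.W" if "v \<in> carrier W" "range v \<subseteq> T" for v
    using that TS S.sub_carrier by blast
  have inS: "s i \<in> carrier S.inc.A.W" "b i \<in> carrier S.inc.A.W" "phi (gen i) \<in> carrier S.inc.A.W" "inv (phi (s i) (f i)) \<in> S" if i: "i < 2 * n" for i
  proof -
    have t: "range (s i) \<subseteq> T" "range (b i) \<subseteq> T" "range (phi (gen i)) \<subseteq> T" "inv (phi (s i) (f i)) \<in> T"
      using i unfolding T_def by blast+
    show "s i \<in> carrier S.inc.A.W" "b i \<in> carrier S.inc.A.W" "phi (gen i) \<in> carrier S.inc.A.W" "inv (phi (s i) (f i)) \<in> S"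
      by (rule sub[OF sb(1)[OF i] t(1)], rule sub[OF sb(2)[OF i] t(2)],
          rule sub[OF phi.hom_closed[OF gen_closed[OF i]] t(3)], rule subsetD[OF TS t(4)])
  qed
  have crS: "c \<in> carrier S.inc.A.W" "r \<in> carrier S.inc.A.W" "inv (r e) \<in> S" "inv (s l d) \<in> S"
  proof -
    have t: "range c \<subseteq> T" "range r \<subseteq> T" "inv (r e) \<in> T" "inv (s l d) \<in> T" unfolding T_def by blast+
    show "c \<in> carrier S.inc.A.W" "r \<in> carrier S.inc.A.W" "inv (r e) \<in> S" "inv (s l d) \<in> S"
      by (rule sub[OF c(1) t(1)], rule sub[OF c(2) t(2)], rule subsetD[OF TS t(3)], rule subsetD[OF TS t(4)])
  qed
  have hom: "phi \<in> ring_hom S.inc.A.W S.inc.A.W"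
    by (rule S.sub_endo[OF phi_hom phi_sc]) (use inS(3) S.sub_carrier in auto)
  interpret red: reduced_endo S.A F n h p phi s b
  proof (intro reduced_endo.intro reduced_endo_axioms.intro weyl_map.intro weyl_mod.intro weyl_mod_axioms.intro
      weyl_charp.intro weyl_charp_axioms.intro weyl_domain.intro ring_hom_cring.intro ring_hom_cring_axioms.intro)
    show "S.inc.A.nc p \<noteq> \<zero>\<^bsub>S.A\<^esub>" using char_zero[OF p0] by (simp add: S.sub_ops(6))
    show "phi (S.inc.A.sc a) = S.inc.A.sc a" if "a \<in> carrier S.A" for a
      using that phi_sc[of a] S.S_closed by (auto simp: S.sub_ops(5))
    show "S.inc.A.gen i \<otimes>\<^bsub>S.inc.A.W\<^esub> phi (s i) = phi (b i)" if i: "i < 2 * n" for i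
    proof -
      have "gen i \<in> carrier S.inc.A.W" using S.inc.A.gen_closed[OF i] by (simp only: S.sub_ops(4))
      moreover have "phi (s i) \<in> carrier S.inc.A.W" using ring_hom_closed[OF hom inS(1)[OF i]] .
      ultimately show ?thesis using rel[OF i] by (simp only: S.sub_ops(1,4))
    qed
    show "\<exists>c. \<exists>a\<in>carrier S.A. S.inc.A.lead (phi (s i)) c \<and> phi (s i) c \<otimes>\<^bsub>S.A\<^esub> a = \<one>\<^bsub>S.A\<^esub>" if i: "i < 2 * n" for i
      using f[OF i] inS(4)[OF i] unit(2)[OF nzs(2,1)[OF i]]
      by (intro exI[of _ "f i"] bexI[of _ "inv (phi (s i) (f i))"]) (auto simp: S.sub_lead)
  qed (use S.A_cring S.A_domain F.is_cring F p p0 pn wF S.inc.A.weyl_axioms hom inS in \<open>simp_all\<close>)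
  have "\<exists>e'. e = (\<lambda>i. e' i + d i)"
  proof (rule red.remainder_lead[OF l crS(1,2)])
    have "c \<otimes>\<^bsub>W\<^esub> s l \<in> carrier S.inc.A.W"
      using S.inc.A.W.m_closed[OF crS(1) inS(1)[OF l]] S.sub_ops(1)[OF crS(1) inS(1)[OF l]] by simp
    then show "b l = c \<otimes>\<^bsub>S.inc.A.W\<^esub> s l \<oplus>\<^bsub>S.inc.A.W\<^esub> r"
      using c(3) crS(2) by (simp add: S.sub_ops(1)[OF crS(1) inS(1)[OF l]] S.sub_ops(2))
    show "S.inc.A.lead r e" "S.inc.A.lead (s l) d" using c(4) d by (simp_all add: S.sub_lead)
    show "\<exists>a\<in>carrier S.A. r e \<otimes>\<^bsub>S.A\<^esub> a = \<one>\<^bsub>S.A\<^esub>" using crS(3) unit(2)[OF rnz(2,1)] by auto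
    show "\<exists>a\<in>carrier S.A. s l d \<otimes>\<^bsub>S.A\<^esub> a = \<one>\<^bsub>S.A\<^esub>" using crS(4) unit(2)[OF snz(2,1)] by auto
  qed
  then show False using ne by blast
qed

text \<open>From b = c s the relation for a generator becomes g phi(s) = phi(c) phi(s), and right
  cancellation gives g = phi(c). With the scalars, the generators generate the algebra.\<close>

lemma surjective:
  assumes "\<And>g. g \<in> carrier W \<Longrightarrow> \<exists>s\<in>carrier W. \<exists>b\<in>carrier W. phi s \<noteq> \<zero>\<^bsub>W\<^esub> \<and> g \<otimes>\<^bsub>W\<^esub> phi s = phi b"
  shows "phi ` carrier W = carrier W"
proof
  have "\<exists>s b. s \<in> carrier W \<and> b \<in> carrier W \<and> phi s \<noteq> \<zero>\<^bsub>W\<^esub> \<and> gen l \<otimes>\<^bsub>W\<^esub> phi s = phi b" if "l < 2 * n" for l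
    using assms[OF gen_closed[OF that]] by blast
  then obtain s b where sb: "\<And>l. l < 2 * n \<Longrightarrow> s l \<in> carrier W" "\<And>l. l < 2 * n \<Longrightarrow> b l \<in> carrier W"
    "\<And>l. l < 2 * n \<Longrightarrow> phi (s l) \<noteq> \<zero>\<^bsub>W\<^esub>" "\<And>l. l < 2 * n \<Longrightarrow> gen l \<otimes>\<^bsub>W\<^esub> phi (s l) = phi (b l)"
    by metis
  have gen_image: "\<exists>c\<in>carrier W. gen l = phi c" if l: "l < 2 * n" for l
  proof -
    obtain c where c: "c \<in> carrier W" "b l = c \<otimes>\<^bsub>W\<^esub> s l" using left_multiple_zero[OF sb l] by blast
    have "gen l \<otimes>\<^bsub>W\<^esub> phi (s l) = phi c \<otimes>\<^bsub>W\<^esub> phi (s l)"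
      unfolding sb(4)[OF l] c(2) using c(1) sb(1)[OF l] by simp
    then have "gen l = phi c"
      by (rule W_cancel_right[OF gen_closed[OF l] _ _ _ sb(3)[OF l], rotated 2]) (use c sb(1)[OF l] in simp_all)
    then show ?thesis using c by blast
  qed
  show "carrier W \<subseteq> phi ` carrier W"
  proof
    fix v assume "v \<in> carrier W"
    then have "\<exists>w\<in>carrier W. phi w = v"
    proof (induction rule: W_induct)
      case one then show ?case by (intro bexI[of _ "\<one>\<^bsub>W\<^esub>"]) auto
    next
      case (add v w)
      then obtain v' w' where "v' \<in> carrier W" "w' \<in> carrier W" "phi v' = v" "phi w' = w" by blast
      then show ?case by (intro bexI[of _ "v' \<oplus>\<^bsub>W\<^esub> w'"]) auto
    next
      case (sc a v)
      then obtain v' where "v' \<in> carrier W" "phi v' = v" by blast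
      then show ?case using sc(1) by (intro bexI[of _ "sc a \<otimes>\<^bsub>W\<^esub> v'"]) (auto simp: phi_sc)
    next
      case (gen j v)
      then obtain v' where v': "v' \<in> carrier W" "phi v' = v" by blast
      obtain c where "c \<in> carrier W" "gen j = phi c" using gen_image[OF gen(1)] by blast
      then show ?case using v' by (intro bexI[of _ "c \<otimes>\<^bsub>W\<^esub> v'"]) auto
    qed
    then show "v \<in> phi ` carrier W" by blast
  qed
qed auto

end

text \<open>Surjectivity is applied to the fraction g/1, which gives g/1 = \<phi>(a)/\<phi>(s).
  Unfolding this equality and cancelling the common multiplier u yields g \<phi>(s) =
  \<phi>(a).\<close>

lemma (in weyl) birational_fractions:
  assumes hom: "\<phi> \<in> ring_hom WA WA" and bir: "birational_hom WA WA \<phi>"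
    and cancel: "\<And>a b u. a \<in> carrier WA \<Longrightarrow> b \<in> carrier WA \<Longrightarrow> u \<in> carrier WA \<Longrightarrow> u \<noteq> \<zero>\<^bsub>WA\<^esub> \<Longrightarrow>
      a \<otimes>\<^bsub>WA\<^esub> u = b \<otimes>\<^bsub>WA\<^esub> u \<Longrightarrow> a = b"
    and nontriv: "\<one>\<^bsub>WA\<^esub> \<noteq> \<zero>\<^bsub>WA\<^esub>" and g: "g \<in> carrier WA"
  shows "\<exists>s\<in>carrier WA. \<exists>b\<in>carrier WA. \<phi> s \<noteq> \<zero>\<^bsub>WA\<^esub> \<and> g \<otimes>\<^bsub>WA\<^esub> \<phi> s = \<phi> b"
proof -
  have "ore_frac WA g \<one>\<^bsub>WA\<^esub> \<in> carrier (ore_quotient WA)"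
    unfolding ore_quotient_def using g nontriv by auto
  then obtain P where P: "P \<in> carrier (ore_quotient WA)" "ore_frac WA g \<one>\<^bsub>WA\<^esub> = ore_quotient_map WA \<phi> P"
    using bir unfolding birational_hom_def by blast
  have "(g, \<one>\<^bsub>WA\<^esub>) \<in> ore_frac WA g \<one>\<^bsub>WA\<^esub>"
    unfolding ore_frac_def using g nontriv by (auto intro!: bexI[of _ "\<one>\<^bsub>WA\<^esub>"])
  then obtain a s where as: "(a, s) \<in> P" "(g, \<one>\<^bsub>WA\<^esub>) \<in> ore_frac WA (\<phi> a) (\<phi> s)"
    unfolding P(2) ore_quotient_map_def by blast
  have cl: "a \<in> carrier WA" "s \<in> carrier WA" using P(1) as(1) by (auto simp: ore_quotient_def ore_frac_def)
  obtain u v where uv: "u \<in> carrier WA" "v \<in> carrier WA" "\<phi> a \<otimes>\<^bsub>WA\<^esub> u = g \<otimes>\<^bsub>WA\<^esub> v"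
    "\<phi> s \<otimes>\<^bsub>WA\<^esub> u = \<one>\<^bsub>WA\<^esub> \<otimes>\<^bsub>WA\<^esub> v" "\<phi> s \<otimes>\<^bsub>WA\<^esub> u \<noteq> \<zero>\<^bsub>WA\<^esub>"
    using as(2) unfolding ore_frac_def by blast
  have pc: "\<phi> a \<in> carrier WA" "\<phi> s \<in> carrier WA" using ring_hom_closed[OF hom] cl by auto
  have nz: "u \<noteq> \<zero>\<^bsub>WA\<^esub>" "\<phi> s \<noteq> \<zero>\<^bsub>WA\<^esub>" using uv pc by auto
  have "(g \<otimes>\<^bsub>WA\<^esub> \<phi> s) \<otimes>\<^bsub>WA\<^esub> u = \<phi> a \<otimes>\<^bsub>WA\<^esub> u"
    using uv g pc by (simp add: A.m_assoc)
  then have "g \<otimes>\<^bsub>WA\<^esub> \<phi> s = \<phi> a" using cancel[of "g \<otimes>\<^bsub>WA\<^esub> \<phi> s" "\<phi> a" u] g pc uv nz by simp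
  then show ?thesis using cl nz by blast
qed

theorem theorem4p3:
  fixes K :: "('a, 'm) ring_scheme"
    and n :: nat
    and \<phi> :: "(weyl_gen list \<Rightarrow> 'a) set \<Rightarrow> (weyl_gen list \<Rightarrow> 'a) set"
  assumes "field K"
    and char_zero: "\<And>m::nat. m > 0 \<Longrightarrow> [m] \<cdot>\<^bsub>K\<^esub> \<one>\<^bsub>K\<^esub> \<noteq> \<zero>\<^bsub>K\<^esub>"
    and "n \<ge> 1"
    and "\<phi> \<in> weyl_endomorphisms K n"
    and "birational_hom (weyl_algebra K n) (weyl_algebra K n) \<phi>"
  shows "\<phi> \<in> ring_iso (weyl_algebra K n) (weyl_algebra K n)"
proof -
  interpret field K by (rule assms(1))
  interpret weyl K n by (intro weyl.intro is_cring)
  interpret weyl_zero K n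
    by (intro weyl_zero.intro weyl_zero_axioms.intro weyl_axioms field_axioms) (simp add: nc_def char_zero)
  have hom: "\<phi> \<in> ring_hom WA WA" and sA: "\<And>a. a \<in> carrier K \<Longrightarrow> \<phi> (sA a) = sA a"
    using assms(4) unfolding weyl_endomorphisms_def by (auto simp: sA_scalar)
  define inu where "inu = inv_into WF mu"
  \<comment> \<open>The endomorphism carried over to coefficient functions, where supports and
    leading exponents make sense.\<close>
  define psi where "psi = (\<lambda>v. inu (\<phi> (mu v)))"
  have inu: "inu \<in> ring_hom WA W" "\<And>a. a \<in> carrier WA \<Longrightarrow> mu (inu a) = a" "\<And>v. v \<in> carrier W \<Longrightarrow> inu (mu v) = v"
    "\<And>a. a \<in> carrier WA \<Longrightarrow> inu a \<in> carrier W"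
    using inv_mu_iso inv_mu_closed by (auto simp: ring_iso_def inu_def W_carrier)
  have mu: "mu \<in> ring_hom W WA" "\<And>v. v \<in> carrier W \<Longrightarrow> mu v \<in> carrier WA"
    using mu_iso by (auto simp: ring_iso_def W_carrier)
  have mup: "mu (psi v) = \<phi> (mu v)" if "v \<in> carrier W" for v
    unfolding psi_def by (rule inu(2)) (rule ring_hom_closed[OF hom mu(2)[OF that]])
  interpret E: zero_endo K n psi
  proof (intro zero_endo.intro zero_endo_axioms.intro weyl_zero_axioms)
    have "inu \<circ> (\<phi> \<circ> mu) \<in> ring_hom W W" using ring_hom_trans[OF ring_hom_trans[OF mu(1) hom] inu(1)] .
    then show "psi \<in> ring_hom W W" by (simp add: psi_def comp_def)
    show "psi (sc a) = sc a" if "a \<in> carrier K" for a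
      using that inu(3)[OF sc_closed[OF that]] by (simp add: psi_def mu_sc sA)
  qed
  have mz: "mu \<zero>\<^bsub>W\<^esub> = \<zero>\<^bsub>WA\<^esub>" by (simp add: W_zero)
  have m1: "mu \<one>\<^bsub>W\<^esub> = \<one>\<^bsub>WA\<^esub>" by (rule ring_hom_one[OF mu(1)])
  have cancel: "a = b" if "a \<in> carrier WA" "b \<in> carrier WA" "u \<in> carrier WA" "u \<noteq> \<zero>\<^bsub>WA\<^esub>" "a \<otimes>\<^bsub>WA\<^esub> u = b \<otimes>\<^bsub>WA\<^esub> u" for a b u
  proof -
    have "inu a \<otimes>\<^bsub>W\<^esub> inu u = inu b \<otimes>\<^bsub>W\<^esub> inu u" using that ring_hom_mult[OF inu(1)] by metis
    moreover have "inu u \<noteq> \<zero>\<^bsub>W\<^esub>" using inu(2)[OF that(3)] that(4) mz by metis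
    ultimately have "inu a = inu b" using W_cancel_right[OF inu(4)[OF that(1)] inu(4)[OF that(2)] inu(4)[OF that(3)]] by blast
    then show ?thesis using inu(2) that by metis
  qed
  have nontriv: "\<one>\<^bsub>WA\<^esub> \<noteq> \<zero>\<^bsub>WA\<^esub>" using inu(3)[OF W.one_closed] inu(3)[OF W.zero_closed] m1 mz W_one_not_zero by metis
  have "psi ` carrier W = carrier W"
  proof (rule E.surjective)
    fix g assume g: "g \<in> carrier W"
    have "\<exists>s\<in>carrier WA. \<exists>b\<in>carrier WA. \<phi> s \<noteq> \<zero>\<^bsub>WA\<^esub> \<and> mu g \<otimes>\<^bsub>WA\<^esub> \<phi> s = \<phi> b"
      by (rule birational_fractions[OF hom assms(5) _ nontriv mu(2)[OF g]]) (rule cancel)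
    then obtain s b where sb: "s \<in> carrier WA" "b \<in> carrier WA" "\<phi> s \<noteq> \<zero>\<^bsub>WA\<^esub>" "mu g \<otimes>\<^bsub>WA\<^esub> \<phi> s = \<phi> b"
      by blast
    have e: "mu (psi (inu s)) = \<phi> s" "mu (psi (inu b)) = \<phi> b" using mup inu(2,4) sb(1,2) by simp_all
    have cl: "psi (inu s) \<in> carrier W" "psi (inu b) \<in> carrier W" using inu(4) sb by auto
    have "mu (g \<otimes>\<^bsub>W\<^esub> psi (inu s)) = mu (psi (inu b))" using e sb(4) ring_hom_mult[OF mu(1) g cl(1)] by simp
    then have "g \<otimes>\<^bsub>W\<^esub> psi (inu s) = psi (inu b)" by (rule mu_eqI[rotated 2]) (use g cl in auto)
    moreover have "psi (inu s) \<noteq> \<zero>\<^bsub>W\<^esub>" using e(1) sb(3) mz by metis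
    ultimately show "\<exists>s\<in>carrier W. \<exists>b\<in>carrier W. psi s \<noteq> \<zero>\<^bsub>W\<^esub> \<and> g \<otimes>\<^bsub>W\<^esub> psi s = psi b"
      using inu(4) sb by blast
  qed
  then have "bij_betw psi (carrier W) (carrier W)" using E.phi_inj by (simp add: bij_betw_def)
  then have "bij_betw (mu \<circ> psi \<circ> inu) (carrier WA) (carrier WA)"
    using inv_mu_iso mu_iso by (intro bij_betw_trans) (auto simp: ring_iso_def inu_def)
  moreover have "(mu \<circ> psi \<circ> inu) a = \<phi> a" if "a \<in> carrier WA" for a
    using mup[OF inu(4)[OF that]] inu(2)[OF that] by simp
  ultimately have "bij_betw \<phi> (carrier WA) (carrier WA)" using bij_betw_cong[of "carrier WA" "mu \<circ> psi \<circ> inu" \<phi>] by blast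
  then show ?thesis using hom by (simp add: ring_iso_def)
qed

end
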